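(* Let $\Gamma$ be a finitely generated group having the rapid decay property (RD) with constant $C_1$, and let $(\rho_N)$ be a sequence of permutation representations $\rho_N:\Gamma\to S_N$ satisfying (B) and (SC) below. Let $p\in\mathbb C[\Gamma]$ with $p=p^*$ and let $I_0\subset\mathbb R$ be a compact interval such that (AC) holds on $I_0$ for $P=\lambda(p)$. Let $I$ be a closed interval (of positive length) contained in the interior of $I_0$, assume (R4$_\gamma$) holds on $I$, and let $(\varphi_\alpha)_{\alpha\in[N]}$ be an orthonormal eigenbasis of $P_N=\rho_N(p)$. Then, for any finite $T\subset\Gamma$, there exists $C>0$ such that for all $N\ge3$ (in the index set of the sequence) and any $T$-local matrix $K_N\in M_N(\mathbb C)$ with $\|K_N\|_{1,\infty}\le1$, we have for all $E_1,E_2\in I$ $$\frac1{|\Lambda_{J_{E_1}^{\eta_N}}|}\sum_{\alpha\in\Lambda_{J_{E_1}^{\eta_N}}}\sum_{\beta\in\Lambda_{J_{E_2}^{\eta_N}}}|\langle\varphi_\beta,K_N\varphi_\alpha\rangle-\langle\varphi_\beta,\langle K_N\rangle\varphi_\alpha\rangle|^2\le C\eta_N^{\frac{1+\gamma}2}$$ and $$\frac1{|\Lambda_I|}\sum_{\alpha\in\Lambda_I}|\langle\varphi_\alpha,K_N\varphi_\alpha\rangle-\langle\varphi_\alpha,\langle K_N\rangle\varphi_\alpha\rangle|^2\le C\eta_N^{\frac{1+\gamma}2},$$ where $\eta_N=C\ln\ln N/\ln N$. Moreover, without assumption (SC), for any finite $T\subset\Gamma$ and any $b>0$ there exist $C>0$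 and vector subspaces $H_N\subset\mathbb C^N$ of dimension at most $N/(\ln N)^b$ such that the two above bounds hold with $\eta_N=C(\ln\ln N)^2/\ln N$ for all $T$-local $K_N$ with $\|K_N\|_{1,\infty}\le1$ such that $(K_N(g.x,x))_{x\in[N]}\in H_N^\perp$ for all $g\in T$.
   Context: Algebra. $e$ is the unit of $\Gamma$; $S$ is a fixed finite symmetric generating set, $|g|$ is the word length of $g$, and $B_S(n)$ is the ball of radius $n$ centered at $e$ in $\mathrm{Cay}(\Gamma,S)$ (edges from $g$ to $sg$, $s\in S$). $\mathbb C[\Gamma]$ is the group algebra of finite sums $p=\sum_gp_gg$, $p^*=\sum_g\bar p_gg^{-1}$, $\|p\|_2^2=\sum_g|p_g|^2$. $\lambda$ is the left regular representation on $\ell^2(\Gamma)$, $\lambda(g)\delta_v=\delta_{gv}$. A permutation representation is a homomorphism $\rho_N:\Gamma\to S_N$; $g.x=\rho_N(g)(x)$ for $x\in[N]=\{1,\dots,N\}$; $\rho_N(g)$ is identified with the matrix $\rho_N(g)(x,y)=\mathbf 1(x=g.y)$; $\rho(p)=\sum_gp_g\rho(g)$. Sequences are indexed by an infinite set of integers $N\to\infty$. (RD): there are $C,C_1>0$ with $\|\lambda(q)\|_{\rm op}\le C(\mathrm{diam}_S(q))^{C_1}\|q\|_2$ for all $q\in\mathbb C[\Gamma]$, where $\mathrm{diam}_S(q)$ is the maximum of $1$ and the diameter of the support of $q$ in $\mathrm{Cay}(\Gamma,S)$. (B): for integer $r\ge1$ let $\mathrm{Bad}_S(r)=\{x\in[N]: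 g.x=x\text{ for some }g\in B_S(2r)\setminus\{e\}\}$; for some $\alpha>0$, $\beta\in[0,1)$, $C>0$, $|\mathrm{Bad}_S(r_N)|\le CN^\beta$ with $r_N=\lceil\alpha\ln N\rceil$. (SC): $\|\rho_N(q)_{|1^\perp}\|_{\rm op}\le2\|\lambda(q)\|_{\rm op}$ for all $q\in\mathbb C[\Gamma]$ supported on $B_S(r_N)$, with the same $r_N$, where $1\in\mathbb C^N$ is the constant vector. With $R^z=(P-z\,\mathrm{Id})^{-1}$, $\Im R^z=(R^z-(R^z)^* )/(2i)$, $Q(g,h)=\langle\delta_g,Q\delta_h\rangle$: (AC) on $I_0$: there is $C_0\ge1$ with $C_0^{-1}\le(\Im R^z)(e,e)\le C_0$ for all $z=E+i\eta$, $E\in I_0$, $0<\eta\le1$. (R4$_\gamma$) on $I$: for some $C>0$, $C_1'>2C_1+1$ and $\gamma\in(0,1]$, $\sum_{g\in\Gamma}\eta^2|g|^{C_1'}|(\Im R^z)(e,g)|^4\le C\eta^{1+\gamma}$ for all $z=\lambda_0+i\eta$ with $\lambda_0\in I$, $0<\eta\le1$. Observables. $\|K\|_{1,\infty}=\max_{x,y}|K(x,y)|$. $K_N$ is $T$-local if $K_N(x,y)=0$ unless $x=g.y$ for some $g\in T$. $\langle K_N\rangle=\rho_N(k_N)$, $k_N=\sum_{g\in T}k_{N,g}\,g$, $k_{N,g}=\frac1N\sum_{x=1}^NK_N(g.x,x)$. $\lambda_\alpha$ is the eigenvalue of $\varphi_\alpha$, $\Lambda_J=\{\alpha:\lambda_\alpha\in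 J\}$, $J_E^\eta=[E-\eta,E+\eta]$; averages over an empty index set are $0$. *)

theory Defs
  imports
    "HOL-Analysis.Infinite_Sum"
    "HOL-Library.Poly_Mapping"
    "HOL-Algebra.Generated_Groups"
    "HOL-Algebra.Group_Action"
    "Jordan_Normal_Form.Char_Poly"
    "Jordan_Normal_Form.VS_Connect"
    "Jordan_Normal_Form.Conjugate"
begin

section \<open>Cayley graph\<close>

definition symmetric_generating_set :: "('g, 'm) monoid_scheme \<Rightarrow> 'g set \<Rightarrow> bool" where
  "symmetric_generating_set G S \<longleftrightarrow>
     finite S \<and> S \<subseteq> carrier G \<and> (\<forall>s\<in>S. inv\<^bsub>G\<^esub> s \<in> S) \<and> generate G S = carrier G"

definition word_length :: "('g, 'm) monoid_scheme \<Rightarrow> 'g set \<Rightarrow> 'g \<Rightarrow> nat" where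
  "word_length G S g =
     (LEAST n. \<exists>ws. length ws = n \<and> set ws \<subseteq> S \<and> foldr (\<otimes>\<^bsub>G\<^esub>) ws \<one>\<^bsub>G\<^esub> = g)"

definition cayley_graph :: "('g, 'm) monoid_scheme \<Rightarrow> 'g set \<Rightarrow> ('g \<times> 'g) set" where
  "cayley_graph G S = {(g, s \<otimes>\<^bsub>G\<^esub> g) | g s. g \<in> carrier G \<and> s \<in> S}"

definition cayley_dist :: "('g, 'm) monoid_scheme \<Rightarrow> 'g set \<Rightarrow> 'g \<Rightarrow> 'g \<Rightarrow> nat" where
  "cayley_dist G S g h = (LEAST n. (g, h) \<in> cayley_graph G S ^^ n)"

definition cayley_ball :: "('g, 'm) monoid_scheme \<Rightarrow> 'g set \<Rightarrow> nat \<Rightarrow> 'g set" where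
  "cayley_ball G S n = {g \<in> carrier G. cayley_dist G S \<one>\<^bsub>G\<^esub> g \<le> n}"

section \<open>Group algebra\<close>

text \<open>Elements of the complex group algebra are finitely supported functions on the group. Only
  the linear structure of \<^typ>\<open>'g \<Rightarrow>\<^sub>0 complex\<close> is used; its multiplication, which refers to an
  additive monoid structure on the index type, is irrelevant here.\<close>

definition group_algebra :: "('g, 'm) monoid_scheme \<Rightarrow> ('g \<Rightarrow>\<^sub>0 complex) set" where
  "group_algebra G = {p. Poly_Mapping.keys p \<subseteq> carrier G}"

definition ga_star :: "('g, 'm) monoid_scheme \<Rightarrow> ('g \<Rightarrow>\<^sub>0 complex) \<Rightarrow> ('g \<Rightarrow>\<^sub>0 complex)" where
  "ga_star G p =
     (\<Sum>g\<in>Poly_Mapping.keys p. Poly_Mapping.single (inv\<^bsub>G\<^esub> g) (cnj (Poly_Mapping.lookup p g)))"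

definition ga_norm2 :: "('g \<Rightarrow>\<^sub>0 complex) \<Rightarrow> real" where
  "ga_norm2 p = sqrt (\<Sum>g\<in>Poly_Mapping.keys p. (cmod (Poly_Mapping.lookup p g))\<^sup>2)"

definition ga_diam :: "('g, 'm) monoid_scheme \<Rightarrow> 'g set \<Rightarrow> ('g \<Rightarrow>\<^sub>0 complex) \<Rightarrow> nat" where
  "ga_diam G S q =
     Max (insert 1 {cayley_dist G S g h | g h. g \<in> Poly_Mapping.keys q \<and> h \<in> Poly_Mapping.keys q})"

section \<open>The Hilbert space of square-summable functions on the group\<close>

text \<open>A vector is a square-summable function on the carrier, extended by \<open>0\<close> to the whole type.\<close>

definition ell2 :: "('g, 'm) monoid_scheme \<Rightarrow> ('g \<Rightarrow> complex) set" where
  "ell2 G = {f. (\<forall>g. g \<notin> carrier G \<longrightarrow> f g = 0) \<and> (\<lambda>g. (cmod (f g))\<^sup>2) summable_on carrier G}"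

definition ell2_inner :: "('g, 'm) monoid_scheme \<Rightarrow> ('g \<Rightarrow> complex) \<Rightarrow> ('g \<Rightarrow> complex) \<Rightarrow> complex" where
  "ell2_inner G u v = (\<Sum>\<^sub>\<infinity>g\<in>carrier G. cnj (u g) * v g)"

definition ell2_norm :: "('g, 'm) monoid_scheme \<Rightarrow> ('g \<Rightarrow> complex) \<Rightarrow> real" where
  "ell2_norm G f = sqrt (\<Sum>\<^sub>\<infinity>g\<in>carrier G. (cmod (f g))\<^sup>2)"

definition ell2_delta :: "'g \<Rightarrow> 'g \<Rightarrow> complex" where
  "ell2_delta g = (\<lambda>h. if h = g then 1 else 0)"

type_synonym 'g ell2_op = "('g \<Rightarrow> complex) \<Rightarrow> ('g \<Rightarrow> complex)"

definition ell2_opnorm :: "('g, 'm) monoid_scheme \<Rightarrow> 'g ell2_op \<Rightarrow> real" where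
  "ell2_opnorm G A = (SUP f\<in>{f \<in> ell2 G. ell2_norm G f \<le> 1}. ell2_norm G (A f))"

definition ell2_adjoint :: "('g, 'm) monoid_scheme \<Rightarrow> 'g ell2_op \<Rightarrow> 'g ell2_op" where
  "ell2_adjoint G A = (\<lambda>u. THE w. w \<in> ell2 G \<and>
     (\<forall>v\<in>ell2 G. ell2_inner G w v = ell2_inner G u (A v)))"

definition ell2_Im :: "('g, 'm) monoid_scheme \<Rightarrow> 'g ell2_op \<Rightarrow> 'g ell2_op" where
  "ell2_Im G A = (\<lambda>f g. (A f g - ell2_adjoint G A f g) / (2 * \<i>))"

definition ell2_coeff :: "('g, 'm) monoid_scheme \<Rightarrow> 'g ell2_op \<Rightarrow> 'g \<Rightarrow> 'g \<Rightarrow> complex" where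
  "ell2_coeff G A g h = ell2_inner G (ell2_delta g) (A (ell2_delta h))"

text \<open>Inverse of \<open>A - z\<close> on \<^const>\<open>ell2\<close>; used only for self-adjoint \<open>A\<close> and non-real \<open>z\<close>, where
  \<open>A - z\<close> is bijective.\<close>

definition ell2_resolvent :: "('g, 'm) monoid_scheme \<Rightarrow> 'g ell2_op \<Rightarrow> complex \<Rightarrow> 'g ell2_op" where
  "ell2_resolvent G A z = inv_into (ell2 G) (\<lambda>f g. A f g - z * f g)"

text \<open>The formula for \<open>left_regular\<close> is the one determined by
  \<open>left_regular G g (ell2_delta v) = ell2_delta (g \<otimes> v)\<close>.\<close>

definition left_regular :: "('g, 'm) monoid_scheme \<Rightarrow> 'g \<Rightarrow> 'g ell2_op" where
  "left_regular G g = (\<lambda>f v. if v \<in> carrier G then f (inv\<^bsub>G\<^esub> g \<otimes>\<^bsub>G\<^esub> v) else 0)"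

definition left_regular_ga :: "('g, 'm) monoid_scheme \<Rightarrow> ('g \<Rightarrow>\<^sub>0 complex) \<Rightarrow> 'g ell2_op" where
  "left_regular_ga G p =
     (\<lambda>f v. \<Sum>g\<in>Poly_Mapping.keys p. Poly_Mapping.lookup p g * left_regular G g f v)"

definition Im_resolvent ::
    "('g, 'm) monoid_scheme \<Rightarrow> ('g \<Rightarrow>\<^sub>0 complex) \<Rightarrow> complex \<Rightarrow> 'g \<Rightarrow> 'g \<Rightarrow> complex" where
  "Im_resolvent G p z = ell2_coeff G (ell2_Im G (ell2_resolvent G (left_regular_ga G p) z))"

section \<open>Vectors, matrices and permutation representations in dimension \<open>N\<close>\<close>

text \<open>The inner product is conjugate-linear in the first argument, whereas \<open>\<bullet>c\<close> conjugates the
  second one.\<close>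

definition cv_inner :: "complex vec \<Rightarrow> complex vec \<Rightarrow> complex" where
  "cv_inner u v = v \<bullet>c u"

definition cv_norm :: "complex vec \<Rightarrow> real" where
  "cv_norm v = sqrt (Re (cv_inner v v))"

definition opnorm_perp_one :: "nat \<Rightarrow> complex mat \<Rightarrow> real" where
  "opnorm_perp_one N A =
     (SUP v\<in>{v \<in> carrier_vec N. cv_inner (vec N (\<lambda>_. 1)) v = 0 \<and> cv_norm v \<le> 1}. cv_norm (A *\<^sub>v v))"

text \<open>Matrices are indexed from \<open>0\<close>, so \<open>N\<close>-point sets are \<open>{0..<N}\<close>, and a permutation
  representation of \<open>G\<close> on \<open>N\<close> points is a map \<open>\<rho>\<close> with \<^term>\<open>group_action G {0..<N} \<rho>\<close>.\<close>

definition perm_mat :: "nat \<Rightarrow> (nat \<Rightarrow> nat) \<Rightarrow> complex mat" where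
  "perm_mat N \<pi> = mat N N (\<lambda>(x, y). if x = \<pi> y then 1 else 0)"

definition perm_rep_ga :: "nat \<Rightarrow> ('g \<Rightarrow> nat \<Rightarrow> nat) \<Rightarrow> ('g \<Rightarrow>\<^sub>0 complex) \<Rightarrow> complex mat" where
  "perm_rep_ga N \<rho> p = mat N N (\<lambda>(x, y).
     \<Sum>g\<in>Poly_Mapping.keys p. Poly_Mapping.lookup p g * perm_mat N (\<rho> g) $$ (x, y))"

definition Bad :: "('g, 'm) monoid_scheme \<Rightarrow> 'g set \<Rightarrow> nat \<Rightarrow> ('g \<Rightarrow> nat \<Rightarrow> nat) \<Rightarrow> nat \<Rightarrow> nat set" where
  "Bad G S N \<rho> r = {x \<in> {0..<N}. \<exists>g\<in>cayley_ball G S (2 * r) - {\<one>\<^bsub>G\<^esub>}. \<rho> g x = x}"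

definition radius :: "real \<Rightarrow> nat \<Rightarrow> nat" where
  "radius a N = nat \<lceil>a * ln (real N)\<rceil>"

section \<open>Assumptions\<close>

definition rapid_decay :: "('g, 'm) monoid_scheme \<Rightarrow> 'g set \<Rightarrow> real \<Rightarrow> bool" where
  "rapid_decay G S C1 \<longleftrightarrow> C1 > 0 \<and>
     (\<exists>C>0. \<forall>q\<in>group_algebra G.
        ell2_opnorm G (left_regular_ga G q) \<le> C * real (ga_diam G S q) powr C1 * ga_norm2 q)"

definition few_bad_points ::
    "('g, 'm) monoid_scheme \<Rightarrow> 'g set \<Rightarrow> nat set \<Rightarrow> (nat \<Rightarrow> 'g \<Rightarrow> nat \<Rightarrow> nat) \<Rightarrow> real \<Rightarrow> bool" where
  "few_bad_points G S Ns \<rho> a \<longleftrightarrow> a > 0 \<and>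
     (\<exists>b C. 0 \<le> b \<and> b < 1 \<and> C > 0 \<and>
        (\<forall>N\<in>Ns. real (card (Bad G S N (\<rho> N) (radius a N))) \<le> C * real N powr b))"

definition quantitative_strong_convergence ::
    "('g, 'm) monoid_scheme \<Rightarrow> 'g set \<Rightarrow> nat set \<Rightarrow> (nat \<Rightarrow> 'g \<Rightarrow> nat \<Rightarrow> nat) \<Rightarrow> real \<Rightarrow> bool" where
  "quantitative_strong_convergence G S Ns \<rho> a \<longleftrightarrow>
     (\<forall>N\<in>Ns. \<forall>q\<in>group_algebra G. Poly_Mapping.keys q \<subseteq> cayley_ball G S (radius a N) \<longrightarrow>
        opnorm_perp_one N (perm_rep_ga N (\<rho> N) q) \<le> 2 * ell2_opnorm G (left_regular_ga G q))"

text \<open>The diagonal coefficient is real, so \<^const>\<open>Re\<close> only converts the type.\<close>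

definition abs_continuous_on :: "('g, 'm) monoid_scheme \<Rightarrow> ('g \<Rightarrow>\<^sub>0 complex) \<Rightarrow> real set \<Rightarrow> bool" where
  "abs_continuous_on G p I0 \<longleftrightarrow>
     (\<exists>C0\<ge>1. \<forall>E\<in>I0. \<forall>\<eta>. 0 < \<eta> \<and> \<eta> \<le> 1 \<longrightarrow>
        1 / C0 \<le> Re (Im_resolvent G p (Complex E \<eta>) \<one>\<^bsub>G\<^esub> \<one>\<^bsub>G\<^esub>) \<and>
        Re (Im_resolvent G p (Complex E \<eta>) \<one>\<^bsub>G\<^esub> \<one>\<^bsub>G\<^esub>) \<le> C0)"

definition R4 ::
    "('g, 'm) monoid_scheme \<Rightarrow> 'g set \<Rightarrow> real \<Rightarrow> ('g \<Rightarrow>\<^sub>0 complex) \<Rightarrow> real \<Rightarrow> real set \<Rightarrow> bool" where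
  "R4 G S C1 p \<gamma> I \<longleftrightarrow> 0 < \<gamma> \<and> \<gamma> \<le> 1 \<and>
     (\<exists>C C1'. C > 0 \<and> C1' > 2 * C1 + 1 \<and>
        (\<forall>E\<in>I. \<forall>\<eta>. 0 < \<eta> \<and> \<eta> \<le> 1 \<longrightarrow>
           (let t = (\<lambda>g. \<eta>\<^sup>2 * real (word_length G S g) powr C1' *
                         cmod (Im_resolvent G p (Complex E \<eta>) \<one>\<^bsub>G\<^esub> g) ^ 4)
            in t summable_on carrier G \<and> (\<Sum>\<^sub>\<infinity>g\<in>carrier G. t g) \<le> C * \<eta> powr (1 + \<gamma>))))"

section \<open>Eigenbases and observables\<close>

definition orthonormal_eigenbasis :: "nat \<Rightarrow> complex mat \<Rightarrow> (nat \<Rightarrow> complex vec) \<Rightarrow> bool" where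
  "orthonormal_eigenbasis N A \<phi> \<longleftrightarrow>
     (\<forall>j<N. \<phi> j \<in> carrier_vec N \<and> (\<exists>\<mu>. eigenvector A (\<phi> j) \<mu>)) \<and>
     (\<forall>j<N. \<forall>k<N. cv_inner (\<phi> j) (\<phi> k) = (if j = k then 1 else 0))"

definition eigenvalue_of :: "complex mat \<Rightarrow> complex vec \<Rightarrow> complex" where
  "eigenvalue_of A v = (THE \<mu>. eigenvector A v \<mu>)"

definition spectral_indices :: "nat \<Rightarrow> complex mat \<Rightarrow> (nat \<Rightarrow> complex vec) \<Rightarrow> real set \<Rightarrow> nat set" where
  "spectral_indices N A \<phi> J = {j \<in> {0..<N}. eigenvalue_of A (\<phi> j) \<in> complex_of_real ` J}"

definition norm_one_inf :: "complex mat \<Rightarrow> real" where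
  "norm_one_inf K = Max (cmod ` elements_mat K)"

definition local_mat :: "nat \<Rightarrow> ('g \<Rightarrow> nat \<Rightarrow> nat) \<Rightarrow> 'g set \<Rightarrow> complex mat \<Rightarrow> bool" where
  "local_mat N \<rho> T K \<longleftrightarrow> K \<in> carrier_mat N N \<and>
     (\<forall>x<N. \<forall>y<N. (\<forall>g\<in>T. x \<noteq> \<rho> g y) \<longrightarrow> K $$ (x, y) = 0)"

definition obs_vec :: "nat \<Rightarrow> ('g \<Rightarrow> nat \<Rightarrow> nat) \<Rightarrow> complex mat \<Rightarrow> 'g \<Rightarrow> complex vec" where
  "obs_vec N \<rho> K g = vec N (\<lambda>x. K $$ (\<rho> g x, x))"

definition obs_symbol :: "nat \<Rightarrow> ('g \<Rightarrow> nat \<Rightarrow> nat) \<Rightarrow> 'g set \<Rightarrow> complex mat \<Rightarrow> ('g \<Rightarrow>\<^sub>0 complex)" where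
  "obs_symbol N \<rho> T K =
     (\<Sum>g\<in>T. Poly_Mapping.single g ((1 / of_nat N) * (\<Sum>x\<in>{0..<N}. obs_vec N \<rho> K g $ x)))"

definition obs_mean :: "nat \<Rightarrow> ('g \<Rightarrow> nat \<Rightarrow> nat) \<Rightarrow> 'g set \<Rightarrow> complex mat \<Rightarrow> complex mat" where
  "obs_mean N \<rho> T K = perm_rep_ga N \<rho> (obs_symbol N \<rho> T K)"

definition window :: "real \<Rightarrow> real \<Rightarrow> real set" where
  "window E \<eta> = {E - \<eta>..E + \<eta>}"

definition obs_dev ::
    "nat \<Rightarrow> ('g \<Rightarrow> nat \<Rightarrow> nat) \<Rightarrow> 'g set \<Rightarrow> complex mat \<Rightarrow> complex vec \<Rightarrow> complex vec \<Rightarrow> real" where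
  "obs_dev N \<rho> T K u v =
     (cmod (cv_inner u (K *\<^sub>v v) - cv_inner u (obs_mean N \<rho> T K *\<^sub>v v)))\<^sup>2"

text \<open>Since \<open>x / 0 = 0\<close>, averages over an empty set of indices are \<open>0\<close>.\<close>

definition ergodicity_bounds ::
    "nat \<Rightarrow> ('g \<Rightarrow> nat \<Rightarrow> nat) \<Rightarrow> ('g \<Rightarrow>\<^sub>0 complex) \<Rightarrow> (nat \<Rightarrow> complex vec) \<Rightarrow> real set \<Rightarrow>
     'g set \<Rightarrow> complex mat \<Rightarrow> real \<Rightarrow> real \<Rightarrow> bool" where
  "ergodicity_bounds N \<rho> p \<phi> I T K \<eta> B \<longleftrightarrow>
     (let \<Lambda> = spectral_indices N (perm_rep_ga N \<rho> p) \<phi> in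
       (\<forall>E1\<in>I. \<forall>E2\<in>I.
          (1 / real (card (\<Lambda> (window E1 \<eta>)))) *
          (\<Sum>j\<in>\<Lambda> (window E1 \<eta>). \<Sum>k\<in>\<Lambda> (window E2 \<eta>). obs_dev N \<rho> T K (\<phi> k) (\<phi> j)) \<le> B) \<and>
       (1 / real (card (\<Lambda> I))) * (\<Sum>j\<in>\<Lambda> I. obs_dev N \<rho> T K (\<phi> j) (\<phi> j)) \<le> B)"

end

theory Submission
  imports Defs "HOL-Analysis.Inner_Product" "HOL-Analysis.L2_Norm" "HOL-Real_Asymp.Real_Asymp"
begin

text \<open>Write \<open>q\<^sub>E\<close> for a polynomial in \<open>p\<close> of degree \<open>n\<close> that dominates the Poisson kernel of width
  \<open>\<eta>\<close> at \<open>E\<close> on the spectrum and agrees with it up to an error \<open>exp (- c \<eta> n)\<close>; a truncated Chebyshev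
  expansion of the resolvent provides it. The double sum of squared matrix elements of a centred local
  observable over two spectral windows is at most a constant times \<open>\<eta>\<^sup>2\<close> times a trace involving
  \<open>\<rho>(q\<^bsub>E1\<^esub>)\<close> and \<open>\<rho>(q\<^bsub>E2\<^esub>)\<close>. Away from the bad points this trace equals a sum of quadratic forms
  \<open>\<langle>K\<^sub>t, \<rho>(w) K\<^sub>s\<rangle>\<close>, where \<open>w\<^sub>g\<close> is the product of a coefficient of \<open>q\<^bsub>E1\<^esub>\<close> at \<open>g\<close> and one of \<open>q\<^bsub>E2\<^esub>\<close> at
  \<open>t g s\<^sup>-\<^sup>1\<close>. Rapid decay and (R4) bound \<open>\<parallel>\<lambda>(w)\<parallel>\<close> by \<open>\<eta> powr ((\<gamma> - 1) / 2)\<close>, and strong convergence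
  transfers this to \<open>\<rho>(w)\<close> on the mean-zero vectors \<open>K\<^sub>s\<close>. Without strong convergence, the number of
  orthonormal vectors on which \<open>\<rho>(w)\<close> is large is bounded by the trace of a power of
  \<open>\<rho>(w)\<^sup>*\<rho>(w)\<close> of order \<open>ln (ln N)\<close>, which again is computed in the regular representation up to
  bad points.\<close>

section \<open>Square-summable functions as a Hilbert space\<close>

text \<open>The polynomial \<open>q_E\<close> acts in three settings: on scalars (the eigenvalues),
  on functions on the group and on functions on \<open>{0..<N}\<close>. Its error bound is therefore
  proved once, for a symmetric operator on a real Hilbert space, where Pell's equation transfers the
  bound 1 on Chebyshev polynomials from \<open>[-1, 1]\<close> to operators. Scale: words of length
  \<open>n\<close> times a constant must stay in the ball of radius of order \<open>ln N\<close> in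
  which most points look free, so \<open>n\<close> is at most of order \<open>ln N\<close>. The
  error \<open>exp (- c \<eta> n)\<close> must beat powers of \<open>ln N\<close>, which forces
  \<open>\<eta>\<close> to be of order \<open>ln (ln N) / ln N\<close>. Without strong convergence
  the symbol \<open>w\<close> is raised to a power of order \<open>ln (ln N)\<close>; the degree
  shrinks by this factor and \<open>\<eta>\<close> grows by it. Exponent: (R4) bounds the weighted
  fourth powers by a multiple of \<open>\<eta> powr (\<gamma> - 1)\<close>, and rapid decay takes
  the square root. The factor \<open>\<eta>^2\<close> of the two windows, divided by the
  \<open>N \<eta>\<close> eigenvalues of one window, leaves the exponent
  \<open>2 + (\<gamma> - 1) / 2 - 1 = (1 + \<gamma>) / 2\<close>.\<close>

typedef 'a l2 = "{f :: 'a \<Rightarrow> complex. (\<lambda>x. (cmod (f x))\<^sup>2) summable_on UNIV}"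
  morphisms l2_at Abs_l2
  by (rule exI[of _ "\<lambda>_. 0"]) simp

lemma l2_summable: "(\<lambda>x. (cmod (l2_at f x))\<^sup>2) summable_on UNIV"
  using l2_at[of f] by simp

lemma l2_eqI: "(\<And>x. l2_at f x = l2_at g x) \<Longrightarrow> f = g"
  by (metis ext l2_at_inject)

lemma Abs_l2_at: "(\<lambda>x. (cmod (f x))\<^sup>2) summable_on UNIV \<Longrightarrow> l2_at (Abs_l2 f) x = f x"
  by (simp add: Abs_l2_inverse)

lemma real_summable_comparison:
  fixes f g :: "'a \<Rightarrow> real"
  assumes "g summable_on A" "\<And>x. x \<in> A \<Longrightarrow> \<bar>f x\<bar> \<le> g x"
  shows "f summable_on A"
proof -
  have "(\<lambda>x. norm (f x)) summable_on A"
    by (rule summable_on_comparison_test[OF assms(1)]) (use assms(2) in auto)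
  then show ?thesis
    by (rule abs_summable_summable)
qed

lemma cmod_add_sq_le: "(cmod (a + b))\<^sup>2 \<le> 2 * (cmod a)\<^sup>2 + 2 * (cmod b)\<^sup>2"
proof -
  have "(cmod (a + b))\<^sup>2 \<le> (cmod a + cmod b)\<^sup>2"
    by (intro power_mono norm_triangle_ineq) auto
  also have "\<dots> \<le> 2 * (cmod a)\<^sup>2 + 2 * (cmod b)\<^sup>2"
    using sum_squares_bound[of "cmod a" "cmod b"] by (simp add: power2_sum)
  finally show ?thesis .
qed

lemma sq_summable_add:
  assumes "(\<lambda>x. (cmod (f x))\<^sup>2) summable_on A" "(\<lambda>x. (cmod (g x))\<^sup>2) summable_on A"
  shows "(\<lambda>x. (cmod (f x + g x))\<^sup>2) summable_on A"
  by (rule real_summable_comparison[where g = "\<lambda>x. 2 * (cmod (f x))\<^sup>2 + 2 * (cmod (g x))\<^sup>2"])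
    (auto intro!: summable_on_add summable_on_cmult_right assms cmod_add_sq_le)

lemma sq_summable_cmult:
  assumes "(\<lambda>x. (cmod (f x))\<^sup>2) summable_on A"
  shows "(\<lambda>x. (cmod (c * f x))\<^sup>2) summable_on A"
  by (simp add: norm_mult power_mult_distrib summable_on_cmult_right assms)

lemma l2_mult_abs_summable:
  "(\<lambda>x. cmod (cnj (l2_at f x) * l2_at g x)) summable_on UNIV"
proof (rule real_summable_comparison[where g = "\<lambda>x. (cmod (l2_at f x))\<^sup>2 + (cmod (l2_at g x))\<^sup>2"])
  show "(\<lambda>x. (cmod (l2_at f x))\<^sup>2 + (cmod (l2_at g x))\<^sup>2) summable_on UNIV"
    by (intro summable_on_add l2_summable)
  fix x
  have "2 * (cmod (l2_at f x) * cmod (l2_at g x)) \<le> (cmod (l2_at f x))\<^sup>2 + (cmod (l2_at g x))\<^sup>2"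
    using sum_squares_bound[of "cmod (l2_at f x)" "cmod (l2_at g x)"] by (simp add: algebra_simps)
  moreover have "0 \<le> cmod (l2_at f x) * cmod (l2_at g x)"
    by simp
  ultimately have "cmod (l2_at f x) * cmod (l2_at g x) \<le> (cmod (l2_at f x))\<^sup>2 + (cmod (l2_at g x))\<^sup>2"
    by linarith
  then show "\<bar>cmod (cnj (l2_at f x) * l2_at g x)\<bar> \<le> (cmod (l2_at f x))\<^sup>2 + (cmod (l2_at g x))\<^sup>2"
    by (simp add: norm_mult)
qed

lemma l2_mult_summable: "(\<lambda>x. cnj (l2_at f x) * l2_at g x) summable_on UNIV"
  by (rule abs_summable_summable[OF l2_mult_abs_summable])

definition cinner :: "'a l2 \<Rightarrow> 'a l2 \<Rightarrow> complex" where
  "cinner f g = (\<Sum>\<^sub>\<infinity>x. cnj (l2_at f x) * l2_at g x)"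

definition cscale :: "complex \<Rightarrow> 'a l2 \<Rightarrow> 'a l2" where
  "cscale c f = Abs_l2 (\<lambda>x. c * l2_at f x)"

lemma cscale_at [simp]: "l2_at (cscale c f) x = c * l2_at f x"
  unfolding cscale_def by (intro Abs_l2_at sq_summable_cmult l2_summable)

lemma cinner_commute: "cinner f g = cnj (cinner g f)"
  unfolding cinner_def infsum_cnj[symmetric] by (simp add: mult.commute)

lemma cinner_cscale_right: "cinner f (cscale c g) = c * cinner f g"
  unfolding cinner_def by (subst infsum_cmult_right'[symmetric]) (simp add: ac_simps)

lemma cinner_cscale_left: "cinner (cscale c f) g = cnj c * cinner f g"
  unfolding cinner_def by (subst infsum_cmult_right'[symmetric]) (simp add: ac_simps)

lemma cinner_self: "cinner f f = of_real (\<Sum>\<^sub>\<infinity>x. (cmod (l2_at f x))\<^sup>2)"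
proof -
  have "((\<lambda>x. complex_of_real ((cmod (l2_at f x))\<^sup>2)) has_sum of_real (\<Sum>\<^sub>\<infinity>x. (cmod (l2_at f x))\<^sup>2)) UNIV"
    using l2_summable[of f] by (intro has_sum_of_real) simp
  moreover have "(\<lambda>x. complex_of_real ((cmod (l2_at f x))\<^sup>2)) = (\<lambda>x. cnj (l2_at f x) * l2_at f x)"
    by (metis complex_norm_square mult.commute)
  ultimately show ?thesis
    unfolding cinner_def by (metis infsumI)
qed

instantiation l2 :: (type) real_vector
begin

definition "(0 :: 'a l2) = Abs_l2 (\<lambda>_. 0)"
definition "f + g = Abs_l2 (\<lambda>x. l2_at f x + l2_at g x)"
definition "f - g = Abs_l2 (\<lambda>x. l2_at f x - l2_at g x)"
definition "- f = Abs_l2 (\<lambda>x. - l2_at f x)"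
definition "r *\<^sub>R f = Abs_l2 (\<lambda>x. r *\<^sub>R l2_at f x)"

lemma l2_at_zero [simp]: "l2_at 0 x = 0"
  unfolding zero_l2_def by (rule Abs_l2_at) simp

lemma l2_at_add [simp]: "l2_at (f + g) x = l2_at f x + l2_at g x"
  unfolding plus_l2_def by (intro Abs_l2_at sq_summable_add l2_summable)

lemma l2_at_uminus [simp]: "l2_at (- f) x = - l2_at f x"
  unfolding uminus_l2_def by (intro Abs_l2_at) (simp add: l2_summable)

lemma l2_at_diff [simp]: "l2_at (f - g) x = l2_at f x - l2_at g x"
proof -
  have "(\<lambda>x. (cmod (l2_at f x + l2_at (- g) x))\<^sup>2) summable_on UNIV"
    by (intro sq_summable_add l2_summable)
  then show ?thesis
    unfolding minus_l2_def by (intro Abs_l2_at) simp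
qed

lemma l2_at_scaleR [simp]: "l2_at (r *\<^sub>R f) x = r *\<^sub>R l2_at f x"
  unfolding scaleR_l2_def scaleR_conv_of_real
  by (intro Abs_l2_at sq_summable_cmult l2_summable)

instance
  by standard (auto intro!: l2_eqI simp: algebra_simps scaleR_conv_of_real)

end

lemma l2_at_sum [simp]: "l2_at (sum f A) x = (\<Sum>i\<in>A. l2_at (f i) x)"
  by (induction A rule: infinite_finite_induct) auto

lemma cinner_add_right: "cinner f (g + h) = cinner f g + cinner f h"
  unfolding cinner_def
  by (subst infsum_add[symmetric]) (simp_all add: l2_mult_summable distrib_left)

lemma cinner_add_left: "cinner (f + g) h = cinner f h + cinner g h"
  by (metis cinner_add_right cinner_commute complex_cnj_add)

text \<open>The Chebyshev argument runs in real inner product spaces, so the type classes carry the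
  real part of \<open>cinner\<close>; complex scalars remain available through
  \<open>cscale\<close>.\<close>

instantiation l2 :: (type) real_inner
begin

definition "inner f g = Re (cinner f g)"
definition "norm f = sqrt (inner f (f :: 'a l2))"
definition "dist f g = norm (f - (g :: 'a l2))"
definition "sgn f = f /\<^sub>R norm (f :: 'a l2)"
definition "uniformity = (INF e\<in>{0 <..}. principal {(x, y :: 'a l2). dist x y < e})"
definition "open U \<longleftrightarrow> (\<forall>x\<in>U. eventually (\<lambda>(x', y). x' = x \<longrightarrow> y \<in> U)
    (uniformity :: ('a l2 \<times> 'a l2) filter))"

instance
proof
  fix x y z :: "'a l2" and r :: real
  show "inner x y = inner y x"
    unfolding inner_l2_def by (subst cinner_commute) simp
  show "inner (x + y) z = inner x z + inner y z"
    by (simp add: inner_l2_def cinner_add_left)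
  have "r *\<^sub>R x = cscale (of_real r) x"
    by (rule l2_eqI) (simp add: scaleR_conv_of_real)
  then show "inner (r *\<^sub>R x) y = r * inner x y"
    by (simp add: inner_l2_def cinner_cscale_left)
  show "0 \<le> inner x x"
    by (simp add: inner_l2_def cinner_self infsum_nonneg)
  show "inner x x = 0 \<longleftrightarrow> x = 0"
  proof
    assume "inner x x = 0"
    then have "(\<Sum>\<^sub>\<infinity>i. (cmod (l2_at x i))\<^sup>2) = 0"
      by (simp add: inner_l2_def cinner_self)
    then have "(cmod (l2_at x i))\<^sup>2 = 0" for i
      using nonneg_infsum_le_0D[OF _ l2_summable, of x i] by simp
    then show "x = 0"
      by (intro l2_eqI) simp
  qed (simp add: inner_l2_def cinner_def)
qed (rule norm_l2_def dist_l2_def sgn_l2_def uniformity_l2_def open_l2_def)+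

end

lemma l2_norm_sq: "(norm f)\<^sup>2 = (\<Sum>\<^sub>\<infinity>x. (cmod (l2_at f x))\<^sup>2)"
  by (simp add: power2_norm_eq_inner inner_l2_def cinner_self)

lemma l2_norm_eq: "norm f = sqrt (\<Sum>\<^sub>\<infinity>x. (cmod (l2_at f x))\<^sup>2)"
  by (metis l2_norm_sq norm_ge_zero real_sqrt_unique)

lemma l2_finite_sum_le: "finite F \<Longrightarrow> (\<Sum>x\<in>F. (cmod (l2_at f x))\<^sup>2) \<le> (norm f)\<^sup>2"
  unfolding l2_norm_sq by (intro finite_sum_le_infsum l2_summable) auto

lemma l2_at_le: "cmod (l2_at f x) \<le> norm f"
  using l2_finite_sum_le[of "{x}" f] by (simp add: power2_le_iff_abs_le)

lemma l2_norm_leI: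
  assumes "0 \<le> c" "\<And>F. finite F \<Longrightarrow> (\<Sum>x\<in>F. (cmod (l2_at f x))\<^sup>2) \<le> c\<^sup>2"
  shows "norm f \<le> c"
proof -
  have "(norm f)\<^sup>2 \<le> c\<^sup>2"
    unfolding l2_norm_sq by (rule infsum_le_finite_sums) (use assms l2_summable in auto)
  then show ?thesis
    using assms(1) by (simp add: power2_le_iff_abs_le)
qed

lemma cinner_cmod_le: "cmod (cinner f g) \<le> norm f * norm g"
proof (cases "cinner f g = 0")
  case False
  \<comment> \<open>Rotating \<open>g\<close> by the phase \<open>u\<close> makes the inner product
    real and nonnegative, so the real Cauchy--Schwarz inequality applies.\<close>
  define u where "u = cnj (cinner f g) / cmod (cinner f g)"
  have u: "cmod u = 1"
    using False by (simp add: u_def norm_divide)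
  have "u * cinner f g = cmod (cinner f g)"
    using False by (simp add: u_def complex_norm_square[symmetric] mult.commute power2_eq_square
        flip: complex_norm_square)
  then have "cmod (cinner f g) = inner f (cscale u g)"
    by (simp add: inner_l2_def cinner_cscale_right)
  also have "\<dots> \<le> norm f * norm (cscale u g)"
    by (rule norm_cauchy_schwarz)
  also have "norm (cscale u g) = norm g"
    by (simp add: l2_norm_eq norm_mult u)
  finally show ?thesis .
qed simp

lemma norm_cscale: "norm (cscale c f) = cmod c * norm f"
  by (simp add: l2_norm_eq norm_mult power_mult_distrib infsum_cmult_right' real_sqrt_mult)

text \<open>The limit is taken pointwise. Bounds for sums over finite sets survive the pointwise
  limit, and \<open>l2_norm_leI\<close> turns them into a norm bound.\<close>

instance l2 :: (type) complete_space
proof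
  fix X :: "nat \<Rightarrow> 'a l2"
  assume X: "Cauchy X"
  have "Cauchy (\<lambda>n. l2_at (X n) x)" for x
  proof (rule CauchyI)
    fix e :: real assume "0 < e"
    then obtain M where M: "\<forall>m\<ge>M. \<forall>n\<ge>M. norm (X m - X n) < e"
      using CauchyD[OF X] by blast
    have "cmod (l2_at (X m) x - l2_at (X n) x) \<le> norm (X m - X n)" for m n
      using l2_at_le[of "X m - X n" x] by simp
    then show "\<exists>M. \<forall>m\<ge>M. \<forall>n\<ge>M. norm (l2_at (X m) x - l2_at (X n) x) < e"
      using M by (meson le_less_trans)
  qed
  then have "\<forall>x. \<exists>l. (\<lambda>n. l2_at (X n) x) \<longlonglongrightarrow> l"
    by (simp add: Cauchy_convergent_iff convergent_def)
  then obtain g where g: "\<And>x. (\<lambda>n. l2_at (X n) x) \<longlonglongrightarrow> g x"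
    by metis
  have close: "(\<Sum>x\<in>F. (cmod (l2_at (X m) x - g x))\<^sup>2) \<le> e\<^sup>2"
    if "finite F" "0 < e" "\<forall>n\<ge>m. norm (X m - X n) < e" for F m e
  proof (rule tendsto_upperbound)
    show "(\<lambda>n. \<Sum>x\<in>F. (cmod (l2_at (X m) x - l2_at (X n) x))\<^sup>2) \<longlonglongrightarrow>
        (\<Sum>x\<in>F. (cmod (l2_at (X m) x - g x))\<^sup>2)"
      by (intro tendsto_intros g)
    have "(\<Sum>x\<in>F. (cmod (l2_at (X m) x - l2_at (X n) x))\<^sup>2) \<le> e\<^sup>2" if "n \<ge> m" for n
    proof -
      have "(\<Sum>x\<in>F. (cmod (l2_at (X m - X n) x))\<^sup>2) \<le> (norm (X m - X n))\<^sup>2"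
        by (rule l2_finite_sum_le) fact
      also have "\<dots> \<le> e\<^sup>2"
        using that \<open>\<forall>n\<ge>m. norm (X m - X n) < e\<close> by (intro power_mono) (auto intro: less_imp_le)
      finally show ?thesis by simp
    qed
    then show "\<forall>\<^sub>F n in sequentially. (\<Sum>x\<in>F. (cmod (l2_at (X m) x - l2_at (X n) x))\<^sup>2) \<le> e\<^sup>2"
      by (auto simp: eventually_sequentially)
  qed simp
  obtain M where M: "\<forall>m\<ge>M. \<forall>n\<ge>M. norm (X m - X n) < 1"
    using CauchyD[OF X, of 1] by auto
  have "(\<lambda>x. (cmod (l2_at (X M) x - g x))\<^sup>2) summable_on UNIV"
    by (rule nonneg_bdd_above_summable_on)
      (use close[of _ 1 M] M in \<open>auto intro!: bdd_aboveI[of _ 1]\<close>)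
  \<comment> \<open>The limit is square summable because \<open>g = X M - (X M - g)\<close> with
    both terms square summable.\<close>
  then have "(\<lambda>x. (cmod (l2_at (X M) x + (-1) * (l2_at (X M) x - g x)))\<^sup>2) summable_on UNIV"
    by (intro sq_summable_add l2_summable sq_summable_cmult)
  then have gs: "(\<lambda>x. (cmod (g x))\<^sup>2) summable_on UNIV"
    by simp
  have "X \<longlonglongrightarrow> Abs_l2 g"
  proof (rule LIMSEQ_I)
    fix r :: real assume "0 < r"
    then obtain M where M: "\<forall>m\<ge>M. \<forall>n\<ge>M. norm (X m - X n) < r / 2"
      using CauchyD[OF X, of "r / 2"] by auto
    have "norm (X m - Abs_l2 g) \<le> r / 2" if "m \<ge> M" for m
      by (rule l2_norm_leI)
        (use close[of _ "r / 2" m] M that \<open>0 < r\<close> in \<open>auto simp: Abs_l2_at[OF gs]\<close>)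
    then show "\<exists>no. \<forall>n\<ge>no. norm (X n - Abs_l2 g) < r"
      using \<open>0 < r\<close> by (intro exI[of _ M]) fastforce
  qed
  then show "convergent X"
    by (auto simp: convergent_def)
qed

instance l2 :: (type) banach ..

section \<open>Chebyshev expansion of the resolvent\<close>

text \<open>The vector \<open>T_n(P) v\<close> for the Chebyshev polynomial of the first kind, given
  directly by the three-term recurrence so that it makes sense for any map on a real vector
  space.\<close>

fun cheb :: "('a \<Rightarrow> 'a) \<Rightarrow> 'a \<Rightarrow> nat \<Rightarrow> 'a::real_vector" where
  "cheb P v 0 = v"
| "cheb P v (Suc 0) = P v"
| "cheb P v (Suc (Suc n)) = 2 *\<^sub>R P (cheb P v (Suc n)) - cheb P v n"

text \<open>The Chebyshev polynomials of the second kind, shifted by one: \<open>chebU P v n = U\<^sub>n\<^sub>-\<^sub>1(P) v\<close>.\<close>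

fun chebU :: "('a \<Rightarrow> 'a) \<Rightarrow> 'a \<Rightarrow> nat \<Rightarrow> 'a::real_vector" where
  "chebU P v 0 = 0"
| "chebU P v (Suc n) = P (chebU P v n) + cheb P v n"

text \<open>Classically \<open>T_(n+1) = x U_n - U_(n-1)\<close>. Together with the defining
  equation \<open>U_n = x U_(n-1) + T_n\<close> it lets \<open>cheb_pell\<close> induct on the pair
  \<open>(T_n, U_(n-1))\<close>.\<close>

lemma cheb_Suc_chebU:
  assumes "linear P"
  shows "cheb P v (Suc n) = P (P (chebU P v n) + cheb P v n) - chebU P v n"
proof (induction n)
  case 0
  then show ?case using linear_0[OF assms] by simp
next
  case (Suc n)
  have "cheb P v (Suc (Suc n)) = 2 *\<^sub>R P (cheb P v (Suc n)) - cheb P v n"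
    by simp
  also have "P (P (chebU P v (Suc n)) + cheb P v (Suc n)) - chebU P v (Suc n) =
     P (P (chebU P v (Suc n))) + P (cheb P v (Suc n)) - P (chebU P v n) - cheb P v n"
    using linear_add[OF assms] by simp
  moreover have "P (cheb P v (Suc n)) = P (P (chebU P v (Suc n))) - P (chebU P v n)"
    unfolding Suc.IH using linear_diff[OF assms] by simp
  ultimately show ?case
    by (simp add: scaleR_2)
qed

text \<open>Pell's equation \<open>T\<^sub>n\<^sup>2 + (1 - x\<^sup>2) U\<^sub>n\<^sub>-\<^sub>1\<^sup>2 = 1\<close>, read as a quadratic form.\<close>

lemma cheb_pell:
  fixes P :: "'a::real_inner \<Rightarrow> 'a"
  assumes "linear P" and sym: "\<And>x y. inner (P x) y = inner x (P y)"
  shows "(norm (cheb P v n))\<^sup>2 + (norm (chebU P v n))\<^sup>2 - (norm (P (chebU P v n)))\<^sup>2 = (norm v)\<^sup>2"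
proof (induction n)
  case 0
  then show ?case using linear_0[OF assms(1)] by simp
next
  case (Suc n)
  define a b where "a = cheb P v n" and "b = chebU P v n"
  have "norm (cheb P v (Suc n))^2 = norm (P (P b + a))^2 - 2 * inner (P (P b + a)) b + norm b ^2"
    unfolding cheb_Suc_chebU[OF assms(1)] a_def b_def
    by (simp add: power2_norm_eq_inner inner_diff inner_commute)
  moreover have "inner (P (P b + a)) b = inner (P b) (P b) + inner a (P b)"
    by (subst sym) (simp add: inner_add_left inner_commute[of _ a])
  moreover have "norm (P b + a)^2 = norm (P b)^2 + 2 * inner a (P b) + norm a ^2"
    by (simp add: power2_norm_eq_inner inner_add inner_commute)
  ultimately show ?case
    using Suc by (simp add: a_def[symmetric] b_def[symmetric] power2_norm_eq_inner)
qed

lemma cheb_norm_le: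
  fixes P :: "'a::real_inner \<Rightarrow> 'a"
  assumes "linear P" "\<And>x y. inner (P x) y = inner x (P y)" "\<And>x. norm (P x) \<le> norm x"
  shows "norm (cheb P v n) \<le> norm v"
proof -
  have "(norm (P (chebU P v n)))\<^sup>2 \<le> (norm (chebU P v n))\<^sup>2"
    by (intro power_mono assms) auto
  then have "(norm (cheb P v n))\<^sup>2 \<le> (norm v)\<^sup>2"
    using cheb_pell[OF assms(1,2), of v n] by linarith
  then show ?thesis
    by (simp add: power2_le_iff_abs_le)
qed

text \<open>The inverse Joukowski map: the solution of \<open>z = (s + 1/s) / 2\<close> inside the
  unit disc. Its powers are the coefficients of \<open>1 / (z - x)\<close> in Chebyshev polynomials,
  up to a common factor.\<close>

definition joukowski :: "complex \<Rightarrow> complex" where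
  "joukowski z = (SOME s. s \<noteq> 0 \<and> cmod s < 1 \<and> s\<^sup>2 + 1 = 2 * z * s)"

text \<open>The two roots of the quadratic have product 1, so one of them lies in the open disc
  unless both are on the circle. On the circle they would be conjugate and their sum
  \<open>2 * z\<close> would be real.\<close>

lemma joukowski:
  assumes "Im z > 0"
  shows "joukowski z \<noteq> 0 \<and> cmod (joukowski z) < 1 \<and> (joukowski z)\<^sup>2 + 1 = 2 * z * joukowski z"
proof -
  define s where "s = z + csqrt (z\<^sup>2 - 1)"
  define t where "t = z - csqrt (z\<^sup>2 - 1)"
  have "s * t = z\<^sup>2 - (csqrt (z\<^sup>2 - 1))\<^sup>2"
    unfolding s_def t_def power2_eq_square by (rule square_diff_square_factored[symmetric])
  then have st: "s * t = 1"
    by simp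
  have sum_st: "s + t = 2 * z"
    by (simp add: s_def t_def)
  have s: "s\<^sup>2 + 1 = 2 * z * s"
    unfolding sum_st[symmetric] using st by (simp add: power2_eq_square algebra_simps)
  have t: "t\<^sup>2 + 1 = 2 * z * t"
    unfolding sum_st[symmetric] using st by (simp add: power2_eq_square algebra_simps)
  have "s \<noteq> 0" "t \<noteq> 0" using st by auto
  have "cmod s \<noteq> 1"
  proof
    assume "cmod s = 1"
    then have "cnj s * s = 1"
      by (metis complex_norm_square mult.commute of_real_1 one_power2)
    then have "cnj s = t"
      using st \<open>s \<noteq> 0\<close> by (metis mult.commute mult_cancel_left)
    moreover note sum_st
    ultimately have "Im (2 * z) = 0"
      by (metis add_uminus_conv_diff cnj.simps(2) diff_self plus_complex.simps(2))
    then show False using assms by simp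
  qed
  have "cmod s * cmod t = 1"
    using st by (metis norm_mult norm_one)
  then have t_eq: "cmod t = 1 / cmod s"
    using \<open>s \<noteq> 0\<close> by (simp add: field_simps)
  have "cmod s < 1 \<or> cmod t < 1"
  proof (cases "cmod s < 1")
    case False
    then have "1 < cmod s"
      using \<open>cmod s \<noteq> 1\<close> by linarith
    then show ?thesis
      by (auto simp: t_eq divide_less_eq)
  qed simp
  then show ?thesis
    unfolding joukowski_def
    using s t \<open>s \<noteq> 0\<close> \<open>t \<noteq> 0\<close>
    by (intro someI_ex[of "\<lambda>s. s \<noteq> 0 \<and> cmod s < 1 \<and> s\<^sup>2 + 1 = 2 * z * s"]) auto
qed

text \<open>Multiplying the quadratic equation by \<open>cnj s\<close> and taking imaginary parts
  expresses \<open>Im z\<close> through \<open>Im s\<close>. The inequality serves twice: it gives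
  the decay rate of \<open>s ^ k\<close> and it keeps the denominator \<open>1 - s^2\<close> away
  from 0.\<close>

lemma joukowski_bound:
  assumes "Im z > 0"
  shows "2 * Im z * cmod (joukowski z) \<le> 1 - (cmod (joukowski z))\<^sup>2"
proof -
  define s where "s = joukowski z"
  have s: "s \<noteq> 0" "cmod s < 1" "s\<^sup>2 + 1 = 2 * z * s"
    using joukowski[OF assms] by (auto simp: s_def)
  have "2 * z * (s * cnj s) = (s\<^sup>2 + 1) * cnj s"
    using s(3) by (simp add: algebra_simps)
  also have "\<dots> = s * (s * cnj s) + cnj s"
    by (simp add: power2_eq_square algebra_simps)
  finally have *: "2 * z * of_real ((cmod s)\<^sup>2) = s * of_real ((cmod s)\<^sup>2) + cnj s"
    unfolding complex_norm_square .
  have "2 * Im z * (cmod s)\<^sup>2 = Im s * (cmod s)\<^sup>2 - Im s"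
    using arg_cong[OF *, of Im] by simp
  also have "\<dots> = (- Im s) * (1 - (cmod s)\<^sup>2)"
    by (simp add: algebra_simps)
  also have "\<dots> \<le> cmod s * (1 - (cmod s)\<^sup>2)"
    using s(2) abs_Im_le_cmod[of s]
    by (intro mult_right_mono) (auto simp: abs_le_iff power_le_one)
  finally have "cmod s * (2 * Im z * cmod s) \<le> cmod s * (1 - (cmod s)\<^sup>2)"
    by (simp add: power2_eq_square algebra_simps)
  then show ?thesis
    using s(1) by (simp add: s_def)
qed

text \<open>For a root of modulus above 1/2, \<open>joukowski_bound\<close> and
  \<open>1 - r^2 <= 2 * (1 - r)\<close> give a gain linear in \<open>Im z\<close>; a smaller root
  satisfies the claim since \<open>Im z <= 1\<close>.\<close>

lemma joukowski_decay:
  assumes "0 < Im z" "Im z \<le> 1"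
  shows "cmod (joukowski z) \<le> 1 - Im z / 2"
proof (cases "cmod (joukowski z) \<le> 1 / 2")
  case False
  define r where "r = cmod (joukowski z)"
  have r: "r > 1/2" "r < 1" using False joukowski[OF assms(1)] by (auto simp: r_def)
  have "Im z * 1 \<le> Im z * (2 * r)" using r assms by (intro mult_left_mono) auto
  also have "\<dots> \<le> 1 - r\<^sup>2"
    using joukowski_bound[OF assms(1)] by (simp add: r_def)
  also have "1 - r\<^sup>2 = (1 - r) * (1 + r)"
    by (simp add: power2_eq_square algebra_simps)
  also have "\<dots> \<le> (1 - r) * 2"
    using r by (intro mult_left_mono) auto
  finally show ?thesis by (simp add: r_def)
qed (use assms in auto)

text \<open>Coefficients in the expansion of \<open>1 / (z - x)\<close> in Chebyshev polynomials of \<open>x\<close>.\<close>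

definition res_coef :: "complex \<Rightarrow> nat \<Rightarrow> complex" where
  "res_coef z k = (if k = 0 then 1 else 2) * 2 * joukowski z ^ Suc k / (1 - (joukowski z)\<^sup>2)"

text \<open>These relations say that the coefficients of \<open>T_k\<close> in
  \<open>(z - x)\<close> times the series match those of the constant 1, by
  \<open>2 x T_k = T_(k+1) + T_(k-1)\<close>. The indices 0 and 1 are separate because the zeroth
  coefficient lacks the factor 2 and \<open>x T_0 = T_1\<close>.\<close>

lemma res_coef_rec:
  assumes "Im z > 0"
  shows "2 * z * res_coef z (Suc (Suc k)) = res_coef z (Suc k) + res_coef z (Suc (Suc (Suc k)))"
    and "2 * z * res_coef z 1 = 2 * res_coef z 0 + res_coef z 2"
    and "2 * z * res_coef z 0 = 2 + res_coef z 1"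
proof -
  define s where "s = joukowski z"
  have s: "s \<noteq> 0" "cmod s < 1" "s\<^sup>2 + 1 = 2 * z * s"
    using joukowski[OF assms] by (auto simp: s_def)
  have "cmod (s\<^sup>2) < 1"
    using s(2) by (simp add: norm_power abs_square_less_1)
  then have "s\<^sup>2 \<noteq> 1"
    by auto
  then have d: "1 - s\<^sup>2 \<noteq> 0" by simp
  have r: "2 * z * s ^ Suc n = s ^ n + s ^ Suc (Suc n)" for n
  proof -
    have "2 * z * s ^ Suc n = (2 * z * s) * s ^ n" by simp
    also have "\<dots> = (s\<^sup>2 + 1) * s ^ n" by (simp add: s(3))
    finally show ?thesis by (simp add: algebra_simps power2_eq_square)
  qed
  have "2 * z * res_coef z (Suc (Suc k)) = 4 * (2 * z * s ^ Suc (Suc (Suc k))) / (1 - s\<^sup>2)"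
    by (simp add: res_coef_def s_def)
  also have "\<dots> = res_coef z (Suc k) + res_coef z (Suc (Suc (Suc k)))"
    unfolding r by (simp add: res_coef_def s_def add_divide_distrib distrib_left)
  finally show "2 * z * res_coef z (Suc (Suc k)) = res_coef z (Suc k) + res_coef z (Suc (Suc (Suc k)))" .
  have "2 * z * res_coef z 1 = 4 * (2 * z * s ^ Suc 1) / (1 - s\<^sup>2)"
    by (simp add: res_coef_def s_def)
  also have "\<dots> = 2 * res_coef z 0 + res_coef z 2"
    unfolding r by (simp add: res_coef_def s_def add_divide_distrib distrib_left numeral_2_eq_2)
  finally show "2 * z * res_coef z 1 = 2 * res_coef z 0 + res_coef z 2" .
  have "2 * z * res_coef z 0 = 2 * (2 * z * s ^ Suc 0) / (1 - s\<^sup>2)"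
    by (simp add: res_coef_def s_def)
  also have "\<dots> = (2 * (1 - s\<^sup>2) + 4 * s\<^sup>2) / (1 - s\<^sup>2)"
    unfolding r by (simp add: algebra_simps power2_eq_square)
  also have "\<dots> = 2 + 4 * s\<^sup>2 / (1 - s\<^sup>2)"
  proof -
    have "2 * (1 - s\<^sup>2) / (1 - s\<^sup>2) = 2"
      using d by (rule nonzero_mult_div_cancel_right)
    then show ?thesis by (simp only: add_divide_distrib)
  qed
  also have "\<dots> = 2 + res_coef z 1"
    by (simp add: res_coef_def s_def power2_eq_square)
  finally show "2 * z * res_coef z 0 = 2 + res_coef z 1" .
qed

lemma res_coef_norm:
  assumes "0 < Im z" "Im z \<le> 1"
  shows "cmod (res_coef z k) \<le> 2 / Im z * (1 - Im z / 2) ^ k"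
proof -
  define s where "s = joukowski z"
  have s: "s \<noteq> 0" "cmod s < 1"
    using joukowski[OF assms(1)] by (auto simp: s_def)
  have b: "2 * Im z * cmod s \<le> 1 - (cmod s)\<^sup>2"
    using joukowski_bound[OF assms(1)] by (simp add: s_def)
  have "1 - (cmod s)\<^sup>2 \<le> cmod (1 - s\<^sup>2)"
    using norm_triangle_ineq2[of 1 "s\<^sup>2"] by (simp add: norm_power)
  then have "2 * Im z * cmod s \<le> cmod (1 - s\<^sup>2)" using b by linarith
  moreover have "0 < 2 * Im z * cmod s" using s assms by simp
  moreover from calculation have "0 < cmod (1 - s\<^sup>2)" by linarith
  ultimately have *: "cmod s / cmod (1 - s\<^sup>2) \<le> 1 / (2 * Im z)"
    using assms by (auto simp add: divide_le_eq le_divide_eq algebra_simps)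
  have "cmod (res_coef z k) \<le> 4 * (cmod s / cmod (1 - s\<^sup>2)) * cmod s ^ k"
    by (auto simp: res_coef_def s_def[symmetric] norm_mult norm_divide norm_power divide_right_mono)
  also have "\<dots> \<le> 4 * (1 / (2 * Im z)) * (1 - Im z / 2) ^ k"
    using joukowski_decay[OF assms] assms
    by (intro mult_mono * power_mono) (auto simp: s_def)
  finally show ?thesis by simp
qed

text \<open>\<open>T1\<close>, \<open>T2\<close>, \<open>T3\<close> stand for consecutive Chebyshev
  vectors, and only two boundary terms remain after adding the next summand. The form with free
  \<open>y\<close> and \<open>v\<close> covers both parts of \<open>res_partial_sum\<close>: the
  imaginary part is the case with \<open>- y\<close>, with \<open>A\<close> and \<open>B\<close>
  exchanged and \<open>v = 0\<close>.\<close>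

lemma res_partial_sum_step:
  fixes P :: "'a::real_vector \<Rightarrow> 'a"
  assumes P: "linear P"
    and IH: "x *\<^sub>R A - P A - y *\<^sub>R B = v + (a2 / 2) *\<^sub>R T1 - (a1 / 2) *\<^sub>R T2"
    and PT: "P T2 = (1/2) *\<^sub>R (T3 + T1)"
    and c: "2 * (x * a2 - y * b2) = a1 + a3"
  shows "x *\<^sub>R (A + a2 *\<^sub>R T2) - P (A + a2 *\<^sub>R T2) - y *\<^sub>R (B + b2 *\<^sub>R T2) =
    v + (a3 / 2) *\<^sub>R T2 - (a2 / 2) *\<^sub>R T3"
proof -
  have c': "x * a2 - y * b2 = a1 / 2 + a3 / 2"
    using c by simp
  have "P (A + a2 *\<^sub>R T2) = P A + a2 *\<^sub>R P T2"
    by (simp only: linear_add[OF P] linear_scale[OF P])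
  then have "x *\<^sub>R (A + a2 *\<^sub>R T2) - P (A + a2 *\<^sub>R T2) - y *\<^sub>R (B + b2 *\<^sub>R T2) =
      (x *\<^sub>R A - P A - y *\<^sub>R B) + (x * a2 - y * b2) *\<^sub>R T2 - a2 *\<^sub>R P T2"
    by (simp add: scaleR_add_right scaleR_diff_left)
  also have "\<dots> = v + (a3 / 2) *\<^sub>R T2 - (a2 / 2) *\<^sub>R T3"
    unfolding IH c' PT by (simp add: scaleR_add_right scaleR_add_left)
  finally show ?thesis .
qed

lemma res_partial_sum_base:
  fixes P :: "'a::real_vector \<Rightarrow> 'a"
  assumes P: "linear P"
    and T2: "P (P v) = (1/2) *\<^sub>R (T2 + v)"
    and c: "2 * (x * a0 - y * b0) = 2 * e + a1" "2 * (x * a1 - y * b1) = 2 * a0 + a2"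
  shows "x *\<^sub>R (a0 *\<^sub>R v + a1 *\<^sub>R P v) - P (a0 *\<^sub>R v + a1 *\<^sub>R P v) - y *\<^sub>R (b0 *\<^sub>R v + b1 *\<^sub>R P v) =
    e *\<^sub>R v + (a2 / 2) *\<^sub>R P v - (a1 / 2) *\<^sub>R T2"
proof -
  have c': "x * a0 - y * b0 = e + a1 / 2" "x * a1 - y * b1 = a0 + a2 / 2"
    using arg_cong[OF c(1), of "\<lambda>t. t / 2"] arg_cong[OF c(2), of "\<lambda>t. t / 2"]
    by (simp_all add: add_divide_distrib)
  have "P (a0 *\<^sub>R v + a1 *\<^sub>R P v) = a0 *\<^sub>R P v + a1 *\<^sub>R P (P v)"
    by (simp only: linear_add[OF P] linear_scale[OF P])
  then have "x *\<^sub>R (a0 *\<^sub>R v + a1 *\<^sub>R P v) - P (a0 *\<^sub>R v + a1 *\<^sub>R P v) - y *\<^sub>R (b0 *\<^sub>R v + b1 *\<^sub>R P v) =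
      (x * a0 - y * b0) *\<^sub>R v + (x * a1 - y * b1) *\<^sub>R P v - a0 *\<^sub>R P v - a1 *\<^sub>R P (P v)"
    by (simp add: scaleR_add_right scaleR_diff_left)
  also have "\<dots> = e *\<^sub>R v + (a2 / 2) *\<^sub>R P v - (a1 / 2) *\<^sub>R T2"
    unfolding c' T2 by (simp add: scaleR_add_right scaleR_add_left)
  finally show ?thesis .
qed

text \<open>Multiplying the partial sum of the Chebyshev expansion by \<open>z - P\<close>, split into real and
  imaginary parts so that it makes sense in a real vector space.\<close>

lemma res_partial_sum:
  fixes P :: "'a::real_vector \<Rightarrow> 'a" and v :: 'a
  assumes P: "linear P" and z: "Im z > 0"
  defines "A \<equiv> \<lambda>n. \<Sum>k\<le>n. Re (res_coef z k) *\<^sub>R cheb P v k"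
    and "B \<equiv> \<lambda>n. \<Sum>k\<le>n. Im (res_coef z k) *\<^sub>R cheb P v k"
  shows "Re z *\<^sub>R A (Suc n) - P (A (Suc n)) - Im z *\<^sub>R B (Suc n) =
           v + (Re (res_coef z (n + 2)) / 2) *\<^sub>R cheb P v (n + 1)
             - (Re (res_coef z (n + 1)) / 2) *\<^sub>R cheb P v (n + 2)" (is "?R n")
    and "Re z *\<^sub>R B (Suc n) - P (B (Suc n)) + Im z *\<^sub>R A (Suc n) =
           (Im (res_coef z (n + 2)) / 2) *\<^sub>R cheb P v (n + 1)
             - (Im (res_coef z (n + 1)) / 2) *\<^sub>R cheb P v (n + 2)" (is "?I n")
proof -
  have PT: "P (cheb P v (Suc k)) = (1/2) *\<^sub>R (cheb P v (Suc (Suc k)) + cheb P v k)" for k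
    by simp
  have reR: "2 * (Re z * Re (res_coef z (Suc (Suc k))) - Im z * Im (res_coef z (Suc (Suc k)))) =
      Re (res_coef z (Suc k)) + Re (res_coef z (Suc (Suc (Suc k))))"
    "2 * (Re z * Im (res_coef z (Suc (Suc k))) + Im z * Re (res_coef z (Suc (Suc k)))) =
      Im (res_coef z (Suc k)) + Im (res_coef z (Suc (Suc (Suc k))))" for k
    using res_coef_rec(1)[OF z, of k, THEN arg_cong[where f = Re]]
      res_coef_rec(1)[OF z, of k, THEN arg_cong[where f = Im]] by simp_all
  have re1: "2 * (Re z * Re (res_coef z 1) - Im z * Im (res_coef z 1)) =
      2 * Re (res_coef z 0) + Re (res_coef z 2)"
    "2 * (Re z * Im (res_coef z 1) + Im z * Re (res_coef z 1)) =
      2 * Im (res_coef z 0) + Im (res_coef z 2)"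
    using res_coef_rec(2)[OF z, THEN arg_cong[where f = Re]]
      res_coef_rec(2)[OF z, THEN arg_cong[where f = Im]] by simp_all
  have re0: "2 * (Re z * Re (res_coef z 0) - Im z * Im (res_coef z 0)) = 2 + Re (res_coef z 1)"
    "2 * (Re z * Im (res_coef z 0) + Im z * Re (res_coef z 0)) = Im (res_coef z 1)"
    using res_coef_rec(3)[OF z, THEN arg_cong[where f = Re]]
      res_coef_rec(3)[OF z, THEN arg_cong[where f = Im]] by simp_all
  have lin: "P (x + r *\<^sub>R y) = P x + r *\<^sub>R P y" for x y r
    by (simp add: linear_add[OF P] linear_scale[OF P])
  have AS: "A (Suc n) = A n + Re (res_coef z (Suc n)) *\<^sub>R cheb P v (Suc n)"
    "B (Suc n) = B n + Im (res_coef z (Suc n)) *\<^sub>R cheb P v (Suc n)" for n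
    by (simp_all add: A_def B_def)
  have A0: "A 0 = Re (res_coef z 0) *\<^sub>R v" "B 0 = Im (res_coef z 0) *\<^sub>R v"
    by (simp_all add: A_def B_def)
  have "?R n \<and> ?I n"
  proof (induction n)
    case 0
    have T2: "P (P v) = (1/2) *\<^sub>R (cheb P v 2 + v)"
      by (simp add: numeral_2_eq_2)
    have "?R 0"
      using res_partial_sum_base[OF P T2, of "Re z" "Re (res_coef z 0)" "Im z" "Im (res_coef z 0)" 1
          "Re (res_coef z 1)" "Im (res_coef z 1)" "Re (res_coef z 2)"] re0 re1
      unfolding AS A0 by (simp add: numeral_2_eq_2 del: mult_eq_if)
    \<comment> \<open>The imaginary part uses the same base identity with the roles of
      \<open>A\<close> and \<open>B\<close> exchanged, the sign of \<open>Im z\<close> reversed and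
      \<open>e = 0\<close>.\<close>
    moreover have "Re z *\<^sub>R B (Suc 0) - P (B (Suc 0)) - (- Im z) *\<^sub>R A (Suc 0) =
        0 *\<^sub>R v + (Im (res_coef z 2) / 2) *\<^sub>R P v - (Im (res_coef z 1) / 2) *\<^sub>R cheb P v 2"
      using res_partial_sum_base[OF P T2, of "Re z" "Im (res_coef z 0)" "- Im z" "Re (res_coef z 0)" 0
          "Im (res_coef z 1)" "Re (res_coef z 1)" "Im (res_coef z 2)"] re0 re1
      unfolding AS A0 by simp
    then have "?I 0" by (simp add: numeral_2_eq_2)
    ultimately show ?case ..
  next
    case (Suc n)
    have IR: "Re z *\<^sub>R A (Suc n) - P (A (Suc n)) - Im z *\<^sub>R B (Suc n) =
        v + (Re (res_coef z (Suc (Suc n))) / 2) *\<^sub>R cheb P v (Suc n) -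
          (Re (res_coef z (Suc n)) / 2) *\<^sub>R cheb P v (Suc (Suc n))"
      using conjunct1[OF Suc] unfolding add_2_eq_Suc' Suc_eq_plus1[symmetric] .
    have II: "Re z *\<^sub>R B (Suc n) - P (B (Suc n)) - (- Im z) *\<^sub>R A (Suc n) =
        0 + (Im (res_coef z (Suc (Suc n))) / 2) *\<^sub>R cheb P v (Suc n) -
          (Im (res_coef z (Suc n)) / 2) *\<^sub>R cheb P v (Suc (Suc n))"
      using conjunct2[OF Suc] unfolding add_2_eq_Suc' Suc_eq_plus1[symmetric]
      by (simp only: scaleR_minus_left diff_minus_eq_add add_0_left)
    have "?R (Suc n)"
      unfolding AS(1)[of "Suc n"] AS(2)[of "Suc n"] add_2_eq_Suc' Suc_eq_plus1[symmetric]
      by (rule res_partial_sum_step[OF P IR PT]) (use reR[of n] in simp)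
    moreover have "Re z *\<^sub>R B (Suc (Suc n)) - P (B (Suc (Suc n))) - (- Im z) *\<^sub>R A (Suc (Suc n)) =
        0 + (Im (res_coef z (Suc (Suc (Suc n)))) / 2) *\<^sub>R cheb P v (Suc (Suc n)) -
          (Im (res_coef z (Suc (Suc n))) / 2) *\<^sub>R cheb P v (Suc (Suc (Suc n)))"
      unfolding AS(1)[of "Suc n"] AS(2)[of "Suc n"]
      by (rule res_partial_sum_step[OF P II PT]) (use reR[of n] in simp)
    then have "?I (Suc n)"
      unfolding add_2_eq_Suc' Suc_eq_plus1[symmetric]
      by (simp only: scaleR_minus_left diff_minus_eq_add add_0_left)
    ultimately show ?case ..
  qed
  then show "?R n" "?I n" by auto
qed

lemma geometric_tail:
  fixes q :: real
  assumes "0 \<le> q" "q < 1"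
  shows "(\<lambda>k. q ^ (k + n)) sums (q ^ n / (1 - q))"
  using sums_mult[OF geometric_sums, of q "q ^ n"] assms by (simp add: power_add ac_simps)

text \<open>The sum over \<open>k >= n\<close> of
  \<open>2 / \<eta> * (1 - \<eta> / (2 * R)) ^ k\<close> is
  \<open>4 * R / \<eta>^2 * (1 - \<eta> / (2 * R)) ^ n\<close>; here the power is replaced by the
  exponential that dominates it.\<close>

definition tail_err :: "real \<Rightarrow> real \<Rightarrow> nat \<Rightarrow> real" where
  "tail_err R \<eta> n = 4 * R / \<eta>\<^sup>2 * exp (- \<eta> * real n / (2 * R))"

text \<open>Dividing by \<open>R\<close> moves the spectrum into \<open>[-1, 1]\<close>. The sign
  appears because \<open>res_coef\<close> expands \<open>1 / (z - x)\<close> whereas the resolvent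
  is \<open>1 / (x - z)\<close>.\<close>

definition pois_coef :: "real \<Rightarrow> real \<Rightarrow> real \<Rightarrow> nat \<Rightarrow> real" where
  "pois_coef R E \<eta> k = - Im (res_coef (Complex (E / R) (\<eta> / R)) k) / R"

lemma tail_err_nonneg: "R > 0 \<Longrightarrow> 0 \<le> tail_err R \<eta> n"
  by (simp add: tail_err_def)

lemma pois_res_coef_bound:
  assumes "R \<ge> 1" "0 < \<eta>" "\<eta> \<le> 1"
  shows "cmod (res_coef (Complex (E / R) (\<eta> / R)) k) / R \<le> 2 / \<eta> * (1 - \<eta> / (2 * R)) ^ k"
proof -
  have "\<eta> / R \<le> 1" using assms by simp
  then show ?thesis
    using res_coef_norm[of "Complex (E / R) (\<eta> / R)" k] assms by (simp add: field_simps)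
qed

lemma res_tail_sums:
  assumes "R \<ge> 1" "0 < \<eta>" "\<eta> \<le> 1"
  shows "\<exists>s\<le>tail_err R \<eta> n. (\<lambda>k. 2 / \<eta> * (1 - \<eta> / (2 * R)) ^ (k + n)) sums s"
proof -
  define q where "q = 1 - \<eta> / (2 * R)"
  have q: "0 \<le> q" "q < 1" using assms by (auto simp: q_def)
  have "q \<le> exp (- (\<eta> / (2 * R)))"
    using exp_ge_add_one_self[of "- (\<eta> / (2 * R))"] by (simp add: q_def)
  then have "q ^ n \<le> exp (- (\<eta> / (2 * R))) ^ n"
    by (intro power_mono q)
  also have "\<dots> = exp (- \<eta> * real n / (2 * R))"
    by (simp add: exp_of_nat_mult[symmetric])
  finally have "2 / \<eta> * (q ^ n / (1 - q)) \<le> 2 / \<eta> * (exp (- \<eta> * real n / (2 * R)) / (1 - q))"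
    using assms q by (intro mult_left_mono divide_right_mono) auto
  also have "\<dots> = tail_err R \<eta> n"
    using assms by (simp add: q_def tail_err_def power2_eq_square)
  finally show ?thesis
    using sums_mult[OF geometric_tail[OF q], of "2 / \<eta>" n] by (auto simp: q_def)
qed

text \<open>Here \<open>A + i B\<close> is \<open>(P - E - i\<eta>)\<^sup>-\<^sup>1 v\<close> in real terms; \<open>B\<close> is the value at \<open>v\<close> of the imaginary
  part of the resolvent.\<close>

lemma poisson_series:
  fixes P :: "'a::{real_inner,banach} \<Rightarrow> 'a"
  assumes P: "linear P" and sym: "\<And>x y. inner (P x) y = inner x (P y)"
    and bd: "\<And>x. norm (P x) \<le> R * norm x"
    and R: "R \<ge> 1" and \<eta>: "0 < \<eta>" "\<eta> \<le> 1"
  obtains A B where "P A - E *\<^sub>R A + \<eta> *\<^sub>R B = v" "P B - E *\<^sub>R B = \<eta> *\<^sub>R A"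
    "\<And>n. norm (B - (\<Sum>k<n. pois_coef R E \<eta> k *\<^sub>R cheb (\<lambda>x. (1 / R) *\<^sub>R P x) v k)) \<le> tail_err R \<eta> n * norm v"
proof -
  define z where "z = Complex (E / R) (\<eta> / R)"
  define P' where "P' = (\<lambda>x. (1 / R) *\<^sub>R P x)"
  define c where "c = (\<lambda>k. - (1 / R) *\<^sub>R res_coef z k)"
  have z: "Im z > 0" using R \<eta> by (simp add: z_def)
  have P': "linear P'" unfolding P'_def by (intro linear_compose_scale_right P)
  have nP': "norm (P' x) \<le> norm x" for x
    using bd[of x] R by (simp add: P'_def field_simps)
  have nT: "norm (cheb P' v k) \<le> norm v" for k
    by (rule cheb_norm_le[OF P' _ nP']) (simp add: P'_def sym)
  define g where "g = (\<lambda>k. 2 / \<eta> * (1 - \<eta> / (2 * R)) ^ k * norm v)"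
  have cb: "cmod (c k) * norm v \<le> g k" for k
  proof -
    have "cmod (c k) = cmod (res_coef z k) / R"
      using R by (simp add: c_def)
    then show ?thesis
      unfolding g_def using pois_res_coef_bound[OF R \<eta>, of E k]
      by (simp only: z_def mult_right_mono norm_ge_zero)
  qed
  have gA: "norm (Re (c k) *\<^sub>R cheb P' v k) \<le> g k" for k
    using mult_mono[OF abs_Re_le_cmod[of "c k"] nT[of k]] cb[of k] by simp
  have gB: "norm (Im (c k) *\<^sub>R cheb P' v k) \<le> g k" for k
    using mult_mono[OF abs_Im_le_cmod[of "c k"] nT[of k]] cb[of k] by simp
  have gs: "\<exists>s\<le>tail_err R \<eta> n * norm v. (\<lambda>k. g (k + n)) sums s" for n
  proof -
    obtain s where "s \<le> tail_err R \<eta> n" "(\<lambda>k. 2 / \<eta> * (1 - \<eta> / (2 * R)) ^ (k + n)) sums s"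
      using res_tail_sums[OF R \<eta>] by blast
    then show ?thesis
      using sums_mult2[of "\<lambda>k. 2 / \<eta> * (1 - \<eta> / (2 * R)) ^ (k + n)" s "norm v"]
      unfolding g_def by (intro exI[of _ "s * norm v"] conjI mult_right_mono) auto
  qed
  then have sg: "summable g"
    using gs[of 0] by (auto simp: summable_def)
  have sA: "summable (\<lambda>k. Re (c k) *\<^sub>R cheb P' v k)" and sB: "summable (\<lambda>k. Im (c k) *\<^sub>R cheb P' v k)"
    by (rule summable_comparison_test'[OF sg, of 0], rule gA,
        rule summable_comparison_test'[OF sg, of 0], rule gB)
  define A B where "A = suminf (\<lambda>k. Re (c k) *\<^sub>R cheb P' v k)"
    and "B = suminf (\<lambda>k. Im (c k) *\<^sub>R cheb P' v k)"
  define An Bn where "An = (\<lambda>n. \<Sum>k\<le>n. Re (res_coef z k) *\<^sub>R cheb P' v k)"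
    and "Bn = (\<lambda>n. \<Sum>k\<le>n. Im (res_coef z k) *\<^sub>R cheb P' v k)"
  have An: "(\<lambda>n. An (Suc n)) \<longlonglongrightarrow> (- R) *\<^sub>R A" and Bn: "(\<lambda>n. Bn (Suc n)) \<longlonglongrightarrow> (- R) *\<^sub>R B"
  proof -
    have "An = (\<lambda>n. (- R) *\<^sub>R (\<Sum>k\<le>n. Re (c k) *\<^sub>R cheb P' v k))"
      "Bn = (\<lambda>n. (- R) *\<^sub>R (\<Sum>k\<le>n. Im (c k) *\<^sub>R cheb P' v k))"
      using R by (simp_all add: An_def Bn_def c_def scaleR_sum_right)
    then have "An \<longlonglongrightarrow> (- R) *\<^sub>R A" "Bn \<longlonglongrightarrow> (- R) *\<^sub>R B"
      using summable_LIMSEQ'[OF sA] summable_LIMSEQ'[OF sB]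
      by (auto simp: A_def B_def intro!: tendsto_intros)
    then show "(\<lambda>n. An (Suc n)) \<longlonglongrightarrow> (- R) *\<^sub>R A" "(\<lambda>n. Bn (Suc n)) \<longlonglongrightarrow> (- R) *\<^sub>R B"
      by (auto intro: LIMSEQ_Suc)
  qed
  have bl: "bounded_linear P'"
    by (rule bounded_linear_intro[of _ 1]) (use nP' linear_add[OF P'] linear_scale[OF P'] in auto)
  have g0: "g \<longlonglongrightarrow> 0" by (rule summable_LIMSEQ_zero[OF sg])
  \<comment> \<open>The boundary terms of \<open>res_partial_sum\<close> vanish in the limit, since
    the coefficients are dominated by a summable geometric sequence and the Chebyshev vectors are
    bounded.\<close>
  have cT: "(\<lambda>n. (u (res_coef z (n + i)) / 2) *\<^sub>R cheb P' v (n + j)) \<longlonglongrightarrow> 0"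
    if "\<And>w. \<bar>u w\<bar> \<le> cmod w" for u :: "complex \<Rightarrow> real" and i j
  proof (rule tendsto_0_le[where K = R])
    show "(\<lambda>n. g (n + i)) \<longlonglongrightarrow> 0"
      by (rule LIMSEQ_ignore_initial_segment[OF g0])
    show "\<forall>\<^sub>F n in sequentially. norm ((u (res_coef z (n + i)) / 2) *\<^sub>R cheb P' v (n + j)) \<le> norm (g (n + i)) * R"
    proof (rule always_eventually, rule allI)
      fix n
      have "norm ((u (res_coef z (n + i)) / 2) *\<^sub>R cheb P' v (n + j)) =
          \<bar>u (res_coef z (n + i))\<bar> / 2 * norm (cheb P' v (n + j))"
        by simp
      also have "\<dots> \<le> cmod (res_coef z (n + i)) * norm v"
      proof (rule mult_mono[OF _ nT])
        show "\<bar>u (res_coef z (n + i))\<bar> / 2 \<le> cmod (res_coef z (n + i))"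
          using that[of "res_coef z (n + i)"] norm_ge_zero[of "res_coef z (n + i)"] by linarith
      qed simp_all
      also have "\<dots> = R * (cmod (c (n + i)) * norm v)"
        using R by (simp add: c_def)
      also have "\<dots> \<le> R * g (n + i)"
        using R cb by (intro mult_left_mono) auto
      also have "\<dots> = norm (g (n + i)) * R"
        using order_trans[OF mult_nonneg_nonneg cb[of "n + i"]] by simp
      finally show "norm ((u (res_coef z (n + i)) / 2) *\<^sub>R cheb P' v (n + j)) \<le> norm (g (n + i)) * R" .
    qed
  qed
  have rs: "Re z *\<^sub>R An (Suc n) - P' (An (Suc n)) - Im z *\<^sub>R Bn (Suc n) =
           v + (Re (res_coef z (n + 2)) / 2) *\<^sub>R cheb P' v (n + 1)
             - (Re (res_coef z (n + 1)) / 2) *\<^sub>R cheb P' v (n + 2)"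
    "Re z *\<^sub>R Bn (Suc n) - P' (Bn (Suc n)) + Im z *\<^sub>R An (Suc n) =
           (Im (res_coef z (n + 2)) / 2) *\<^sub>R cheb P' v (n + 1)
             - (Im (res_coef z (n + 1)) / 2) *\<^sub>R cheb P' v (n + 2)" for n
    unfolding An_def Bn_def by (rule res_partial_sum[OF P' z])+
  have l1: "(\<lambda>n. Re z *\<^sub>R An (Suc n) - P' (An (Suc n)) - Im z *\<^sub>R Bn (Suc n)) \<longlonglongrightarrow>
      Re z *\<^sub>R ((- R) *\<^sub>R A) - P' ((- R) *\<^sub>R A) - Im z *\<^sub>R ((- R) *\<^sub>R B)"
    by (intro tendsto_intros An Bn bounded_linear.tendsto[OF bl])
  have r1: "(\<lambda>n. v + (Re (res_coef z (n + 2)) / 2) *\<^sub>R cheb P' v (n + 1)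
             - (Re (res_coef z (n + 1)) / 2) *\<^sub>R cheb P' v (n + 2)) \<longlonglongrightarrow> v + 0 - 0"
    by (intro tendsto_add tendsto_diff tendsto_const cT abs_Re_le_cmod)
  \<comment> \<open>Uniqueness of limits turns the partial-sum identity into the resolvent equation
    of the rescaled operator \<open>P'\<close>.\<close>
  have e1: "Re z *\<^sub>R ((- R) *\<^sub>R A) - P' ((- R) *\<^sub>R A) - Im z *\<^sub>R ((- R) *\<^sub>R B) = v + 0 - 0"
    using l1 r1 unfolding rs(1)[symmetric]
    by (rule LIMSEQ_unique)
  have l2: "(\<lambda>n. Re z *\<^sub>R Bn (Suc n) - P' (Bn (Suc n)) + Im z *\<^sub>R An (Suc n)) \<longlonglongrightarrow>
      Re z *\<^sub>R ((- R) *\<^sub>R B) - P' ((- R) *\<^sub>R B) + Im z *\<^sub>R ((- R) *\<^sub>R A)"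
    by (intro tendsto_intros An Bn bounded_linear.tendsto[OF bl])
  have r2: "(\<lambda>n. (Im (res_coef z (n + 2)) / 2) *\<^sub>R cheb P' v (n + 1)
             - (Im (res_coef z (n + 1)) / 2) *\<^sub>R cheb P' v (n + 2)) \<longlonglongrightarrow> 0 - 0"
    by (intro tendsto_diff cT abs_Im_le_cmod)
  have e2: "Re z *\<^sub>R ((- R) *\<^sub>R B) - P' ((- R) *\<^sub>R B) + Im z *\<^sub>R ((- R) *\<^sub>R A) = 0 - 0"
    using l2 r2 unfolding rs(2)[symmetric]
    by (rule LIMSEQ_unique)
  have PR: "P' ((- R) *\<^sub>R x) = - P x" for x
    using R by (simp add: P'_def linear_scale[OF P] linear_neg[OF P])
  have zR: "R * Re z = E" "R * Im z = \<eta>"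
    using R by (simp_all add: z_def)
  show ?thesis
  proof
    show "P A - E *\<^sub>R A + \<eta> *\<^sub>R B = v"
      using e1 unfolding PR by (simp add: zR algebra_simps)
    show "P B - E *\<^sub>R B = \<eta> *\<^sub>R A"
      using e2 unfolding PR by (simp add: zR algebra_simps)
    fix n
    have B: "(\<lambda>k. Im (c (k + n)) *\<^sub>R cheb P' v (k + n)) sums (B - (\<Sum>k<n. Im (c k) *\<^sub>R cheb P' v k))"
      using sums_split_initial_segment[OF summable_sums[OF sB]] by (simp add: B_def)
    obtain s where s: "s \<le> tail_err R \<eta> n * norm v" "(\<lambda>k. g (k + n)) sums s"
      using gs by blast
    have "norm (B - (\<Sum>k<n. Im (c k) *\<^sub>R cheb P' v k)) \<le> s"
      unfolding sums_unique[OF B] sums_unique[OF s(2)]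
      by (rule norm_suminf_le[OF gB sums_summable[OF s(2)]])
    moreover have "Im (c k) = pois_coef R E \<eta> k" for k
      by (simp add: c_def pois_coef_def z_def)
    ultimately show "norm (B - (\<Sum>k<n. pois_coef R E \<eta> k *\<^sub>R cheb (\<lambda>x. (1 / R) *\<^sub>R P x) v k))
        \<le> tail_err R \<eta> n * norm v"
      using s(1) by (simp add: P'_def)
  qed
qed

section \<open>Word length\<close>

locale cayley = group G for G :: "('g, 'm) monoid_scheme" (structure) +
  fixes S :: "'g set"
  assumes sgs: "symmetric_generating_set G S"
begin

lemma S_carrier: "S \<subseteq> carrier G" and S_inv: "s \<in> S \<Longrightarrow> inv s \<in> S"
  using sgs by (auto simp: symmetric_generating_set_def)

abbreviation word_prod :: "'g list \<Rightarrow> 'g" where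
  "word_prod ws \<equiv> foldr (\<otimes>) ws \<one>"

lemma word_prod_closed: "set ws \<subseteq> S \<Longrightarrow> word_prod ws \<in> carrier G"
  using S_carrier by (induction ws) auto

lemma word_prod_append:
  "set us \<subseteq> S \<Longrightarrow> set ws \<subseteq> S \<Longrightarrow> word_prod (us @ ws) = word_prod us \<otimes> word_prod ws"
  using S_carrier by (induction us) (auto simp: word_prod_closed m_assoc subset_iff)

lemma word_prod_rev_inv:
  "set ws \<subseteq> S \<Longrightarrow> word_prod (rev (map (\<lambda>s. inv s) ws)) = inv (word_prod ws)"
proof (induction ws)
  case (Cons w ws)
  then have w: "w \<in> S" "set ws \<subseteq> S" by auto
  then have "word_prod (rev (map (\<lambda>s. inv s) ws) @ [inv w]) = inv (word_prod ws) \<otimes> inv w"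
    using Cons.IH S_inv S_carrier by (subst word_prod_append) (auto simp: subset_iff)
  then show ?case
    using w S_carrier by (auto simp: inv_mult_group word_prod_closed subset_iff)
qed simp

lemma word_exists: "g \<in> carrier G \<Longrightarrow> \<exists>ws. set ws \<subseteq> S \<and> word_prod ws = g"
proof -
  assume "g \<in> carrier G"
  then have "g \<in> generate G S"
    using sgs by (simp add: symmetric_generating_set_def)
  then show ?thesis
  proof induction
    case one
    show ?case by (rule exI[of _ "[]"]) simp
  next
    case (incl h)
    then show ?case using S_carrier by (intro exI[of _ "[h]"]) auto
  next
    case (inv h)
    then show ?case using S_carrier S_inv by (intro exI[of _ "[inv h]"]) auto
  next
    case (eng h1 h2)
    then obtain us ws where "set us \<subseteq> S" "word_prod us = h1" "set ws \<subseteq> S" "word_prod ws = h2"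
      by blast
    then show ?case
      using word_prod_append[of us ws] by (intro exI[of _ "us @ ws"]) simp
  qed
qed

abbreviation wl :: "'g \<Rightarrow> nat" where
  "wl \<equiv> word_length G S"

lemma wl_le: "set ws \<subseteq> S \<Longrightarrow> wl (word_prod ws) \<le> length ws"
  unfolding word_length_def by (rule Least_le) auto

lemma wl_word:
  assumes "g \<in> carrier G"
  obtains ws where "set ws \<subseteq> S" "word_prod ws = g" "length ws = wl g"
proof -
  have "\<exists>n ws. length ws = n \<and> set ws \<subseteq> S \<and> word_prod ws = g"
    using word_exists[OF assms] by auto
  from LeastI_ex[OF this] show ?thesis
    using that unfolding word_length_def by blast
qed

lemma wl_one: "wl \<one> = 0"
  using wl_le[of "[]"] by simp

lemma wl_eq_0: "g \<in> carrier G \<Longrightarrow> wl g = 0 \<Longrightarrow> g = \<one>"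
  using wl_word[of g] by auto

lemma wl_mult: "g \<in> carrier G \<Longrightarrow> h \<in> carrier G \<Longrightarrow> wl (g \<otimes> h) \<le> wl g + wl h"
proof -
  assume "g \<in> carrier G" "h \<in> carrier G"
  obtain us where "set us \<subseteq> S" "word_prod us = g" "length us = wl g"
    using \<open>g \<in> carrier G\<close> by (rule wl_word)
  moreover obtain ws where "set ws \<subseteq> S" "word_prod ws = h" "length ws = wl h"
    using \<open>h \<in> carrier G\<close> by (rule wl_word)
  ultimately show ?thesis
    using wl_le[of "us @ ws"] word_prod_append[of us ws] by simp
qed

lemma wl_inv_le: "g \<in> carrier G \<Longrightarrow> wl (inv g) \<le> wl g"
proof -
  assume "g \<in> carrier G"
  then obtain ws where w: "set ws \<subseteq> S" "word_prod ws = g" "length ws = wl g"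
    by (rule wl_word)
  have "wl (inv g) \<le> length (rev (map (\<lambda>s. inv s) ws))"
    using wl_le[of "rev (map (\<lambda>s. inv s) ws)"] word_prod_rev_inv[OF w(1)] w S_inv by auto
  then show ?thesis
    using w(3) by simp
qed

lemma wl_inv: "g \<in> carrier G \<Longrightarrow> wl (inv g) = wl g"
  using wl_inv_le[of g] wl_inv_le[of "inv g"] by simp

lemma cayley_graph_relpow:
  "g \<in> carrier G \<Longrightarrow> (g, h) \<in> cayley_graph G S ^^ n \<longleftrightarrow>
     (\<exists>ws. length ws = n \<and> set ws \<subseteq> S \<and> h = word_prod ws \<otimes> g)"
proof (induction n arbitrary: h)
  case 0
  then show ?case by auto
next
  case (Suc n)
  show ?case
  proof
    assume "(g, h) \<in> cayley_graph G S ^^ Suc n"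
    then obtain k where k: "(g, k) \<in> cayley_graph G S ^^ n" "(k, h) \<in> cayley_graph G S"
      by auto
    then obtain s ws where sw: "s \<in> S" "h = s \<otimes> k" "length ws = n" "set ws \<subseteq> S" "k = word_prod ws \<otimes> g"
      using Suc by (auto simp: cayley_graph_def)
    then show "\<exists>ws. length ws = Suc n \<and> set ws \<subseteq> S \<and> h = word_prod ws \<otimes> g"
      using S_carrier Suc.prems
      by (intro exI[of _ "s # ws"]) (auto simp: m_assoc word_prod_closed subset_iff)
  next
    assume "\<exists>ws. length ws = Suc n \<and> set ws \<subseteq> S \<and> h = word_prod ws \<otimes> g"
    then obtain s ws where sw: "length ws = n" "s \<in> S" "set ws \<subseteq> S" "h = (s \<otimes> word_prod ws) \<otimes> g"
      by (auto simp: length_Suc_conv)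
    have "(g, word_prod ws \<otimes> g) \<in> cayley_graph G S ^^ n"
      using Suc sw by auto
    moreover have "(word_prod ws \<otimes> g, h) \<in> cayley_graph G S"
      using sw S_carrier Suc.prems word_prod_closed[OF sw(3)]
      by (auto simp: cayley_graph_def m_assoc subset_iff)
    ultimately show "(g, h) \<in> cayley_graph G S ^^ Suc n"
      by auto
  qed
qed

text \<open>Edges multiply on the left, so a path from \<open>g\<close> spelled by a word ends at
  that word times \<open>g\<close>. The metric is thus invariant under right translation.\<close>

lemma cayley_dist_eq:
  assumes "g \<in> carrier G" "h \<in> carrier G"
  shows "cayley_dist G S g h = wl (h \<otimes> inv g)"
proof -
  have "h = word_prod ws \<otimes> g \<longleftrightarrow> word_prod ws = h \<otimes> inv g" if "set ws \<subseteq> S" for ws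
    using assms word_prod_closed[OF that] by (auto simp: m_assoc)
  then show ?thesis
    unfolding cayley_dist_def word_length_def cayley_graph_relpow[OF assms(1)]
    by (intro arg_cong[where f = Least] ext) auto
qed

lemma cayley_ball_iff: "g \<in> cayley_ball G S n \<longleftrightarrow> g \<in> carrier G \<and> wl g \<le> n"
  unfolding cayley_ball_def by (auto simp: cayley_dist_eq)

end

section \<open>The group algebra acting on square-summable functions\<close>

abbreviation lk :: "('g \<Rightarrow>\<^sub>0 complex) \<Rightarrow> 'g \<Rightarrow> complex" where "lk \<equiv> Poly_Mapping.lookup"
abbreviation ks :: "('g \<Rightarrow>\<^sub>0 complex) \<Rightarrow> 'g set" where "ks \<equiv> Poly_Mapping.keys"

lemma lk_not_in_ks: "g \<notin> ks p \<Longrightarrow> lk p g = 0"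
  by (simp add: in_keys_iff)

definition ga_smul :: "complex \<Rightarrow> ('g \<Rightarrow>\<^sub>0 complex) \<Rightarrow> ('g \<Rightarrow>\<^sub>0 complex)" where
  "ga_smul c p = Poly_Mapping.map ((*) c) p"

lemma lookup_ga_smul [simp]: "lk (ga_smul c p) g = c * lk p g"
  by (simp add: ga_smul_def Poly_Mapping.map.rep_eq when_def)

lemma keys_ga_smul: "ks (ga_smul c p) \<subseteq> ks p"
  by (auto simp: in_keys_iff)

definition ga_conv :: "('g, 'm) monoid_scheme \<Rightarrow> ('g \<Rightarrow>\<^sub>0 complex) \<Rightarrow> ('g \<Rightarrow>\<^sub>0 complex) \<Rightarrow> ('g \<Rightarrow>\<^sub>0 complex)" where
  "ga_conv G p q = (\<Sum>g\<in>ks p. \<Sum>h\<in>ks q. Poly_Mapping.single (g \<otimes>\<^bsub>G\<^esub> h) (lk p g * lk q h))"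

lemma keys_ga_conv: "ks (ga_conv G p q) \<subseteq> (\<lambda>(g, h). g \<otimes>\<^bsub>G\<^esub> h) ` (ks p \<times> ks q)"
proof -
  have "ks (ga_conv G p q) \<subseteq> (\<Union>g\<in>ks p. ks (\<Sum>h\<in>ks q. Poly_Mapping.single (g \<otimes>\<^bsub>G\<^esub> h) (lk p g * lk q h)))"
    unfolding ga_conv_def by (rule keys_sum)
  also have "\<dots> \<subseteq> (\<Union>g\<in>ks p. \<Union>h\<in>ks q. {g \<otimes>\<^bsub>G\<^esub> h})"
    by (intro UN_mono order.trans[OF keys_sum]) auto
  finally show ?thesis by auto
qed

lemma ga_star_lookup:
  assumes "group G" "ks p \<subseteq> carrier G" "g \<in> carrier G"
  shows "lk (ga_star G p) g = cnj (lk p (inv\<^bsub>G\<^esub> g))"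
proof -
  interpret group G by fact
  have "lk (ga_star G p) g = (\<Sum>h\<in>ks p. if h = inv\<^bsub>G\<^esub> g then cnj (lk p h) else 0)"
    unfolding ga_star_def lookup_sum lookup_single when_def
    using assms(2,3) by (intro sum.cong) auto
  then show ?thesis
    by (simp add: sum.delta' lk_not_in_ks)
qed

lemma ga_star_keys: "ks (ga_star G p) \<subseteq> (\<lambda>g. inv\<^bsub>G\<^esub> g) ` ks p"
  unfolding ga_star_def by (rule order.trans[OF keys_sum]) auto

section \<open>Point masses and support conditions\<close>

definition l2_delta :: "'a \<Rightarrow> 'a l2" where
  "l2_delta x = Abs_l2 (\<lambda>y. if y = x then 1 else 0)"

lemma finite_support_sq_summable:
  "finite A \<Longrightarrow> (\<And>x. x \<notin> A \<Longrightarrow> f x = 0) \<Longrightarrow> (\<lambda>x. (cmod (f x))\<^sup>2) summable_on UNIV"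
  by (subst summable_on_cong_neutral[where T = A and g = "\<lambda>x. (cmod (f x))\<^sup>2"]) auto

lemma l2_delta_at [simp]: "l2_at (l2_delta x) y = (if y = x then 1 else 0)"
  unfolding l2_delta_def by (rule Abs_l2_at, rule finite_support_sq_summable[of "{x}"]) auto

lemma cinner_l2_delta: "cinner (l2_delta x) f = l2_at f x"
proof -
  have "cinner (l2_delta x) f = (\<Sum>\<^sub>\<infinity>y\<in>{x}. cnj (l2_at (l2_delta x) y) * l2_at f y)"
    unfolding cinner_def by (rule infsum_cong_neutral) auto
  then show ?thesis by simp
qed

lemma norm_l2_delta [simp]: "norm (l2_delta x) = 1"
  by (simp add: norm_eq_sqrt_inner inner_l2_def cinner_l2_delta)

text \<open>The group carrier and \<open>{0..<N}\<close> are sets inside a type, whereas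
  \<open>l2\<close> is built over the whole type; this predicate selects the subspace that
  matters.\<close>

definition l2_on :: "'a set \<Rightarrow> 'a l2 \<Rightarrow> bool" where
  "l2_on X f \<longleftrightarrow> (\<forall>x. x \<notin> X \<longrightarrow> l2_at f x = 0)"

lemma cnj_mult_self: "cnj a * a = complex_of_real ((cmod a)\<^sup>2)"
  by (simp only: complex_norm_square mult.commute)

lemma l2_on_delta: "x \<in> X \<Longrightarrow> l2_on X (l2_delta x)"
  by (auto simp: l2_on_def)

lemma cscale_add_right: "cscale c (f + g) = cscale c f + cscale c g"
  by (rule l2_eqI) (simp add: distrib_left)

lemma cscale_of_real: "cscale (of_real r) f = r *\<^sub>R f"
  by (rule l2_eqI) (simp add: scaleR_conv_of_real)

lemma cscale_sum_right: "cscale c (sum f A) = (\<Sum>i\<in>A. cscale c (f i))"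
  by (rule l2_eqI) (simp add: sum_distrib_left)

lemma cinner_sum_right: "cinner f (sum g A) = (\<Sum>i\<in>A. cinner f (g i))"
  by (induction A rule: infinite_finite_induct) (auto simp: cinner_add_right cinner_def[of _ 0])

lemma cinner_sum_left: "cinner (sum g A) f = (\<Sum>i\<in>A. cinner (g i) f)"
  by (induction A rule: infinite_finite_induct) (auto simp: cinner_add_left cinner_def[of 0])

text \<open>One interface for left translation on the group and for the action on
  \<open>{0..<N}\<close>, so that every operator identity below is proved for both representations
  at once.\<close>

locale gact = group G for G :: "('g, 'm) monoid_scheme" (structure) +
  fixes X :: "'x set" and act :: "'g \<Rightarrow> 'x \<Rightarrow> 'x"
  assumes act_closed: "g \<in> carrier G \<Longrightarrow> x \<in> X \<Longrightarrow> act g x \<in> X"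
    and act_one: "x \<in> X \<Longrightarrow> act \<one> x = x"
    and act_mult: "g \<in> carrier G \<Longrightarrow> h \<in> carrier G \<Longrightarrow> x \<in> X \<Longrightarrow> act (g \<otimes> h) x = act g (act h x)"
begin

lemma act_inv_act: "g \<in> carrier G \<Longrightarrow> x \<in> X \<Longrightarrow> act (inv g) (act g x) = x"
  using act_mult[of "inv g" g x] act_one by simp

lemma act_act_inv: "g \<in> carrier G \<Longrightarrow> x \<in> X \<Longrightarrow> act g (act (inv g) x) = x"
  using act_mult[of g "inv g" x] act_one by simp

lemma act_bij: "g \<in> carrier G \<Longrightarrow> bij_betw (act g) X X"
  by (rule bij_betw_byWitness[of _ "act (inv g)"]) (auto simp: act_inv_act act_act_inv act_closed)

lemma act_eq_iff: "g \<in> carrier G \<Longrightarrow> x \<in> X \<Longrightarrow> y \<in> X \<Longrightarrow> act g x = y \<longleftrightarrow> x = act (inv g) y"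
  by (auto simp: act_inv_act act_act_inv)

text \<open>Values outside \<open>X\<close> are set to 0, so \<open>shift\<close> by the unit is the
  projection onto functions supported on \<open>X\<close>. Hence \<open>shift_one\<close> asks for
  \<open>l2_on\<close> and \<open>norm_shift_le\<close> is an inequality.\<close>

definition shift :: "'g \<Rightarrow> 'x l2 \<Rightarrow> 'x l2" where
  "shift g f = Abs_l2 (\<lambda>x. if x \<in> X then l2_at f (act (inv g) x) else 0)"

lemma shift_at:
  assumes "g \<in> carrier G"
  shows "l2_at (shift g f) x = (if x \<in> X then l2_at f (act (inv g) x) else 0)"
proof -
  have "(\<lambda>x. (cmod (l2_at f x))\<^sup>2) summable_on X"
    by (rule summable_on_subset_banach[OF l2_summable]) simp
  then have "(\<lambda>x. (cmod (l2_at f (act (inv g) x)))\<^sup>2) summable_on X"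
    by (subst summable_on_reindex_bij_betw[OF act_bij, of "inv g" "\<lambda>x. (cmod (l2_at f x))\<^sup>2"])
      (use assms in auto)
  then have "(\<lambda>x. (cmod (if x \<in> X then l2_at f (act (inv g) x) else 0))\<^sup>2) summable_on UNIV"
    by (subst summable_on_cong_neutral[where T = X and g = "\<lambda>x. (cmod (l2_at f (act (inv g) x)))\<^sup>2"]) auto
  then show ?thesis
    unfolding shift_def by (rule Abs_l2_at)
qed

lemma cinner_shift:
  assumes "g \<in> carrier G"
  shows "cinner (shift g f) h = cinner f (shift (inv g) h)"
proof -
  have "cinner (shift g f) h = (\<Sum>\<^sub>\<infinity>x\<in>X. cnj (l2_at f (act (inv g) x)) * l2_at h x)"
    unfolding cinner_def by (rule infsum_cong_neutral) (auto simp: shift_at assms)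
  also have "\<dots> = (\<Sum>\<^sub>\<infinity>y\<in>X. cnj (l2_at f (act (inv g) (act g y))) * l2_at h (act g y))"
    by (rule infsum_reindex_bij_betw[OF act_bij[OF assms], symmetric])
  also have "\<dots> = (\<Sum>\<^sub>\<infinity>y\<in>X. cnj (l2_at f y) * l2_at h (act g y))"
    by (rule infsum_cong) (simp add: act_inv_act assms)
  also have "\<dots> = cinner f (shift (inv g) h)"
    unfolding cinner_def by (rule infsum_cong_neutral) (auto simp: shift_at assms)
  finally show ?thesis .
qed

lemma shift_mult:
  assumes "g \<in> carrier G" "h \<in> carrier G"
  shows "shift (g \<otimes> h) f = shift g (shift h f)"
  using assms by (intro l2_eqI) (simp add: shift_at inv_mult_group act_mult act_closed)

lemma shift_one: "l2_on X f \<Longrightarrow> shift \<one> f = f"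
  by (intro l2_eqI) (auto simp: shift_at act_one l2_on_def)

lemma shift_add: "g \<in> carrier G \<Longrightarrow> shift g (f + h) = shift g f + shift g h"
  by (intro l2_eqI) (simp add: shift_at)

lemma shift_cscale: "g \<in> carrier G \<Longrightarrow> shift g (cscale c f) = cscale c (shift g f)"
  by (intro l2_eqI) (simp add: shift_at)

lemma norm_shift_le:
  assumes "g \<in> carrier G"
  shows "norm (shift g f) \<le> norm f"
proof -
  have "(norm (shift g f))\<^sup>2 = Re (cinner (shift g f) (shift g f))"
    by (simp add: power2_norm_eq_inner inner_l2_def)
  also have "\<dots> = inner f (shift (inv g) (shift g f))"
    by (simp add: cinner_shift assms inner_l2_def)
  also have "shift (inv g) (shift g f) = shift \<one> f"
    using shift_mult[of "inv g" g f] assms by simp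
  also have "inner f (shift \<one> f) = (\<Sum>\<^sub>\<infinity>x\<in>X. (cmod (l2_at f x))\<^sup>2)"
  proof -
    have "cinner f (shift \<one> f) = (\<Sum>\<^sub>\<infinity>x\<in>X. complex_of_real ((cmod (l2_at f x))\<^sup>2))"
      unfolding cinner_def
      by (rule infsum_cong_neutral) (auto simp: shift_at act_one cnj_mult_self simp del: of_real_power)
    also have "\<dots> = of_real (\<Sum>\<^sub>\<infinity>x\<in>X. (cmod (l2_at f x))\<^sup>2)"
      by (rule infsumI, rule has_sum_of_real, rule has_sum_infsum,
          rule summable_on_subset_banach[OF l2_summable]) simp
    finally show ?thesis by (simp add: inner_l2_def)
  qed
  also have "\<dots> \<le> (norm f)\<^sup>2"
    unfolding l2_norm_sq
    by (rule infsum_mono2) (auto intro: summable_on_subset_banach[OF l2_summable] l2_summable)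
  finally show ?thesis
    by (simp add: power2_le_iff_abs_le)
qed

lemma shift_delta: "g \<in> carrier G \<Longrightarrow> x \<in> X \<Longrightarrow> shift g (l2_delta x) = l2_delta (act g x)"
  by (intro l2_eqI) (auto simp: shift_at act_act_inv act_inv_act act_closed)

text \<open>The image of \<open>q\<close> under the representation. It becomes
  \<open>left_regular_ga\<close> through \<open>left_regular_ga_l2_at\<close> and
  \<open>perm_rep_ga\<close> through \<open>perm_rep_ga_vl\<close>.\<close>

definition lop :: "('g \<Rightarrow>\<^sub>0 complex) \<Rightarrow> 'x l2 \<Rightarrow> 'x l2" where
  "lop q f = (\<Sum>g\<in>ks q. cscale (lk q g) (shift g f))"

lemma lop_superset:
  assumes "finite A" "ks q \<subseteq> A"
  shows "lop q f = (\<Sum>g\<in>A. cscale (lk q g) (shift g f))"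
  unfolding lop_def
  by (rule sum.mono_neutral_left[OF assms]) (auto simp: lk_not_in_ks intro!: l2_eqI)

lemma lop_at:
  assumes "ks q \<subseteq> carrier G"
  shows "l2_at (lop q f) x = (if x \<in> X then \<Sum>g\<in>ks q. lk q g * l2_at f (act (inv g) x) else 0)"
  unfolding lop_def using assms by (auto simp: shift_at subset_iff intro!: sum.cong sum.neutral)

lemma lop_on: "ks q \<subseteq> carrier G \<Longrightarrow> l2_on X (lop q f)"
  by (simp add: l2_on_def lop_at)

lemma lop_add: "lop (p + q) f = lop p f + lop q f"
proof -
  have *: "lop r f = (\<Sum>g\<in>ks p \<union> ks q. cscale (lk r g) (shift g f))" if "ks r \<subseteq> ks p \<union> ks q" for r
    by (rule lop_superset[OF _ that]) simp
  show ?thesis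
    unfolding *[OF Poly_Mapping.keys_add] *[OF Un_upper1] *[OF Un_upper2] sum.distrib[symmetric]
    by (intro sum.cong refl l2_eqI) (simp add: lookup_add distrib_right)
qed

lemma lop_zero [simp]: "lop 0 f = 0"
  by (simp add: lop_def)

lemma lop_smul: "lop (ga_smul c q) f = cscale c (lop q f)"
  by (subst lop_superset[OF _ keys_ga_smul]) (auto simp: lop_def cscale_sum_right intro!: sum.cong l2_eqI)

lemma lop_diff: "lop (p - q) f = lop p f - lop q f"
  using lop_add[of "p - q" q f] by simp

lemma lop_sum: "lop (sum q A) f = (\<Sum>i\<in>A. lop (q i) f)"
  by (induction A rule: infinite_finite_induct) (auto simp: lop_add)

lemma lop_single: "lop (Poly_Mapping.single g c) f = cscale c (shift g f)"
  by (subst lop_superset[of "{g}"]) auto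

lemma lop_right_add: "ks q \<subseteq> carrier G \<Longrightarrow> lop q (f + h) = lop q f + lop q h"
  unfolding lop_def sum.distrib[symmetric]
  by (intro sum.cong refl) (auto simp: shift_add cscale_add_right)

lemma lop_right_cscale: "ks q \<subseteq> carrier G \<Longrightarrow> lop q (cscale c f) = cscale c (lop q f)"
  unfolding lop_def cscale_sum_right
  by (intro sum.cong refl l2_eqI) (auto simp: shift_cscale)

lemma lop_linear: "ks q \<subseteq> carrier G \<Longrightarrow> linear (lop q)"
  by (rule linearI) (simp_all add: lop_right_add lop_right_cscale flip: cscale_of_real)

lemma lop_conv:
  assumes "ks p \<subseteq> carrier G" "ks q \<subseteq> carrier G"
  shows "lop (ga_conv G p q) f = lop p (lop q f)"
proof -
  have sub: "g \<in> ks p \<Longrightarrow> g \<in> carrier G" "h \<in> ks q \<Longrightarrow> h \<in> carrier G" for g h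
    using assms by auto
  have sh: "shift g (\<Sum>h\<in>A. u h) = (\<Sum>h\<in>A. shift g (u h))" if "g \<in> carrier G" for g A and u :: "'g \<Rightarrow> 'x l2"
    using that by (intro l2_eqI) (simp add: shift_at)
  have "cscale (lk p g) (shift g (lop q f)) = (\<Sum>h\<in>ks q. cscale (lk p g * lk q h) (shift (g \<otimes> h) f))"
    if g: "g \<in> ks p" for g
  proof -
    have "shift g (lop q f) = (\<Sum>h\<in>ks q. cscale (lk q h) (shift g (shift h f)))"
      unfolding lop_def sh[OF sub(1)[OF g]] by (intro sum.cong refl) (simp add: shift_cscale sub(1)[OF g])
    also have "cscale (lk p g) \<dots> = (\<Sum>h\<in>ks q. cscale (lk p g * lk q h) (shift (g \<otimes> h) f))"
      unfolding cscale_sum_right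
      by (intro sum.cong refl l2_eqI) (simp add: shift_mult[OF sub(1)[OF g] sub(2)])
    finally show ?thesis .
  qed
  then show ?thesis
    unfolding ga_conv_def lop_sum lop_single lop_def[of p] by simp
qed

lemma lop_adjoint:
  assumes "ks q \<subseteq> carrier G"
  shows "cinner (lop q f) h = cinner f (lop (ga_star G q) h)"
proof -
  have inj: "inj_on (\<lambda>g. inv g) (ks q)"
    using assms inv_inv by (intro inj_onI) (metis subsetD)
  have "lop (ga_star G q) h = (\<Sum>g\<in>(\<lambda>g. inv g) ` ks q. cscale (lk (ga_star G q) g) (shift g h))"
    by (rule lop_superset[OF _ ga_star_keys]) auto
  also have "\<dots> = (\<Sum>g\<in>ks q. cscale (lk (ga_star G q) (inv g)) (shift (inv g) h))"
    by (rule sum.reindex_cong[OF inj refl refl])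
  also have "\<dots> = (\<Sum>g\<in>ks q. cscale (cnj (lk q g)) (shift (inv g) h))"
    by (intro sum.cong refl) (use assms in \<open>auto simp: ga_star_lookup[OF is_group assms] subset_iff\<close>)
  finally have star: "lop (ga_star G q) h = (\<Sum>g\<in>ks q. cscale (cnj (lk q g)) (shift (inv g) h))" .
  show ?thesis
    unfolding star lop_def[of q] cinner_sum_left cinner_sum_right
  proof (rule sum.cong[OF refl])
    fix g assume "g \<in> ks q"
    then have "g \<in> carrier G" using assms by auto
    then show "cinner (cscale (lk q g) (shift g f)) h = cinner f (cscale (cnj (lk q g)) (shift (inv g) h))"
      by (simp add: cinner_cscale_left cinner_cscale_right cinner_shift)
  qed
qed

lemma norm_lop_le: "ks q \<subseteq> carrier G \<Longrightarrow> norm (lop q f) \<le> (\<Sum>g\<in>ks q. cmod (lk q g)) * norm f"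
  unfolding lop_def sum_distrib_right
  by (rule order.trans[OF norm_sum sum_mono]) (auto simp: norm_cscale intro!: mult_left_mono norm_shift_le)

lemma lop_delta_at:
  assumes "ks q \<subseteq> carrier G" "x \<in> X"
  shows "l2_at (lop q (l2_delta x)) y = (\<Sum>g\<in>ks q. if act g x = y then lk q g else 0)"
  unfolding lop_def using assms by (auto simp: shift_delta subset_iff intro!: sum.cong)

end

section \<open>Polynomial approximation of the Poisson kernel in the group algebra\<close>

text \<open>The element \<open>T_n(p / R)\<close> of the group algebra. Working with an element
  rather than an operator gives access to its support (\<open>keys_ga_cheb\<close>) and allows it to
  act in both representations.\<close>

fun ga_cheb :: "('g, 'm) monoid_scheme \<Rightarrow> real \<Rightarrow> ('g \<Rightarrow>\<^sub>0 complex) \<Rightarrow> nat \<Rightarrow> ('g \<Rightarrow>\<^sub>0 complex)" where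
  "ga_cheb G R p 0 = Poly_Mapping.single \<one>\<^bsub>G\<^esub> 1"
| "ga_cheb G R p (Suc 0) = ga_smul (of_real (1 / R)) p"
| "ga_cheb G R p (Suc (Suc n)) =
     ga_smul (of_real (2 / R)) (ga_conv G p (ga_cheb G R p (Suc n))) - ga_cheb G R p n"

text \<open>The constant term \<^const>\<open>tail_err\<close> makes the approximating polynomial dominate the Poisson kernel,
  hence nonnegative, on the spectrum.\<close>

definition ga_pois ::
    "('g, 'm) monoid_scheme \<Rightarrow> real \<Rightarrow> ('g \<Rightarrow>\<^sub>0 complex) \<Rightarrow> real \<Rightarrow> real \<Rightarrow> nat \<Rightarrow> ('g \<Rightarrow>\<^sub>0 complex)" where
  "ga_pois G R p E \<eta> n =
     (\<Sum>k<n. ga_smul (of_real (pois_coef R E \<eta> k)) (ga_cheb G R p k)) +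
     Poly_Mapping.single \<one>\<^bsub>G\<^esub> (of_real (tail_err R \<eta> n))"

lemma keys_single_subset: "ks (Poly_Mapping.single g c) \<subseteq> {g}"
  by simp

lemma keys_minus_subset: "ks (p - q) \<subseteq> ks p \<union> ks q"
  by (auto simp: in_keys_iff lookup_minus)

context cayley
begin

lemma keys_ga_cheb:
  assumes "ks p \<subseteq> carrier G" "\<And>g. g \<in> ks p \<Longrightarrow> wl g \<le> d"
  shows "ks (ga_cheb G R p n) \<subseteq> {g \<in> carrier G. wl g \<le> n * d}"
proof (induction n rule: induct_nat_012)
  case 0
  then show ?case using wl_one by simp
next
  case 1
  show ?case using assms order.trans[OF keys_ga_smul assms(1)] keys_ga_smul[of "of_real (1 / R)" p] by auto
next
  case (ge2 n)
  have "g \<otimes> h \<in> carrier G \<and> wl (g \<otimes> h) \<le> Suc (Suc n) * d"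
    if "g \<in> ks p" "h \<in> ks (ga_cheb G R p (Suc n))" for g h
  proof -
    have g: "g \<in> carrier G" "wl g \<le> d" using that assms by auto
    have h: "h \<in> carrier G" "wl h \<le> Suc n * d" using that ge2 by auto
    show ?thesis using wl_mult[OF g(1) h(1)] g h by auto
  qed
  then have "ks (ga_conv G p (ga_cheb G R p (Suc n))) \<subseteq> {g \<in> carrier G. wl g \<le> Suc (Suc n) * d}"
    by (intro order.trans[OF keys_ga_conv]) auto
  moreover have "ks (ga_cheb G R p n) \<subseteq> {g \<in> carrier G. wl g \<le> Suc (Suc n) * d}"
    using ge2(1) by auto
  ultimately show ?case
    unfolding ga_cheb.simps
    by (intro order.trans[OF keys_minus_subset] Un_least order.trans[OF keys_ga_smul])
qed

lemma keys_ga_pois: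
  assumes "ks p \<subseteq> carrier G" "\<And>g. g \<in> ks p \<Longrightarrow> wl g \<le> d"
  shows "ks (ga_pois G R p E \<eta> n) \<subseteq> {g \<in> carrier G. wl g \<le> n * d}"
proof -
  have "ks (ga_smul c (ga_cheb G R p k)) \<subseteq> {g \<in> carrier G. wl g \<le> n * d}" if "k < n" for c k
  proof -
    have "k * d \<le> n * d" using that by simp
    then show ?thesis
      by (intro order.trans[OF keys_ga_smul] order.trans[OF keys_ga_cheb[OF assms, of R k]])
        (auto simp del: mult_le_cancel2 intro: order.trans)
  qed
  then show ?thesis
    unfolding ga_pois_def
    by (intro order.trans[OF Poly_Mapping.keys_add] Un_least order.trans[OF keys_sum] UN_least
        order.trans[OF keys_single_subset]) (auto simp: wl_one)
qed

end

lemma (in group) carrier_ga_cheb: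
  assumes "ks p \<subseteq> carrier G"
  shows "ks (ga_cheb G R p n) \<subseteq> carrier G"
proof (induction n rule: induct_nat_012)
  case 1
  show ?case using order.trans[OF keys_ga_smul assms(1)] by simp
next
  case (ge2 n)
  have "ks (ga_conv G p (ga_cheb G R p (Suc n))) \<subseteq> carrier G"
    by (intro order.trans[OF keys_ga_conv]) (use ge2 assms in auto)
  with ge2 show ?case
    unfolding ga_cheb.simps
    by (intro order.trans[OF keys_minus_subset] Un_least order.trans[OF keys_ga_smul])
qed simp

lemma (in group) carrier_ga_pois:
  assumes "ks p \<subseteq> carrier G"
  shows "ks (ga_pois G R p E \<eta> n) \<subseteq> carrier G"
  unfolding ga_pois_def
  by (intro order.trans[OF Poly_Mapping.keys_add] Un_least order.trans[OF keys_sum] UN_least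
      order.trans[OF keys_single_subset] order.trans[OF keys_ga_smul] carrier_ga_cheb assms) auto

text \<open>The sum of the absolute values of the coefficients bounds the operator norm of
  \<open>p\<close> in every such representation, so one \<open>R\<close> serves the group and all
  \<open>N\<close>.\<close>

locale gact_sa = gact +
  fixes p :: "'a \<Rightarrow>\<^sub>0 complex" and R :: real
  assumes p_carrier: "ks p \<subseteq> carrier G" and p_star: "ga_star G p = p"
    and R1: "R \<ge> 1" and pR: "(\<Sum>g\<in>ks p. cmod (lk p g)) \<le> R"
begin

lemma cinner_lop_p: "cinner (lop p f) h = cinner f (lop p h)"
  by (simp add: lop_adjoint[OF p_carrier] p_star)

lemma inner_lop_p: "inner (lop p f) h = inner f (lop p h)"
  by (simp add: inner_l2_def cinner_lop_p)

lemma norm_lop_p: "norm (lop p f) \<le> R * norm f"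
  using norm_lop_le[OF p_carrier, of f] mult_right_mono[OF pR norm_ge_zero[of f]] by linarith

abbreviation pcheb :: "'c l2 \<Rightarrow> nat \<Rightarrow> 'c l2" where
  "pcheb \<equiv> cheb (\<lambda>x. (1 / R) *\<^sub>R lop p x)"

lemma lop_cheb:
  assumes "l2_on X f"
  shows "lop (ga_cheb G R p n) f = pcheb f n"
proof (induction n rule: induct_nat_012)
  case 0
  then show ?case by (simp add: lop_single shift_one assms cscale_of_real[of 1, simplified])
next
  case 1
  show ?case by (simp add: lop_smul cscale_of_real[of "1/R", simplified])
next
  case (ge2 n)
  have "cscale (complex_of_real (2 / R)) x = 2 *\<^sub>R (1 / R) *\<^sub>R x" for x :: "'c l2"
    unfolding cscale_of_real by simp
  then show ?case
    using ge2 unfolding ga_cheb.simps cheb.simps lop_diff lop_smul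
    by (simp only: lop_conv[OF p_carrier carrier_ga_cheb[OF p_carrier]])
qed

lemma lop_ga_pois:
  assumes "l2_on X f"
  shows "lop (ga_pois G R p E \<eta> n) f =
    (\<Sum>k<n. pois_coef R E \<eta> k *\<^sub>R pcheb f k) + tail_err R \<eta> n *\<^sub>R f"
  unfolding ga_pois_def lop_add lop_sum lop_smul lop_single shift_one[OF assms] cscale_of_real
    lop_cheb[OF assms] ..

text \<open>\<open>A + iB\<close> is the resolvent at \<open>E + i\<eta>\<close> applied to \<open>v\<close>.\<close>

definition res_pair :: "real \<Rightarrow> real \<Rightarrow> 'c l2 \<Rightarrow> 'c l2 \<Rightarrow> 'c l2 \<Rightarrow> bool" where
  "res_pair E \<eta> v A B \<longleftrightarrow> lop p A - E *\<^sub>R A + \<eta> *\<^sub>R B = v \<and> lop p B - E *\<^sub>R B = \<eta> *\<^sub>R A"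

text \<open>The factor 2 in the error counts one \<open>tail_err\<close> for the truncation and one
  for the constant added in \<open>ga_pois\<close>.\<close>

lemma res_pair_exists:
  assumes "0 < \<eta>" "\<eta> \<le> 1" "l2_on X v"
  obtains A B where "res_pair E \<eta> v A B" "l2_on X A" "l2_on X B"
    "\<And>n. norm (lop (ga_pois G R p E \<eta> n) v - B) \<le> 2 * tail_err R \<eta> n * norm v"
proof -
  obtain A B where AB: "lop p A - E *\<^sub>R A + \<eta> *\<^sub>R B = v" "lop p B - E *\<^sub>R B = \<eta> *\<^sub>R A"
    "\<And>n. norm (B - (\<Sum>k<n. pois_coef R E \<eta> k *\<^sub>R pcheb v k)) \<le> tail_err R \<eta> n * norm v"
    by (rule poisson_series[OF lop_linear[OF p_carrier] inner_lop_p norm_lop_p R1 assms(1,2), of E v]) (rule that)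
  \<comment> \<open>Outside \<open>X\<close> the operator contributes nothing, and the two resolvent
    equations become a homogeneous linear system with determinant
    \<open>\<eta> * \<eta> + E * E > 0\<close>.\<close>
  have "l2_at A x = 0 \<and> l2_at B x = 0" if "x \<notin> X" for x
  proof -
    have o: "l2_at (lop p f) x = 0" for f
      using lop_on[OF p_carrier] that by (auto simp: l2_on_def)
    have "l2_at (lop p A - E *\<^sub>R A + \<eta> *\<^sub>R B) x = 0"
      unfolding AB(1) using assms(3) that by (simp add: l2_on_def)
    then have 1: "of_real \<eta> * l2_at B x = of_real E * l2_at A x"
      by (simp add: o scaleR_conv_of_real)
    have "l2_at (lop p B - E *\<^sub>R B) x = l2_at (\<eta> *\<^sub>R A) x"
      unfolding AB(2) ..
    then have 2: "of_real \<eta> * l2_at A x = - (of_real E * l2_at B x)"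
      by (simp add: o scaleR_conv_of_real)
    have "of_real \<eta> * (of_real \<eta> * l2_at B x) = of_real E * (of_real \<eta> * l2_at A x)"
      unfolding 1 by (rule mult.left_commute)
    also have "\<dots> = - (of_real E * of_real E * l2_at B x)"
      unfolding 2 by simp
    finally have "complex_of_real (\<eta> * \<eta> + E * E) * l2_at B x = 0"
      by (simp only: of_real_add of_real_mult distrib_right mult.assoc) simp
    moreover have "\<eta> * \<eta> + E * E > 0"
      using assms(1) by (intro add_pos_nonneg) auto
    then have "complex_of_real (\<eta> * \<eta> + E * E) \<noteq> 0"
      by (simp only: of_real_eq_0_iff)
    ultimately have "l2_at B x = 0"
      by (simp only: mult_eq_0_iff simp_thms)
    then show ?thesis using 2 assms(1) by simp
  qed
  then have on: "l2_on X A" "l2_on X B" by (auto simp: l2_on_def)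
  have "norm (lop (ga_pois G R p E \<eta> n) v - B) \<le> 2 * tail_err R \<eta> n * norm v" for n
  proof -
    have "lop (ga_pois G R p E \<eta> n) v - B =
        tail_err R \<eta> n *\<^sub>R v - (B - (\<Sum>k<n. pois_coef R E \<eta> k *\<^sub>R pcheb v k))"
      unfolding lop_ga_pois[OF assms(3)] by simp
    also have "norm \<dots> \<le> norm (tail_err R \<eta> n *\<^sub>R v) + tail_err R \<eta> n * norm v"
      using norm_triangle_ineq4[of "tail_err R \<eta> n *\<^sub>R v" "B - (\<Sum>k<n. pois_coef R E \<eta> k *\<^sub>R pcheb v k)"]
        AB(3)[of n] by linarith
    also have "\<dots> = 2 * tail_err R \<eta> n * norm v"
      using tail_err_nonneg[of R \<eta> n] R1 by simp
    finally show ?thesis .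
  qed
  with AB on show ?thesis
    using that by (simp add: res_pair_def)
qed

text \<open>A bound uniform in the degree, of which 12 is three times 4: the vector \<open>B\<close>
  (from the error bound with the empty partial sum), the truncation error and the added constant are
  each at most \<open>4 * R / \<eta>^2\<close>.\<close>

lemma norm_lop_ga_pois:
  assumes "0 < \<eta>" "\<eta> \<le> 1" "l2_on X v"
  shows "norm (lop (ga_pois G R p E \<eta> n) v) \<le> 12 * R / \<eta>\<^sup>2 * norm v"
proof -
  obtain A B where AB: "lop p A - E *\<^sub>R A + \<eta> *\<^sub>R B = v" "lop p B - E *\<^sub>R B = \<eta> *\<^sub>R A"
    "\<And>n. norm (B - (\<Sum>k<n. pois_coef R E \<eta> k *\<^sub>R pcheb v k)) \<le> tail_err R \<eta> n * norm v"
    by (rule poisson_series[OF lop_linear[OF p_carrier] inner_lop_p norm_lop_p R1 assms(1,2), of E v]) (rule that)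
  let ?S = "\<Sum>k<n. pois_coef R E \<eta> k *\<^sub>R pcheb v k"
  have t: "tail_err R \<eta> m \<le> 4 * R / \<eta>\<^sup>2" for m
    using R1 assms(1) mult_left_mono[of "exp (- \<eta> * real m / (2 * R))" 1 "4 * R / \<eta>\<^sup>2"]
    by (simp add: tail_err_def)
  have tv: "tail_err R \<eta> m * norm v \<le> 4 * R / \<eta>\<^sup>2 * norm v" for m
    by (rule mult_right_mono[OF t]) simp
  have "norm B \<le> 4 * R / \<eta>\<^sup>2 * norm v"
    using AB(3)[of 0] tv[of 0] by simp
  moreover have "norm ?S \<le> norm B + norm (B - ?S)"
    using norm_triangle_ineq4[of B "B - ?S"] by simp
  moreover have "norm (tail_err R \<eta> n *\<^sub>R v) = tail_err R \<eta> n * norm v"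
    using tail_err_nonneg[of R \<eta> n] R1 by simp
  ultimately have "norm ?S + norm (tail_err R \<eta> n *\<^sub>R v) \<le> 3 * (4 * R / \<eta>\<^sup>2 * norm v)"
    using AB(3)[of n] tv[of n] by linarith
  then show ?thesis
    unfolding lop_ga_pois[OF assms(3)]
    using norm_triangle_ineq[of ?S "tail_err R \<eta> n *\<^sub>R v"] by simp
qed

text \<open>Self-adjointness of the imaginary part of the resolvent. It trades the entries of one
  row for those of one column and makes the diagonal entry real.\<close>

lemma res_pair_cinner:
  assumes "res_pair E \<eta> u A B" "res_pair E \<eta> v A' B'"
  shows "cinner B v = cinner u B'"
proof -
  have sR: "cinner f (r *\<^sub>R h) = of_real r * cinner f h" "cinner (r *\<^sub>R f) h = of_real r * cinner f h"
    for f h :: "'c l2" and r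
    by (simp_all add: cinner_cscale_right cinner_cscale_left flip: cscale_of_real)
  have D: "cinner f (h - h') = cinner f h - cinner f h'" "cinner (f - f') h = cinner f h - cinner f' h"
    for f f' h h' :: "'c l2"
    subgoal using cinner_add_right[of f "h - h'" h'] by simp
    subgoal using cinner_add_left[of "f - f'" f' h] by simp
    done
  have 1: "lop p A - E *\<^sub>R A + \<eta> *\<^sub>R B = u" "lop p B - E *\<^sub>R B = \<eta> *\<^sub>R A"
    "lop p A' - E *\<^sub>R A' + \<eta> *\<^sub>R B' = v" "lop p B' - E *\<^sub>R B' = \<eta> *\<^sub>R A'"
    using assms by (auto simp: res_pair_def)
  have "cinner B v = cinner (lop p B - E *\<^sub>R B) A' + \<eta> * cinner B B'"
    unfolding 1(3)[symmetric] by (simp add: cinner_add_right D sR cinner_lop_p)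
  also have "\<dots> = cinner A (lop p B' - E *\<^sub>R B') + \<eta> * cinner B B'"
    unfolding 1(2,4) by (simp add: sR)
  also have "\<dots> = cinner u B'"
    unfolding 1(1)[symmetric] by (simp add: cinner_add_left D sR cinner_lop_p)
  finally show ?thesis .
qed

text \<open>A difference of two solutions is an eigenvector of a symmetric operator with non-real
  eigenvalue, hence 0.\<close>

lemma resolvent_injective:
  assumes "Im z \<noteq> 0" "lop p f - cscale z f = lop p h - cscale z h"
  shows "f = h"
proof -
  define y where "y = f - h"
  have D: "lop p (f - h) = lop p f - lop p h"
    by (rule linear_diff[OF lop_linear[OF p_carrier]])
  have py: "lop p y = cscale z y"
  proof (rule l2_eqI)
    fix x
    show "l2_at (lop p y) x = l2_at (cscale z y) x"
      using arg_cong[OF assms(2), of "\<lambda>w. l2_at w x"] by (simp add: y_def D algebra_simps)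
  qed
  have "cnj z * cinner y y = z * cinner y y"
    using cinner_lop_p[of y y] by (simp add: py cinner_cscale_left cinner_cscale_right)
  moreover have "cnj z \<noteq> z"
    using assms(1) by (simp add: complex_eq_iff)
  ultimately have "cinner y y = 0" by simp
  then have "inner y y = 0" by (simp add: inner_l2_def)
  then show ?thesis by (simp add: y_def)
qed

end

text \<open>The mean value theorem for the antiderivative replaces the integral comparison by a
  telescoping difference.\<close>

lemma powr_telescope:
  fixes s :: real
  assumes "s > 1" "n \<ge> 1"
  shows "real (Suc n) powr - s \<le> (real n powr (1 - s) - real (Suc n) powr (1 - s)) / (s - 1)"
proof -
  have "\<exists>z>real n. z < real (Suc n) \<and> real (Suc n) powr (1 - s) - real n powr (1 - s) =
      (real (Suc n) - real n) * ((1 - s) * z powr (1 - s - 1))"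
    using assms by (intro MVT2 has_real_derivative_powr) auto
  then obtain z where z: "z > real n" "z < real (Suc n)"
    "real (Suc n) powr (1 - s) - real n powr (1 - s) = (1 - s) * z powr (- s)"
    by auto
  have "real (Suc n) powr - s \<le> z powr - s"
    using z assms by (intro powr_mono2') auto
  also have "z powr - s = (real n powr (1 - s) - real (Suc n) powr (1 - s)) / (s - 1)"
  proof -
    have "real n powr (1 - s) - real (Suc n) powr (1 - s) = (s - 1) * z powr - s"
      using z(3) by (simp add: algebra_simps)
    then show ?thesis
      using assms(1) by simp
  qed
  finally show ?thesis .
qed

text \<open>The indices 0 and 1 contribute 1 each because of \<open>max 1 n\<close>; the remaining
  terms telescope to at most \<open>1 / (s - 1)\<close>.\<close>

lemma sum_powr_bound:
  fixes s :: real
  assumes s: "s > 1"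
  shows "(\<Sum>n\<le>Suc N. real (max 1 n) powr - s) \<le> 2 + 1 / (s - 1)"
proof -
  have "(\<Sum>n\<le>Suc N. real (max 1 n) powr - s) \<le> 2 + (1 - real (Suc N) powr (1 - s)) / (s - 1)"
  proof (induction N)
    case (Suc N)
    have "real (max 1 (Suc (Suc N))) powr - s \<le>
        (real (Suc N) powr (1 - s) - real (Suc (Suc N)) powr (1 - s)) / (s - 1)"
      using powr_telescope[OF s, of "Suc N"] by (simp add: max_def)
    then have "(\<Sum>n\<le>Suc (Suc N). real (max 1 n) powr - s) \<le> 2 +
        ((1 - real (Suc N) powr (1 - s)) / (s - 1) +
        (real (Suc N) powr (1 - s) - real (Suc (Suc N)) powr (1 - s)) / (s - 1))"
      using Suc unfolding sum.atMost_Suc[of _ "Suc N"] by linarith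
    also have "\<dots> = 2 + (1 - real (Suc (Suc N)) powr (1 - s)) / (s - 1)"
      unfolding add_divide_distrib[symmetric] by simp
    finally show ?case .
  qed simp
  also have "\<dots> \<le> 2 + 1 / (s - 1)"
    using s by (intro add_left_mono divide_right_mono) auto
  finally show ?thesis .
qed

section \<open>The left regular representation\<close>

lemma ell2_l2_at: "l2_on (carrier G) F \<Longrightarrow> l2_at F \<in> ell2 G"
  unfolding ell2_def l2_on_def by (auto intro: summable_on_subset_banach[OF l2_summable])

lemma ell2E:
  assumes "f \<in> ell2 G"
  obtains F where "l2_on (carrier G) F" "f = l2_at F"
proof -
  have "(\<lambda>x. (cmod (f x))\<^sup>2) summable_on UNIV"
    using assms unfolding ell2_def
    by (subst summable_on_cong_neutral[where T = "carrier G" and g = "\<lambda>x. (cmod (f x))\<^sup>2"]) auto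
  then have "f = l2_at (Abs_l2 f)"
    by (auto simp: Abs_l2_at)
  moreover from this have "l2_on (carrier G) (Abs_l2 f)"
    using assms by (simp add: l2_on_def ell2_def)
  ultimately show ?thesis using that by blast
qed

lemma ell2_inner_l2_at: "l2_on (carrier G) F \<Longrightarrow> ell2_inner G (l2_at F) (l2_at H) = cinner F H"
  unfolding ell2_inner_def cinner_def by (rule infsum_cong_neutral) (auto simp: l2_on_def)

lemma ell2_norm_l2_at: "l2_on (carrier G) F \<Longrightarrow> ell2_norm G (l2_at F) = norm F"
  unfolding ell2_norm_def l2_norm_eq
  by (intro arg_cong[where f = sqrt] infsum_cong_neutral) (auto simp: l2_on_def)

lemma ell2_delta_l2_at: "ell2_delta g = l2_at (l2_delta g)"
  by (auto simp: ell2_delta_def fun_eq_iff)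

sublocale cayley \<subseteq> L: gact G "carrier G" "(\<otimes>)"
  by unfold_locales (auto simp: m_assoc)

context cayley
begin

lemma left_regular_ga_l2_at:
  "ks q \<subseteq> carrier G \<Longrightarrow> left_regular_ga G q (l2_at F) = l2_at (L.lop q F)"
  by (auto simp: left_regular_ga_def left_regular_def L.lop_at fun_eq_iff)

text \<open>In the regular representation the orbit of the unit is free, so the column at the unit
  is \<open>q\<close> itself. Norm estimates on that column become estimates on
  coefficients.\<close>

lemma lop_delta_one:
  assumes "ks q \<subseteq> carrier G" "g \<in> carrier G"
  shows "l2_at (L.lop q (l2_delta \<one>)) g = lk q g"
proof -
  have "l2_at (L.lop q (l2_delta \<one>)) g = (\<Sum>h\<in>ks q. if h = g then lk q h else 0)"
    unfolding L.lop_delta_at[OF assms(1) one_closed] using assms(1) by (intro sum.cong) auto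
  also have "\<dots> = lk q g"
    by (subst sum.delta) (simp_all add: lk_not_in_ks)
  finally show ?thesis .
qed

definition opn :: "('g \<Rightarrow>\<^sub>0 complex) \<Rightarrow> real" where
  "opn q = ell2_opnorm G (left_regular_ga G q)"

lemma opn_eq:
  assumes "ks q \<subseteq> carrier G"
  shows "opn q = (SUP F\<in>{F. l2_on (carrier G) F \<and> norm F \<le> 1}. norm (L.lop q F))"
proof -
  have "(\<lambda>f. ell2_norm G (left_regular_ga G q f)) ` {f \<in> ell2 G. ell2_norm G f \<le> 1} =
      (\<lambda>F. norm (L.lop q F)) ` {F. l2_on (carrier G) F \<and> norm F \<le> 1}" (is "?L = ?R")
  proof
    show "?L \<subseteq> ?R"
    proof
      fix y assume "y \<in> ?L"
      then obtain f where f: "f \<in> ell2 G" "ell2_norm G f \<le> 1" "y = ell2_norm G (left_regular_ga G q f)"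
        by blast
      obtain F where F: "l2_on (carrier G) F" "f = l2_at F"
        using f(1) by (rule ell2E)
      have "y = norm (L.lop q F)" "norm F \<le> 1"
        using f F by (simp_all add: left_regular_ga_l2_at assms ell2_norm_l2_at L.lop_on)
      then show "y \<in> ?R" using F by blast
    qed
    show "?R \<subseteq> ?L"
    proof
      fix y assume "y \<in> ?R"
      then obtain F where F: "l2_on (carrier G) F" "norm F \<le> 1" "y = norm (L.lop q F)"
        by blast
      then have "l2_at F \<in> {f \<in> ell2 G. ell2_norm G f \<le> 1}"
        "y = ell2_norm G (left_regular_ga G q (l2_at F))"
        by (simp_all add: ell2_l2_at left_regular_ga_l2_at assms ell2_norm_l2_at L.lop_on)
      then show "y \<in> ?L" by blast
    qed
  qed
  then show ?thesis by (simp only: opn_def ell2_opnorm_def)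
qed

lemma opn_bdd:
  assumes "ks q \<subseteq> carrier G"
  shows "bdd_above ((\<lambda>F. norm (L.lop q F)) ` {F. l2_on (carrier G) F \<and> norm F \<le> 1})"
proof (rule bdd_aboveI2)
  fix F :: "'g l2" assume "F \<in> {F. l2_on (carrier G) F \<and> norm F \<le> 1}"
  then have "(\<Sum>g\<in>ks q. cmod (lk q g)) * norm F \<le> (\<Sum>g\<in>ks q. cmod (lk q g)) * 1"
    by (intro mult_left_mono sum_nonneg) auto
  then show "norm (L.lop q F) \<le> (\<Sum>g\<in>ks q. cmod (lk q g)) * 1"
    using L.norm_lop_le[OF assms, of F] by linarith
qed

lemma norm_lop_le_opn:
  assumes "ks q \<subseteq> carrier G" "l2_on (carrier G) F"
  shows "norm (L.lop q F) \<le> opn q * norm F"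
proof (cases "F = 0")
  case True
  then show ?thesis using linear_0[OF L.lop_linear[OF assms(1)]] by simp
next
  case False
  define H where "H = (1 / norm F) *\<^sub>R F"
  have "H \<in> {F. l2_on (carrier G) F \<and> norm F \<le> 1}"
    using False assms(2) by (auto simp: H_def l2_on_def)
  then have "norm (L.lop q H) \<le> opn q"
    unfolding opn_eq[OF assms(1)] by (rule cSUP_upper[OF _ opn_bdd[OF assms(1)]])
  moreover have "L.lop q H = (1 / norm F) *\<^sub>R L.lop q F"
    unfolding H_def by (rule linear_scale[OF L.lop_linear[OF assms(1)]])
  ultimately show ?thesis
    using False by (simp add: field_simps)
qed

lemma opn_le:
  assumes "ks q \<subseteq> carrier G" "0 \<le> c"
    and "\<And>F. l2_on (carrier G) F \<Longrightarrow> norm (L.lop q F) \<le> c * norm F"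
  shows "opn q \<le> c"
  unfolding opn_eq[OF assms(1)]
proof (rule cSUP_least)
  show "{F::'g l2. l2_on (carrier G) F \<and> norm F \<le> 1} \<noteq> {}"
    by (auto intro!: exI[of _ 0] simp: l2_on_def)
  fix F :: "'g l2" assume "F \<in> {F. l2_on (carrier G) F \<and> norm F \<le> 1}"
  then show "norm (L.lop q F) \<le> c"
    using assms(3)[of F] mult_left_mono[of "norm F" 1 c] assms(2) by auto
qed

lemma opn_nonneg: "ks q \<subseteq> carrier G \<Longrightarrow> 0 \<le> opn q"
  using order.trans[OF norm_ge_zero norm_lop_le_opn[of q "l2_delta \<one>"]] by (simp add: l2_on_delta)

text \<open>The word length vanishes at the unit, where the weight in (R4) gives no control. With
  weight at least 1 everywhere the unit has to be bounded separately, which (AC) does in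
  \<open>wsum4_ga_pois\<close>.\<close>

definition wt :: "'g \<Rightarrow> real" where
  "wt g = real (max 1 (wl g))"

definition ga_sphere :: "nat \<Rightarrow> ('g \<Rightarrow>\<^sub>0 complex) \<Rightarrow> ('g \<Rightarrow>\<^sub>0 complex)" where
  "ga_sphere n q = (\<Sum>g\<in>{g \<in> ks q. wl g = n}. Poly_Mapping.single g (lk q g))"

lemma lookup_ga_sphere: "lk (ga_sphere n q) g = (if wl g = n then lk q g else 0)"
proof -
  have "lk (ga_sphere n q) g = (\<Sum>h\<in>{h \<in> ks q. wl h = n}. if h = g then lk q g else 0)"
    unfolding ga_sphere_def lookup_sum lookup_single when_def by (intro sum.cong) auto
  also have "\<dots> = (if g \<in> {h \<in> ks q. wl h = n} then lk q g else 0)"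
    by (rule sum.delta) simp
  finally show ?thesis by (auto simp: lk_not_in_ks)
qed

lemma keys_ga_sphere: "ks (ga_sphere n q) = {g \<in> ks q. wl g = n}"
  by (auto simp: in_keys_iff lookup_ga_sphere split: if_splits)

lemma lop_ga_sphere_sum:
  assumes "\<And>g. g \<in> ks q \<Longrightarrow> wl g \<le> N"
  shows "L.lop q F = (\<Sum>n\<le>N. L.lop (ga_sphere n q) F)"
proof -
  have "L.lop q F = (\<Sum>n\<le>N. \<Sum>g\<in>{g \<in> ks q. wl g = n}. cscale (lk q g) (L.shift g F))"
    unfolding L.lop_def by (rule sum.group[symmetric]) (use assms in auto)
  also have "\<dots> = (\<Sum>n\<le>N. L.lop (ga_sphere n q) F)"
    unfolding L.lop_def keys_ga_sphere by (intro sum.cong refl) (auto simp: lookup_ga_sphere)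
  finally show ?thesis .
qed

lemma ga_diam_sphere:
  assumes "ks q \<subseteq> carrier G"
  shows "real (ga_diam G S (ga_sphere n q)) \<le> 2 * real (max 1 n)"
proof -
  let ?D = "{cayley_dist G S g h | g h. g \<in> ks (ga_sphere n q) \<and> h \<in> ks (ga_sphere n q)}"
  have fin: "finite (insert 1 ?D)"
    by (simp add: finite_image_set2)
  have "d \<le> 2 * max 1 n" if d: "d \<in> insert 1 ?D" for d
  proof (cases "d = 1")
    case False
    then obtain g h where gh: "d = cayley_dist G S g h" "g \<in> ks q" "h \<in> ks q" "wl g = n" "wl h = n"
      using d by (auto simp: keys_ga_sphere)
    then have "d \<le> wl h + wl (inv g)"
      using assms wl_mult[of h "inv g"] by (auto simp: cayley_dist_eq subset_iff)
    then show ?thesis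
      using gh assms wl_inv[of g] by auto
  qed simp
  then have "Max (insert 1 ?D) \<le> 2 * max 1 n"
    using fin by (subst Max_le_iff) auto
  then have "real (Max (insert 1 ?D)) \<le> real (2 * max 1 n)"
    by (rule of_nat_mono)
  then show ?thesis
    unfolding ga_diam_def by simp
qed

text \<open>Rapid decay is applied to the restriction of \<open>q\<close> to each sphere; the Cauchy--Schwarz inequality over
  the radii converges because \<open>C1' > 2 * C1 + 1\<close>.\<close>

lemma rapid_decay_weighted:
  assumes rd: "rapid_decay G S C1" and C1': "C1' > 2 * C1 + 1"
  obtains K where "K > 0"
    "\<And>q. ks q \<subseteq> carrier G \<Longrightarrow> opn q \<le> K * sqrt (\<Sum>g\<in>ks q. wt g powr C1' * (cmod (lk q g))\<^sup>2)"
proof -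
  obtain C where C: "C > 0" "C1 > 0"
    "\<And>q. ks q \<subseteq> carrier G \<Longrightarrow> opn q \<le> C * real (ga_diam G S q) powr C1 * ga_norm2 q"
    using rd by (auto simp: rapid_decay_def group_algebra_def opn_def)
  define m where "m = (\<lambda>n. real (max 1 n))"
  have m1: "m n \<ge> 1" for n by (simp add: m_def)
  \<comment> \<open>\<open>sum_powr_bound\<close> with exponent \<open>C1' - 2 * C1\<close>, which
    exceeds 1.\<close>
  define Z where "Z = 2 + 1 / (C1' - 2 * C1 - 1)"
  have Z: "(\<Sum>n\<le>N. m n powr (2 * C1 - C1')) \<le> Z" for N
  proof -
    have "(\<Sum>n\<le>N. m n powr (2 * C1 - C1')) \<le> (\<Sum>n\<le>Suc N. m n powr (2 * C1 - C1'))"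
      by simp
    also have "\<dots> = (\<Sum>n\<le>Suc N. real (max 1 n) powr - (C1' - 2 * C1))"
      by (simp add: m_def)
    also have "\<dots> \<le> Z"
      unfolding Z_def using C1' by (intro sum_powr_bound) auto
    finally show ?thesis .
  qed
  have Z1: "Z > 0"
    using Z[of 0] by (simp add: m_def)
  define K where "K = C * 2 powr C1 * sqrt Z"
  have K: "K > 0" using C Z1 by (simp add: K_def)
  have "opn q \<le> K * sqrt (\<Sum>g\<in>ks q. wt g powr C1' * (cmod (lk q g))\<^sup>2)"
    if q: "ks q \<subseteq> carrier G" for q
  proof -
    define N where "N = Max (insert 0 (wl ` ks q))"
    have N: "wl g \<le> N" if "g \<in> ks q" for g
      unfolding N_def using that by (intro Max_ge) auto
    define a where "a = (\<lambda>n. ga_norm2 (ga_sphere n q))"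
    have a2: "(a n)\<^sup>2 = (\<Sum>g\<in>{g \<in> ks q. wl g = n}. (cmod (lk q g))\<^sup>2)" for n
      unfolding a_def ga_norm2_def keys_ga_sphere
      by (auto simp: lookup_ga_sphere sum_nonneg intro!: sum.cong)
    have a0: "a n \<ge> 0" for n by (simp add: a_def ga_norm2_def sum_nonneg)
    have sph: "opn (ga_sphere n q) \<le> C * 2 powr C1 * (m n powr C1 * a n)" for n
    proof -
      have "opn (ga_sphere n q) \<le> C * real (ga_diam G S (ga_sphere n q)) powr C1 * a n"
        unfolding a_def by (rule C(3)) (use q in \<open>auto simp: keys_ga_sphere\<close>)
      also have "\<dots> \<le> C * (2 * m n) powr C1 * a n"
        using C a0 ga_diam_sphere[OF q, of n]
        by (intro mult_right_mono mult_left_mono powr_mono2) (auto simp: m_def)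
      also have "\<dots> = C * 2 powr C1 * (m n powr C1 * a n)"
        using m1[of n] by (simp add: powr_mult)
      finally show ?thesis .
    qed
    \<comment> \<open>The exponent is split as \<open>C1 = (C1 - C1'/2) + C1'/2\<close>: squaring
      the first factor gives the convergent series bounded by \<open>Z\<close>, squaring the second
      gives the weighted norm.\<close>
    have "(\<Sum>n\<le>N. m n powr C1 * a n) = (\<Sum>n\<le>N. \<bar>m n powr (C1 - C1'/2)\<bar> * \<bar>m n powr (C1'/2) * a n\<bar>)"
      using a0 by (intro sum.cong refl) (simp add: powr_add[symmetric] flip: mult.assoc)
    also have "\<dots> \<le> L2_set (\<lambda>n. m n powr (C1 - C1'/2)) {..N} * L2_set (\<lambda>n. m n powr (C1'/2) * a n) {..N}"
      by (rule L2_set_mult_ineq)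
    also have "L2_set (\<lambda>n. m n powr (C1 - C1'/2)) {..N} = sqrt (\<Sum>n\<le>N. m n powr (2 * C1 - C1'))"
      unfolding L2_set_def power2_eq_square by (simp add: powr_add[symmetric] algebra_simps)
    also have "L2_set (\<lambda>n. m n powr (C1'/2) * a n) {..N} = sqrt (\<Sum>n\<le>N. m n powr C1' * (a n)\<^sup>2)"
    proof -
      have "(m n powr (C1'/2))\<^sup>2 = m n powr C1'" for n
        unfolding power2_eq_square by (simp add: powr_add[symmetric])
      then show ?thesis unfolding L2_set_def power_mult_distrib by simp
    qed
    also have "(\<Sum>n\<le>N. m n powr C1' * (a n)\<^sup>2) =
        (\<Sum>n\<le>N. \<Sum>g\<in>{g \<in> ks q. wl g = n}. wt g powr C1' * (cmod (lk q g))\<^sup>2)"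
      unfolding a2 sum_distrib_left by (intro sum.cong refl) (auto simp: wt_def m_def)
    also have "\<dots> = (\<Sum>g\<in>ks q. wt g powr C1' * (cmod (lk q g))\<^sup>2)"
      by (rule sum.group) (use N in auto)
    finally have main: "(\<Sum>n\<le>N. m n powr C1 * a n) \<le>
        sqrt (\<Sum>n\<le>N. m n powr (2 * C1 - C1')) * sqrt (\<Sum>g\<in>ks q. wt g powr C1' * (cmod (lk q g))\<^sup>2)"
      (is "_ \<le> _ * ?Q") .
    have "(\<Sum>n\<le>N. m n powr C1 * a n) \<le> sqrt Z * ?Q"
      by (rule order.trans[OF main], intro mult_right_mono real_sqrt_le_mono Z) (simp add: sum_nonneg)
    have "opn q \<le> (\<Sum>n\<le>N. opn (ga_sphere n q))"
    proof (rule opn_le[OF q])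
      have sq: "ks (ga_sphere n q) \<subseteq> carrier G" for n
        using q by (auto simp: keys_ga_sphere)
      show "0 \<le> (\<Sum>n\<le>N. opn (ga_sphere n q))"
        by (intro sum_nonneg opn_nonneg sq)
      fix F :: "'g l2" assume F: "l2_on (carrier G) F"
      have "L.lop q F = (\<Sum>n\<le>N. L.lop (ga_sphere n q) F)"
        by (rule lop_ga_sphere_sum) (rule N)
      then have "norm (L.lop q F) \<le> (\<Sum>n\<le>N. norm (L.lop (ga_sphere n q) F))"
        by (simp only: norm_sum)
      also have "\<dots> \<le> (\<Sum>n\<le>N. opn (ga_sphere n q) * norm F)"
        by (intro sum_mono norm_lop_le_opn sq F)
      finally show "norm (L.lop q F) \<le> (\<Sum>n\<le>N. opn (ga_sphere n q)) * norm F"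
        by (simp add: sum_distrib_right)
    qed
    also have "\<dots> \<le> (\<Sum>n\<le>N. C * 2 powr C1 * (m n powr C1 * a n))"
      by (intro sum_mono sph)
    also have "\<dots> = C * 2 powr C1 * (\<Sum>n\<le>N. m n powr C1 * a n)"
      by (simp add: sum_distrib_left)
    also have "\<dots> \<le> C * 2 powr C1 * (sqrt Z * ?Q)"
      using C \<open>(\<Sum>n\<le>N. m n powr C1 * a n) \<le> sqrt Z * ?Q\<close> by (intro mult_left_mono) auto
    finally show ?thesis by (simp add: K_def mult.assoc)
  qed
  with K show ?thesis using that by blast
qed

end

section \<open>Entries of the resolvent in the left regular representation\<close>

locale cayley_sa = cayley G S for G :: "('g, 'm) monoid_scheme" (structure) and S +
  fixes p :: "'g \<Rightarrow>\<^sub>0 complex" and R :: real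
  assumes p_carrier: "ks p \<subseteq> carrier G" and p_star: "ga_star G p = p"
    and R1: "R \<ge> 1" and pR: "(\<Sum>g\<in>ks p. cmod (lk p g)) \<le> R"

sublocale cayley_sa \<subseteq> L: gact_sa G "carrier G" "(\<otimes>)" p R
  by unfold_locales (rule p_carrier p_star R1 pR)+

context cayley_sa
begin

abbreviation Pz :: "complex \<Rightarrow> ('g \<Rightarrow> complex) \<Rightarrow> 'g \<Rightarrow> complex" where
  "Pz z \<equiv> (\<lambda>f g. left_regular_ga G p f g - z * f g)"

lemma Pz_l2_at: "Pz z (l2_at F) = l2_at (L.lop p F - cscale z F)"
  by (auto simp: left_regular_ga_l2_at p_carrier)

text \<open>\<open>ell2_resolvent\<close> is an \<open>inv_into\<close>, so any explicit preimage
  \<open>Y\<close> is its value once \<open>P - z\<close> is known to be injective. The preimage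
  comes from the Chebyshev series.\<close>

lemma ell2_resolvent_eqI:
  assumes "Im z \<noteq> 0" "l2_on (carrier G) Y" "L.lop p Y - cscale z Y = V"
  shows "ell2_resolvent G (left_regular_ga G p) z (l2_at V) = l2_at Y"
proof -
  have "inj_on (Pz z) (ell2 G)"
  proof (rule inj_onI)
    fix f h assume fh: "f \<in> ell2 G" "h \<in> ell2 G" "Pz z f = Pz z h"
    obtain F where F: "l2_on (carrier G) F" "f = l2_at F" using fh(1) by (rule ell2E)
    obtain H where H: "l2_on (carrier G) H" "h = l2_at H" using fh(2) by (rule ell2E)
    have "l2_at (L.lop p F - cscale z F) = l2_at (L.lop p H - cscale z H)"
      using fh(3) unfolding F(2) H(2) Pz_l2_at .
    then have "L.lop p F - cscale z F = L.lop p H - cscale z H"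
      by (simp only: l2_at_inject)
    then show "f = h"
      using L.resolvent_injective[OF assms(1)] F H by blast
  qed
  then have "inv_into (ell2 G) (Pz z) (Pz z (l2_at Y)) = l2_at Y"
    by (rule inv_into_f_f) (rule ell2_l2_at[OF assms(2)])
  then show ?thesis
    unfolding ell2_resolvent_def Pz_l2_at assms(3) .
qed

text \<open>The real pair is recombined into the resolvents at \<open>E + i \<eta>\<close> and
  \<open>E - i \<eta>\<close>; their difference divided by \<open>2 i\<close> is
  \<open>B\<close>.\<close>

lemma res_pair_cscale:
  assumes "L.res_pair E \<eta> V A B"
  shows "L.lop p (A + cscale \<i> B) - cscale (Complex E \<eta>) (A + cscale \<i> B) = V"
    and "L.lop p (A - cscale \<i> B) - cscale (Complex E (- \<eta>)) (A - cscale \<i> B) = V"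
proof -
  have 1: "L.lop p A - E *\<^sub>R A + \<eta> *\<^sub>R B = V" "L.lop p B - E *\<^sub>R B = \<eta> *\<^sub>R A"
    using assms by (auto simp: L.res_pair_def)
  have a: "l2_at (L.lop p A) x = l2_at V x + of_real E * l2_at A x - of_real \<eta> * l2_at B x"
    and b: "l2_at (L.lop p B) x = of_real E * l2_at B x + of_real \<eta> * l2_at A x" for x
    using arg_cong[OF 1(1), of "\<lambda>f. l2_at f x"] arg_cong[OF 1(2), of "\<lambda>f. l2_at f x"]
    by (simp_all add: scaleR_conv_of_real algebra_simps)
  have d: "L.lop p (A - cscale \<i> B) = L.lop p A - cscale \<i> (L.lop p B)"
    using linear_diff[OF L.lop_linear[OF p_carrier], of A "cscale \<i> B"]
    by (simp add: L.lop_right_cscale p_carrier)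
  show "L.lop p (A + cscale \<i> B) - cscale (Complex E \<eta>) (A + cscale \<i> B) = V"
    unfolding L.lop_right_add[OF p_carrier] L.lop_right_cscale[OF p_carrier]
    by (rule l2_eqI) (simp add: a b complex_eq_iff algebra_simps)
  show "L.lop p (A - cscale \<i> B) - cscale (Complex E (- \<eta>)) (A - cscale \<i> B) = V"
    unfolding d by (rule l2_eqI) (simp add: a b complex_eq_iff algebra_simps)
qed

text \<open>The adjoint of the resolvent is the resolvent at the conjugate point: writing
  \<open>v\<close> as \<open>(P - z) Y\<close> and moving the symmetric operator across the inner
  product gives the defining identity. Point masses as test vectors give uniqueness.\<close>

lemma ell2_adjoint_resolvent:
  assumes "0 < \<eta>" "\<eta> \<le> 1" "l2_on (carrier G) U" "L.res_pair E \<eta> U A B"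
    "l2_on (carrier G) A" "l2_on (carrier G) B"
  shows "ell2_adjoint G (ell2_resolvent G (left_regular_ga G p) (Complex E \<eta>)) (l2_at U) = l2_at (A - cscale \<i> B)"
proof -
  let ?R = "ell2_resolvent G (left_regular_ga G p) (Complex E \<eta>)"
  let ?W = "A - cscale \<i> B"
  have W: "l2_on (carrier G) ?W" using assms(5,6) by (auto simp: l2_on_def)
  have adj: "ell2_inner G (l2_at ?W) v = ell2_inner G (l2_at U) (?R v)" if v: "v \<in> ell2 G" for v
  proof -
    obtain V where V: "l2_on (carrier G) V" "v = l2_at V" using v by (rule ell2E)
    obtain A' B' where AB: "L.res_pair E \<eta> V A' B'" "l2_on (carrier G) A'" "l2_on (carrier G) B'"
      by (rule L.res_pair_exists[OF assms(1,2) V(1), of E]) (rule that)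
    let ?Y = "A' + cscale \<i> B'"
    have Y: "l2_on (carrier G) ?Y" using AB(2,3) by (auto simp: l2_on_def)
    have Rv: "?R v = l2_at ?Y"
      unfolding V(2) by (rule ell2_resolvent_eqI) (use assms(1) Y res_pair_cscale(1)[OF AB(1)] in auto)
    have D: "cinner f (h - h') = cinner f h - cinner f h'" for f h h' :: "'g l2"
      using cinner_add_right[of f "h - h'" h'] by simp
    have D': "cinner (f - f') h = cinner f h - cinner f' h" for f f' h :: "'g l2"
      using cinner_add_left[of "f - f'" f' h] by simp
    have cz: "cnj (Complex E (- \<eta>)) = Complex E \<eta>" by (simp add: complex_eq_iff)
    have "ell2_inner G (l2_at ?W) v = cinner ?W (L.lop p ?Y - cscale (Complex E \<eta>) ?Y)"
      unfolding V(2) ell2_inner_l2_at[OF W] res_pair_cscale(1)[OF AB(1)] ..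
    also have "\<dots> = cinner (L.lop p ?W - cscale (Complex E (- \<eta>)) ?W) ?Y"
      unfolding D D' L.cinner_lop_p cinner_cscale_left cinner_cscale_right cz ..
    also have "\<dots> = ell2_inner G (l2_at U) (?R v)"
      unfolding Rv ell2_inner_l2_at[OF assms(3)] res_pair_cscale(2)[OF assms(4)] ..
    finally show ?thesis .
  qed
  show ?thesis
    unfolding ell2_adjoint_def
  proof (rule the_equality)
    show "l2_at ?W \<in> ell2 G \<and> (\<forall>v\<in>ell2 G. ell2_inner G (l2_at ?W) v = ell2_inner G (l2_at U) (?R v))"
      using adj ell2_l2_at[OF W] by blast
    fix w assume w: "w \<in> ell2 G \<and> (\<forall>v\<in>ell2 G. ell2_inner G w v = ell2_inner G (l2_at U) (?R v))"
    then obtain W' where W': "l2_on (carrier G) W'" "w = l2_at W'" by (blast elim: ell2E)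
    have "l2_at W' g = l2_at ?W g" for g
    proof (cases "g \<in> carrier G")
      case True
      then have "l2_at (l2_delta g) \<in> ell2 G" by (intro ell2_l2_at l2_on_delta)
      then have "ell2_inner G w (l2_at (l2_delta g)) = ell2_inner G (l2_at ?W) (l2_at (l2_delta g))"
        using adj w by metis
      then have "cinner W' (l2_delta g) = cinner ?W (l2_delta g)"
        unfolding W'(2) ell2_inner_l2_at[OF W'(1)] ell2_inner_l2_at[OF W] .
      then have "cnj (cinner (l2_delta g) W') = cnj (cinner (l2_delta g) ?W)"
        by (simp only: cinner_commute[symmetric])
      then show ?thesis by (simp only: cinner_l2_delta complex_cnj_cancel_iff)
    next
      case False
      then show ?thesis using W W'(1) by (simp add: l2_on_def)
    qed
    then show "w = l2_at ?W" unfolding W'(2) by blast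
  qed
qed

text \<open>The entry at \<open>(1, g)\<close> a priori involves the solution for \<open>g\<close>.
  By \<open>res_pair_cinner\<close> it is the conjugate of a value of the single solution
  \<open>B\<close> for the unit, so one norm estimate controls all entries together.\<close>

lemma Im_resolvent_approx:
  assumes "0 < \<eta>" "\<eta> \<le> 1"
  obtains B where "\<And>g. g \<in> carrier G \<Longrightarrow> Im_resolvent G p (Complex E \<eta>) \<one> g = cnj (l2_at B g)"
    "Im (l2_at B \<one>) = 0"
    "\<And>n. norm (L.lop (ga_pois G R p E \<eta> n) (l2_delta \<one>) - B) \<le> 2 * tail_err R \<eta> n"
proof -
  let ?R = "ell2_resolvent G (left_regular_ga G p) (Complex E \<eta>)"
  have ImR: "Im_resolvent G p (Complex E \<eta>) h g = l2_at B h"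
    if "g \<in> carrier G" "h \<in> carrier G" "L.res_pair E \<eta> (l2_delta g) A B" "l2_on (carrier G) A" "l2_on (carrier G) B" for g h A B
  proof -
    have g: "l2_on (carrier G) (l2_delta g)" "l2_on (carrier G) (l2_delta h)"
      using that by (auto intro: l2_on_delta)
    have Y: "l2_on (carrier G) (A + cscale \<i> B)" using that by (auto simp: l2_on_def)
    have "?R (l2_at (l2_delta g)) = l2_at (A + cscale \<i> B)"
      by (rule ell2_resolvent_eqI) (use assms(1) Y res_pair_cscale(1)[OF that(3)] in auto)
    then have "ell2_Im G ?R (ell2_delta g) = l2_at B"
      unfolding ell2_Im_def ell2_delta_l2_at ell2_adjoint_resolvent[OF assms g(1) that(3-5)] by auto
    then show ?thesis
      unfolding Im_resolvent_def ell2_coeff_def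
      by (simp only: ell2_delta_l2_at ell2_inner_l2_at[OF g(2)] cinner_l2_delta)
  qed
  obtain A B where AB: "L.res_pair E \<eta> (l2_delta \<one>) A B" "l2_on (carrier G) A" "l2_on (carrier G) B"
    "\<And>n. norm (L.lop (ga_pois G R p E \<eta> n) (l2_delta \<one>) - B) \<le> 2 * tail_err R \<eta> n * norm (l2_delta \<one> :: 'g l2)"
    by (rule L.res_pair_exists[OF assms l2_on_delta[OF one_closed], of E]) (rule that)
  have "Im_resolvent G p (Complex E \<eta>) \<one> g = cnj (l2_at B g)" if "g \<in> carrier G" for g
  proof -
    obtain A' B' where AB': "L.res_pair E \<eta> (l2_delta g) A' B'" "l2_on (carrier G) A'" "l2_on (carrier G) B'"
      by (rule L.res_pair_exists[OF assms l2_on_delta[OF \<open>g \<in> carrier G\<close>], of E]) (rule that)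
    have "Im_resolvent G p (Complex E \<eta>) \<one> g = cinner (l2_delta \<one>) B'"
      using ImR[OF \<open>g \<in> carrier G\<close> one_closed AB'] by (simp only: cinner_l2_delta)
    also have "\<dots> = cinner B (l2_delta g)"
      by (rule L.res_pair_cinner[OF AB(1) AB'(1), symmetric])
    also have "\<dots> = cnj (l2_at B g)"
      by (subst cinner_commute) (simp only: cinner_l2_delta)
    finally show ?thesis .
  qed
  moreover have "l2_at B \<one> = cnj (l2_at B \<one>)"
    using L.res_pair_cinner[OF AB(1) AB(1)] cinner_commute[of B "l2_delta \<one>"] by (simp only: cinner_l2_delta)
  then have "Im (l2_at B \<one>) = 0"
    by (simp add: complex_eq_iff)
  ultimately show ?thesis using that AB(4) by simp
qed

end

section \<open>Eigenbases of permutation representations\<close>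

text \<open>Complex linearity, needed because coordinates in an eigenbasis are complex; the
  predicate \<open>linear\<close> covers real scalars only.\<close>

definition clin :: "('a l2 \<Rightarrow> 'b l2) \<Rightarrow> bool" where
  "clin A \<longleftrightarrow> (\<forall>f g. A (f + g) = A f + A g) \<and> (\<forall>c f. A (cscale c f) = cscale c (A f))"

lemma clin_sum: "clin A \<Longrightarrow> A (sum f I) = (\<Sum>i\<in>I. A (f i))"
proof -
  assume A: "clin A"
  have z: "cscale 0 f = 0" for f :: "'x l2" by (rule l2_eqI) simp
  have "A (cscale 0 0) = cscale 0 (A 0)" using A by (simp add: clin_def)
  then have "A 0 = 0" by (simp only: z)
  with A show ?thesis
    by (induction I rule: infinite_finite_induct) (auto simp: clin_def)
qed

lemma clin_cscale: "clin A \<Longrightarrow> A (cscale c f) = cscale c (A f)"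
  by (simp add: clin_def)

lemma clin_compose: "clin A \<Longrightarrow> clin B \<Longrightarrow> clin (\<lambda>f. A (B f))"
  by (simp add: clin_def)

lemma (in gact) clin_lop: "ks q \<subseteq> carrier G \<Longrightarrow> clin (lop q)"
  by (simp add: clin_def lop_right_add lop_right_cscale)

lemma cinner_finite:
  fixes N :: nat
  assumes "l2_on {0..<N} f"
  shows "cinner f g = (\<Sum>x<N. cnj (l2_at f x) * l2_at g x)"
proof -
  have "cinner f g = (\<Sum>\<^sub>\<infinity>x\<in>{..<N}. cnj (l2_at f x) * l2_at g x)"
    unfolding cinner_def by (rule infsum_cong_neutral) (use assms in \<open>auto simp: l2_on_def\<close>)
  then show ?thesis by (simp only: infsum_finite finite_lessThan)
qed

lemma norm_sq_finite:
  fixes N :: nat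
  assumes "l2_on {0..<N} f"
  shows "(norm f)\<^sup>2 = (\<Sum>x<N. (cmod (l2_at f x))\<^sup>2)"
proof -
  have "(norm f)\<^sup>2 = (\<Sum>\<^sub>\<infinity>x\<in>{..<N}. (cmod (l2_at f x))\<^sup>2)"
    unfolding l2_norm_sq by (rule infsum_cong_neutral) (use assms in \<open>auto simp: l2_on_def\<close>)
  then show ?thesis by (simp only: infsum_finite finite_lessThan)
qed

lemma cinner_sum_sum: "cinner (sum f I) (sum g J) = (\<Sum>i\<in>I. \<Sum>j\<in>J. cinner (f i) (g j))"
  unfolding cinner_sum_left by (simp only: cinner_sum_right)

locale onb =
  fixes N :: nat and e :: "nat \<Rightarrow> nat l2"
  assumes e_on: "j < N \<Longrightarrow> l2_on {0..<N} (e j)"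
    and e_orth: "j < N \<Longrightarrow> k < N \<Longrightarrow> cinner (e j) (e k) = (if j = k then 1 else 0)"
begin

text \<open>Orthonormality says that the conjugate transpose is a left inverse of the matrix of the
  family; for a square matrix it is then a right inverse, which is completeness.\<close>

lemma complete:
  assumes "x < N" "y < N"
  shows "(\<Sum>j<N. l2_at (e j) x * cnj (l2_at (e j) y)) = (if x = y then 1 else 0)"
proof -
  define U where "U = mat N N (\<lambda>(x, j). l2_at (e j) x)"
  define V where "V = mat N N (\<lambda>(j, x). cnj (l2_at (e j) x))"
  have UV: "U \<in> carrier_mat N N" "V \<in> carrier_mat N N"
    unfolding U_def V_def by (rule mat_carrier)+
  have "V * U = 1\<^sub>m N"
  proof (rule eq_matI)
    fix j k assume jk': "j < dim_row (1\<^sub>m N)" "k < dim_col (1\<^sub>m N)"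
    have jk: "j < N" "k < N" using jk' by (simp_all only: index_one_mat)
    have "(V * U) $$ (j, k) = (\<Sum>x<N. cnj (l2_at (e j) x) * l2_at (e k) x)"
      using jk by (simp add: U_def V_def scalar_prod_def atLeast0LessThan)
    also have "\<dots> = cinner (e j) (e k)"
      by (rule cinner_finite[symmetric], rule e_on, fact)
    finally show "(V * U) $$ (j, k) = 1\<^sub>m N $$ (j, k)"
      using jk by (simp add: e_orth)
  qed (use UV in simp_all)
  then have "U * V = 1\<^sub>m N"
    by (rule mat_mult_left_right_inverse[OF UV(2,1)])
  then have "(U * V) $$ (x, y) = 1\<^sub>m N $$ (x, y)" by simp
  then show ?thesis
    using assms by (simp add: U_def V_def scalar_prod_def atLeast0LessThan)
qed

lemma expand:
  assumes "l2_on {0..<N} f"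
  shows "f = (\<Sum>j<N. cscale (cinner (e j) f) (e j))"
proof (rule l2_eqI)
  fix x
  show "l2_at f x = l2_at (\<Sum>j<N. cscale (cinner (e j) f) (e j)) x"
  proof (cases "x < N")
    case True
    have "l2_at (\<Sum>j<N. cscale (cinner (e j) f) (e j)) x =
        (\<Sum>j<N. \<Sum>y<N. cnj (l2_at (e j) y) * l2_at f y * l2_at (e j) x)"
      by (simp add: cinner_finite[OF e_on] sum_distrib_right)
    also have "\<dots> = (\<Sum>y<N. \<Sum>j<N. cnj (l2_at (e j) y) * l2_at f y * l2_at (e j) x)"
      by (rule sum.swap)
    also have "\<dots> = (\<Sum>y<N. l2_at f y * (\<Sum>j<N. l2_at (e j) x * cnj (l2_at (e j) y)))"
      unfolding sum_distrib_left by (intro sum.cong refl) (simp add: mult_ac)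
    also have "\<dots> = (\<Sum>y<N. if x = y then l2_at f y else 0)"
      using True by (intro sum.cong refl) (simp add: complete)
    also have "\<dots> = l2_at f x"
      using True by simp
    finally show ?thesis ..
  next
    case False
    then show ?thesis
      using assms e_on by (auto simp: l2_on_def intro!: sum.neutral)
  qed
qed

text \<open>Basis independence of the trace of \<open>A* B\<close>. It links the eigenbasis, where
  the polynomial is diagonal, with the points, where the action can be compared with the
  group.\<close>

lemma trace_basis:
  assumes A: "clin A" and B: "clin B"
  shows "(\<Sum>x<N. cinner (A (l2_delta x)) (B (l2_delta x))) = (\<Sum>j<N. cinner (A (e j)) (B (e j)))"
proof -
  have d: "l2_delta x = (\<Sum>j<N. cscale (cnj (l2_at (e j) x)) (e j))" if "x < N" for x
  proof -
    have "cinner (e j) (l2_delta x) = cnj (l2_at (e j) x)" for j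
      by (subst cinner_commute) (simp add: cinner_l2_delta)
    then show ?thesis
      using expand[OF l2_on_delta[of x "{0..<N}"]] that by simp
  qed
  have ex: "C (l2_delta x) = (\<Sum>j<N. cscale (cnj (l2_at (e j) x)) (C (e j)))" if "clin C" "x < N"
    for C :: "nat l2 \<Rightarrow> 'x l2" and x
    by (subst d[OF that(2)]) (simp add: clin_sum[OF that(1)] clin_cscale[OF that(1)])
  have "(\<Sum>x<N. cinner (A (l2_delta x)) (B (l2_delta x))) =
      (\<Sum>x<N. \<Sum>j<N. \<Sum>k<N. l2_at (e j) x * cnj (l2_at (e k) x) * cinner (A (e j)) (B (e k)))"
    by (intro sum.cong refl)
      (simp only: ex[OF A] ex[OF B] lessThan_iff cinner_sum_sum cinner_cscale_left cinner_cscale_right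
        complex_cnj_cnj mult.assoc, intro sum.cong refl, simp only: mult_ac)
  also have "\<dots> = (\<Sum>j<N. \<Sum>x<N. \<Sum>k<N. l2_at (e j) x * cnj (l2_at (e k) x) * cinner (A (e j)) (B (e k)))"
    by (rule sum.swap)
  also have "\<dots> = (\<Sum>j<N. \<Sum>k<N. \<Sum>x<N. l2_at (e j) x * cnj (l2_at (e k) x) * cinner (A (e j)) (B (e k)))"
    by (intro sum.cong refl sum.swap)
  also have "\<dots> = (\<Sum>j<N. \<Sum>k<N. cinner (e k) (e j) * cinner (A (e j)) (B (e k)))"
  proof (intro sum.cong refl)
    fix j k assume "k \<in> {..<N}"
    then have "cinner (e k) (e j) = (\<Sum>x<N. cnj (l2_at (e k) x) * l2_at (e j) x)"
      by (intro cinner_finite e_on) simp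
    then show "(\<Sum>x<N. l2_at (e j) x * cnj (l2_at (e k) x) * cinner (A (e j)) (B (e k))) =
        cinner (e k) (e j) * cinner (A (e j)) (B (e k))"
      unfolding sum_distrib_right[symmetric] by (simp only: mult.commute[of "cnj _"])
  qed
  also have "\<dots> = (\<Sum>j<N. \<Sum>k<N. if k = j then cinner (A (e j)) (B (e k)) else 0)"
    by (intro sum.cong refl) (simp add: e_orth)
  also have "\<dots> = (\<Sum>j<N. cinner (A (e j)) (B (e j)))"
    by (intro sum.cong refl) simp
  finally show ?thesis .
qed

lemma hs_basis:
  assumes A: "clin A"
  shows "(\<Sum>x<N. (norm (A (l2_delta x)))\<^sup>2) = (\<Sum>j<N. (norm (A (e j)))\<^sup>2)"
proof -
  have "of_real ((norm f)\<^sup>2) = cinner f f" for f :: "'a l2"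
    by (simp only: cinner_self l2_norm_sq)
  then have "complex_of_real (\<Sum>x<N. (norm (A (l2_delta x)))\<^sup>2) = of_real (\<Sum>j<N. (norm (A (e j)))\<^sup>2)"
    using trace_basis[OF A A] by (simp only: of_real_sum)
  then show ?thesis by (simp only: of_real_eq_iff)
qed

lemma cinner_expand:
  assumes "clin B" "l2_on {0..<N} w"
  shows "cinner w (B w) = (\<Sum>j<N. cinner (e j) w * cinner w (B (e j)))"
  by (subst (2) expand[OF assms(2)])
    (simp add: clin_sum[OF assms(1)] clin_cscale[OF assms(1)] cinner_sum_right cinner_cscale_right)

lemma parseval:
  assumes "l2_on {0..<N} w"
  shows "(norm w)\<^sup>2 = (\<Sum>j<N. (cmod (cinner (e j) w))\<^sup>2)"
proof -
  have "of_real ((norm w)\<^sup>2) = cinner w w"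
    by (simp only: cinner_self l2_norm_sq)
  also have "\<dots> = (\<Sum>j<N. cinner (e j) w * cinner w (e j))"
    by (rule cinner_expand[OF _ assms]) (simp add: clin_def)
  also have "\<dots> = (\<Sum>j<N. of_real ((cmod (cinner (e j) w))\<^sup>2))"
    by (intro sum.cong refl) (simp only: cinner_commute[of w] complex_norm_square)
  finally show ?thesis
    by (simp only: of_real_sum[symmetric] of_real_eq_iff)
qed

end

section \<open>Transfer between matrices and operators on square-summable functions\<close>

definition vl :: "nat \<Rightarrow> complex vec \<Rightarrow> nat l2" where
  "vl N v = Abs_l2 (\<lambda>x. if x < N then v $ x else 0)"

lemma vl_at [simp]: "l2_at (vl N v) x = (if x < N then v $ x else 0)"
  unfolding vl_def by (rule Abs_l2_at, rule finite_support_sq_summable[of "{..<N}"]) auto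

lemma vl_on: "l2_on {0..<N} (vl N v)"
  by (simp add: l2_on_def)

lemma cv_inner_vl: "u \<in> carrier_vec N \<Longrightarrow> v \<in> carrier_vec N \<Longrightarrow> cv_inner u v = cinner (vl N u) (vl N v)"
  by (simp add: cinner_finite[OF vl_on] cv_inner_def scalar_prod_def atLeast0LessThan mult.commute)

lemma cv_norm_vl: "v \<in> carrier_vec N \<Longrightarrow> cv_norm v = norm (vl N v)"
  by (simp add: cv_norm_def cv_inner_vl norm_eq_sqrt_inner inner_l2_def)

lemma vl_vec: "l2_on {0..<N} f \<Longrightarrow> vl N (vec N (l2_at f)) = f"
  by (rule l2_eqI) (auto simp: l2_on_def)

definition mop :: "nat \<Rightarrow> complex mat \<Rightarrow> nat l2 \<Rightarrow> nat l2" where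
  "mop N M f = Abs_l2 (\<lambda>x. if x < N then \<Sum>y<N. M $$ (x, y) * l2_at f y else 0)"

lemma mop_at [simp]: "l2_at (mop N M f) x = (if x < N then \<Sum>y<N. M $$ (x, y) * l2_at f y else 0)"
  unfolding mop_def by (rule Abs_l2_at, rule finite_support_sq_summable[of "{..<N}"]) auto

lemma mop_on: "l2_on {0..<N} (mop N M f)"
  by (simp add: l2_on_def)

lemma clin_mop: "clin (mop N M)"
  by (auto simp: clin_def distrib_left sum.distrib sum_distrib_left mult_ac intro!: l2_eqI)

lemma vl_mult_mat_vec:
  "M \<in> carrier_mat N N \<Longrightarrow> v \<in> carrier_vec N \<Longrightarrow> vl N (M *\<^sub>v v) = mop N M (vl N v)"
  by (rule l2_eqI) (auto simp: scalar_prod_def atLeast0LessThan)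

lemma mop_delta: "y < N \<Longrightarrow> x < N \<Longrightarrow> l2_at (mop N M (l2_delta y)) x = M $$ (x, y)"
  by (simp add: if_distrib cong: if_cong)

lemma group_action_gact:
  assumes "group G" "group_action G X act"
  shows "gact G X act"
proof -
  interpret group G by fact
  interpret A: group_action G X act by fact
  show ?thesis
  proof
    show "act \<one>\<^bsub>G\<^esub> x = x" if "x \<in> X" for x
      using that by (simp flip: A.id_eq_one)
    show "act g x \<in> X" if "g \<in> carrier G" "x \<in> X" for g x
      by (rule A.element_image[OF that refl])
    show "act (g \<otimes>\<^bsub>G\<^esub> h) x = act g (act h x)" if "g \<in> carrier G" "h \<in> carrier G" "x \<in> X" for g h x
      by (rule A.composition_rule[OF that(3,1,2)])
  qed
qed

lemma perm_rep_ga_vl: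
  assumes act: "gact G {0..<N} act" and q: "ks q \<subseteq> carrier G"
  shows "mop N (perm_rep_ga N act q) f = gact.lop G {0..<N} act q f"
proof (rule l2_eqI)
  interpret gact G "{0..<N}" act by fact
  fix x
  show "l2_at (mop N (perm_rep_ga N act q) f) x = l2_at (lop q f) x"
  proof (cases "x < N")
    case True
    have "l2_at (mop N (perm_rep_ga N act q) f) x =
        (\<Sum>y<N. \<Sum>g\<in>ks q. lk q g * (if x = act g y then 1 else 0) * l2_at f y)"
      using True by (simp add: perm_rep_ga_def perm_mat_def sum_distrib_right)
    also have "\<dots> = (\<Sum>g\<in>ks q. \<Sum>y<N. lk q g * (if x = act g y then 1 else 0) * l2_at f y)"
      by (rule sum.swap)
    also have "\<dots> = (\<Sum>g\<in>ks q. lk q g * l2_at f (act (inv\<^bsub>G\<^esub> g) x))"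
    proof (intro sum.cong refl)
      fix g assume "g \<in> ks q"
      then have g: "g \<in> carrier G" using q by auto
      then have a: "act (inv\<^bsub>G\<^esub> g) x < N"
        using act_closed[of "inv\<^bsub>G\<^esub> g" x] True by auto
      have "(\<Sum>y<N. lk q g * (if x = act g y then 1 else 0) * l2_at f y) =
          (\<Sum>y<N. if y = act (inv\<^bsub>G\<^esub> g) x then lk q g * l2_at f y else 0)"
      proof (intro sum.cong refl)
        fix y assume "y \<in> {..<N}"
        then have "x = act g y \<longleftrightarrow> y = act (inv\<^bsub>G\<^esub> g) x"
          using act_eq_iff[OF g, of y x] True by auto
        then show "lk q g * (if x = act g y then 1 else 0) * l2_at f y =
            (if y = act (inv\<^bsub>G\<^esub> g) x then lk q g * l2_at f y else 0)"
          by simp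
      qed
      also have "\<dots> = lk q g * l2_at f (act (inv\<^bsub>G\<^esub> g) x)"
        using a by (simp add: sum.delta)
      finally show "(\<Sum>y<N. lk q g * (if x = act g y then 1 else 0) * l2_at f y) =
          lk q g * l2_at f (act (inv\<^bsub>G\<^esub> g) x)" .
    qed
    finally show ?thesis
      using True by (simp add: lop_at[OF q])
  next
    case False
    then show ?thesis by (simp add: lop_at[OF q])
  qed
qed

definition poisson :: "real \<Rightarrow> real \<Rightarrow> real \<Rightarrow> real" where
  "poisson E \<eta> x = \<eta> / ((x - E)\<^sup>2 + \<eta>\<^sup>2)"

definition pois_poly :: "real \<Rightarrow> real \<Rightarrow> real \<Rightarrow> nat \<Rightarrow> real \<Rightarrow> real" where
  "pois_poly R E \<eta> n x =
    (\<Sum>k<n. pois_coef R E \<eta> k * cheb (\<lambda>y. (1 / R) *\<^sub>R (x * y)) 1 k) + tail_err R \<eta> n"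

text \<open>This is \<open>poisson_series\<close> for multiplication by \<open>x\<close> on the real
  line: eliminating \<open>A\<close> shows that \<open>B\<close> is the Poisson kernel at
  \<open>x\<close>. The added constant puts the polynomial above the kernel.\<close>

lemma pois_poly_bounds:
  assumes "R \<ge> 1" "0 < \<eta>" "\<eta> \<le> 1" "\<bar>x\<bar> \<le> R"
  shows "poisson E \<eta> x \<le> pois_poly R E \<eta> n x" "pois_poly R E \<eta> n x \<le> poisson E \<eta> x + 2 * tail_err R \<eta> n"
proof -
  have "\<bar>x * y\<bar> \<le> R * \<bar>y\<bar>" for y
    unfolding abs_mult by (rule mult_right_mono) (use assms in auto)
  then obtain A B where AB: "x * A - E * A + \<eta> * B = 1" "x * B - E * B = \<eta> * A"
    "\<And>n. norm (B - (\<Sum>k<n. pois_coef R E \<eta> k *\<^sub>R cheb (\<lambda>y. (1 / R) *\<^sub>R (x * y)) 1 k)) \<le> tail_err R \<eta> n * norm (1::real)"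
    using poisson_series[of "\<lambda>y. x * y" R \<eta> E "1::real"] assms
    by (auto simp: linear_times)
  have "\<eta> * 1 = (x - E) * (\<eta> * A) + \<eta>\<^sup>2 * B"
    unfolding AB(1)[symmetric] by (simp add: algebra_simps power2_eq_square)
  also have "\<dots> = ((x - E)\<^sup>2 + \<eta>\<^sup>2) * B"
    unfolding AB(2)[symmetric] by (simp add: algebra_simps power2_eq_square)
  finally have "\<eta> = ((x - E)\<^sup>2 + \<eta>\<^sup>2) * B" by simp
  moreover have "(x - E)\<^sup>2 + \<eta>\<^sup>2 \<noteq> 0"
    using assms(2) by (metis add_pos_pos less_irrefl sum_power2_gt_zero_iff)
  ultimately have "B = poisson E \<eta> x"
    unfolding poisson_def by (metis nonzero_mult_div_cancel_left)
  then show "poisson E \<eta> x \<le> pois_poly R E \<eta> n x" "pois_poly R E \<eta> n x \<le> poisson E \<eta> x + 2 * tail_err R \<eta> n"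
    using AB(3)[of n] by (auto simp: pois_poly_def abs_le_iff)
qed

lemma poisson_pos: "\<eta> > 0 \<Longrightarrow> 0 < poisson E \<eta> x"
  unfolding poisson_def by (intro divide_pos_pos add_nonneg_pos) auto

section \<open>A permutation representation with an eigenbasis\<close>

locale perm_rep = cayley_sa G S p R
  for G :: "('g, 'm) monoid_scheme" (structure) and S p R +
  fixes N :: nat and act :: "'g \<Rightarrow> nat \<Rightarrow> nat" and \<phi> :: "nat \<Rightarrow> complex vec"
  assumes N0: "N > 0" and action: "group_action G {0..<N} act"
    and eigenbasis: "orthonormal_eigenbasis N (perm_rep_ga N act p) \<phi>"

sublocale perm_rep \<subseteq> F: gact_sa G "{0..<N}" act p R
proof -
  interpret gact G "{0..<N}" act
    by (rule group_action_gact[OF is_group action])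
  show "gact_sa G {0..<N} act p R"
    by unfold_locales (rule p_carrier p_star R1 pR)+
qed

context perm_rep
begin

definition ev :: "nat \<Rightarrow> nat l2" where
  "ev j = vl N (\<phi> j)"

lemma \<phi>_carrier: "j < N \<Longrightarrow> \<phi> j \<in> carrier_vec N"
  using eigenbasis by (simp add: orthonormal_eigenbasis_def)

sublocale onb N ev
proof
  fix j k assume jk: "j < N" "k < N"
  then have "cv_inner (\<phi> j) (\<phi> k) = (if j = k then 1 else 0)"
    using eigenbasis by (simp add: orthonormal_eigenbasis_def)
  then show "cinner (ev j) (ev k) = (if j = k then 1 else 0)"
    unfolding ev_def cv_inner_vl[OF \<phi>_carrier[OF jk(1)] \<phi>_carrier[OF jk(2)]] .
qed (simp add: ev_def vl_on)

lemma norm_ev: "j < N \<Longrightarrow> norm (ev j) = 1"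
  using e_orth[of j j] by (simp add: norm_eq_sqrt_inner inner_l2_def)

definition lam :: "nat \<Rightarrow> real" where
  "lam j = Re (eigenvalue_of (perm_rep_ga N act p) (\<phi> j))"

lemma eigen:
  assumes j: "j < N"
  shows "eigenvalue_of (perm_rep_ga N act p) (\<phi> j) = of_real (lam j)" "F.lop p (ev j) = lam j *\<^sub>R ev j"
    "\<bar>lam j\<bar> \<le> R"
proof -
  let ?M = "perm_rep_ga N act p"
  obtain \<mu> where \<mu>: "eigenvector ?M (\<phi> j) \<mu>"
    using eigenbasis j by (auto simp: orthonormal_eigenbasis_def)
  have M: "?M \<in> carrier_mat N N" by (simp add: perm_rep_ga_def)
  have key: "F.lop p (ev j) = cscale \<nu> (ev j)" if "eigenvector ?M (\<phi> j) \<nu>" for \<nu>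
  proof -
    have "?M *\<^sub>v \<phi> j = \<nu> \<cdot>\<^sub>v \<phi> j" using that by (simp add: eigenvector_def)
    then have "vl N (?M *\<^sub>v \<phi> j) = vl N (\<nu> \<cdot>\<^sub>v \<phi> j)" by simp
    also have "\<dots> = cscale \<nu> (ev j)"
      using \<phi>_carrier[OF j] by (intro l2_eqI) (auto simp: ev_def)
    finally show ?thesis
      using perm_rep_ga_vl[OF F.gact_axioms p_carrier, of "vl N (\<phi> j)"]
      by (simp add: vl_mult_mat_vec[OF M \<phi>_carrier[OF j]] ev_def)
  qed
  \<comment> \<open>An eigenvalue is recovered from its unit eigenvector, so the definite
    description in \<open>eigenvalue_of\<close> is well defined; symmetry of \<open>p\<close> then
    makes it real.\<close>
  have val: "\<nu> = cinner (ev j) (F.lop p (ev j))" if "eigenvector ?M (\<phi> j) \<nu>" for \<nu>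
    using key[OF that] e_orth[OF j j] by (simp add: cinner_cscale_right)
  have ev\<mu>: "eigenvalue_of ?M (\<phi> j) = \<mu>"
    unfolding eigenvalue_of_def
    by (rule the_equality, rule \<mu>, use val \<mu> in metis)
  have "cnj \<mu> = \<mu>"
    using val[OF \<mu>] F.cinner_lop_p[of "ev j" "ev j"] cinner_commute by metis
  then have "\<mu> = of_real (Re \<mu>)" by (simp add: complex_eq_iff)
  then show 1: "eigenvalue_of ?M (\<phi> j) = of_real (lam j)"
    unfolding lam_def ev\<mu> .
  then show 2: "F.lop p (ev j) = lam j *\<^sub>R ev j"
    using key[OF \<mu>] unfolding ev\<mu> by (simp add: cscale_of_real)
  show "\<bar>lam j\<bar> \<le> R"
    using F.norm_lop_p[of "ev j"] unfolding 2 by (simp add: norm_ev[OF j])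
qed

lemma spectral_indices_eq: "spectral_indices N (perm_rep_ga N act p) \<phi> J = {j. j < N \<and> lam j \<in> J}"
  unfolding spectral_indices_def using eigen(1) by auto

lemma lop_ga_pois_ev:
  assumes "j < N"
  shows "F.lop (ga_pois G R p E \<eta> n) (ev j) = pois_poly R E \<eta> n (lam j) *\<^sub>R ev j"
proof -
  have c: "F.pcheb (ev j) k = cheb (\<lambda>y. (1 / R) *\<^sub>R (lam j * y)) 1 k *\<^sub>R ev j" for k
  proof (induction k rule: induct_nat_012)
    case 1
    then show ?case by (simp add: eigen(2)[OF assms])
  next
    case (ge2 k)
    have "F.lop p (r *\<^sub>R ev j) = (r * lam j) *\<^sub>R ev j" for r
      using linear_scale[OF F.lop_linear[OF p_carrier], of r "ev j"] by (simp add: eigen(2)[OF assms])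
    then show ?case
      unfolding cheb.simps ge2 by (simp add: scaleR_diff_left mult_ac)
  qed simp
  show ?thesis
    unfolding F.lop_ga_pois[OF e_on[OF assms]] c pois_poly_def
    by (simp add: scaleR_add_left scaleR_sum_left)
qed

end

section \<open>The trace of two spectral windows\<close>

definition fl :: "nat \<Rightarrow> (nat \<Rightarrow> complex) \<Rightarrow> nat l2" where
  "fl N d = Abs_l2 (\<lambda>x. if x < N then d x else 0)"

lemma fl_at [simp]: "l2_at (fl N d) x = (if x < N then d x else 0)"
  unfolding fl_def by (rule Abs_l2_at, rule finite_support_sq_summable[of "{..<N}"]) auto

lemma fl_on: "l2_on {0..<N} (fl N d)"
  by (simp add: l2_on_def)

lemma norm_fl_le:
  assumes "0 \<le> c" "\<And>x. x < N \<Longrightarrow> cmod (d x) \<le> c"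
  shows "norm (fl N d) \<le> c * sqrt N"
proof -
  have "(norm (fl N d))\<^sup>2 = (\<Sum>x<N. (cmod (d x))\<^sup>2)"
    unfolding norm_sq_finite[OF fl_on] by simp
  also have "\<dots> \<le> (\<Sum>x<N. c\<^sup>2)"
    by (intro sum_mono power_mono) (use assms in auto)
  also have "\<dots> = (c * sqrt N)\<^sup>2"
    by (simp add: power_mult_distrib)
  finally show ?thesis
    using assms(1) by (simp add: power2_le_iff_abs_le)
qed

definition dm :: "nat \<Rightarrow> (nat \<Rightarrow> complex) \<Rightarrow> nat l2 \<Rightarrow> nat l2" where
  "dm N d f = Abs_l2 (\<lambda>x. if x < N then d x * l2_at f x else 0)"

lemma dm_at [simp]: "l2_at (dm N d f) x = (if x < N then d x * l2_at f x else 0)"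
  unfolding dm_def by (rule Abs_l2_at, rule finite_support_sq_summable[of "{..<N}"]) auto

lemma clin_dm: "clin (dm N d)"
  by (auto simp: clin_def distrib_left mult_ac intro!: l2_eqI)

lemma norm_dm_le:
  assumes "0 \<le> c" "\<And>x. x < N \<Longrightarrow> cmod (d x) \<le> c"
  shows "norm (dm N d f) \<le> c * norm f"
proof (rule l2_norm_leI)
  show "0 \<le> c * norm f" using assms by simp
  fix A :: "nat set" assume A: "finite A"
  have "(\<Sum>x\<in>A. (cmod (l2_at (dm N d f) x))\<^sup>2) \<le> (\<Sum>x\<in>A. c\<^sup>2 * (cmod (l2_at f x))\<^sup>2)"
  proof (rule sum_mono)
    fix x
    have "cmod (l2_at (dm N d f) x) \<le> c * cmod (l2_at f x)"
      using assms(2)[of x] assms(1) by (auto simp: norm_mult intro!: mult_right_mono)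
    then have "(cmod (l2_at (dm N d f) x))\<^sup>2 \<le> (c * cmod (l2_at f x))\<^sup>2"
      by (rule power_mono) simp
    then show "(cmod (l2_at (dm N d f) x))\<^sup>2 \<le> c\<^sup>2 * (cmod (l2_at f x))\<^sup>2"
      by (simp only: power_mult_distrib)
  qed
  also have "\<dots> \<le> c\<^sup>2 * (norm f)\<^sup>2"
    unfolding sum_distrib_left[symmetric] by (intro mult_left_mono l2_finite_sum_le A) auto
  finally show "(\<Sum>x\<in>A. (cmod (l2_at (dm N d f) x))\<^sup>2) \<le> (c * norm f)\<^sup>2"
    by (simp only: power_mult_distrib)
qed

lemma sum_reindex_le:
  fixes f :: "'b \<Rightarrow> real"
  assumes "finite A" "finite B" "inj_on h A" "\<And>x. 0 \<le> f x" "\<And>x. x \<notin> B \<Longrightarrow> f x = 0"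
  shows "(\<Sum>x\<in>A. f (h x)) \<le> sum f B"
proof -
  have "(\<Sum>x\<in>A. f (h x)) = sum f (h ` A)"
    using sum.reindex[OF assms(3), of f] by simp
  also have "\<dots> \<le> sum f (h ` A \<union> B)"
    by (rule sum_mono2) (use assms in auto)
  also have "\<dots> = sum f B"
    by (rule sum.mono_neutral_right) (use assms in auto)
  finally show ?thesis .
qed

section \<open>The cross symbol and its norms\<close>

context cayley
begin

lemma sum_sq_lookup:
  assumes "ks q \<subseteq> carrier G"
  shows "(\<Sum>g\<in>ks q. (cmod (lk q g))\<^sup>2) \<le> (norm (L.lop q (l2_delta \<one>)))\<^sup>2"
proof -
  have "(\<Sum>g\<in>ks q. (cmod (lk q g))\<^sup>2) = (\<Sum>g\<in>ks q. (cmod (l2_at (L.lop q (l2_delta \<one>)) g))\<^sup>2)"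
    by (intro sum.cong refl) (simp only: lop_delta_one[OF assms subsetD[OF assms]])
  also have "\<dots> \<le> (norm (L.lop q (l2_delta \<one>)))\<^sup>2"
    by (rule l2_finite_sum_le) simp
  finally show ?thesis .
qed

text \<open>The group element through which the trace of two operators conjugated by \<open>t\<close> and \<open>s\<close> acts.\<close>

definition cross :: "('g \<Rightarrow>\<^sub>0 complex) \<Rightarrow> ('g \<Rightarrow>\<^sub>0 complex) \<Rightarrow> 'g \<Rightarrow> 'g \<Rightarrow> ('g \<Rightarrow>\<^sub>0 complex)" where
  "cross q1 q2 t s = (\<Sum>g\<in>ks q1. Poly_Mapping.single g (cnj (lk q1 g) * lk q2 (t \<otimes> g \<otimes> inv s)))"

lemma lookup_cross: "lk (cross q1 q2 t s) g = cnj (lk q1 g) * lk q2 (t \<otimes> g \<otimes> inv s)"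
proof -
  have "lk (cross q1 q2 t s) g =
      (\<Sum>h\<in>ks q1. if h = g then cnj (lk q1 h) * lk q2 (t \<otimes> h \<otimes> inv s) else 0)"
    unfolding cross_def lookup_sum lookup_single when_def by (intro sum.cong) auto
  also have "\<dots> = (if g \<in> ks q1 then cnj (lk q1 g) * lk q2 (t \<otimes> g \<otimes> inv s) else 0)"
    by (rule sum.delta) simp
  finally show ?thesis by (simp add: lk_not_in_ks)
qed

lemma keys_cross: "ks (cross q1 q2 t s) \<subseteq> ks q1"
  by (auto simp: in_keys_iff lookup_cross)

lemma inj_conj: "t \<in> carrier G \<Longrightarrow> s \<in> carrier G \<Longrightarrow> A \<subseteq> carrier G \<Longrightarrow> inj_on (\<lambda>g. t \<otimes> g \<otimes> inv s) A"
  by (rule inj_onI) (auto simp: subset_iff)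

text \<open>Cauchy--Schwarz, since the coefficients are products of one coefficient of
  \<open>q1\<close> and one of \<open>q2\<close> along an injective reindexing; the column at the
  unit bounds the square sums.\<close>

lemma cross_norm1:
  assumes "ks q1 \<subseteq> carrier G" "ks q2 \<subseteq> carrier G" "t \<in> carrier G" "s \<in> carrier G"
    and M: "norm (L.lop q1 (l2_delta \<one>)) \<le> M" "norm (L.lop q2 (l2_delta \<one>)) \<le> M"
  shows "(\<Sum>g\<in>ks q1. cmod (lk (cross q1 q2 t s) g)) \<le> M\<^sup>2"
proof -
  have M0: "0 \<le> M" using M(1) norm_ge_zero order.trans by blast
  have m: "(\<Sum>g\<in>ks q. (cmod (lk q g))\<^sup>2) \<le> M\<^sup>2"
    if "ks q \<subseteq> carrier G" "norm (L.lop q (l2_delta \<one>)) \<le> M" for q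
    using sum_sq_lookup[OF that(1)] power_mono[OF that(2), of 2] by simp
  have "(\<Sum>g\<in>ks q1. cmod (lk (cross q1 q2 t s) g)) =
      (\<Sum>g\<in>ks q1. \<bar>cmod (lk q1 g)\<bar> * \<bar>cmod (lk q2 (t \<otimes> g \<otimes> inv s))\<bar>)"
    by (simp add: lookup_cross norm_mult)
  also have "\<dots> \<le> L2_set (\<lambda>g. cmod (lk q1 g)) (ks q1) * L2_set (\<lambda>g. cmod (lk q2 (t \<otimes> g \<otimes> inv s))) (ks q1)"
    by (rule L2_set_mult_ineq)
  also have "\<dots> \<le> M * M"
  proof (rule mult_mono)
    show "L2_set (\<lambda>g. cmod (lk q1 g)) (ks q1) \<le> M"
      unfolding L2_set_def using m[OF assms(1) M(1)] M0 by (simp add: real_le_lsqrt)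
    have "(\<Sum>g\<in>ks q1. (cmod (lk q2 (t \<otimes> g \<otimes> inv s)))\<^sup>2) \<le> (\<Sum>g\<in>ks q2. (cmod (lk q2 g))\<^sup>2)"
      by (rule sum_reindex_le[where f = "\<lambda>g. (cmod (lk q2 g))\<^sup>2"])
        (use assms inj_conj in \<open>auto simp: lk_not_in_ks\<close>)
    then have "(\<Sum>g\<in>ks q1. (cmod (lk q2 (t \<otimes> g \<otimes> inv s)))\<^sup>2) \<le> M\<^sup>2"
      using m[OF assms(2) M(2)] by linarith
    then show "L2_set (\<lambda>g. cmod (lk q2 (t \<otimes> g \<otimes> inv s))) (ks q1) \<le> M"
      unfolding L2_set_def using M0 by (simp add: real_le_lsqrt)
  qed (use M0 in auto)
  finally show ?thesis by (simp add: power2_eq_square)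
qed

definition wsum4 :: "real \<Rightarrow> ('g \<Rightarrow>\<^sub>0 complex) \<Rightarrow> real" where
  "wsum4 C q = (\<Sum>g\<in>ks q. wt g powr C * (cmod (lk q g)) ^ 4)"

lemma wt_ge_1: "1 \<le> wt g"
  by (simp add: wt_def)

text \<open>The inequality \<open>a^2 b^2 <= a^4 + b^4\<close> separates the two factors and
  produces the fourth powers of (R4). Passing from \<open>g\<close> to \<open>t g s^-1\<close>
  changes the length by at most \<open>2 * d\<close>, which costs the constant in front.\<close>

lemma cross_wsum:
  assumes "ks q1 \<subseteq> carrier G" "ks q2 \<subseteq> carrier G" "t \<in> carrier G" "s \<in> carrier G"
    and "wl t \<le> d" "wl s \<le> d" "0 \<le> C"
  shows "(\<Sum>g\<in>ks (cross q1 q2 t s). wt g powr C * (cmod (lk (cross q1 q2 t s) g))\<^sup>2) \<le>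
    (1 + 2 * real d) powr C * (wsum4 C q1 + wsum4 C q2)"
proof -
  let ?k = "\<lambda>g. t \<otimes> g \<otimes> inv s"
  let ?D = "(1 + 2 * real d) powr C"
  have D1: "?D \<ge> 1" using assms by (intro ge_one_powr_ge_zero) auto
  have wk: "wt g powr C \<le> ?D * wt (?k g) powr C" if g: "g \<in> carrier G" for g
  proof -
    have k: "?k g \<in> carrier G" using assms g by simp
    have "?k g \<otimes> s = t \<otimes> g"
      using assms g by (simp add: m_assoc)
    then have "inv t \<otimes> (?k g \<otimes> s) = g"
      using assms g by (simp add: m_assoc[symmetric])
    then have "wl g \<le> wl (inv t) + (wl (?k g) + wl s)"
      using wl_mult[of "inv t" "?k g \<otimes> s"] wl_mult[of "?k g" s] k assms by fastforce
    then have "wl g \<le> 2 * d + wl (?k g)"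
      using wl_inv[OF assms(3)] assms by simp
    then have "wt g \<le> 2 * real d + wt (?k g)"
      by (auto simp: wt_def)
    also have "\<dots> \<le> 2 * real d * wt (?k g) + wt (?k g)"
      using mult_left_mono[OF wt_ge_1[of "?k g"], of "2 * real d"] by simp
    also have "\<dots> = (1 + 2 * real d) * wt (?k g)"
      by (simp add: algebra_simps)
    finally have "wt g powr C \<le> ((1 + 2 * real d) * wt (?k g)) powr C"
      using assms wt_ge_1[of g] by (intro powr_mono2) auto
    then show ?thesis
      using wt_ge_1[of "?k g"] by (simp add: powr_mult)
  qed
  have "(\<Sum>g\<in>ks (cross q1 q2 t s). wt g powr C * (cmod (lk (cross q1 q2 t s) g))\<^sup>2) \<le>
      (\<Sum>g\<in>ks q1. wt g powr C * (cmod (lk (cross q1 q2 t s) g))\<^sup>2)"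
    by (rule sum_mono2) (use keys_cross in auto)
  also have "\<dots> \<le> (\<Sum>g\<in>ks q1. ?D * (wt g powr C * cmod (lk q1 g) ^ 4) +
      ?D * (wt (?k g) powr C * cmod (lk q2 (?k g)) ^ 4))"
  proof (rule sum_mono)
    fix g assume "g \<in> ks q1"
    then have g: "g \<in> carrier G" using assms by auto
    define a b where "a = cmod (lk q1 g)" and "b = cmod (lk q2 (?k g))"
    have "2 * (a\<^sup>2 * b\<^sup>2) \<le> a ^ 4 + b ^ 4"
      using sum_squares_bound[of "a\<^sup>2" "b\<^sup>2"] by (simp add: power_mult[symmetric] mult.assoc)
    moreover have "0 \<le> a\<^sup>2 * b\<^sup>2" by simp
    ultimately have ab: "a\<^sup>2 * b\<^sup>2 \<le> a ^ 4 + b ^ 4" by linarith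
    have "wt g powr C * (cmod (lk (cross q1 q2 t s) g))\<^sup>2 = wt g powr C * (a\<^sup>2 * b\<^sup>2)"
      by (simp add: lookup_cross norm_mult power_mult_distrib a_def b_def)
    also have "\<dots> \<le> wt g powr C * (a ^ 4 + b ^ 4)"
      by (rule mult_left_mono[OF ab]) simp
    also have "\<dots> = wt g powr C * a ^ 4 + wt g powr C * b ^ 4"
      by (rule distrib_left)
    also have "\<dots> \<le> ?D * (wt g powr C * a ^ 4) + ?D * wt (?k g) powr C * b ^ 4"
    proof (rule add_mono)
      show "wt g powr C * a ^ 4 \<le> ?D * (wt g powr C * a ^ 4)"
        using mult_right_mono[OF D1, of "wt g powr C * a ^ 4"] by (simp add: a_def)
      show "wt g powr C * b ^ 4 \<le> ?D * wt (?k g) powr C * b ^ 4"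
        by (rule mult_right_mono[OF wk[OF g]]) (simp add: b_def)
    qed
    finally show "wt g powr C * (cmod (lk (cross q1 q2 t s) g))\<^sup>2 \<le>
        ?D * (wt g powr C * cmod (lk q1 g) ^ 4) + ?D * (wt (?k g) powr C * cmod (lk q2 (?k g)) ^ 4)"
      by (simp add: a_def b_def mult.assoc)
  qed
  also have "\<dots> = ?D * wsum4 C q1 + ?D * (\<Sum>g\<in>ks q1. wt (?k g) powr C * cmod (lk q2 (?k g)) ^ 4)"
    by (simp add: sum.distrib sum_distrib_left wsum4_def)
  also have "\<dots> \<le> ?D * wsum4 C q1 + ?D * wsum4 C q2"
    unfolding wsum4_def
    by (intro add_left_mono mult_left_mono sum_reindex_le[where f = "\<lambda>g. wt g powr C * cmod (lk q2 g) ^ 4"])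
      (use assms inj_conj in \<open>auto simp: lk_not_in_ks\<close>)
  finally show ?thesis by (simp add: distrib_left)
qed

end

lemma pow4_add_le: "((a::real) + b) ^ 4 \<le> 8 * (a ^ 4 + b ^ 4)"
proof -
  have 1: "(u + v)\<^sup>2 \<le> 2 * (u\<^sup>2 + v\<^sup>2)" for u v :: real
    using sum_squares_bound[of u v] by (simp add: power2_sum)
  have "(a + b) ^ 4 = ((a + b)\<^sup>2)\<^sup>2" by simp
  also have "\<dots> \<le> (2 * (a\<^sup>2 + b\<^sup>2))\<^sup>2"
    by (rule power_mono[OF 1]) simp
  also have "\<dots> = 4 * (a\<^sup>2 + b\<^sup>2)\<^sup>2"
    by (simp only: power_mult_distrib) simp
  also have "\<dots> \<le> 4 * (2 * ((a\<^sup>2)\<^sup>2 + (b\<^sup>2)\<^sup>2))"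
    by (rule mult_left_mono[OF 1]) simp
  finally show ?thesis by simp
qed

context cayley_sa
begin

text \<open>Each coefficient is an entry of the imaginary part of the resolvent plus an error. The
  entries are controlled by (R4), except at the unit, where \<open>C0\<close> steps in; the error is
  small in square sum. The factor 8 comes from \<open>pow4_add_le\<close>.\<close>

lemma wsum4_ga_pois:
  assumes "0 < \<eta>" "\<eta> \<le> 1" "0 \<le> C" and d: "\<And>g. g \<in> ks p \<Longrightarrow> wl g \<le> d"
    and C0: "\<bar>Re (Im_resolvent G p (Complex E \<eta>) \<one> \<one>)\<bar> \<le> C0"
    and sm: "(\<lambda>g. \<eta>\<^sup>2 * real (wl g) powr C * cmod (Im_resolvent G p (Complex E \<eta>) \<one> g) ^ 4) summable_on carrier G"
    and C2: "(\<Sum>\<^sub>\<infinity>g\<in>carrier G. \<eta>\<^sup>2 * real (wl g) powr C * cmod (Im_resolvent G p (Complex E \<eta>) \<one> g) ^ 4) \<le> \<eta>\<^sup>2 * C2"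
  shows "wsum4 C (ga_pois G R p E \<eta> n) \<le>
    8 * (C0 ^ 4 + C2 + real (max 1 (n * d)) powr C * (2 * tail_err R \<eta> n) ^ 4)"
proof -
  define q where "q = ga_pois G R p E \<eta> n"
  have q: "ks q \<subseteq> carrier G" unfolding q_def by (rule carrier_ga_pois[OF p_carrier])
  have qd: "g \<in> ks q \<Longrightarrow> wl g \<le> n * d" for g
    using keys_ga_pois[OF p_carrier d, of R E \<eta> n] by (auto simp: q_def)
  obtain B where B: "\<And>g. g \<in> carrier G \<Longrightarrow> Im_resolvent G p (Complex E \<eta>) \<one> g = cnj (l2_at B g)"
    "Im (l2_at B \<one>) = 0" "norm (L.lop q (l2_delta \<one>) - B) \<le> 2 * tail_err R \<eta> n"
    unfolding q_def using Im_resolvent_approx[OF assms(1,2)] by metis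
  define b where "b = (\<lambda>g. cmod (l2_at B g))"
  define u where "u = (\<lambda>g. cmod (l2_at (L.lop q (l2_delta \<one>) - B) g))"
  have le: "cmod (lk q g) \<le> b g + u g" if "g \<in> ks q" for g
  proof -
    have "lk q g = l2_at B g + l2_at (L.lop q (l2_delta \<one>) - B) g"
      using lop_delta_one[OF q, of g] that q by auto
    then show ?thesis unfolding b_def u_def by (metis norm_triangle_ineq)
  qed
  have "wsum4 C q \<le> (\<Sum>g\<in>ks q. wt g powr C * (8 * (b g ^ 4 + u g ^ 4)))"
    unfolding wsum4_def
    by (intro sum_mono mult_left_mono order.trans[OF power_mono[OF le] pow4_add_le]) auto
  also have "\<dots> = 8 * ((\<Sum>g\<in>ks q. wt g powr C * b g ^ 4) + (\<Sum>g\<in>ks q. wt g powr C * u g ^ 4))"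
    by (simp add: distrib_left sum.distrib sum_distrib_left mult_ac)
  also have "\<dots> \<le> 8 * ((C0 ^ 4 + C2) + real (max 1 (n * d)) powr C * (2 * tail_err R \<eta> n) ^ 4)"
  proof (intro mult_left_mono add_mono)
    have bB: "b g = cmod (Im_resolvent G p (Complex E \<eta>) \<one> g)" if "g \<in> carrier G" for g
      by (simp add: b_def B(1)[OF that])
    have b1: "b \<one> \<le> C0"
      using C0 B(1)[OF one_closed] B(2) by (simp add: b_def cmod_def)
    have "(\<Sum>g\<in>ks q. wt g powr C * b g ^ 4) \<le> (\<Sum>g\<in>ks q. (if g = \<one> then C0 ^ 4 else 0) + real (wl g) powr C * b g ^ 4)"
    proof (rule sum_mono)
      fix g assume "g \<in> ks q"
      then have g: "g \<in> carrier G" using q by auto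
      show "wt g powr C * b g ^ 4 \<le> (if g = \<one> then C0 ^ 4 else 0) + real (wl g) powr C * b g ^ 4"
      proof (cases "g = \<one>")
        case True
        then show ?thesis
          using power_mono[OF b1, of 4] by (simp add: wt_def wl_one b_def)
      next
        case False
        then have "wl g \<ge> 1" using wl_eq_0[OF g] by (cases "wl g") auto
        then show ?thesis using False by (simp add: wt_def max_def)
      qed
    qed
    also have "\<dots> \<le> C0 ^ 4 + (\<Sum>g\<in>ks q. real (wl g) powr C * b g ^ 4)"
      by (simp add: sum.distrib sum.delta)
    also have "(\<Sum>g\<in>ks q. real (wl g) powr C * b g ^ 4) \<le> C2"
    proof -
      have "\<eta>\<^sup>2 * (\<Sum>g\<in>ks q. real (wl g) powr C * b g ^ 4) =
          (\<Sum>g\<in>ks q. \<eta>\<^sup>2 * real (wl g) powr C * cmod (Im_resolvent G p (Complex E \<eta>) \<one> g) ^ 4)"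
        unfolding sum_distrib_left using q by (intro sum.cong refl) (auto simp: bB)
      also have "\<dots> \<le> \<eta>\<^sup>2 * C2"
        by (rule order.trans[OF finite_sum_le_infsum[OF sm] C2]) (use q in auto)
      finally show ?thesis using assms(1) by simp
    qed
    finally show "(\<Sum>g\<in>ks q. wt g powr C * b g ^ 4) \<le> C0 ^ 4 + C2" by simp
    \<comment> \<open>Two of the four powers are bounded by the supremum of the error and the other
      two by its square sum; the weight is bounded on the support, whose radius is
      \<open>n * d\<close>.\<close>
    have "(\<Sum>g\<in>ks q. wt g powr C * u g ^ 4) \<le> (\<Sum>g\<in>ks q. real (max 1 (n * d)) powr C * ((2 * tail_err R \<eta> n)\<^sup>2 * (u g)\<^sup>2))"
    proof (rule sum_mono)
      fix g assume g: "g \<in> ks q"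
      have "u g \<le> 2 * tail_err R \<eta> n"
        unfolding u_def by (rule order.trans[OF l2_at_le B(3)])
      then have "(u g)\<^sup>2 * (u g)\<^sup>2 \<le> (2 * tail_err R \<eta> n)\<^sup>2 * (u g)\<^sup>2"
        by (intro mult_right_mono power_mono) (auto simp: u_def)
      then have "u g ^ 4 \<le> (2 * tail_err R \<eta> n)\<^sup>2 * (u g)\<^sup>2"
        by (simp add: power_add[symmetric])
      moreover have "wt g powr C \<le> real (max 1 (n * d)) powr C"
        using qd[OF g] assms(3) by (intro powr_mono2) (auto simp: wt_def)
      ultimately show "wt g powr C * u g ^ 4 \<le> real (max 1 (n * d)) powr C * ((2 * tail_err R \<eta> n)\<^sup>2 * (u g)\<^sup>2)"
        by (intro mult_mono) (auto simp: u_def)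
    qed
    also have "\<dots> = real (max 1 (n * d)) powr C * ((2 * tail_err R \<eta> n)\<^sup>2 * (\<Sum>g\<in>ks q. (u g)\<^sup>2))"
      by (simp add: sum_distrib_left)
    also have "\<dots> \<le> real (max 1 (n * d)) powr C * ((2 * tail_err R \<eta> n)\<^sup>2 * (2 * tail_err R \<eta> n)\<^sup>2)"
    proof (intro mult_left_mono)
      have "(\<Sum>g\<in>ks q. (u g)\<^sup>2) \<le> (norm (L.lop q (l2_delta \<one>) - B))\<^sup>2"
        unfolding u_def by (rule l2_finite_sum_le) simp
      also have "\<dots> \<le> (2 * tail_err R \<eta> n)\<^sup>2"
        by (rule power_mono[OF B(3)]) simp
      finally show "(\<Sum>g\<in>ks q. (u g)\<^sup>2) \<le> (2 * tail_err R \<eta> n)\<^sup>2" .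
    qed auto
    also have "\<dots> = real (max 1 (n * d)) powr C * (2 * tail_err R \<eta> n) ^ 4"
      by (simp only: power_add[symmetric]) simp
    finally show "(\<Sum>g\<in>ks q. wt g powr C * u g ^ 4) \<le> real (max 1 (n * d)) powr C * (2 * tail_err R \<eta> n) ^ 4" .
  qed auto
  finally show ?thesis by (simp add: q_def)
qed

end

section \<open>Traces at good points and the cost of bad points\<close>

context perm_rep
begin

abbreviation bad :: "nat \<Rightarrow> nat set" where
  "bad r \<equiv> Bad G S N act r"

lemma finite_bad: "finite (bad r)" and bad_subset: "bad r \<subseteq> {..<N}"
  by (auto simp: Bad_def)

lemma act_less: "g \<in> carrier G \<Longrightarrow> x < N \<Longrightarrow> act g x < N"
  using F.act_closed[of g x] by simp

lemma act_compose: "g \<in> carrier G \<Longrightarrow> h \<in> carrier G \<Longrightarrow> x < N \<Longrightarrow> act g (act h x) = act (g \<otimes> h) x"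
  using F.act_mult[of g h x] by simp

text \<open>If the two images agree, \<open>h^-1 g\<close> fixes \<open>x\<close>, and its length is
  within the radius in the definition of \<open>Bad\<close>. Near a good point the action thus looks
  like left translation of the group on itself.\<close>

lemma good_eq:
  assumes "x < N" "x \<notin> bad r" "g \<in> carrier G" "h \<in> carrier G" "wl g + wl h \<le> 2 * r"
  shows "act g x = act h x \<longleftrightarrow> g = h"
proof
  assume "act g x = act h x"
  then have "act (inv h \<otimes> g) x = x"
    using assms F.act_inv_act[of h x] by (simp flip: act_compose)
  moreover have "wl (inv h \<otimes> g) \<le> 2 * r"
    using wl_mult[of "inv h" g] wl_inv[of h] assms by simp
  ultimately have "inv h \<otimes> g = \<one>"
    using assms by (auto simp: Bad_def cayley_ball_iff)
  then show "g = h"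
    using assms by (metis inv_equality inv_inv inv_closed)
qed simp

text \<open>The sum over \<open>t\<close> of the permutation matrix of \<open>t\<close> after the
  diagonal matrix \<open>D t\<close>. Coefficients add up when several \<open>t\<close> send
  \<open>x\<close> to the same point, so away from good points this may differ from the matrix with
  entries \<open>D t x\<close> at \<open>(t.x, x)\<close>.\<close>

definition Lop :: "'g set \<Rightarrow> ('g \<Rightarrow> nat \<Rightarrow> complex) \<Rightarrow> nat l2 \<Rightarrow> nat l2" where
  "Lop T D f = (\<Sum>t\<in>T. F.shift t (dm N (D t) f))"

lemma clin_Lop:
  assumes "T \<subseteq> carrier G"
  shows "clin (Lop T D)"
proof -
  have "F.shift t (dm N (D t) (f + g)) = F.shift t (dm N (D t) f) + F.shift t (dm N (D t) g)"
    "F.shift t (dm N (D t) (cscale c f)) = cscale c (F.shift t (dm N (D t) f))" if "t \<in> T" for t c f g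
    using clin_dm[of N "D t"] assms that by (auto simp: clin_def F.shift_add F.shift_cscale)
  then show ?thesis
    by (simp add: clin_def Lop_def sum.distrib cscale_sum_right)
qed

lemma Lop_on: "T \<subseteq> carrier G \<Longrightarrow> l2_on {0..<N} (Lop T D f)"
  by (auto simp: l2_on_def Lop_def F.shift_at subset_iff intro!: sum.neutral)

lemma Lop_delta:
  assumes "T \<subseteq> carrier G" "x < N"
  shows "Lop T D (l2_delta x) = (\<Sum>t\<in>T. cscale (D t x) (l2_delta (act t x)))"
  unfolding Lop_def
proof (intro sum.cong refl)
  fix t assume "t \<in> T"
  then have t: "t \<in> carrier G" using assms by auto
  have "dm N (D t) (l2_delta x) = cscale (D t x) (l2_delta x)"
    using assms(2) by (intro l2_eqI) auto
  then show "F.shift t (dm N (D t) (l2_delta x)) = cscale (D t x) (l2_delta (act t x))"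
    using t assms(2) by (simp add: F.shift_cscale F.shift_delta)
qed

lemma norm_Lop_le:
  assumes "T \<subseteq> carrier G" "0 \<le> c" "\<And>t x. t \<in> T \<Longrightarrow> x < N \<Longrightarrow> cmod (D t x) \<le> c"
  shows "norm (Lop T D f) \<le> real (card T) * c * norm f"
proof -
  have "norm (Lop T D f) \<le> (\<Sum>t\<in>T. c * norm f)"
    unfolding Lop_def
    by (rule order.trans[OF norm_sum sum_mono], rule order.trans[OF F.norm_shift_le norm_dm_le])
      (use assms in auto)
  then show ?thesis by simp
qed

lemma lop_delta_F:
  assumes "ks q \<subseteq> carrier G" "x < N"
  shows "F.lop q (l2_delta x) = (\<Sum>g\<in>ks q. cscale (lk q g) (l2_delta (act g x)))"
  unfolding F.lop_def using assms by (intro sum.cong refl) (auto simp: F.shift_delta subset_iff)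

definition cross_term ::
    "'g set \<Rightarrow> ('g \<Rightarrow> nat \<Rightarrow> complex) \<Rightarrow> ('g \<Rightarrow>\<^sub>0 complex) \<Rightarrow> ('g \<Rightarrow>\<^sub>0 complex) \<Rightarrow> nat \<Rightarrow> complex" where
  "cross_term T D q1 q2 x =
    (\<Sum>t\<in>T. \<Sum>s\<in>T. \<Sum>g\<in>ks q1. lk (cross q1 q2 t s) g * cnj (D t (act g x)) * D s x)"

text \<open>Both vectors expand into point masses at \<open>(t g).x\<close> and
  \<open>(h s).x\<close>. At a good point these coincide exactly when \<open>h = t g s^-1\<close>,
  since either word has length at most \<open>m + d <= r\<close>; this leaves the coefficients of
  \<open>cross\<close>.\<close>

lemma trace_good:
  assumes T: "T \<subseteq> carrier G" "finite T" and q: "ks q1 \<subseteq> carrier G" "ks q2 \<subseteq> carrier G"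
    and x: "x < N" "x \<notin> bad r"
    and len: "\<And>t. t \<in> T \<Longrightarrow> wl t \<le> d" "\<And>g. g \<in> ks q1 \<union> ks q2 \<Longrightarrow> wl g \<le> m" and r: "m + d \<le> r"
  shows "cinner (Lop T D (F.lop q1 (l2_delta x))) (F.lop q2 (Lop T D (l2_delta x))) = cross_term T D q1 q2 x"
proof -
  have Tc: "t \<in> carrier G" if "t \<in> T" for t using that T by auto
  have qc: "g \<in> carrier G" if "g \<in> ks q1 \<union> ks q2" for g using that q by auto
  have "Lop T D (F.lop q1 (l2_delta x)) =
      (\<Sum>g\<in>ks q1. cscale (lk q1 g) (Lop T D (l2_delta (act g x))))"
    unfolding lop_delta_F[OF q(1) x(1)]
    by (simp add: clin_sum[OF clin_Lop[OF T(1)]] clin_cscale[OF clin_Lop[OF T(1)]])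
  also have "\<dots> = (\<Sum>g\<in>ks q1. \<Sum>t\<in>T. cscale (lk q1 g * D t (act g x)) (l2_delta (act (t \<otimes> g) x)))"
  proof (intro sum.cong refl)
    fix g assume "g \<in> ks q1"
    then have g: "g \<in> carrier G" using q by auto
    show "cscale (lk q1 g) (Lop T D (l2_delta (act g x))) =
        (\<Sum>t\<in>T. cscale (lk q1 g * D t (act g x)) (l2_delta (act (t \<otimes> g) x)))"
      unfolding Lop_delta[OF T(1) act_less[OF g x(1)]] cscale_sum_right
      by (intro sum.cong refl l2_eqI) (simp add: act_compose[OF Tc g x(1)])
  qed
  finally have 1: "Lop T D (F.lop q1 (l2_delta x)) =
      (\<Sum>g\<in>ks q1. \<Sum>t\<in>T. cscale (lk q1 g * D t (act g x)) (l2_delta (act (t \<otimes> g) x)))" .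
  have "F.lop q2 (Lop T D (l2_delta x)) = (\<Sum>s\<in>T. cscale (D s x) (F.lop q2 (l2_delta (act s x))))"
    unfolding Lop_delta[OF T(1) x(1)]
    by (simp add: clin_sum[OF F.clin_lop[OF q(2)]] clin_cscale[OF F.clin_lop[OF q(2)]])
  also have "\<dots> = (\<Sum>s\<in>T. \<Sum>h\<in>ks q2. cscale (D s x * lk q2 h) (l2_delta (act (h \<otimes> s) x)))"
  proof (intro sum.cong refl)
    fix s assume "s \<in> T"
    then have s: "s \<in> carrier G" by (rule Tc)
    show "cscale (D s x) (F.lop q2 (l2_delta (act s x))) =
        (\<Sum>h\<in>ks q2. cscale (D s x * lk q2 h) (l2_delta (act (h \<otimes> s) x)))"
      unfolding lop_delta_F[OF q(2) act_less[OF s x(1)]] cscale_sum_right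
      by (intro sum.cong refl l2_eqI) (simp add: act_compose[OF qc s x(1)])
  qed
  finally have 2: "F.lop q2 (Lop T D (l2_delta x)) =
      (\<Sum>s\<in>T. \<Sum>h\<in>ks q2. cscale (D s x * lk q2 h) (l2_delta (act (h \<otimes> s) x)))" .
  have inn: "(\<Sum>h\<in>ks q2. cinner (cscale a (l2_delta (act (t \<otimes> g) x))) (cscale (D s x * lk q2 h) (l2_delta (act (h \<otimes> s) x))))
      = cnj a * D s x * lk q2 (t \<otimes> g \<otimes> inv s)" if g: "g \<in> ks q1" and t: "t \<in> T" and s: "s \<in> T" for a g t s
  proof -
    have gc: "g \<in> carrier G" and tc: "t \<in> carrier G" and sc: "s \<in> carrier G" using g t s qc Tc by auto
    have "cinner (cscale a (l2_delta (act (t \<otimes> g) x))) (cscale (D s x * lk q2 h) (l2_delta (act (h \<otimes> s) x))) =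
        (if h = t \<otimes> g \<otimes> inv s then cnj a * D s x * lk q2 h else 0)" if h: "h \<in> ks q2" for h
    proof -
      have hc: "h \<in> carrier G" using h qc by auto
      have "wl (t \<otimes> g) + wl (h \<otimes> s) \<le> 2 * r"
        using wl_mult[OF tc gc] wl_mult[OF hc sc] len(1)[OF t] len(1)[OF s] len(2)[of g] len(2)[of h] g h r by auto
      then have "act (t \<otimes> g) x = act (h \<otimes> s) x \<longleftrightarrow> t \<otimes> g = h \<otimes> s"
        using gc tc sc hc by (intro good_eq[OF x]) auto
      also have "\<dots> \<longleftrightarrow> h = t \<otimes> g \<otimes> inv s"
        using gc tc sc hc by (metis inv_solve_right m_closed)
      finally show ?thesis
        by (simp add: cinner_cscale_left cinner_cscale_right cinner_l2_delta)
    qed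
    then have "(\<Sum>h\<in>ks q2. cinner (cscale a (l2_delta (act (t \<otimes> g) x))) (cscale (D s x * lk q2 h) (l2_delta (act (h \<otimes> s) x))))
        = (\<Sum>h\<in>ks q2. if h = t \<otimes> g \<otimes> inv s then cnj a * D s x * lk q2 h else 0)"
      by (intro sum.cong refl)
    also have "\<dots> = cnj a * D s x * lk q2 (t \<otimes> g \<otimes> inv s)"
      by (subst sum.delta) (simp_all add: lk_not_in_ks)
    finally show ?thesis .
  qed
  have "cinner (Lop T D (F.lop q1 (l2_delta x))) (F.lop q2 (Lop T D (l2_delta x))) =
      (\<Sum>g\<in>ks q1. \<Sum>t\<in>T. \<Sum>s\<in>T. cnj (lk q1 g * D t (act g x)) * D s x * lk q2 (t \<otimes> g \<otimes> inv s))"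
    unfolding 1 2 cinner_sum_left
    by (intro sum.cong refl, subst cinner_sum_right, intro sum.cong refl, subst cinner_sum_right, rule inn)
  also have "\<dots> = (\<Sum>g\<in>ks q1. \<Sum>t\<in>T. \<Sum>s\<in>T. lk (cross q1 q2 t s) g * cnj (D t (act g x)) * D s x)"
    by (intro sum.cong refl) (simp add: lookup_cross mult_ac)
  also have "\<dots> = (\<Sum>t\<in>T. \<Sum>g\<in>ks q1. \<Sum>s\<in>T. lk (cross q1 q2 t s) g * cnj (D t (act g x)) * D s x)"
    by (rule sum.swap)
  also have "\<dots> = cross_term T D q1 q2 x"
    unfolding cross_term_def by (intro sum.cong refl sum.swap)
  finally show ?thesis .
qed

text \<open>Summing over all points, including the bad ones, is what turns the local expression into
  a quadratic form of the symbol.\<close>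

lemma sum_cross_term:
  assumes T: "T \<subseteq> carrier G" and q: "ks q1 \<subseteq> carrier G"
  shows "(\<Sum>x<N. cross_term T D q1 q2 x) =
    (\<Sum>t\<in>T. \<Sum>s\<in>T. cinner (fl N (D t)) (F.lop (cross q1 q2 t s) (fl N (D s))))"
proof -
  have *: "cinner (fl N (D t)) (F.lop (cross q1 q2 t s) (fl N (D s))) =
      (\<Sum>g\<in>ks q1. \<Sum>x<N. lk (cross q1 q2 t s) g * cnj (D t (act g x)) * D s x)" for t s
  proof -
    have "cinner (fl N (D t)) (F.lop (cross q1 q2 t s) (fl N (D s))) =
        (\<Sum>g\<in>ks q1. lk (cross q1 q2 t s) g * cinner (fl N (D t)) (F.shift g (fl N (D s))))"
      by (simp add: F.lop_superset[OF _ keys_cross] cinner_sum_right cinner_cscale_right)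
    also have "\<dots> = (\<Sum>g\<in>ks q1. \<Sum>x<N. lk (cross q1 q2 t s) g * cnj (D t (act g x)) * D s x)"
    proof (intro sum.cong refl)
      fix g assume "g \<in> ks q1"
      then have g: "g \<in> carrier G" using q by auto
      have "cinner (fl N (D t)) (F.shift g (fl N (D s))) = cinner (F.shift (inv g) (fl N (D t))) (fl N (D s))"
        using g by (simp add: F.cinner_shift)
      also have "\<dots> = (\<Sum>x<N. cnj (l2_at (F.shift (inv g) (fl N (D t))) x) * l2_at (fl N (D s)) x)"
        using g by (intro cinner_finite) (auto simp: l2_on_def F.shift_at)
      also have "\<dots> = (\<Sum>x<N. cnj (D t (act g x)) * D s x)"
        using g by (intro sum.cong refl) (auto simp: F.shift_at act_less)
      finally show "lk (cross q1 q2 t s) g * cinner (fl N (D t)) (F.shift g (fl N (D s))) =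
          (\<Sum>x<N. lk (cross q1 q2 t s) g * cnj (D t (act g x)) * D s x)"
        by (simp add: sum_distrib_left mult.assoc)
    qed
    finally show ?thesis .
  qed
  have "(\<Sum>x<N. cross_term T D q1 q2 x) =
      (\<Sum>t\<in>T. \<Sum>x<N. \<Sum>s\<in>T. \<Sum>g\<in>ks q1. lk (cross q1 q2 t s) g * cnj (D t (act g x)) * D s x)"
    unfolding cross_term_def by (rule sum.swap)
  also have "\<dots> = (\<Sum>t\<in>T. \<Sum>s\<in>T. \<Sum>x<N. \<Sum>g\<in>ks q1. lk (cross q1 q2 t s) g * cnj (D t (act g x)) * D s x)"
    by (intro sum.cong refl sum.swap)
  also have "\<dots> = (\<Sum>t\<in>T. \<Sum>s\<in>T. \<Sum>g\<in>ks q1. \<Sum>x<N. lk (cross q1 q2 t s) g * cnj (D t (act g x)) * D s x)"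
    by (intro sum.cong refl sum.swap)
  finally show ?thesis unfolding * .
qed

text \<open>The trace and the sum of \<open>cross_term\<close> differ only at bad points. There each
  of the two is at most \<open>(card T * c * M)^2\<close>, by Cauchy--Schwarz for the first and
  \<open>cross_norm1\<close> for the second.\<close>

lemma trace_bound:
  assumes T: "T \<subseteq> carrier G" "finite T" and q: "ks q1 \<subseteq> carrier G" "ks q2 \<subseteq> carrier G"
    and len: "\<And>t. t \<in> T \<Longrightarrow> wl t \<le> d" "\<And>g. g \<in> ks q1 \<union> ks q2 \<Longrightarrow> wl g \<le> m" and r: "m + d \<le> r"
    and M: "\<And>v. l2_on {0..<N} v \<Longrightarrow> norm (F.lop q1 v) \<le> M * norm v"
      "\<And>v. l2_on {0..<N} v \<Longrightarrow> norm (F.lop q2 v) \<le> M * norm v"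
      "norm (L.lop q1 (l2_delta \<one>)) \<le> M" "norm (L.lop q2 (l2_delta \<one>)) \<le> M"
    and c: "0 \<le> c" "\<And>t x. t \<in> T \<Longrightarrow> x < N \<Longrightarrow> cmod (D t x) \<le> c"
  shows "cmod (\<Sum>x<N. cinner (Lop T D (F.lop q1 (l2_delta x))) (F.lop q2 (Lop T D (l2_delta x)))) \<le>
    (\<Sum>t\<in>T. \<Sum>s\<in>T. cmod (cinner (fl N (D t)) (F.lop (cross q1 q2 t s) (fl N (D s))))) +
    real (card (bad r)) * (2 * (real (card T) * c * M)\<^sup>2)"
proof -
  define Z where "Z = (\<lambda>x. cinner (Lop T D (F.lop q1 (l2_delta x))) (F.lop q2 (Lop T D (l2_delta x))))"
  define Y where "Y = cross_term T D q1 q2"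
  have M0: "0 \<le> M" using M(3) norm_ge_zero order.trans by blast
  have ZY: "Z x - Y x = 0" if "x < N" "x \<notin> bad r" for x
    using trace_good[OF T q that len r, of D] by (simp add: Z_def Y_def)
  have Zb: "cmod (Z x) \<le> (real (card T) * c * M)\<^sup>2" if x: "x < N" for x
  proof -
    have d: "l2_on {0..<N} (l2_delta x)" using x by (auto intro: l2_on_delta)
    have "norm (Lop T D (F.lop q1 (l2_delta x))) \<le> real (card T) * c * (M * 1)"
      by (rule order.trans[OF norm_Lop_le[OF T(1) c]], assumption+, rule mult_left_mono)
        (use M(1)[OF d] c in auto)
    moreover have "norm (F.lop q2 (Lop T D (l2_delta x))) \<le> M * (real (card T) * c * 1)"
      by (rule order.trans[OF M(2)[OF Lop_on[OF T(1)]]], rule mult_left_mono)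
        (use norm_Lop_le[OF T(1) c, where f = "l2_delta x"] M0 in auto)
    ultimately have "norm (Lop T D (F.lop q1 (l2_delta x))) * norm (F.lop q2 (Lop T D (l2_delta x))) \<le>
        (real (card T) * c * (M * 1)) * (M * (real (card T) * c * 1))"
      using c M0 by (intro mult_mono) auto
    then have "cmod (Z x) \<le> (real (card T) * c * (M * 1)) * (M * (real (card T) * c * 1))"
      unfolding Z_def by (rule order.trans[OF cinner_cmod_le])
    then show ?thesis
      by (simp add: power2_eq_square mult_ac)
  qed
  have Yb: "cmod (Y x) \<le> (real (card T) * c * M)\<^sup>2" if x: "x < N" for x
  proof -
    have "cmod (Y x) \<le> (\<Sum>t\<in>T. \<Sum>s\<in>T. \<Sum>g\<in>ks q1. cmod (lk (cross q1 q2 t s) g * cnj (D t (act g x)) * D s x))"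
      unfolding Y_def cross_term_def
      by (intro order.trans[OF norm_sum] sum_mono order.refl)
    also have "\<dots> \<le> (\<Sum>t\<in>T. \<Sum>s\<in>T. c\<^sup>2 * M\<^sup>2)"
    proof (intro sum_mono)
      fix t s assume ts: "t \<in> T" "s \<in> T"
      have "(\<Sum>g\<in>ks q1. cmod (lk (cross q1 q2 t s) g * cnj (D t (act g x)) * D s x)) \<le>
          (\<Sum>g\<in>ks q1. cmod (lk (cross q1 q2 t s) g) * (c * c))"
        unfolding norm_mult mult.assoc complex_mod_cnj
        by (intro sum_mono mult_left_mono mult_mono c ts act_less x) (use q c in auto)
      also have "\<dots> = (c * c) * (\<Sum>g\<in>ks q1. cmod (lk (cross q1 q2 t s) g))"
        by (simp add: sum_distrib_left mult_ac)
      also have "\<dots> \<le> (c * c) * M\<^sup>2"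
        using cross_norm1[OF q _ _ M(3,4), of t s] T ts by (intro mult_left_mono) auto
      finally show "(\<Sum>g\<in>ks q1. cmod (lk (cross q1 q2 t s) g * cnj (D t (act g x)) * D s x)) \<le> c\<^sup>2 * M\<^sup>2"
        by (simp add: power2_eq_square)
    qed
    also have "\<dots> = (real (card T) * c * M)\<^sup>2"
      by (simp add: power2_eq_square mult_ac)
    finally show ?thesis .
  qed
  have "(\<Sum>x<N. Z x) = (\<Sum>x<N. Y x) + (\<Sum>x<N. Z x - Y x)"
    by (simp add: sum_subtractf)
  also have "(\<Sum>x<N. Z x - Y x) = (\<Sum>x\<in>bad r. Z x - Y x)"
    by (rule sum.mono_neutral_right) (use ZY bad_subset in auto)
  finally have "cmod (\<Sum>x<N. Z x) \<le> cmod (\<Sum>x<N. Y x) + cmod (\<Sum>x\<in>bad r. Z x - Y x)"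
    by (simp only: norm_triangle_ineq)
  also have "cmod (\<Sum>x\<in>bad r. Z x - Y x) \<le> (\<Sum>x\<in>bad r. 2 * (real (card T) * c * M)\<^sup>2)"
  proof (rule order.trans[OF norm_sum sum_mono])
    fix x assume "x \<in> bad r"
    then have "x < N" using bad_subset by auto
    then show "cmod (Z x - Y x) \<le> 2 * (real (card T) * c * M)\<^sup>2"
      using norm_triangle_ineq4[of "Z x" "Y x"] Zb[of x] Yb[of x] by linarith
  qed
  also have "(\<Sum>x\<in>bad r. 2 * (real (card T) * c * M)\<^sup>2) = real (card (bad r)) * (2 * (real (card T) * c * M)\<^sup>2)"
    by simp
  also have "cmod (\<Sum>x<N. Y x) \<le>
      (\<Sum>t\<in>T. \<Sum>s\<in>T. cmod (cinner (fl N (D t)) (F.lop (cross q1 q2 t s) (fl N (D s)))))"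
    unfolding Y_def sum_cross_term[OF T(1) q(1)]
    by (intro order.trans[OF norm_sum] sum_mono order.refl)
  finally show ?thesis
    by (simp add: Z_def)
qed

end

section \<open>Counting eigenvalues and bounding observables\<close>

text \<open>Width \<open>2 * \<eta>\<close> is used because a window of half-width
  \<open>\<eta>\<close> will be compared with a net point at distance at most \<open>\<eta>\<close>
  from its centre; 5 is \<open>2^2 + 1\<close>.\<close>

lemma poisson_window:
  assumes "\<eta> > 0" "\<bar>x - E\<bar> \<le> 2 * \<eta>"
  shows "1 / (5 * \<eta>) \<le> poisson E \<eta> x"
proof -
  have "(x - E)\<^sup>2 \<le> (2 * \<eta>)\<^sup>2"
    using power_mono[OF assms(2), of 2] by simp
  then have "(x - E)\<^sup>2 + \<eta>\<^sup>2 \<le> 5 * \<eta>\<^sup>2"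
    by (simp add: power_mult_distrib)
  then have "\<eta> / (5 * \<eta>\<^sup>2) \<le> \<eta> / ((x - E)\<^sup>2 + \<eta>\<^sup>2)"
    using assms(1) by (intro divide_left_mono mult_pos_pos) (auto intro: add_nonneg_pos)
  then show ?thesis
    using assms(1) by (simp add: poisson_def power2_eq_square)
qed

lemma poisson_le: "\<eta> > 0 \<Longrightarrow> poisson E \<eta> x \<le> 1 / \<eta>"
proof -
  assume "\<eta> > 0"
  then have "\<eta> / ((x - E)\<^sup>2 + \<eta>\<^sup>2) \<le> \<eta> / \<eta>\<^sup>2"
    by (intro divide_left_mono mult_pos_pos) (auto intro: add_nonneg_pos)
  with \<open>\<eta> > 0\<close> show ?thesis by (simp add: poisson_def power2_eq_square)
qed

text \<open>Away from \<open>E\<close> the Poisson kernel is dominated by the one at a larger scale, which controls its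
  tail without any lower bound on the distance to the edge of the interval.\<close>

lemma poisson_tail:
  assumes "\<eta> > 0" "M \<ge> 1" "\<bar>x - E\<bar> > M * \<eta>"
  shows "poisson E \<eta> x \<le> 2 / M * poisson E (M * \<eta>) x"
proof -
  have M\<eta>: "M * \<eta> > 0" using assms by simp
  have "(M * \<eta>)\<^sup>2 \<le> (x - E)\<^sup>2"
    using power_mono[of "M * \<eta>" "\<bar>x - E\<bar>" 2] assms M\<eta> by simp
  then have "(x - E)\<^sup>2 + (M * \<eta>)\<^sup>2 \<le> (x - E)\<^sup>2 + (x - E)\<^sup>2"
    by (rule add_left_mono)
  also have "\<dots> \<le> 2 * ((x - E)\<^sup>2 + \<eta>\<^sup>2)"
    by simp
  finally have "M * ((x - E)\<^sup>2 + (M * \<eta>)\<^sup>2) \<le> M * (2 * ((x - E)\<^sup>2 + \<eta>\<^sup>2))"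
    by (rule mult_left_mono) (use assms(2) in simp)
  then have "\<eta> * (M * ((x - E)\<^sup>2 + (M * \<eta>)\<^sup>2)) \<le> \<eta> * (M * (2 * ((x - E)\<^sup>2 + \<eta>\<^sup>2)))"
    by (rule mult_left_mono) (use assms(1) in simp)
  moreover have "0 < (x - E)\<^sup>2 + \<eta>\<^sup>2" "0 < (x - E)\<^sup>2 + (M * \<eta>)\<^sup>2"
    using assms M\<eta> by (auto intro!: add_nonneg_pos)
  ultimately show ?thesis
    using assms(2) by (simp add: poisson_def divide_le_eq le_divide_eq mult_ac)
qed

section \<open>Window sums as traces, and eigenvalue counts\<close>

context perm_rep
begin

lemma pois_poly_pos: "j < N \<Longrightarrow> 0 < \<eta> \<Longrightarrow> \<eta> \<le> 1 \<Longrightarrow> 0 < pois_poly R E \<eta> n (lam j)"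
  using pois_poly_bounds(1)[OF R1 _ _ eigen(3), of \<eta> j E n] poisson_pos[of \<eta> E "lam j"] by linarith

lemma cinner_pois_expand:
  assumes "l2_on {0..<N} w"
  shows "cinner w (F.lop (ga_pois G R p E \<eta> n) w) =
    of_real (\<Sum>k<N. pois_poly R E \<eta> n (lam k) * (cmod (cinner (ev k) w))\<^sup>2)"
proof -
  have "cinner w (F.lop (ga_pois G R p E \<eta> n) w) =
      (\<Sum>k<N. cinner (ev k) w * cinner w (F.lop (ga_pois G R p E \<eta> n) (ev k)))"
    by (rule cinner_expand[OF F.clin_lop[OF carrier_ga_pois[OF p_carrier]] assms])
  also have "\<dots> = (\<Sum>k<N. of_real (pois_poly R E \<eta> n (lam k) * (cmod (cinner (ev k) w))\<^sup>2))"
  proof (intro sum.cong refl)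
    fix k assume "k \<in> {..<N}"
    then have k: "k < N" by simp
    have "cinner w (F.lop (ga_pois G R p E \<eta> n) (ev k)) = of_real (pois_poly R E \<eta> n (lam k)) * cinner w (ev k)"
      by (simp only: lop_ga_pois_ev[OF k] cinner_cscale_right flip: cscale_of_real)
    moreover have "cinner (ev k) w * cinner w (ev k) = of_real ((cmod (cinner (ev k) w))\<^sup>2)"
      by (simp only: cinner_commute[of w "ev k"] complex_norm_square)
    ultimately show "cinner (ev k) w * cinner w (F.lop (ga_pois G R p E \<eta> n) (ev k)) =
        of_real (pois_poly R E \<eta> n (lam k) * (cmod (cinner (ev k) w))\<^sup>2)"
      by (simp only: of_real_mult mult.left_commute[of "cinner (ev k) w"])
  qed
  finally show ?thesis by simp
qed

text \<open>In the eigenbasis the trace is a sum of squared matrix elements with weights given by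
  the two polynomials. The weights are positive everywhere and at least \<open>\<kappa>\<close> on
  the windows, so restricting to the windows only loses.\<close>

lemma window_trace:
  assumes \<eta>: "0 < \<eta>" "\<eta> \<le> 1" and L: "clin L" "\<And>f. l2_on {0..<N} (L f)"
    and A: "A1 \<subseteq> {..<N}" "A2 \<subseteq> {..<N}" and \<kappa>: "0 \<le> \<kappa>"
    and k1: "\<And>j. j \<in> A1 \<Longrightarrow> \<kappa> \<le> pois_poly R E1 \<eta> n (lam j)"
    and k2: "\<And>j. j \<in> A2 \<Longrightarrow> \<kappa> \<le> pois_poly R E2 \<eta> n (lam j)"
  shows "\<kappa>\<^sup>2 * (\<Sum>j\<in>A1. \<Sum>k\<in>A2. (cmod (cinner (ev k) (L (ev j))))\<^sup>2) \<le>
    cmod (\<Sum>x<N. cinner (L (F.lop (ga_pois G R p E1 \<eta> n) (l2_delta x)))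
      (F.lop (ga_pois G R p E2 \<eta> n) (L (l2_delta x))))"
proof -
  define q1 q2 where "q1 = ga_pois G R p E1 \<eta> n" and "q2 = ga_pois G R p E2 \<eta> n"
  define Q1 Q2 where "Q1 = (\<lambda>j. pois_poly R E1 \<eta> n (lam j))" and "Q2 = (\<lambda>j. pois_poly R E2 \<eta> n (lam j))"
  define a where "a = (\<lambda>j k. (cmod (cinner (ev k) (L (ev j))))\<^sup>2)"
  have q: "ks q1 \<subseteq> carrier G" "ks q2 \<subseteq> carrier G"
    unfolding q1_def q2_def by (intro carrier_ga_pois p_carrier)+
  have Qpos: "0 \<le> Q1 j" "0 \<le> Q2 j" if "j < N" for j
    using pois_poly_pos[OF that \<eta>, of E1 n] pois_poly_pos[OF that \<eta>, of E2 n] by (auto simp: Q1_def Q2_def)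
  define X where "X = (\<Sum>x<N. cinner (L (F.lop q1 (l2_delta x))) (F.lop q2 (L (l2_delta x))))"
  define Y where "Y = (\<Sum>j<N. \<Sum>k<N. Q1 j * (Q2 k * a j k))"
  have "X = (\<Sum>j<N. cinner (L (F.lop q1 (ev j))) (F.lop q2 (L (ev j))))"
    unfolding X_def
    by (rule trace_basis[of "\<lambda>f. L (F.lop q1 f)" "\<lambda>f. F.lop q2 (L f)"])
      (rule clin_compose[OF L(1) F.clin_lop[OF q(1)]] clin_compose[OF F.clin_lop[OF q(2)] L(1)])+
  moreover have "(\<Sum>j<N. cinner (L (F.lop q1 (ev j))) (F.lop q2 (L (ev j)))) = of_real Y"
    unfolding Y_def of_real_sum[of _ "{..<N}"]
  proof (intro sum.cong refl)
    fix j assume "j \<in> {..<N}"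
    then have j: "j < N" by simp
    have "F.lop q1 (ev j) = cscale (of_real (Q1 j)) (ev j)"
      using lop_ga_pois_ev[OF j, of E1 \<eta> n] by (simp only: q1_def Q1_def cscale_of_real)
    then have 1: "cinner (L (F.lop q1 (ev j))) w = of_real (Q1 j) * cinner (L (ev j)) w" for w
      by (simp only: clin_cscale[OF L(1)] cinner_cscale_left complex_cnj_complex_of_real)
    have 2: "cinner (L (ev j)) (F.lop q2 (L (ev j))) = of_real (\<Sum>k<N. Q2 k * a j k)"
      unfolding q2_def Q2_def a_def by (rule cinner_pois_expand) (rule L(2))
    show "cinner (L (F.lop q1 (ev j))) (F.lop q2 (L (ev j))) = (\<Sum>k<N. of_real (Q1 j * (Q2 k * a j k)))"
      by (simp only: 1 2 of_real_sum of_real_mult sum_distrib_left)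
  qed
  ultimately have S: "cmod X = \<bar>Y\<bar>"
    by (simp only: norm_of_real)
  have l1: "(\<Sum>j\<in>A1. \<Sum>k\<in>A2. \<kappa> * (\<kappa> * a j k)) \<le> (\<Sum>j\<in>A1. \<Sum>k\<in>A2. Q1 j * (Q2 k * a j k))"
  proof (intro sum_mono)
    fix j k assume jk: "j \<in> A1" "k \<in> A2"
    have kQ: "\<kappa> \<le> Q1 j" "\<kappa> \<le> Q2 k"
      unfolding Q1_def Q2_def by (rule k1[OF jk(1)], rule k2[OF jk(2)])
    have a0: "0 \<le> a j k" unfolding a_def by (rule zero_le_power2)
    show "\<kappa> * (\<kappa> * a j k) \<le> Q1 j * (Q2 k * a j k)"
      by (rule mult_mono[OF kQ(1) mult_right_mono[OF kQ(2) a0] order.trans[OF \<kappa> kQ(1)] mult_nonneg_nonneg[OF \<kappa> a0]])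
  qed
  have l0: "\<kappa>\<^sup>2 * (\<Sum>j\<in>A1. \<Sum>k\<in>A2. a j k) = (\<Sum>j\<in>A1. \<Sum>k\<in>A2. \<kappa> * (\<kappa> * a j k))"
    by (simp only: sum_distrib_left power2_eq_square mult.assoc)
  have nn: "0 \<le> Q1 j * (Q2 k * a j k)" if "j < N" "k < N" for j k
    by (intro mult_nonneg_nonneg Qpos that) (simp add: a_def)
  have l2: "(\<Sum>j\<in>A1. \<Sum>k\<in>A2. Q1 j * (Q2 k * a j k)) \<le> (\<Sum>j\<in>A1. \<Sum>k<N. Q1 j * (Q2 k * a j k))"
  proof (rule sum_mono)
    fix j assume "j \<in> A1"
    then have "j < N" using A(1) by auto
    then show "(\<Sum>k\<in>A2. Q1 j * (Q2 k * a j k)) \<le> (\<Sum>k<N. Q1 j * (Q2 k * a j k))"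
      by (rule sum_mono2[OF finite_lessThan A(2) nn]) simp
  qed
  have l3: "(\<Sum>j\<in>A1. \<Sum>k<N. Q1 j * (Q2 k * a j k)) \<le> Y"
    unfolding Y_def
  proof (rule sum_mono2[OF finite_lessThan A(1)])
    fix j assume "j \<in> {..<N} - A1"
    then show "0 \<le> (\<Sum>k<N. Q1 j * (Q2 k * a j k))"
      by (intro sum_nonneg nn) auto
  qed
  have "\<kappa>\<^sup>2 * (\<Sum>j\<in>A1. \<Sum>k\<in>A2. a j k) \<le> cmod X"
    unfolding S l0 by (rule order.trans[OF l1 order.trans[OF l2 order.trans[OF l3 abs_ge_self]]])
  then show ?thesis by (simp only: X_def a_def q1_def q2_def)
qed

text \<open>The trace of the polynomial is computed twice. At a good point the diagonal entry is the
  coefficient at the unit, which is within \<open>2 * tail_err\<close> of the spectral density; in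
  the eigenbasis another \<open>2 * tail_err\<close> separates polynomial and kernel.\<close>

lemma pois_count:
  assumes \<eta>: "0 < \<eta>" "\<eta> \<le> 1" and d: "\<And>g. g \<in> ks p \<Longrightarrow> wl g \<le> d" and r: "n * d \<le> 2 * r"
  shows "\<bar>(\<Sum>j<N. poisson E \<eta> (lam j)) - real N * Re (Im_resolvent G p (Complex E \<eta>) \<one> \<one>)\<bar> \<le>
    4 * real N * tail_err R \<eta> n + card (bad r) * (32 * R / \<eta>\<^sup>2)"
proof -
  define q where "q = ga_pois G R p E \<eta> n"
  define \<tau> where "\<tau> = tail_err R \<eta> n"
  define I where "I = Re (Im_resolvent G p (Complex E \<eta>) \<one> \<one>)"
  have q: "ks q \<subseteq> carrier G" unfolding q_def by (rule carrier_ga_pois[OF p_carrier])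
  have \<tau>: "0 \<le> \<tau>" "\<tau> \<le> 4 * R / \<eta>\<^sup>2"
    using R1 \<eta> mult_left_mono[of "exp (- \<eta> * real n / (2 * R))" 1 "4 * R / \<eta>\<^sup>2"]
    by (auto simp: \<tau>_def tail_err_def)
  obtain B where B: "\<And>g. g \<in> carrier G \<Longrightarrow> Im_resolvent G p (Complex E \<eta>) \<one> g = cnj (l2_at B g)"
    "Im (l2_at B \<one>) = 0" "norm (L.lop q (l2_delta \<one>) - B) \<le> 2 * \<tau>"
    unfolding q_def \<tau>_def using Im_resolvent_approx[OF \<eta>] by metis
  have IB: "of_real I = l2_at B \<one>"
    using B(1)[OF one_closed] B(2) by (simp add: I_def complex_eq_iff)
  have qI: "cmod (lk q \<one> - of_real I) \<le> 2 * \<tau>"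
    using order.trans[OF l2_at_le B(3), of \<one>] lop_delta_one[OF q one_closed] by (simp add: IB)
  have q1: "cmod (lk q \<one>) \<le> 12 * R / \<eta>\<^sup>2"
    using order.trans[OF l2_at_le L.norm_lop_ga_pois[OF \<eta> l2_on_delta[OF one_closed], of E n], of \<one>]
      lop_delta_one[OF q one_closed] by (simp add: q_def)
  define Z where "Z = (\<lambda>x. cinner (l2_delta x) (F.lop q (l2_delta x)))"
  have good: "Z x = lk q \<one>" if x: "x < N" "x \<notin> bad r" for x
  proof -
    have "Z x = (\<Sum>g\<in>ks q. lk q g * cinner (l2_delta x) (l2_delta (act g x)))"
      unfolding Z_def lop_delta_F[OF q x(1)] cinner_sum_right cinner_cscale_right ..
    also have "\<dots> = (\<Sum>g\<in>ks q. if g = \<one> then lk q g else 0)"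
    proof (intro sum.cong refl)
      fix g assume g: "g \<in> ks q"
      then have gc: "g \<in> carrier G" using q by auto
      have "wl g \<le> n * d" using keys_ga_pois[OF p_carrier d, of R E \<eta> n] g by (auto simp: q_def)
      then have "act g x = act \<one> x \<longleftrightarrow> g = \<one>"
        using r by (intro good_eq[OF x]) (auto simp: gc wl_one)
      then show "lk q g * cinner (l2_delta x) (l2_delta (act g x)) = (if g = \<one> then lk q g else 0)"
        using F.act_one[of x] x by (auto simp: cinner_l2_delta)
    qed
    also have "\<dots> = lk q \<one>"
      by (subst sum.delta) (simp_all add: lk_not_in_ks)
    finally show ?thesis .
  qed
  \<comment> \<open>32 is 12 for the diagonal entry plus \<open>12 + 2 * 4\<close> for the density,
    which is bounded through the coefficient at the unit.\<close>
  have Zb: "cmod (Z x - of_real I) \<le> 32 * R / \<eta>\<^sup>2" if "x \<in> bad r" for x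
  proof -
    have x: "x < N" using that bad_subset by auto
    have "cmod (Z x) \<le> 12 * R / \<eta>\<^sup>2"
      unfolding Z_def q_def using x F.norm_lop_ga_pois[OF \<eta> l2_on_delta, of x E n]
      by (intro order.trans[OF cinner_cmod_le]) simp
    moreover have "cmod (of_real I) \<le> 12 * R / \<eta>\<^sup>2 + 2 * \<tau>"
      using qI q1 norm_triangle_ineq2[of "of_real I" "lk q \<one>"] by (simp only: norm_minus_commute[of "lk q \<one>"])
    ultimately show ?thesis
      using norm_triangle_ineq4[of "Z x" "of_real I"] \<tau>(2) by simp
  qed
  have "(\<Sum>x<N. Z x) = (\<Sum>j<N. cinner (ev j) (F.lop q (ev j)))"
    unfolding Z_def
    by (rule trace_basis[of "\<lambda>f. f" "F.lop q"]) (simp_all add: clin_def F.lop_right_add F.lop_right_cscale q)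
  also have "\<dots> = (\<Sum>j<N. of_real (pois_poly R E \<eta> n (lam j)))"
  proof (intro sum.cong refl)
    fix j assume "j \<in> {..<N}"
    then have j: "j < N" by simp
    show "cinner (ev j) (F.lop q (ev j)) = of_real (pois_poly R E \<eta> n (lam j))"
      unfolding q_def lop_ga_pois_ev[OF j] cscale_of_real[symmetric] cinner_cscale_right e_orth[OF j j] by simp
  qed
  finally have ZQ: "(\<Sum>x<N. Z x) = of_real (\<Sum>j<N. pois_poly R E \<eta> n (lam j))"
    by simp
  have "\<bar>(\<Sum>j<N. pois_poly R E \<eta> n (lam j)) - N * I\<bar> = cmod (\<Sum>x<N. Z x - of_real I)"
  proof -
    have "(\<Sum>x<N. Z x - of_real I) = of_real ((\<Sum>j<N. pois_poly R E \<eta> n (lam j)) - N * I)"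
      unfolding sum_subtractf ZQ by simp
    then show ?thesis by (simp only: norm_of_real)
  qed
  also have "\<dots> \<le> (\<Sum>x<N. cmod (Z x - of_real I))"
    by (rule norm_sum)
  also have "\<dots> \<le> (\<Sum>x<N. 2 * \<tau> + (if x \<in> bad r then 32 * R / \<eta>\<^sup>2 else 0))"
  proof (rule sum_mono)
    fix x assume "x \<in> {..<N}"
    then show "cmod (Z x - of_real I) \<le> 2 * \<tau> + (if x \<in> bad r then 32 * R / \<eta>\<^sup>2 else 0)"
      using good[of x] qI Zb[of x] \<tau>(1) by (cases "x \<in> bad r") auto
  qed
  also have "\<dots> = 2 * N * \<tau> + card (bad r) * (32 * R / \<eta>\<^sup>2)"
  proof -
    have "{x. x < N \<and> x \<in> bad r} = bad r" using bad_subset by auto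
    then have "{..<N} \<inter> {x. x \<in> bad r} = bad r" by auto
    then have "(\<Sum>x<N. if x \<in> bad r then 32 * R / \<eta>\<^sup>2 else 0) = card (bad r) * (32 * R / \<eta>\<^sup>2)"
      by (subst sum.If_cases) simp_all
    then show ?thesis
      by (simp add: sum.distrib)
  qed
  finally have 1: "\<bar>(\<Sum>j<N. pois_poly R E \<eta> n (lam j)) - N * I\<bar> \<le> 2 * N * \<tau> + card (bad r) * (32 * R / \<eta>\<^sup>2)" .
  have "\<bar>(\<Sum>j<N. poisson E \<eta> (lam j)) - (\<Sum>j<N. pois_poly R E \<eta> n (lam j))\<bar> \<le> (\<Sum>j<N. 2 * \<tau>)"
    unfolding sum_subtractf[symmetric]
  proof (rule order.trans[OF sum_abs sum_mono])
    fix j assume "j \<in> {..<N}"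
    then show "\<bar>poisson E \<eta> (lam j) - pois_poly R E \<eta> n (lam j)\<bar> \<le> 2 * \<tau>"
      using pois_poly_bounds[OF R1 \<eta> eigen(3), of j E n] by (simp add: \<tau>_def)
  qed
  then have 2: "\<bar>(\<Sum>j<N. poisson E \<eta> (lam j)) - (\<Sum>j<N. pois_poly R E \<eta> n (lam j))\<bar> \<le> 2 * N * \<tau>"
    by simp
  show ?thesis
    unfolding I_def[symmetric] \<tau>_def[symmetric] using 1 2 by linarith
qed

text \<open>At scale \<open>\<eta>\<close> the total Poisson mass is at least
  \<open>N / C0 - N / (4 * C0)\<close>. By \<open>poisson_tail\<close> the mass from outside the
  window is at most \<open>2 / M\<close> times the mass at scale \<open>M * \<eta>\<close>, and
  \<open>M = 16 * C0^2\<close> makes this \<open>N / (4 * C0)\<close>. Each eigenvalue inside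
  contributes at most \<open>1 / \<eta>\<close>.\<close>

lemma window_count:
  fixes C0 M \<eta> E :: real
  assumes C0: "C0 \<ge> 1" and M: "M = 16 * C0\<^sup>2" and \<eta>: "0 < \<eta>" "M * \<eta> \<le> 1"
    and d: "\<And>g. g \<in> ks p \<Longrightarrow> wl g \<le> d" and r: "n * d \<le> 2 * r"
    and ac: "\<And>h. 0 < h \<Longrightarrow> h \<le> 1 \<Longrightarrow> 1 / C0 \<le> Re (Im_resolvent G p (Complex E h) \<one> \<one>) \<and>
        Re (Im_resolvent G p (Complex E h) \<one> \<one>) \<le> C0"
    and err: "4 * real N * tail_err R \<eta> n + card (bad r) * (32 * R / \<eta>\<^sup>2) \<le> real N / (4 * C0)"
  shows "real N * \<eta> / (2 * C0) \<le> card {j. j < N \<and> lam j \<in> window E (M * \<eta>)}"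
proof -
  have C2: "C0\<^sup>2 \<ge> 1" using C0 by simp
  have M1: "M \<ge> 1" using C2 M by linarith
  have M\<eta>: "0 < M * \<eta>" "\<eta> \<le> M * \<eta>"
    using M1 \<eta> mult_right_mono[of 1 M \<eta>] by auto
  then have \<eta>1: "\<eta> \<le> 1" using \<eta>(2) by linarith
  define W where "W = {j. j < N \<and> lam j \<in> window E (M * \<eta>)}"
  define err' where "err' = (\<lambda>h. 4 * real N * tail_err R h n + card (bad r) * (32 * R / h\<^sup>2))"
  have "tail_err R (M * \<eta>) n \<le> tail_err R \<eta> n"
    unfolding tail_err_def
    using R1 \<eta> M\<eta> by (intro mult_mono divide_left_mono power_mono) (auto simp: divide_right_mono mult_right_mono)
  moreover have "32 * R / (M * \<eta>)\<^sup>2 \<le> 32 * R / \<eta>\<^sup>2"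
    using R1 \<eta> M\<eta> by (intro divide_left_mono power_mono) auto
  ultimately have "err' (M * \<eta>) \<le> err' \<eta>"
    unfolding err'_def by (intro add_mono mult_left_mono) auto
  then have err2: "err' (M * \<eta>) \<le> real N / (4 * C0)" "err' \<eta> \<le> real N / (4 * C0)"
    using err by (auto simp: err'_def)
  have "1 / (4 * C0) \<le> C0"
  proof -
    have "1 / (4 * C0) \<le> 1 / 1" using C0 by (intro divide_left_mono) auto
    then show ?thesis using C0 by linarith
  qed
  then have NC: "real N / (4 * C0) \<le> real N * C0"
    using mult_left_mono[of "1 / (4 * C0)" C0 "real N"] by simp
  have F1: "(\<Sum>j<N. poisson E \<eta> (lam j)) \<ge> real N / C0 - real N / (4 * C0)"
  proof -
    have "real N * (1 / C0) \<le> real N * Re (Im_resolvent G p (Complex E \<eta>) \<one> \<one>)"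
      using ac[OF \<eta>(1) \<eta>1] by (intro mult_left_mono) auto
    then show ?thesis
      using pois_count[OF \<eta>(1) \<eta>1 d r, of E] err2(2) by (simp add: err'_def abs_le_iff)
  qed
  have F2: "(\<Sum>j<N. poisson E (M * \<eta>) (lam j)) \<le> 2 * (real N * C0)"
  proof -
    have "real N * Re (Im_resolvent G p (Complex E (M * \<eta>)) \<one> \<one>) \<le> real N * C0"
      using ac[OF M\<eta>(1) \<eta>(2)] by (intro mult_left_mono) auto
    then show ?thesis
      using pois_count[OF M\<eta>(1) \<eta>(2) d r, of E] err2(1) NC by (simp add: err'_def abs_le_iff)
  qed
  have pt: "poisson E \<eta> (lam j) \<le> (if j \<in> W then 1 / \<eta> else 0) + 2 / M * poisson E (M * \<eta>) (lam j)"
    if j: "j < N" for j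
  proof (cases "j \<in> W")
    case True
    have "0 \<le> 2 / M * poisson E (M * \<eta>) (lam j)"
      using poisson_pos[OF M\<eta>(1), of E "lam j"] M1 by simp
    then show ?thesis using True poisson_le[OF \<eta>(1), of E "lam j"] by simp
  next
    case False
    then have "\<bar>lam j - E\<bar> > M * \<eta>"
      using j unfolding W_def window_def by auto
    then show ?thesis using False poisson_tail[OF \<eta>(1) M1, of "lam j" E] by simp
  qed
  have "{..<N} \<inter> {j. j \<in> W} = W" unfolding W_def by blast
  then have W0: "(\<Sum>j<N. if j \<in> W then 1 / \<eta> else 0) = card W * (1 / \<eta>)"
    by (subst sum.If_cases) simp_all
  have "(\<Sum>j<N. poisson E \<eta> (lam j)) \<le> (\<Sum>j<N. (if j \<in> W then 1 / \<eta> else 0) + 2 / M * poisson E (M * \<eta>) (lam j))"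
    by (rule sum_mono) (use pt in blast)
  then have "(\<Sum>j<N. poisson E \<eta> (lam j)) \<le> card W * (1 / \<eta>) + 2 / M * (\<Sum>j<N. poisson E (M * \<eta>) (lam j))"
    by (simp only: sum.distrib W0 sum_distrib_left)
  moreover have "2 / M * (\<Sum>j<N. poisson E (M * \<eta>) (lam j)) \<le> 2 / M * (2 * (real N * C0))"
    by (rule mult_left_mono[OF F2]) (use M1 in simp)
  ultimately have W1: "(\<Sum>j<N. poisson E \<eta> (lam j)) \<le> card W * (1 / \<eta>) + 2 / M * (2 * (real N * C0))"
    by linarith
  have W2: "2 / M * (2 * (real N * C0)) = real N / (4 * C0)"
    using C0 by (simp add: M power2_eq_square)
  have "real N / C0 - real N / (4 * C0) - real N / (4 * C0) \<le> card W * (1 / \<eta>)"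
    using F1 W1 unfolding W2 by linarith
  moreover have "real N / C0 - real N / (4 * C0) - real N / (4 * C0) = real N / (2 * C0)"
    using C0 by (simp add: field_simps)
  ultimately have "real N / (2 * C0) * \<eta> \<le> card W * (1 / \<eta>) * \<eta>"
    using \<eta>(1) by (intro mult_right_mono) auto
  then show ?thesis
    using \<eta>(1) by (simp add: W_def)
qed

end

section \<open>Local observables\<close>

locale local_obs = perm_rep G S p R N act \<phi>
  for G :: "('g, 'm) monoid_scheme" (structure) and S p R N act \<phi> +
  fixes T :: "'g set" and K :: "complex mat"
  assumes T: "T \<subseteq> carrier G" "finite T"
    and K_local: "local_mat N act T K" and K_norm: "norm_one_inf K \<le> 1"
begin

lemma K_carrier: "K \<in> carrier_mat N N"
  using K_local by (simp add: local_mat_def)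

lemma K_le_1: "x < N \<Longrightarrow> y < N \<Longrightarrow> cmod (K $$ (x, y)) \<le> 1"
proof -
  assume "x < N" "y < N"
  then have "K $$ (x, y) \<in> elements_mat K"
    using K_carrier by blast
  moreover have "finite (elements_mat K)"
    by (simp add: elements_mat_def)
  ultimately have "cmod (K $$ (x, y)) \<le> norm_one_inf K"
    unfolding norm_one_inf_def by (intro Max_ge) auto
  with K_norm show ?thesis by simp
qed

definition kmean :: "'g \<Rightarrow> complex" where
  "kmean t = (1 / of_nat N) * (\<Sum>x\<in>{0..<N}. obs_vec N act K t $ x)"

text \<open>The centred symbol; its mean over the points is 0 (\<open>sum_Kc\<close>), which places
  it in the space where strong convergence speaks.\<close>

definition Kc :: "'g \<Rightarrow> nat \<Rightarrow> complex" where
  "Kc t x = K $$ (act t x, x) - kmean t"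

lemma obs_symbol_lookup: "lk (obs_symbol N act T K) t = (if t \<in> T then kmean t else 0)"
proof -
  have "lk (obs_symbol N act T K) t = (\<Sum>s\<in>T. if s = t then kmean s else 0)"
    unfolding obs_symbol_def lookup_sum lookup_single when_def kmean_def ..
  then show ?thesis by (simp add: sum.delta T(2))
qed

lemma obs_symbol_keys: "ks (obs_symbol N act T K) \<subseteq> T"
  by (auto simp: in_keys_iff obs_symbol_lookup split: if_splits)

lemma kmean_eq: "t \<in> T \<Longrightarrow> kmean t = (\<Sum>x<N. K $$ (act t x, x)) / of_nat N"
  by (simp add: kmean_def obs_vec_def atLeast0LessThan)

lemma kmean_le_1: "t \<in> T \<Longrightarrow> cmod (kmean t) \<le> 1"
proof -
  assume t: "t \<in> T"
  then have "cmod (\<Sum>x<N. K $$ (act t x, x)) \<le> (\<Sum>x<N. 1)"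
    using T by (intro order.trans[OF norm_sum] sum_mono K_le_1 act_less) auto
  then show ?thesis
    using N0 t by (simp add: kmean_eq norm_divide)
qed

lemma Kc_le_2: "t \<in> T \<Longrightarrow> x < N \<Longrightarrow> cmod (Kc t x) \<le> 2"
  using norm_triangle_ineq4[of "K $$ (act t x, x)" "kmean t"] kmean_le_1[of t] K_le_1[of "act t x" x] act_less[of t x] T
  unfolding Kc_def by fastforce

lemma sum_Kc: "t \<in> T \<Longrightarrow> (\<Sum>x<N. Kc t x) = 0"
  using N0 by (simp add: Kc_def sum_subtractf kmean_eq)

definition Kdev :: "nat l2 \<Rightarrow> nat l2" where
  "Kdev f = mop N K f - F.lop (obs_symbol N act T K) f"

text \<open>Several elements of \<open>T\<close> may lead from \<open>x\<close> to the same point,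
  and then \<open>Lop\<close> counts one matrix entry repeatedly. The difference collected here
  lives on the columns at bad points (\<open>Kerr_good\<close>).\<close>

definition Kerr :: "nat l2 \<Rightarrow> nat l2" where
  "Kerr f = Kdev f - Lop T Kc f"

lemma clin_diff: "clin A \<Longrightarrow> clin B \<Longrightarrow> clin (\<lambda>f. A f - B f)"
  unfolding clin_def by (auto intro!: l2_eqI simp: algebra_simps)

lemma clin_Kdev: "clin Kdev"
  unfolding Kdev_def using obs_symbol_keys T by (intro clin_diff clin_mop F.clin_lop) auto

lemma clin_Kerr: "clin Kerr"
  unfolding Kerr_def by (intro clin_diff[of Kdev] clin_Kdev clin_Lop T)

lemma obs_dev_eq:
  assumes "j < N" "k < N"
  shows "obs_dev N act T K (\<phi> k) (\<phi> j) = (cmod (cinner (ev k) (Kdev (ev j))))\<^sup>2"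
proof -
  have Km: "obs_mean N act T K \<in> carrier_mat N N"
    by (simp add: obs_mean_def perm_rep_ga_def)
  have ksT: "ks (obs_symbol N act T K) \<subseteq> carrier G"
    using obs_symbol_keys T by blast
  have "cv_inner (\<phi> k) (M *\<^sub>v \<phi> j) = cinner (ev k) (mop N M (ev j))" if "M \<in> carrier_mat N N" for M
    using that \<phi>_carrier assms
    by (subst cv_inner_vl[of _ N]) (auto simp: vl_mult_mat_vec ev_def)
  moreover have "mop N (obs_mean N act T K) (ev j) = F.lop (obs_symbol N act T K) (ev j)"
    unfolding obs_mean_def by (rule perm_rep_ga_vl[OF F.gact_axioms ksT])
  moreover have "cinner f (g - h) = cinner f g - cinner f h" for f g h :: "nat l2"
    using cinner_add_right[of f "g - h" h] by simp
  ultimately show ?thesis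
    unfolding obs_dev_def Kdev_def using K_carrier Km by simp
qed

lemma norm_sum_cscale_delta:
  assumes "\<And>t. t \<in> T \<Longrightarrow> cmod (a t) \<le> 1"
  shows "norm (\<Sum>t\<in>T. cscale (a t) (l2_delta (b t))) \<le> card T"
proof -
  have "norm (\<Sum>t\<in>T. cscale (a t) (l2_delta (b t))) \<le> (\<Sum>t\<in>T. 1)"
    by (intro order.trans[OF norm_sum] sum_mono) (use assms in \<open>simp add: norm_cscale\<close>)
  then show ?thesis by simp
qed

text \<open>By locality a column has nonzero entries only at the at most \<open>card T\<close>
  points reached from \<open>x\<close>, each of modulus at most 1.\<close>

lemma norm_mop_delta:
  assumes "x < N"
  shows "norm (mop N K (l2_delta x)) \<le> card T"
proof (cases "T = {}")
  case True
  then have "mop N K (l2_delta x) = 0"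
    using K_local assms by (intro l2_eqI) (auto simp: local_mat_def intro!: sum.neutral)
  then show ?thesis by simp
next
  case False
  have "(norm (mop N K (l2_delta x)))\<^sup>2 = (\<Sum>y<N. (cmod (K $$ (y, x)))\<^sup>2)"
    unfolding norm_sq_finite[OF mop_on] by (intro sum.cong refl) (simp only: lessThan_iff mop_delta assms)
  also have "\<dots> = (\<Sum>y\<in>(\<lambda>t. act t x) ` T. (cmod (K $$ (y, x)))\<^sup>2)"
    by (rule sum.mono_neutral_right)
      (use K_local assms T act_less in \<open>auto simp: local_mat_def image_iff subset_iff\<close>)
  also have "\<dots> \<le> (\<Sum>y\<in>(\<lambda>t. act t x) ` T. 1)"
    by (intro sum_mono power_le_one K_le_1) (use assms T act_less in auto)
  also have "\<dots> \<le> card T"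
    using card_image_le[OF T(2), of "\<lambda>t. act t x"] by simp
  also have "\<dots> \<le> (real (card T))\<^sup>2"
    using False T(2) by (simp add: power2_eq_square Suc_le_eq card_gt_0_iff)
  finally show ?thesis
    by (simp add: power2_le_iff_abs_le)
qed

lemma Kdev_delta_norm:
  assumes "x < N"
  shows "norm (Kdev (l2_delta x)) \<le> 2 * real (card T)"
proof -
  have "F.lop (obs_symbol N act T K) (l2_delta x) = (\<Sum>t\<in>T. cscale (kmean t) (l2_delta (act t x)))"
    using assms T by (subst F.lop_superset[OF T(2) obs_symbol_keys], intro sum.cong refl)
      (auto simp: obs_symbol_lookup F.shift_delta subset_iff)
  then have "norm (F.lop (obs_symbol N act T K) (l2_delta x)) \<le> card T"
    using norm_sum_cscale_delta[OF kmean_le_1] by simp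
  then show ?thesis
    unfolding Kdev_def using norm_mop_delta[OF assms]
      norm_triangle_ineq4[of "mop N K (l2_delta x)" "F.lop (obs_symbol N act T K) (l2_delta x)"] by linarith
qed

lemma Kerr_delta:
  assumes "x < N"
  shows "Kerr (l2_delta x) = mop N K (l2_delta x) - (\<Sum>t\<in>T. cscale (K $$ (act t x, x)) (l2_delta (act t x)))"
proof -
  have "F.lop (obs_symbol N act T K) (l2_delta x) + Lop T Kc (l2_delta x) =
      (\<Sum>t\<in>T. cscale (kmean t) (l2_delta (act t x)) + cscale (Kc t x) (l2_delta (act t x)))"
    unfolding Lop_delta[OF T(1) assms] sum.distrib
    using assms T by (subst F.lop_superset[OF T(2) obs_symbol_keys], intro arg_cong2[where f = "(+)"] sum.cong refl)
      (auto simp: obs_symbol_lookup F.shift_delta subset_iff)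
  also have "\<dots> = (\<Sum>t\<in>T. cscale (K $$ (act t x, x)) (l2_delta (act t x)))"
    by (intro sum.cong refl l2_eqI) (simp add: Kc_def)
  finally show ?thesis
    by (simp add: Kerr_def Kdev_def algebra_simps)
qed

lemma Kerr_delta_norm:
  assumes "x < N"
  shows "norm (Kerr (l2_delta x)) \<le> 2 * real (card T)"
proof -
  have "norm (\<Sum>t\<in>T. cscale (K $$ (act t x, x)) (l2_delta (act t x))) \<le> card T"
    by (rule norm_sum_cscale_delta) (use assms T act_less K_le_1 in auto)
  then show ?thesis
    unfolding Kerr_delta[OF assms] using norm_mop_delta[OF assms]
      norm_triangle_ineq4[of "mop N K (l2_delta x)" "\<Sum>t\<in>T. cscale (K $$ (act t x, x)) (l2_delta (act t x))"]
    by linarith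
qed

lemma Kerr_good:
  assumes x: "x < N" "x \<notin> bad r" and d: "\<And>t. t \<in> T \<Longrightarrow> wl t \<le> r"
  shows "Kerr (l2_delta x) = 0"
proof (rule l2_eqI)
  fix y
  have inj: "act t x = act s x \<longleftrightarrow> t = s" if "t \<in> T" "s \<in> T" for t s
    using that T d[of t] d[of s] by (intro good_eq[OF x]) auto
  have "l2_at (mop N K (l2_delta x)) y = (\<Sum>t\<in>T. K $$ (act t x, x) * (if y = act t x then 1 else 0))"
  proof (cases "\<exists>t\<in>T. y = act t x")
    case True
    then obtain s where s: "s \<in> T" "y = act s x" by blast
    then have y: "y < N" using act_less x T by auto
    have "(\<Sum>t\<in>T. K $$ (act t x, x) * (if y = act t x then 1 else 0)) =
        (\<Sum>t\<in>T. if t = s then K $$ (act t x, x) else 0)"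
      by (intro sum.cong refl) (use s inj in auto)
    also have "\<dots> = K $$ (y, x)"
      using s T(2) by (simp add: sum.delta)
    finally show ?thesis
      using mop_delta[OF x(1) y, of K] by simp
  next
    case False
    have "l2_at (mop N K (l2_delta x)) y = 0"
    proof (cases "y < N")
      case True
      then show ?thesis
        using mop_delta[OF x(1) True, of K] False K_local x by (auto simp: local_mat_def)
    qed simp
    moreover have "(\<Sum>t\<in>T. K $$ (act t x, x) * (if y = act t x then 1 else 0)) = 0"
      by (rule sum.neutral) (use False in auto)
    ultimately show ?thesis by simp
  qed
  then show "l2_at (Kerr (l2_delta x)) y = l2_at 0 y"
    unfolding Kerr_delta[OF x(1)] by simp
qed

lemma hs_expand:
  assumes "clin A" "\<And>f. l2_on {0..<N} f \<Longrightarrow> l2_on {0..<N} (A f)"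
  shows "(\<Sum>j<N. \<Sum>k<N. (cmod (cinner (ev k) (A (ev j))))\<^sup>2) = (\<Sum>x<N. (norm (A (l2_delta x)))\<^sup>2)"
  unfolding hs_basis[OF assms(1)]
  by (intro sum.cong refl parseval[symmetric] assms(2) e_on) simp

lemma l2_on_diff: "l2_on X f \<Longrightarrow> l2_on X g \<Longrightarrow> l2_on X (f - g)"
  by (simp add: l2_on_def)

lemma Kdev_on: "l2_on {0..<N} (Kdev f)"
  unfolding Kdev_def using obs_symbol_keys T by (intro l2_on_diff mop_on F.lop_on) auto

lemma Kerr_on: "l2_on {0..<N} (Kerr f)"
  unfolding Kerr_def by (intro l2_on_diff Kdev_on Lop_on T)

text \<open>The trivial bound by the Hilbert--Schmidt norm; it suffices whenever the claimed bound
  is of order one.\<close>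

lemma obs_dev_total: "(\<Sum>j<N. \<Sum>k<N. obs_dev N act T K (\<phi> k) (\<phi> j)) \<le> N * (2 * real (card T))\<^sup>2"
proof -
  have "(\<Sum>j<N. \<Sum>k<N. obs_dev N act T K (\<phi> k) (\<phi> j)) = (\<Sum>x<N. (norm (Kdev (l2_delta x)))\<^sup>2)"
    unfolding hs_expand[OF clin_Kdev Kdev_on, symmetric] by (intro sum.cong refl) (simp add: obs_dev_eq)
  also have "\<dots> \<le> (\<Sum>x<N. (2 * real (card T))\<^sup>2)"
    by (intro sum_mono power_mono Kdev_delta_norm) auto
  finally show ?thesis by simp
qed

lemma obs_dev_nonneg: "0 \<le> obs_dev N act T K u v"
  by (simp add: obs_dev_def)

lemma obs_dev_subset:
  assumes "A1 \<subseteq> {..<N}" "A2 \<subseteq> {..<N}"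
  shows "(\<Sum>j\<in>A1. \<Sum>k\<in>A2. obs_dev N act T K (\<phi> k) (\<phi> j)) \<le> N * (2 * real (card T))\<^sup>2"
proof -
  have "(\<Sum>j\<in>A1. \<Sum>k\<in>A2. obs_dev N act T K (\<phi> k) (\<phi> j)) \<le> (\<Sum>j\<in>A1. \<Sum>k<N. obs_dev N act T K (\<phi> k) (\<phi> j))"
    by (intro sum_mono sum_mono2) (use assms obs_dev_nonneg in auto)
  also have "\<dots> \<le> (\<Sum>j<N. \<Sum>k<N. obs_dev N act T K (\<phi> k) (\<phi> j))"
    by (intro sum_mono2) (use assms obs_dev_nonneg in \<open>auto intro!: sum_nonneg\<close>)
  also note obs_dev_total
  finally show ?thesis .
qed

text \<open>The kernels are at least \<open>1 / (5 * \<eta>)\<close> on the windows, which gives the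
  factor \<open>25 * \<eta>^2\<close>; splitting the deviation into \<open>Lop T Kc\<close> and
  \<open>Kerr\<close> doubles it to 50. The factor \<open>4 * N\<close> is the product of two norms
  of centred symbols, each at most \<open>2 * sqrt N\<close>.\<close>

lemma window_bound:
  fixes \<eta> \<Omega> E1 E2 :: real
  assumes \<eta>: "0 < \<eta>" "\<eta> \<le> 1" and len: "\<And>g. g \<in> ks p \<Longrightarrow> wl g \<le> d" "\<And>t. t \<in> T \<Longrightarrow> wl t \<le> d"
    and r: "n * d + d \<le> r"
    and A1: "A1 \<subseteq> {j. j < N \<and> \<bar>lam j - E1\<bar> \<le> 2 * \<eta>}" and A2: "A2 \<subseteq> {j. j < N \<and> \<bar>lam j - E2\<bar> \<le> 2 * \<eta>}"
    and \<Omega>: "\<And>t s. t \<in> T \<Longrightarrow> s \<in> T \<Longrightarrow>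
      cmod (cinner (fl N (Kc t)) (F.lop (cross (ga_pois G R p E1 \<eta> n) (ga_pois G R p E2 \<eta> n) t s) (fl N (Kc s)))) \<le>
      \<Omega> * (norm (fl N (Kc t)) * norm (fl N (Kc s)))" "0 \<le> \<Omega>"
  shows "(\<Sum>j\<in>A1. \<Sum>k\<in>A2. obs_dev N act T K (\<phi> k) (\<phi> j)) \<le>
    50 * \<eta>\<^sup>2 * ((card T)\<^sup>2 * (\<Omega> * (4 * real N)) + card (bad r) * (2 * (real (card T) * 2 * (12 * R / \<eta>\<^sup>2))\<^sup>2))
    + 8 * (real (card T))\<^sup>2 * card (bad r)"
proof -
  define q1 q2 where "q1 = ga_pois G R p E1 \<eta> n" and "q2 = ga_pois G R p E2 \<eta> n"
  have q: "ks q1 \<subseteq> carrier G" "ks q2 \<subseteq> carrier G"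
    unfolding q1_def q2_def by (intro carrier_ga_pois p_carrier)+
  have ql: "g \<in> ks q1 \<union> ks q2 \<Longrightarrow> wl g \<le> n * d" for g
    using keys_ga_pois[OF p_carrier len(1), of R E1 \<eta> n] keys_ga_pois[OF p_carrier len(1), of R E2 \<eta> n]
    by (auto simp: q1_def q2_def)
  have A: "A1 \<subseteq> {..<N}" "A2 \<subseteq> {..<N}" using A1 A2 by auto
  define a b where "a = (\<lambda>j k. (cmod (cinner (ev k) (Lop T Kc (ev j))))\<^sup>2)"
    and "b = (\<lambda>j k. (cmod (cinner (ev k) (Kerr (ev j))))\<^sup>2)"
  have M: "norm (F.lop q v) \<le> 12 * R / \<eta>\<^sup>2 * norm v" if "l2_on {0..<N} v" "q = q1 \<or> q = q2" for q v
    using F.norm_lop_ga_pois[OF \<eta> that(1)] that(2) by (auto simp: q1_def q2_def)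
  have M': "norm (L.lop q (l2_delta \<one>)) \<le> 12 * R / \<eta>\<^sup>2" if "q = q1 \<or> q = q2" for q
    using L.norm_lop_ga_pois[OF \<eta> l2_on_delta[OF one_closed]] that by (auto simp: q1_def q2_def)
  have "1 / (5 * \<eta>) \<le> pois_poly R E1 \<eta> n (lam j)" if "j \<in> A1" for j
    using A1 that pois_poly_bounds(1)[OF R1 \<eta> eigen(3), of j E1 n] poisson_window[OF \<eta>(1), of "lam j" E1] by fastforce
  moreover have "1 / (5 * \<eta>) \<le> pois_poly R E2 \<eta> n (lam j)" if "j \<in> A2" for j
    using A2 that pois_poly_bounds(1)[OF R1 \<eta> eigen(3), of j E2 n] poisson_window[OF \<eta>(1), of "lam j" E2] by fastforce
  ultimately have "(1 / (5 * \<eta>))\<^sup>2 * (\<Sum>j\<in>A1. \<Sum>k\<in>A2. a j k) \<le>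
      cmod (\<Sum>x<N. cinner (Lop T Kc (F.lop q1 (l2_delta x))) (F.lop q2 (Lop T Kc (l2_delta x))))"
    unfolding a_def q1_def q2_def using \<eta>(1)
    by (intro window_trace \<eta> clin_Lop Lop_on T A) auto
  also have "\<dots> \<le> (\<Sum>t\<in>T. \<Sum>s\<in>T. cmod (cinner (fl N (Kc t)) (F.lop (cross q1 q2 t s) (fl N (Kc s))))) +
      card (bad r) * (2 * (real (card T) * 2 * (12 * R / \<eta>\<^sup>2))\<^sup>2)"
  proof (rule trace_bound[OF T q])
    show "\<And>t. t \<in> T \<Longrightarrow> wl t \<le> d" by (rule len(2))
    show "\<And>g. g \<in> ks q1 \<union> ks q2 \<Longrightarrow> wl g \<le> n * d" by (rule ql)
    show "n * d + d \<le> r" by (rule r)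
    show "norm (F.lop q1 v) \<le> 12 * R / \<eta>\<^sup>2 * norm v" if "l2_on {0..<N} v" for v
      using M[OF that, of q1] by blast
    show "norm (F.lop q2 v) \<le> 12 * R / \<eta>\<^sup>2 * norm v" if "l2_on {0..<N} v" for v
      using M[OF that, of q2] by blast
    show "norm (L.lop q1 (l2_delta \<one>)) \<le> 12 * R / \<eta>\<^sup>2" using M'[of q1] by blast
    show "norm (L.lop q2 (l2_delta \<one>)) \<le> 12 * R / \<eta>\<^sup>2" using M'[of q2] by blast
    show "\<And>t x. t \<in> T \<Longrightarrow> x < N \<Longrightarrow> cmod (Kc t x) \<le> 2" by (rule Kc_le_2)
  qed simp
  finally have s1: "(1 / (5 * \<eta>))\<^sup>2 * (\<Sum>j\<in>A1. \<Sum>k\<in>A2. a j k) \<le>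
      (\<Sum>t\<in>T. \<Sum>s\<in>T. cmod (cinner (fl N (Kc t)) (F.lop (cross q1 q2 t s) (fl N (Kc s))))) +
      card (bad r) * (2 * (real (card T) * 2 * (12 * R / \<eta>\<^sup>2))\<^sup>2)" .
  have "(\<Sum>t\<in>T. \<Sum>s\<in>T. cmod (cinner (fl N (Kc t)) (F.lop (cross q1 q2 t s) (fl N (Kc s))))) \<le>
      (\<Sum>t\<in>T. \<Sum>s\<in>T. \<Omega> * (4 * real N))"
  proof (intro sum_mono)
    fix t s assume ts: "t \<in> T" "s \<in> T"
    have "norm (fl N (Kc t)) * norm (fl N (Kc s)) \<le> (2 * sqrt N) * (2 * sqrt N)"
      by (intro mult_mono norm_fl_le Kc_le_2 ts) auto
    then have "norm (fl N (Kc t)) * norm (fl N (Kc s)) \<le> 4 * real N" by simp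
    then have "\<Omega> * (norm (fl N (Kc t)) * norm (fl N (Kc s))) \<le> \<Omega> * (4 * real N)"
      by (rule mult_left_mono[OF _ \<Omega>(2)])
    then show "cmod (cinner (fl N (Kc t)) (F.lop (cross q1 q2 t s) (fl N (Kc s)))) \<le> \<Omega> * (4 * real N)"
      using \<Omega>(1)[OF ts] by (simp add: q1_def q2_def)
  qed
  then have s2: "(\<Sum>t\<in>T. \<Sum>s\<in>T. cmod (cinner (fl N (Kc t)) (F.lop (cross q1 q2 t s) (fl N (Kc s))))) \<le>
      (card T)\<^sup>2 * (\<Omega> * (4 * real N))"
    by (simp add: power2_eq_square)
  define Y where "Y = (card T)\<^sup>2 * (\<Omega> * (4 * real N)) + card (bad r) * (2 * (real (card T) * 2 * (12 * R / \<eta>\<^sup>2))\<^sup>2)"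
  have "(1 / (5 * \<eta>))\<^sup>2 * (\<Sum>j\<in>A1. \<Sum>k\<in>A2. a j k) \<le> Y"
    unfolding Y_def by (rule order.trans[OF s1 add_right_mono[OF s2]])
  then have "(25 * \<eta>\<^sup>2) * ((1 / (5 * \<eta>))\<^sup>2 * (\<Sum>j\<in>A1. \<Sum>k\<in>A2. a j k)) \<le> (25 * \<eta>\<^sup>2) * Y"
    by (rule mult_left_mono) simp
  moreover have "(25 * \<eta>\<^sup>2) * (1 / (5 * \<eta>))\<^sup>2 = 1"
    using \<eta>(1) by (simp add: power2_eq_square)
  ultimately have aa: "(\<Sum>j\<in>A1. \<Sum>k\<in>A2. a j k) \<le> (25 * \<eta>\<^sup>2) * Y"
    by (simp only: mult.assoc[symmetric] mult_1_left)
  have "(\<Sum>j\<in>A1. \<Sum>k\<in>A2. b j k) \<le> (\<Sum>j<N. \<Sum>k<N. b j k)"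
  proof -
    have "(\<Sum>j\<in>A1. \<Sum>k\<in>A2. b j k) \<le> (\<Sum>j\<in>A1. \<Sum>k<N. b j k)"
      by (intro sum_mono sum_mono2) (use A in \<open>auto simp: b_def\<close>)
    also have "\<dots> \<le> (\<Sum>j<N. \<Sum>k<N. b j k)"
      by (intro sum_mono2) (use A in \<open>auto simp: b_def intro!: sum_nonneg\<close>)
    finally show ?thesis .
  qed
  also have "\<dots> = (\<Sum>x<N. (norm (Kerr (l2_delta x)))\<^sup>2)"
    unfolding b_def by (rule hs_expand[OF clin_Kerr Kerr_on])
  also have "\<dots> = (\<Sum>x\<in>bad r. (norm (Kerr (l2_delta x)))\<^sup>2)"
  proof (rule sum.mono_neutral_right)
    show "\<forall>x\<in>{..<N} - bad r. (norm (Kerr (l2_delta x)))\<^sup>2 = 0"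
    proof
      fix x assume "x \<in> {..<N} - bad r"
      moreover have "wl t \<le> r" if "t \<in> T" for t using len(2)[OF that] r by linarith
      ultimately have "Kerr (l2_delta x) = 0" by (intro Kerr_good[of x r]) auto
      then show "(norm (Kerr (l2_delta x)))\<^sup>2 = 0" by simp
    qed
  qed (use bad_subset in auto)
  also have "\<dots> \<le> (\<Sum>x\<in>bad r. (2 * real (card T))\<^sup>2)"
    by (intro sum_mono power_mono Kerr_delta_norm) (use bad_subset[of r] in auto)
  finally have bb: "(\<Sum>j\<in>A1. \<Sum>k\<in>A2. b j k) \<le> card (bad r) * (2 * real (card T))\<^sup>2"
    by simp
  have "(\<Sum>j\<in>A1. \<Sum>k\<in>A2. obs_dev N act T K (\<phi> k) (\<phi> j)) \<le> (\<Sum>j\<in>A1. \<Sum>k\<in>A2. 2 * a j k + 2 * b j k)"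
  proof (intro sum_mono)
    fix j k assume jk: "j \<in> A1" "k \<in> A2"
    have "Kdev (ev j) = Lop T Kc (ev j) + Kerr (ev j)" by (simp add: Kerr_def)
    then have "obs_dev N act T K (\<phi> k) (\<phi> j) =
        (cmod (cinner (ev k) (Lop T Kc (ev j)) + cinner (ev k) (Kerr (ev j))))\<^sup>2"
      using jk A by (subst obs_dev_eq) (auto simp: cinner_add_right)
    also have "\<dots> \<le> 2 * a j k + 2 * b j k"
      unfolding a_def b_def by (rule cmod_add_sq_le)
    finally show "obs_dev N act T K (\<phi> k) (\<phi> j) \<le> 2 * a j k + 2 * b j k" .
  qed
  also have "\<dots> = 2 * (\<Sum>j\<in>A1. \<Sum>k\<in>A2. a j k) + 2 * (\<Sum>j\<in>A1. \<Sum>k\<in>A2. b j k)"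
    by (simp add: sum.distrib sum_distrib_left)
  also have "\<dots> \<le> 2 * ((25 * \<eta>\<^sup>2) * Y) + 2 * (card (bad r) * (2 * real (card T))\<^sup>2)"
    by (rule add_mono[OF mult_left_mono[OF aa] mult_left_mono[OF bb]]) simp_all
  also have "\<dots> = 50 * \<eta>\<^sup>2 * Y + 8 * (real (card T))\<^sup>2 * card (bad r)"
    by (simp add: power_mult_distrib)
  finally show ?thesis unfolding Y_def .
qed

end

section \<open>Exceptional subspaces\<close>

lemma subspace_of_finite:
  assumes "finite A" "A \<subseteq> carrier_vec N"
  obtains H :: "complex vec set" where "subspace class_ring H (module_vec TYPE(complex) N)"
    "vectorspace.dim class_ring ((module_vec TYPE(complex) N)\<lparr>carrier := H\<rparr>) \<le> card A" "A \<subseteq> H"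
proof -
  interpret vec_space "TYPE(complex)" N .
  have sp: "subspace class_ring (span A) V" by (rule span_is_subspace[OF assms(2)])
  have vs: "vectorspace class_ring (vs (span A))" using sp by (rule subspace_is_vs)
  have AH: "A \<subseteq> span A" by (rule in_own_span[OF assms(2)])
  have sub: "submodule class_ring (span A) V" by (rule span_is_submodule[OF assms(2)])
  interpret W: vectorspace class_ring "vs (span A)" by (rule vs)
  have gen: "LinearCombinations.module.span class_ring (vs (span A)) A = carrier (vs (span A))"
    using span_li_not_depend(1)[OF AH sub] by simp
  have "W.dim \<le> card A"
    by (rule W.gen_ge_dim[OF assms(1) _ gen]) (use AH in simp)
  then show ?thesis using that sp AH by blast
qed

definition orthfam :: "nat \<Rightarrow> nat \<Rightarrow> (nat \<Rightarrow> nat l2) \<Rightarrow> bool" where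
  "orthfam N m f \<longleftrightarrow> (\<forall>i<m. l2_on {0..<N} (f i)) \<and>
     (\<forall>i<m. \<forall>j<m. cinner (f i) (f j) = (if i = j then 1 else 0))"

lemma bessel:
  assumes f: "orthfam N m f"
  shows "(\<Sum>i<m. (cmod (cinner (f i) v))\<^sup>2) \<le> (norm v)\<^sup>2"
proof -
  define u where "u = (\<Sum>i<m. cscale (cinner (f i) v) (f i))"
  define B where "B = (\<Sum>i<m. (cmod (cinner (f i) v))\<^sup>2)"
  have vu: "cinner v u = of_real B"
  proof -
    have "cinner v u = (\<Sum>i<m. cinner (f i) v * cinner v (f i))"
      unfolding u_def cinner_sum_right cinner_cscale_right ..
    also have "\<dots> = (\<Sum>i<m. of_real ((cmod (cinner (f i) v))\<^sup>2))"
      by (intro sum.cong refl) (simp only: cinner_commute[of v] complex_norm_square)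
    finally show ?thesis by (simp only: B_def of_real_sum)
  qed
  have fu: "cinner (f i) u = cinner (f i) v" if "i < m" for i
  proof -
    have "cinner (f i) u = (\<Sum>j<m. if j = i then cinner (f j) v else 0)"
      unfolding u_def cinner_sum_right cinner_cscale_right
      by (intro sum.cong refl) (use f that in \<open>auto simp: orthfam_def\<close>)
    then show ?thesis using that by simp
  qed
  have uu: "cinner u u = of_real B"
  proof -
    have "cinner u u = (\<Sum>i<m. cnj (cinner (f i) v) * cinner (f i) u)"
      by (subst (1) u_def) (simp only: cinner_sum_left cinner_cscale_left)
    also have "\<dots> = (\<Sum>i<m. of_real ((cmod (cinner (f i) v))\<^sup>2))"
      by (intro sum.cong refl) (simp add: fu cnj_mult_self)
    finally show ?thesis by (simp only: B_def of_real_sum)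
  qed
  have "0 \<le> inner (v - u) (v - u)" by simp
  also have "\<dots> = (norm v)\<^sup>2 - 2 * inner v u + inner u u"
    by (simp add: inner_diff_left inner_diff_right inner_commute power2_norm_eq_inner)
  also have "\<dots> = (norm v)\<^sup>2 - B"
    by (simp add: inner_l2_def vu uu)
  finally show ?thesis by (simp add: B_def)
qed

lemma orthfam_norm: "orthfam N m f \<Longrightarrow> i < m \<Longrightarrow> norm (f i) = 1"
  by (simp add: orthfam_def norm_eq_sqrt_inner inner_l2_def)

text \<open>Bessel's inequality applied to the columns of a self-adjoint operator: an orthonormal
  family sees no more than the Hilbert--Schmidt norm.\<close>

lemma orthfam_hs:
  assumes f: "orthfam N m f" and sa: "\<And>u v. cinner (A u) v = cinner u (A v)"
    and on: "\<And>v. l2_on {0..<N} v \<Longrightarrow> l2_on {0..<N} (A v)"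
  shows "(\<Sum>i<m. (norm (A (f i)))\<^sup>2) \<le> (\<Sum>x<N. (norm (A (l2_delta x)))\<^sup>2)"
proof -
  have "(\<Sum>i<m. (norm (A (f i)))\<^sup>2) = (\<Sum>i<m. \<Sum>x<N. (cmod (cinner (f i) (A (l2_delta x))))\<^sup>2)"
  proof (intro sum.cong refl)
    fix i assume "i \<in> {..<m}"
    then have "l2_on {0..<N} (A (f i))" using f on by (simp add: orthfam_def)
    then have "(norm (A (f i)))\<^sup>2 = (\<Sum>x<N. (cmod (l2_at (A (f i)) x))\<^sup>2)"
      by (rule norm_sq_finite)
    also have "\<dots> = (\<Sum>x<N. (cmod (cinner (f i) (A (l2_delta x))))\<^sup>2)"
    proof (intro sum.cong refl arg_cong[where f = "\<lambda>t. t\<^sup>2"])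
      fix x
      have "cinner (f i) (A (l2_delta x)) = cinner (A (f i)) (l2_delta x)"
        by (rule sa[symmetric])
      also have "\<dots> = cnj (cinner (l2_delta x) (A (f i)))"
        by (rule cinner_commute)
      finally show "cmod (l2_at (A (f i)) x) = cmod (cinner (f i) (A (l2_delta x)))"
        by (simp add: cinner_l2_delta)
    qed
    finally show "(norm (A (f i)))\<^sup>2 = (\<Sum>x<N. (cmod (cinner (f i) (A (l2_delta x))))\<^sup>2)" .
  qed
  also have "\<dots> = (\<Sum>x<N. \<Sum>i<m. (cmod (cinner (f i) (A (l2_delta x))))\<^sup>2)"
    by (rule sum.swap)
  also have "\<dots> \<le> (\<Sum>x<N. (norm (A (l2_delta x)))\<^sup>2)"
    by (intro sum_mono bessel[OF f])
  finally show ?thesis .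
qed

text \<open>\<open>orthfam_hs\<close> for the identity compares the number of vectors with the
  number of points.\<close>

lemma orthfam_le:
  assumes "orthfam N m f"
  shows "m \<le> N"
proof -
  have "(\<Sum>i<m. (norm (f i))\<^sup>2) \<le> (\<Sum>x<N. (norm (l2_delta x :: nat l2))\<^sup>2)"
    by (rule orthfam_hs[OF assms, of "\<lambda>f. f"]) simp_all
  then show ?thesis
    by (simp add: orthfam_norm[OF assms])
qed

text \<open>Takes the place of the span of the large singular vectors. The families have at most
  \<open>N\<close> members, so a longest one exists; a violating vector orthogonal to it could be
  normalized and appended.\<close>

lemma maximal_orthfam:
  assumes M: "\<And>c v. norm (M (c *\<^sub>R v)) = \<bar>c\<bar> * norm (M v :: nat l2)"
  obtains m f where "orthfam N m f" "\<And>i. i < m \<Longrightarrow> norm (M (f i)) > s"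
    "\<And>v. l2_on {0..<N} v \<Longrightarrow> (\<And>i. i < m \<Longrightarrow> cinner (f i) v = 0) \<Longrightarrow> norm (M v) \<le> s * norm v"
proof -
  define P where "P = (\<lambda>m. \<exists>f. orthfam N m f \<and> (\<forall>i<m. norm (M (f i)) > s))"
  have "P 0" by (auto simp: P_def orthfam_def)
  have bd: "\<And>m. P m \<Longrightarrow> m \<le> N" using orthfam_le by (auto simp: P_def)
  define m where "m = (GREATEST m. P m)"
  have "P m" unfolding m_def by (rule GreatestI_nat[of P 0 N]) (use \<open>P 0\<close> bd in auto)
  then obtain f where f: "orthfam N m f" "\<forall>i<m. norm (M (f i)) > s" by (auto simp: P_def)
  have "norm (M v) \<le> s * norm v" if v: "l2_on {0..<N} v" "\<And>i. i < m \<Longrightarrow> cinner (f i) v = 0" for v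
  proof (rule ccontr)
    assume contr: "\<not> norm (M v) \<le> s * norm v"
    have "v \<noteq> 0"
    proof
      assume "v = 0"
      then have "norm (M v) = 0" using M[of 0 v] by simp
      then show False using contr \<open>v = 0\<close> by simp
    qed
    define u where "u = (1 / norm v) *\<^sub>R v"
    have u1: "cinner u u = 1"
    proof -
      have "norm u = 1" using \<open>v \<noteq> 0\<close> by (simp add: u_def)
      then show ?thesis by (metis cinner_self l2_norm_sq of_real_1 one_power2)
    qed
    have fu: "cinner (f i) u = 0" "cinner u (f i) = 0" if "i < m" for i
    proof -
      have "u = cscale (of_real (1 / norm v)) v" unfolding u_def cscale_of_real ..
      then show "cinner (f i) u = 0" using v(2)[OF that] by (simp add: cinner_cscale_right)
      then show "cinner u (f i) = 0" by (subst cinner_commute) simp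
    qed
    have "l2_on {0..<N} u" using v(1) by (simp add: l2_on_def u_def)
    have "norm (M u) > s"
      using contr \<open>v \<noteq> 0\<close> by (simp add: u_def M field_simps)
    define f' where "f' = (\<lambda>i. if i = m then u else f i)"
    have "orthfam N (Suc m) f'"
      unfolding orthfam_def
    proof (intro conjI allI impI)
      fix i assume "i < Suc m"
      then show "l2_on {0..<N} (f' i)"
        using f(1) \<open>l2_on {0..<N} u\<close> by (auto simp: orthfam_def f'_def less_Suc_eq)
    next
      fix i j assume ij: "i < Suc m" "j < Suc m"
      consider "i = m" "j = m" | "i = m" "j < m" | "i < m" "j = m" | "i < m" "j < m"
        using ij by (auto simp: less_Suc_eq)
      then show "cinner (f' i) (f' j) = (if i = j then 1 else 0)"
        using f(1) fu u1 by cases (auto simp: f'_def orthfam_def)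
    qed
    moreover have "\<forall>i<Suc m. norm (M (f' i)) > s"
      using f(2) \<open>norm (M u) > s\<close> by (auto simp: f'_def less_Suc_eq)
    ultimately have "P (Suc m)" unfolding P_def by blast
    then have "Suc m \<le> m"
      unfolding m_def by (rule Greatest_le_nat) (use bd in auto)
    then show False by simp
  qed
  with f that show ?thesis by blast
qed

text \<open>\<open>|A^k v|^2 = <v, A^(2k) v> <= |A^(2k) v|\<close> for a unit vector, so a lower
  bound is squared each time the power doubles. This is the reason for powers
  \<open>2 ^ j\<close>.\<close>

lemma norm_power_two:
  fixes A :: "'a l2 \<Rightarrow> 'a l2"
  assumes sa: "\<And>u v. cinner (A u) v = cinner u (A v)" and v: "norm v = 1" and c: "0 \<le> c" "c \<le> norm (A v)"
  shows "c ^ (2 ^ j) \<le> norm ((A ^^ (2 ^ j)) v)"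
proof (induction j)
  case 0
  then show ?case using c by simp
next
  case (Suc j)
  let ?k = "2 ^ j :: nat"
  have sak: "cinner ((A ^^ n) u) w = cinner u ((A ^^ n) w)" for n u w
    by (induction n arbitrary: u w) (simp_all add: sa funpow_swap1)
  have "(c ^ ?k)\<^sup>2 \<le> (norm ((A ^^ ?k) v))\<^sup>2"
    using Suc c(1) by (intro power_mono) auto
  also have "\<dots> = inner ((A ^^ ?k) v) ((A ^^ ?k) v)"
    by (rule power2_norm_eq_inner)
  also have "\<dots> = inner v ((A ^^ ?k) ((A ^^ ?k) v))"
    by (simp add: inner_l2_def sak)
  also have "\<dots> \<le> norm v * norm ((A ^^ ?k) ((A ^^ ?k) v))"
    by (rule norm_cauchy_schwarz)
  also have "(A ^^ ?k) ((A ^^ ?k) v) = (A ^^ (2 ^ Suc j)) v"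
    by (simp add: funpow_add[symmetric, THEN fun_cong, unfolded o_apply] mult_2)
  finally show ?case
    by (simp add: v power_mult[symmetric] mult.commute)
qed

section \<open>Powers of the Gram operator\<close>

context gact
begin

text \<open>With \<open>h\<close> the image of \<open>f\<close> under the adjoint,
  \<open>|h|^2 = <q h, f> <= c |h| |f|\<close>, and one factor \<open>|h|\<close> cancels.\<close>

lemma norm_lop_star_le:
  assumes q: "ks q \<subseteq> carrier G" and c: "\<And>f. l2_on X f \<Longrightarrow> norm (lop q f) \<le> c * norm f" and "l2_on X f"
  shows "norm (lop (ga_star G q) f) \<le> c * norm f"
proof -
  let ?h = "lop (ga_star G q) f"
  have sc: "ks (ga_star G q) \<subseteq> carrier G"
    using ga_star_keys[of G q] q by auto
  have h: "l2_on X ?h" by (rule lop_on[OF sc])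
  have "(norm ?h)\<^sup>2 = inner ?h ?h" by (rule power2_norm_eq_inner)
  also have "\<dots> = inner (lop q ?h) f"
    by (simp add: inner_l2_def lop_adjoint[OF q])
  also have "\<dots> \<le> norm (lop q ?h) * norm f"
    by (rule norm_cauchy_schwarz)
  also have "\<dots> \<le> (c * norm ?h) * norm f"
    by (rule mult_right_mono[OF c[OF h]]) simp
  finally have "norm ?h * norm ?h \<le> norm ?h * (c * norm f)"
    by (simp add: power2_eq_square mult_ac)
  then show ?thesis
  proof (cases "norm ?h = 0")
    case True
    show ?thesis
    proof (cases "norm f = 0")
      case False
      have "0 \<le> c * norm f" using c[OF assms(3)] norm_ge_zero order.trans by blast
      then show ?thesis using True by simp
    qed (use True in simp)
  next
    case False
    then have "norm ?h > 0" by simp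
    then show ?thesis using \<open>norm ?h * norm ?h \<le> norm ?h * (c * norm f)\<close>
      by (simp only: mult_le_cancel_left_pos)
  qed
qed

definition gram :: "('g \<Rightarrow>\<^sub>0 complex) \<Rightarrow> 'x l2 \<Rightarrow> 'x l2" where
  "gram q f = lop (ga_star G q) (lop q f)"

lemma carrier_star: "ks q \<subseteq> carrier G \<Longrightarrow> ks (ga_star G q) \<subseteq> carrier G"
  using ga_star_keys[of G q] by auto

lemma gram_on: "ks q \<subseteq> carrier G \<Longrightarrow> l2_on X (gram q f)"
  unfolding gram_def by (intro lop_on carrier_star)

lemma gram_pow_on: "ks q \<subseteq> carrier G \<Longrightarrow> l2_on X f \<Longrightarrow> l2_on X ((gram q ^^ k) f)"
  by (cases k) (auto intro: gram_on)

lemma gram_self_adjoint: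
  assumes q: "ks q \<subseteq> carrier G"
  shows "cinner (gram q u) v = cinner u (gram q v)"
proof -
  have "cinner (gram q u) v = cnj (cinner (lop q v) (lop q u))"
    unfolding gram_def lop_adjoint[OF q] by (rule cinner_commute)
  also have "\<dots> = cinner (lop q u) (lop q v)" by (rule cinner_commute[symmetric])
  finally show ?thesis unfolding gram_def lop_adjoint[OF q] .
qed

lemma norm_gram_pow:
  assumes q: "ks q \<subseteq> carrier G" and c: "\<And>f. l2_on X f \<Longrightarrow> norm (lop q f) \<le> c * norm f" "0 \<le> c" and f: "l2_on X f"
  shows "norm ((gram q ^^ k) f) \<le> c ^ (2 * k) * norm f"
proof (induction k)
  case (Suc k)
  have "norm ((gram q ^^ Suc k) f) \<le> c * norm (lop q ((gram q ^^ k) f))"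
    by (simp add: gram_def, rule norm_lop_star_le[OF q c(1) lop_on[OF q]])
  also have "\<dots> \<le> c * (c * norm ((gram q ^^ k) f))"
    by (intro mult_left_mono c gram_pow_on q f)
  also have "\<dots> \<le> c * (c * (c ^ (2 * k) * norm f))"
    by (intro mult_left_mono c Suc)
  finally show ?case by (simp add: mult_ac)
qed simp

lemma gram_lower:
  assumes q: "ks q \<subseteq> carrier G" and v: "norm v = 1" and s: "0 \<le> s" "s \<le> norm (lop q v)"
  shows "s\<^sup>2 \<le> norm (gram q v)"
proof -
  have "s\<^sup>2 \<le> (norm (lop q v))\<^sup>2" using s by (intro power_mono)
  also have "\<dots> = inner v (gram q v)"
    by (simp add: power2_norm_eq_inner inner_l2_def lop_adjoint[OF q] gram_def)
  also have "\<dots> \<le> norm v * norm (gram q v)" by (rule norm_cauchy_schwarz)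
  finally show ?thesis by (simp add: v)
qed

end

text \<open>The element \<open>(q* q)^k\<close>. Having it in the group algebra bounds its word
  length by \<open>2 * k\<close> times that of \<open>q\<close>, so that its columns at good points
  can be compared with the group.\<close>

fun ga_gram_pow :: "('g, 'm) monoid_scheme \<Rightarrow> ('g \<Rightarrow>\<^sub>0 complex) \<Rightarrow> nat \<Rightarrow> ('g \<Rightarrow>\<^sub>0 complex)" where
  "ga_gram_pow G q 0 = Poly_Mapping.single \<one>\<^bsub>G\<^esub> 1"
| "ga_gram_pow G q (Suc k) = ga_conv G (ga_star G q) (ga_conv G q (ga_gram_pow G q k))"

lemma (in cayley) keys_ga_gram_pow:
  assumes q: "ks q \<subseteq> {g \<in> carrier G. wl g \<le> l}"
  shows "ks (ga_gram_pow G q k) \<subseteq> {g \<in> carrier G. wl g \<le> k * (2 * l)}"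
proof (induction k)
  case 0
  then show ?case by (simp add: wl_one)
next
  case (Suc k)
  have conv: "ks (ga_conv G u v) \<subseteq> {g \<in> carrier G. wl g \<le> a + b}"
    if uv: "ks u \<subseteq> {g \<in> carrier G. wl g \<le> a}" "ks v \<subseteq> {g \<in> carrier G. wl g \<le> b}" for u v a b
  proof (rule order.trans[OF keys_ga_conv], rule image_subsetI)
    fix z assume "z \<in> ks u \<times> ks v"
    then obtain g h where z: "z = (g, h)" "g \<in> carrier G" "wl g \<le> a" "h \<in> carrier G" "wl h \<le> b"
      using uv by blast
    then show "(case z of (g, h) \<Rightarrow> g \<otimes> h) \<in> {g \<in> carrier G. wl g \<le> a + b}"
      using wl_mult[of g h] by auto
  qed
  have "ks (ga_star G q) \<subseteq> {g \<in> carrier G. wl g \<le> l}"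
    by (rule order.trans[OF ga_star_keys]) (use q wl_inv in auto)
  moreover have "l + (l + k * (2 * l)) = Suc k * (2 * l)" by simp
  ultimately show ?case
    using conv[OF _ conv[OF q Suc], of "ga_star G q" l] by simp
qed

lemma (in group) carrier_conv:
  assumes "ks u \<subseteq> carrier G" "ks v \<subseteq> carrier G"
  shows "ks (ga_conv G u v) \<subseteq> carrier G"
  by (rule order.trans[OF keys_ga_conv]) (use assms in auto)

lemma (in gact) lop_ga_gram_pow:
  assumes "ks q \<subseteq> carrier G" "l2_on X f"
  shows "lop (ga_gram_pow G q k) f = (gram q ^^ k) f \<and> ks (ga_gram_pow G q k) \<subseteq> carrier G"
proof (induction k)
  case 0
  then show ?case
    using cscale_of_real[of 1 f] by (simp add: lop_single shift_one[OF assms(2)])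
next
  case (Suc k)
  then have k: "ks (ga_gram_pow G q k) \<subseteq> carrier G" by simp
  have c: "ks (ga_conv G q (ga_gram_pow G q k)) \<subseteq> carrier G" by (rule carrier_conv[OF assms(1) k])
  show ?case
    using Suc by (simp add: lop_conv[OF carrier_star[OF assms(1)] c] lop_conv[OF assms(1) k] gram_def
        carrier_conv carrier_star assms k)
qed

section \<open>Exceptional vectors of one symbol\<close>

context perm_rep
begin

text \<open>At a good point distinct elements of the support lead to distinct points, so the column
  has the square sum of the coefficients as its squared norm.\<close>

lemma norm_lop_good:
  assumes q: "ks q \<subseteq> carrier G" and len: "\<And>g. g \<in> ks q \<Longrightarrow> wl g \<le> r" and x: "x < N" "x \<notin> bad r"
  shows "norm (F.lop q (l2_delta x)) \<le> norm (L.lop q (l2_delta \<one>))"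
proof -
  have "cinner (F.lop q (l2_delta x)) (F.lop q (l2_delta x)) =
      (\<Sum>g\<in>ks q. \<Sum>h\<in>ks q. if h = g then cnj (lk q g) * lk q h else 0)"
    unfolding lop_delta_F[OF q x(1)] cinner_sum_sum
  proof (intro sum.cong refl)
    fix g h assume gh: "g \<in> ks q" "h \<in> ks q"
    then have "act g x = act h x \<longleftrightarrow> g = h"
      using q len[of g] len[of h] by (intro good_eq[OF x]) auto
    then show "cinner (cscale (lk q g) (l2_delta (act g x))) (cscale (lk q h) (l2_delta (act h x))) =
        (if h = g then cnj (lk q g) * lk q h else 0)"
      by (auto simp: cinner_cscale_left cinner_cscale_right cinner_l2_delta)
  qed
  also have "\<dots> = (\<Sum>g\<in>ks q. of_real ((cmod (lk q g))\<^sup>2))"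
    by (intro sum.cong refl) (simp add: cnj_mult_self)
  finally have "(norm (F.lop q (l2_delta x)))\<^sup>2 = (\<Sum>g\<in>ks q. (cmod (lk q g))\<^sup>2)"
    by (simp add: power2_norm_eq_inner inner_l2_def flip: of_real_sum)
  also have "\<dots> \<le> (norm (L.lop q (l2_delta \<one>)))\<^sup>2"
    by (rule sum_sq_lookup[OF q])
  finally show ?thesis by (simp add: power2_le_iff_abs_le)
qed

text \<open>Let \<open>k = 2 ^ j\<close>. The family is bounded by the Hilbert--Schmidt norm of \<open>(\<rho>(q)\<^sup>*\<rho>(q)) ^ k\<close>, whose
  columns at good points have the same norm as in the regular representation.\<close>

lemma exceptional_family:
  assumes q: "ks q \<subseteq> {g \<in> carrier G. wl g \<le> l}" and W: "(\<Sum>g\<in>ks q. cmod (lk q g)) \<le> W"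
    and \<epsilon>: "\<epsilon> > 0" and r: "2 ^ j * (2 * l) \<le> r"
  obtains m f where "orthfam N m f"
    "real m \<le> N / 16 ^ (2 ^ j) + card (bad r) * (W / \<epsilon>) ^ (4 * 2 ^ j)"
    "\<And>v. l2_on {0..<N} v \<Longrightarrow> (\<And>i. i < m \<Longrightarrow> cinner (f i) v = 0) \<Longrightarrow>
        norm (F.lop q v) \<le> (2 * opn q + \<epsilon>) * norm v"
proof -
  have qc: "ks q \<subseteq> carrier G" using q by auto
  \<comment> \<open>The factor 2 makes \<open>opn q / s\<close> at most 1/2, the source of
    \<open>16 ^ (2 ^ j)\<close>; the summand \<open>\<epsilon>\<close> keeps \<open>s\<close>
    positive and bounds the ratio \<open>W / s\<close> at bad points.\<close>
  define s where "s = 2 * opn q + \<epsilon>"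
  define k where "k = (2 ^ j :: nat)"
  have o0: "0 \<le> opn q" by (rule opn_nonneg[OF qc])
  have s0: "s > 0" using o0 \<epsilon> by (simp add: s_def)
  have W0: "0 \<le> W" using W by (meson order.trans sum_nonneg norm_ge_zero)
  have Msc: "norm (F.lop q (c *\<^sub>R v)) = \<bar>c\<bar> * norm (F.lop q v)" for c v
    by (simp add: linear_scale[OF F.lop_linear[OF qc]])
  obtain m f where f: "orthfam N m f" "\<And>i. i < m \<Longrightarrow> norm (F.lop q (f i)) > s"
    "\<And>v. l2_on {0..<N} v \<Longrightarrow> (\<And>i. i < m \<Longrightarrow> cinner (f i) v = 0) \<Longrightarrow> norm (F.lop q v) \<le> s * norm v"
    by (rule maximal_orthfam[of "F.lop q" N s, OF Msc]) blast
  have sak: "cinner ((F.gram q ^^ n) u) v = cinner u ((F.gram q ^^ n) v)" for n u v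
    by (induction n arbitrary: u v) (simp_all add: F.gram_self_adjoint[OF qc] funpow_swap1)
  have low: "s ^ (4 * k) \<le> (norm ((F.gram q ^^ k) (f i)))\<^sup>2" if i: "i < m" for i
  proof -
    have n1: "norm (f i) = 1" by (rule orthfam_norm[OF f(1) i])
    have "s\<^sup>2 \<le> norm (F.gram q (f i))"
      by (rule F.gram_lower[OF qc n1]) (use s0 f(2)[OF i] in auto)
    then have "(s\<^sup>2) ^ k \<le> norm ((F.gram q ^^ k) (f i))"
      unfolding k_def by (intro norm_power_two F.gram_self_adjoint qc n1) auto
    then have "((s\<^sup>2) ^ k)\<^sup>2 \<le> (norm ((F.gram q ^^ k) (f i)))\<^sup>2"
      by (rule power_mono) simp
    then show ?thesis by (simp add: power_mult[symmetric] mult_ac)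
  qed
  have up: "(norm ((F.gram q ^^ k) (l2_delta x)))\<^sup>2 \<le> opn q ^ (4 * k) + (if x \<in> bad r then W ^ (4 * k) else 0)"
    if x: "x < N" for x
  proof (cases "x \<in> bad r")
    case True
    have d: "l2_on {0..<N} (l2_delta x)" using x by (auto intro: l2_on_delta)
    have "norm (F.lop q v) \<le> W * norm v" for v
      using F.norm_lop_le[OF qc, of v] mult_right_mono[OF W norm_ge_zero[of v]] by linarith
    then have "norm ((F.gram q ^^ k) (l2_delta x)) \<le> W ^ (2 * k) * 1"
      using F.norm_gram_pow[OF qc _ W0 d, of k] by simp
    then have "(norm ((F.gram q ^^ k) (l2_delta x)))\<^sup>2 \<le> (W ^ (2 * k))\<^sup>2"
      by (intro power_mono) auto
    also have "\<dots> = W ^ (4 * k)"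
      by (simp add: power_mult[symmetric] mult_ac)
    finally show ?thesis using True o0 by (simp add: add_increasing)
  next
    case False
    have d: "l2_on {0..<N} (l2_delta x)" using x by (auto intro: l2_on_delta)
    let ?u = "ga_gram_pow G q k"
    have "norm ((F.gram q ^^ k) (l2_delta x)) = norm (F.lop ?u (l2_delta x))"
      using F.lop_ga_gram_pow[OF qc d, of k] by simp
    also have "\<dots> \<le> norm (L.lop ?u (l2_delta \<one>))"
    proof (rule norm_lop_good[OF _ _ x False])
      have "ks ?u \<subseteq> {g \<in> carrier G. wl g \<le> k * (2 * l)}" by (rule keys_ga_gram_pow[OF q])
      then show "ks ?u \<subseteq> carrier G" "\<And>g. g \<in> ks ?u \<Longrightarrow> wl g \<le> r"
        using r by (auto simp: k_def)
    qed
    also have "\<dots> = norm ((L.gram q ^^ k) (l2_delta \<one>))"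
      using L.lop_ga_gram_pow[OF qc l2_on_delta[OF one_closed], of k] by simp
    also have "\<dots> \<le> opn q ^ (2 * k) * norm (l2_delta \<one> :: 'g l2)"
      by (rule L.norm_gram_pow[OF qc norm_lop_le_opn[OF qc] o0 l2_on_delta[OF one_closed]])
    finally have "norm ((F.gram q ^^ k) (l2_delta x)) \<le> opn q ^ (2 * k)" by simp
    then have "(norm ((F.gram q ^^ k) (l2_delta x)))\<^sup>2 \<le> (opn q ^ (2 * k))\<^sup>2"
      by (intro power_mono) auto
    then show ?thesis using False by (simp add: power_mult[symmetric] mult_ac)
  qed
  \<comment> \<open>Markov's inequality: each member of the family contributes at least
    \<open>s ^ (4 * k)\<close> to the squared Hilbert--Schmidt norm of the \<open>k\<close>-th Gram
    power.\<close>
  have "real m * s ^ (4 * k) \<le> (\<Sum>i<m. (norm ((F.gram q ^^ k) (f i)))\<^sup>2)"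
    using sum_mono[of "{..<m}" "\<lambda>_. s ^ (4 * k)"] low by simp
  also have "\<dots> \<le> (\<Sum>x<N. (norm ((F.gram q ^^ k) (l2_delta x)))\<^sup>2)"
    by (rule orthfam_hs[OF f(1) sak F.gram_pow_on[OF qc]])
  also have "\<dots> \<le> (\<Sum>x<N. opn q ^ (4 * k) + (if x \<in> bad r then W ^ (4 * k) else 0))"
    by (intro sum_mono up) simp
  also have "\<dots> = N * opn q ^ (4 * k) + card (bad r) * W ^ (4 * k)"
  proof -
    have "{..<N} \<inter> {x. x \<in> bad r} = bad r" using bad_subset[of r] by auto
    then have "(\<Sum>x<N. if x \<in> bad r then W ^ (4 * k) else 0) = card (bad r) * W ^ (4 * k)"
      by (subst sum.If_cases) simp_all
    then show ?thesis by (simp add: sum.distrib)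
  qed
  finally have "real m \<le> (N * opn q ^ (4 * k) + card (bad r) * W ^ (4 * k)) / s ^ (4 * k)"
    using s0 by (simp add: le_divide_eq)
  also have "\<dots> = N * (opn q / s) ^ (4 * k) + card (bad r) * (W / s) ^ (4 * k)"
    by (simp add: add_divide_distrib power_divide)
  also have "\<dots> \<le> N * (1 / 2) ^ (4 * k) + card (bad r) * (W / \<epsilon>) ^ (4 * k)"
  proof (intro add_mono mult_left_mono power_mono)
    show "opn q / s \<le> 1 / 2" using s0 \<epsilon> by (simp add: s_def divide_le_eq)
    show "W / s \<le> W / \<epsilon>" using \<epsilon> o0 W0 s0 by (intro divide_left_mono) (auto simp: s_def)
  qed (use o0 s0 W0 in auto)
  also have "N * (1 / 2) ^ (4 * k) + card (bad r) * (W / \<epsilon>) ^ (4 * k) =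
      N / 16 ^ (2 ^ j) + card (bad r) * (W / \<epsilon>) ^ (4 * 2 ^ j)"
  proof -
    have "(1 / 2 :: real) ^ (4 * k) = 1 / 16 ^ k"
      by (simp add: power_mult power_divide)
    then show ?thesis by (simp add: k_def)
  qed
  finally show ?thesis
    using that[OF f(1)] f(3) by (simp add: s_def)
qed

end

section \<open>Ergodicity bounds at a fixed size\<close>

lemma sum_UNION_le:
  fixes f :: "'b \<Rightarrow> real"
  assumes "finite I" "\<And>i. i \<in> I \<Longrightarrow> finite (A i)" "\<And>x. 0 \<le> f x"
  shows "(\<Sum>x\<in>(\<Union>i\<in>I. A i). f x) \<le> (\<Sum>i\<in>I. \<Sum>x\<in>A i. f x)"
  using assms(1,2)
proof (induction I rule: finite_induct)
  case (insert i I)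
  have "(\<Sum>x\<in>A i \<union> (\<Union>i\<in>I. A i). f x) \<le> (\<Sum>x\<in>A i. f x) + (\<Sum>x\<in>(\<Union>i\<in>I. A i). f x)"
    using sum.union_inter[of "A i" "\<Union>i\<in>I. A i" f] insert.hyps insert.prems
      sum_nonneg[of "A i \<inter> (\<Union>i\<in>I. A i)" f] assms(3) by auto
  then show ?case using insert by auto
qed simp

text \<open>The hypotheses that do not involve \<open>N\<close>, with their existential constants
  named, so that later bounds can be written as explicit functions of them.\<close>

locale qe = cayley_sa G S p R for G :: "('g, 'm) monoid_scheme" (structure) and S p R +
  fixes C1' K C0 C4 \<gamma> l u :: real
  assumes K_pos: "K > 0" and C1'_nonneg: "0 \<le> C1'"
    and RD: "\<And>q. ks q \<subseteq> carrier G \<Longrightarrow> opn q \<le> K * sqrt (\<Sum>g\<in>ks q. wt g powr C1' * (cmod (lk q g))\<^sup>2)"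
    and C0_ge: "C0 \<ge> 1" and C4_pos: "C4 > 0"
    and AC: "\<And>E h. l \<le> E \<Longrightarrow> E \<le> u \<Longrightarrow> 0 < h \<Longrightarrow> h \<le> 1 \<Longrightarrow>
        1 / C0 \<le> Re (Im_resolvent G p (Complex E h) \<one> \<one>) \<and> Re (Im_resolvent G p (Complex E h) \<one> \<one>) \<le> C0"
    and \<gamma>: "0 < \<gamma>" "\<gamma> \<le> 1" and lu: "l < u"
    and R4sum: "\<And>E h. l \<le> E \<Longrightarrow> E \<le> u \<Longrightarrow> 0 < h \<Longrightarrow> h \<le> 1 \<Longrightarrow>
        (\<lambda>g. h\<^sup>2 * real (wl g) powr C1' * cmod (Im_resolvent G p (Complex E h) \<one> g) ^ 4) summable_on carrier G \<and>
        (\<Sum>\<^sub>\<infinity>g\<in>carrier G. h\<^sup>2 * real (wl g) powr C1' * cmod (Im_resolvent G p (Complex E h) \<one> g) ^ 4)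
          \<le> C4 * h powr (1 + \<gamma>)"
begin

text \<open>16 is twice the 8 of \<open>wsum4_ga_pois\<close>, for two polynomials; the outer 2 and
  the final 1 come from the bound \<open>2 * opn w + 1\<close> on the symbol
  \<open>w\<close>.\<close>

definition opc :: "nat \<Rightarrow> real" where
  "opc d = 2 * K * sqrt (16 * (1 + 2 * real d) powr C1' * (C0 ^ 4 + C4 + 1)) + 1"

lemma opc_nonneg: "0 \<le> opc d"
  using K_pos C0_ge C4_pos by (simp add: opc_def)

text \<open>The sum in (R4) carries the factor \<open>\<eta>^2\<close>, so the fourth powers are of
  order \<open>\<eta> powr (1 + \<gamma>) / \<eta>^2\<close>; rapid decay takes the root. As
  \<open>\<gamma> <= 1\<close> this power of \<open>\<eta>\<close> is at least 1 and absorbs all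
  bounded terms.\<close>

lemma opn_cross_bound:
  assumes \<eta>: "0 < \<eta>" "\<eta> \<le> 1" and len: "\<And>g. g \<in> ks p \<Longrightarrow> wl g \<le> d"
    and ts: "t \<in> carrier G" "s \<in> carrier G" "wl t \<le> d" "wl s \<le> d"
    and tail: "real (max 1 (n * d)) powr C1' * (2 * tail_err R \<eta> n) ^ 4 \<le> 1"
    and E: "l \<le> E1" "E1 \<le> u" "l \<le> E2" "E2 \<le> u"
  shows "2 * opn (cross (ga_pois G R p E1 \<eta> n) (ga_pois G R p E2 \<eta> n) t s) + 1 \<le> opc d * \<eta> powr ((\<gamma> - 1) / 2)"
proof -
  define q1 q2 where "q1 = ga_pois G R p E1 \<eta> n" and "q2 = ga_pois G R p E2 \<eta> n"
  define y where "y = \<eta> powr (\<gamma> - 1)"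
  have q: "ks q1 \<subseteq> carrier G" "ks q2 \<subseteq> carrier G"
    unfolding q1_def q2_def by (rule carrier_ga_pois[OF p_carrier])+
  have y1: "1 \<le> y"
  proof -
    have "\<eta> powr 0 \<le> \<eta> powr (\<gamma> - 1)"
      by (rule powr_mono') (use \<gamma> \<eta> in auto)
    then show ?thesis using \<eta> by (simp add: y_def)
  qed
  have W: "wsum4 C1' (ga_pois G R p E \<eta> n) \<le> 8 * ((C0 ^ 4 + C4 + 1) * y)" if E: "l \<le> E" "E \<le> u" for E
  proof -
    have e: "C4 * \<eta> powr (1 + \<gamma>) = \<eta>\<^sup>2 * (C4 * y)"
    proof -
      have "\<eta> powr (1 + \<gamma>) = \<eta> powr (2 + (\<gamma> - 1))" by simp
      also have "\<dots> = \<eta> powr 2 * y" unfolding y_def by (rule powr_add)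
      also have "\<eta> powr 2 = \<eta>\<^sup>2" using \<eta> by simp
      finally show ?thesis by simp
    qed
    have a: "1 / C0 \<le> Re (Im_resolvent G p (Complex E \<eta>) \<one> \<one>)" "Re (Im_resolvent G p (Complex E \<eta>) \<one> \<one>) \<le> C0"
      using AC[OF E \<eta>] by auto
    have "0 < 1 / C0" using C0_ge by simp
    then have "\<bar>Re (Im_resolvent G p (Complex E \<eta>) \<one> \<one>)\<bar> \<le> C0"
      using a by linarith
    then have "wsum4 C1' (ga_pois G R p E \<eta> n) \<le>
        8 * (C0 ^ 4 + C4 * y + real (max 1 (n * d)) powr C1' * (2 * tail_err R \<eta> n) ^ 4)"
      using R4sum[OF E \<eta>] unfolding e
      by (intro wsum4_ga_pois[OF \<eta> C1'_nonneg len]) auto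
    also have "\<dots> \<le> 8 * (C0 ^ 4 * y + C4 * y + 1 * y)"
    proof -
      have "C0 ^ 4 * 1 \<le> C0 ^ 4 * y" using C0_ge by (intro mult_left_mono y1) auto
      then show ?thesis using tail y1 by simp
    qed
    also have "\<dots> = 8 * ((C0 ^ 4 + C4 + 1) * y)"
      by (simp add: distrib_right)
    finally show ?thesis .
  qed
  have kc: "ks (cross q1 q2 t s) \<subseteq> carrier G"
    using keys_cross q by blast
  have "opn (cross q1 q2 t s) \<le> K * sqrt ((1 + 2 * real d) powr C1' * (wsum4 C1' q1 + wsum4 C1' q2))"
    using K_pos
    by (intro order.trans[OF RD[OF kc]] mult_left_mono real_sqrt_le_mono cross_wsum[OF q ts C1'_nonneg]) auto
  also have "\<dots> \<le> K * sqrt ((1 + 2 * real d) powr C1' * (16 * ((C0 ^ 4 + C4 + 1) * y)))"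
    using K_pos W[OF E(1,2)] W[OF E(3,4)]
    by (intro mult_left_mono real_sqrt_le_mono) (auto simp: q1_def q2_def)
  also have "(1 + 2 * real d) powr C1' * (16 * ((C0 ^ 4 + C4 + 1) * y)) =
      (16 * (1 + 2 * real d) powr C1' * (C0 ^ 4 + C4 + 1)) * y"
    by simp
  also have "sqrt \<dots> = sqrt (16 * (1 + 2 * real d) powr C1' * (C0 ^ 4 + C4 + 1)) * sqrt y"
    by (rule real_sqrt_mult)
  finally have 1: "opn (cross q1 q2 t s) \<le> K * (sqrt (16 * (1 + 2 * real d) powr C1' * (C0 ^ 4 + C4 + 1)) * sqrt y)" .
  have sy: "sqrt y = \<eta> powr ((\<gamma> - 1) / 2)"
    unfolding y_def using \<eta> by (simp add: powr_half_sqrt[symmetric] powr_powr)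
  have sy1: "1 \<le> sqrt y" using y1 by simp
  define Z where "Z = sqrt (16 * (1 + 2 * real d) powr C1' * (C0 ^ 4 + C4 + 1))"
  have "opc d * sqrt y = 2 * (K * (Z * sqrt y)) + sqrt y"
    unfolding opc_def Z_def[symmetric] by (simp only: distrib_right mult_1 mult.assoc)
  then have "2 * opn (cross q1 q2 t s) + 1 \<le> opc d * sqrt y"
    using 1 sy1 unfolding Z_def[symmetric] by linarith
  then show ?thesis by (simp add: sy q1_def q2_def)
qed

text \<open>The constants of \<open>window_bound\<close> collected: \<open>200 = 50 * 4\<close> and
  \<open>57600 = 50 * 2 * (2 * 12)^2\<close>.\<close>

definition pairc :: "nat \<Rightarrow> nat \<Rightarrow> real" where
  "pairc d k = 200 * (real k)\<^sup>2 * opc d + 57600 * (real k)\<^sup>2 * R\<^sup>2 + 8 * (real k)\<^sup>2"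

lemma pairc_nonneg: "0 \<le> pairc d k"
  using opc_nonneg by (simp add: pairc_def)

text \<open>A grid of mesh \<open>\<eta>\<close>. Exceptional spaces can accommodate only finitely
  many pairs of energies, so arbitrary windows are compared with grid points.\<close>

definition net :: "real \<Rightarrow> real set" where
  "net \<eta> = (\<lambda>j. l + real j * \<eta>) ` {..nat \<lfloor>(u - l) / \<eta>\<rfloor>}"

lemma net_bounds: "\<eta> > 0 \<Longrightarrow> E \<in> net \<eta> \<Longrightarrow> l \<le> E \<and> E \<le> u"
proof -
  assume \<eta>: "\<eta> > 0" and "E \<in> net \<eta>"
  then obtain j where j: "E = l + real j * \<eta>" "j \<le> nat \<lfloor>(u - l) / \<eta>\<rfloor>" by (auto simp: net_def)
  have "0 \<le> (u - l) / \<eta>" using lu \<eta> by simp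
  then have "real j \<le> (u - l) / \<eta>"
    using j(2) by (simp add: le_nat_iff le_floor_iff)
  then have "real j * \<eta> \<le> u - l" using \<eta> by (simp add: le_divide_eq)
  then show ?thesis using j(1) \<eta> by simp
qed

lemma net_near:
  assumes "\<eta> > 0" "l \<le> E" "E \<le> u"
  obtains E' where "E' \<in> net \<eta>" "\<bar>E - E'\<bar> \<le> \<eta>"
proof -
  define j where "j = nat \<lfloor>(E - l) / \<eta>\<rfloor>"
  have q: "0 \<le> (E - l) / \<eta>" using assms by simp
  have "(E - l) / \<eta> \<le> (u - l) / \<eta>" using assms by (intro divide_right_mono) auto
  then have "j \<le> nat \<lfloor>(u - l) / \<eta>\<rfloor>" unfolding j_def by (intro nat_mono floor_mono)
  then have "l + real j * \<eta> \<in> net \<eta>" by (auto simp: net_def)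
  moreover have "real j \<le> (E - l) / \<eta>" "(E - l) / \<eta> < real j + 1"
    using q unfolding j_def by linarith+
  then have "real j * \<eta> \<le> E - l" "E - l < (real j + 1) * \<eta>"
    using assms(1) by (simp_all add: le_divide_eq divide_less_eq)
  then have "\<bar>E - (l + real j * \<eta>)\<bar> \<le> \<eta>"
    by (simp add: abs_le_iff algebra_simps)
  ultimately show ?thesis using that by blast
qed

lemma finite_net: "finite (net \<eta>)"
  by (simp add: net_def)

lemma card_net: "0 < \<eta> \<Longrightarrow> real (card (net \<eta>)) \<le> (u - l) / \<eta> + 1"
proof -
  assume \<eta>: "0 < \<eta>"
  have "card (net \<eta>) \<le> card {..nat \<lfloor>(u - l) / \<eta>\<rfloor>}"
    unfolding net_def by (rule card_image_le) simp
  then have "real (card (net \<eta>)) \<le> real (nat \<lfloor>(u - l) / \<eta>\<rfloor>) + 1" by simp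
  moreover have "0 \<le> (u - l) / \<eta>" using lu \<eta> by simp
  ultimately show ?thesis by linarith
qed

end

section \<open>Estimates for one observable\<close>

locale qe_obs = qe G S p R C1' K C0 C4 \<gamma> l u + local_obs G S p R N act \<phi> T Kx
  for G :: "('g, 'm) monoid_scheme" (structure) and S p R C1' K C0 C4 \<gamma> l u N act \<phi> T Kx
begin

text \<open>Bad points enter with \<open>\<eta>^2 * (1 / \<eta>^2)^2\<close>, so a proportion
  \<open>\<eta>^6\<close> leaves \<open>\<eta>^4\<close>. This and the direct error are below the
  main term because \<open>1 + (1 + \<gamma>) / 2 <= 2\<close>.\<close>

lemma pair_bound:
  assumes \<eta>: "0 < \<eta>" "\<eta> \<le> 1" and len: "\<And>g. g \<in> ks p \<Longrightarrow> wl g \<le> d" "\<And>t. t \<in> T \<Longrightarrow> wl t \<le> d"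
    and r: "n * d + d \<le> r"
    and tail: "real (max 1 (n * d)) powr C1' * (2 * tail_err R \<eta> n) ^ 4 \<le> 1"
    and bad: "card (bad r) \<le> real N * \<eta> ^ 6"
    and E: "l \<le> E1" "E1 \<le> u" "l \<le> E2" "E2 \<le> u"
    and A1: "A1 \<subseteq> {j. j < N \<and> \<bar>lam j - E1\<bar> \<le> 2 * \<eta>}" and A2: "A2 \<subseteq> {j. j < N \<and> \<bar>lam j - E2\<bar> \<le> 2 * \<eta>}"
    and hyp: "\<And>t s. t \<in> T \<Longrightarrow> s \<in> T \<Longrightarrow>
      cmod (cinner (fl N (Kc t)) (F.lop (cross (ga_pois G R p E1 \<eta> n) (ga_pois G R p E2 \<eta> n) t s) (fl N (Kc s)))) \<le>
      (2 * opn (cross (ga_pois G R p E1 \<eta> n) (ga_pois G R p E2 \<eta> n) t s) + 1) *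
        (norm (fl N (Kc t)) * norm (fl N (Kc s)))"
  shows "(\<Sum>j\<in>A1. \<Sum>k\<in>A2. obs_dev N act T Kx (\<phi> k) (\<phi> j)) \<le>
    pairc d (card T) * (real N * \<eta> powr (1 + (1 + \<gamma>) / 2))"
proof -
  define \<Omega> where "\<Omega> = opc d * \<eta> powr ((\<gamma> - 1) / 2)"
  define k where "k = real (card T)"
  define w where "w = \<eta> powr (1 + (1 + \<gamma>) / 2)"
  have \<Omega>0: "0 \<le> \<Omega>" using opc_nonneg by (simp add: \<Omega>_def)
  have om: "cmod (cinner (fl N (Kc t)) (F.lop (cross (ga_pois G R p E1 \<eta> n) (ga_pois G R p E2 \<eta> n) t s) (fl N (Kc s)))) \<le>
      \<Omega> * (norm (fl N (Kc t)) * norm (fl N (Kc s)))" if ts: "t \<in> T" "s \<in> T" for t s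
  proof -
    have "2 * opn (cross (ga_pois G R p E1 \<eta> n) (ga_pois G R p E2 \<eta> n) t s) + 1 \<le> \<Omega>"
      unfolding \<Omega>_def using T(1) ts by (intro opn_cross_bound \<eta> len tail E) auto
    then show ?thesis
      by (intro order.trans[OF hyp[OF ts]] mult_right_mono) auto
  qed
  have 1: "(\<Sum>j\<in>A1. \<Sum>k\<in>A2. obs_dev N act T Kx (\<phi> k) (\<phi> j)) \<le>
    50 * \<eta>\<^sup>2 * ((card T)\<^sup>2 * (\<Omega> * (4 * real N)) + card (bad r) * (2 * (real (card T) * 2 * (12 * R / \<eta>\<^sup>2))\<^sup>2))
    + 8 * (real (card T))\<^sup>2 * card (bad r)"
    by (rule window_bound[OF \<eta> len r A1 A2 om \<Omega>0])
  have w1: "\<eta>\<^sup>2 * \<eta> powr ((\<gamma> - 1) / 2) = w"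
  proof -
    have "\<eta>\<^sup>2 * \<eta> powr ((\<gamma> - 1) / 2) = \<eta> powr 2 * \<eta> powr ((\<gamma> - 1) / 2)" using \<eta> by simp
    also have "\<dots> = \<eta> powr (2 + (\<gamma> - 1) / 2)" by (rule powr_add[symmetric])
    also have "2 + (\<gamma> - 1) / 2 = 1 + (1 + \<gamma>) / 2" by (simp add: field_simps)
    finally show ?thesis by (simp add: w_def)
  qed
  have w2: "\<eta>\<^sup>2 \<le> w"
  proof -
    have "\<eta> powr 2 \<le> \<eta> powr (1 + (1 + \<gamma>) / 2)"
      by (rule powr_mono') (use \<gamma> \<eta> in auto)
    then show ?thesis using \<eta> by (simp add: w_def)
  qed
  have n2: "real N * \<eta> ^ m \<le> real N * w" if "2 \<le> m" for m
  proof -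
    have "\<eta> ^ m \<le> \<eta>\<^sup>2" using \<eta> that by (intro power_decreasing) auto
    then show ?thesis using w2 by (intro mult_left_mono) auto
  qed
  have t1: "50 * \<eta>\<^sup>2 * (k\<^sup>2 * (\<Omega> * (4 * real N))) = 200 * k\<^sup>2 * opc d * (real N * w)"
    unfolding \<Omega>_def w1[symmetric] by simp
  have t2: "50 * \<eta>\<^sup>2 * (card (bad r) * (2 * (k * 2 * (12 * R / \<eta>\<^sup>2))\<^sup>2)) \<le> 57600 * k\<^sup>2 * R\<^sup>2 * (real N * w)"
  proof -
    have "50 * \<eta>\<^sup>2 * (card (bad r) * (2 * (k * 2 * (12 * R / \<eta>\<^sup>2))\<^sup>2)) = 57600 * k\<^sup>2 * R\<^sup>2 / \<eta>\<^sup>2 * card (bad r)"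
      using \<eta> by (simp add: power2_eq_square field_simps)
    also have "\<dots> \<le> 57600 * k\<^sup>2 * R\<^sup>2 / \<eta>\<^sup>2 * (real N * \<eta> ^ 6)"
      by (rule mult_left_mono[OF bad]) simp
    also have "\<dots> = 57600 * k\<^sup>2 * R\<^sup>2 * (real N * \<eta> ^ 4)"
      using \<eta> by (simp add: power2_eq_square power4_eq_xxxx eval_nat_numeral field_simps)
    also have "\<dots> \<le> 57600 * k\<^sup>2 * R\<^sup>2 * (real N * w)"
      by (intro mult_left_mono n2) auto
    finally show ?thesis .
  qed
  have t3: "8 * k\<^sup>2 * card (bad r) \<le> 8 * k\<^sup>2 * (real N * w)"
    by (intro mult_left_mono order.trans[OF bad n2]) auto
  have "(\<Sum>j\<in>A1. \<Sum>k\<in>A2. obs_dev N act T Kx (\<phi> k) (\<phi> j)) \<le>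
      50 * \<eta>\<^sup>2 * (k\<^sup>2 * (\<Omega> * (4 * real N))) + 50 * \<eta>\<^sup>2 * (card (bad r) * (2 * (k * 2 * (12 * R / \<eta>\<^sup>2))\<^sup>2)) + 8 * k\<^sup>2 * card (bad r)"
    using 1 by (simp only: k_def of_nat_power distrib_left)
  also have "\<dots> \<le> 200 * k\<^sup>2 * opc d * (real N * w) + 57600 * k\<^sup>2 * R\<^sup>2 * (real N * w) + 8 * k\<^sup>2 * (real N * w)"
    unfolding t1 by (intro add_mono order.refl t2 t3)
  also have "\<dots> = pairc d (card T) * (real N * w)"
    unfolding pairc_def k_def by (simp only: distrib_right)
  finally show ?thesis unfolding w_def .
qed

definition \<Lambda> :: "real set \<Rightarrow> nat set" where
  "\<Lambda> J = {j. j < N \<and> lam j \<in> J}"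

lemma finite_\<Lambda>: "finite (\<Lambda> J)" and \<Lambda>_subset: "\<Lambda> J \<subseteq> {..<N}"
  by (auto simp: \<Lambda>_def)

text \<open>Averages over an empty index set are 0, so the numerator and count bounds are requested
  for nonempty windows.\<close>

lemma ergodicityI:
  fixes b b' c c' B \<eta> :: real
  assumes b0: "0 \<le> b" "0 \<le> b'" and c: "0 < c" "0 < c'"
    and 1: "\<And>E1 E2. l \<le> E1 \<Longrightarrow> E1 \<le> u \<Longrightarrow> l \<le> E2 \<Longrightarrow> E2 \<le> u \<Longrightarrow> \<Lambda> (window E1 \<eta>) \<noteq> {} \<Longrightarrow>
      (\<Sum>j\<in>\<Lambda> (window E1 \<eta>). \<Sum>k\<in>\<Lambda> (window E2 \<eta>). obs_dev N act T Kx (\<phi> k) (\<phi> j)) \<le> b"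
    and 2: "\<And>E. l \<le> E \<Longrightarrow> E \<le> u \<Longrightarrow> \<Lambda> (window E \<eta>) \<noteq> {} \<Longrightarrow> c \<le> real (card (\<Lambda> (window E \<eta>)))"
    and 3: "\<Lambda> {l..u} \<noteq> {} \<Longrightarrow> (\<Sum>j\<in>\<Lambda> {l..u}. obs_dev N act T Kx (\<phi> j) (\<phi> j)) \<le> b'"
    and 4: "\<Lambda> {l..u} \<noteq> {} \<Longrightarrow> c' \<le> real (card (\<Lambda> {l..u}))"
    and B: "b / c \<le> B" "b' / c' \<le> B"
  shows "ergodicity_bounds N act p \<phi> {l..u} T Kx \<eta> B"
proof -
  have B0: "0 \<le> B" using b0 c B by (meson divide_nonneg_pos order.trans)
  have quot: "1 / real (card A) * s \<le> x / y" if "A \<noteq> {} \<Longrightarrow> s \<le> x" "A \<noteq> {} \<Longrightarrow> y \<le> real (card A)" "0 < y" "0 \<le> x" "finite A"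
    for A :: "nat set" and s x y :: real
  proof (cases "A = {}")
    case True
    then show ?thesis using that by simp
  next
    case False
    then have "s / real (card A) \<le> x / real (card A)" using that by (intro divide_right_mono) auto
    also have "\<dots> \<le> x / y" using that False by (intro divide_left_mono) auto
    finally show ?thesis by simp
  qed
  show ?thesis
    unfolding ergodicity_bounds_def Let_def spectral_indices_eq \<Lambda>_def[symmetric]
  proof (intro conjI ballI)
    fix E1 E2 assume E: "E1 \<in> {l..u}" "E2 \<in> {l..u}"
    show "1 / real (card (\<Lambda> (window E1 \<eta>))) *
        (\<Sum>j\<in>\<Lambda> (window E1 \<eta>). \<Sum>k\<in>\<Lambda> (window E2 \<eta>). obs_dev N act T Kx (\<phi> k) (\<phi> j)) \<le> B"
    proof (rule order.trans[OF _ B(1)], rule quot)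
      show "(\<Sum>j\<in>\<Lambda> (window E1 \<eta>). \<Sum>k\<in>\<Lambda> (window E2 \<eta>). obs_dev N act T Kx (\<phi> k) (\<phi> j)) \<le> b"
        if "\<Lambda> (window E1 \<eta>) \<noteq> {}"
        by (rule 1) (use E that in auto)
      show "c \<le> real (card (\<Lambda> (window E1 \<eta>)))" if "\<Lambda> (window E1 \<eta>) \<noteq> {}"
        by (rule 2) (use E that in auto)
    qed (fact c b0 finite_\<Lambda>)+
  next
    show "1 / real (card (\<Lambda> {l..u})) * (\<Sum>j\<in>\<Lambda> {l..u}. obs_dev N act T Kx (\<phi> j) (\<phi> j)) \<le> B"
    proof (rule order.trans[OF _ B(2)], rule quot)
    qed (fact 3 4 c b0 finite_\<Lambda> | erule 3 4)+
  qed
qed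

lemma diag_le: "(\<Sum>j\<in>\<Lambda> J. obs_dev N act T Kx (\<phi> j) (\<phi> j)) \<le> (\<Sum>j\<in>\<Lambda> J. \<Sum>k\<in>\<Lambda> J. obs_dev N act T Kx (\<phi> k) (\<phi> j))"
  by (intro sum_mono member_le_sum finite_\<Lambda> obs_dev_nonneg)

text \<open>If every index set involved is empty or contains a fixed proportion of all indices,
  \<open>obs_dev_subset\<close> already bounds the averages by a constant.\<close>

lemma ergodicity_trivial:
  fixes c B \<eta> :: real
  assumes c: "0 < c"
    and 2: "\<And>E. l \<le> E \<Longrightarrow> E \<le> u \<Longrightarrow> \<Lambda> (window E \<eta>) \<noteq> {} \<Longrightarrow> c * real N \<le> real (card (\<Lambda> (window E \<eta>)))"
    and 4: "\<Lambda> {l..u} \<noteq> {} \<Longrightarrow> c * real N \<le> real (card (\<Lambda> {l..u}))"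
    and B: "(2 * real (card T))\<^sup>2 / c \<le> B"
  shows "ergodicity_bounds N act p \<phi> {l..u} T Kx \<eta> B"
proof -
  have *: "real N * (2 * real (card T))\<^sup>2 / (c * real N) \<le> B"
    using B N0 by simp
  show ?thesis
  proof (rule ergodicityI[where b = "real N * (2 * real (card T))\<^sup>2" and b' = "real N * (2 * real (card T))\<^sup>2"
        and c = "c * real N" and c' = "c * real N"])
    show "0 < c * real N" "0 < c * real N" using c N0 by auto
    show "(\<Sum>j\<in>\<Lambda> (window E1 \<eta>). \<Sum>k\<in>\<Lambda> (window E2 \<eta>). obs_dev N act T Kx (\<phi> k) (\<phi> j)) \<le>
        real N * (2 * real (card T))\<^sup>2" for E1 E2
      by (rule obs_dev_subset[OF \<Lambda>_subset \<Lambda>_subset])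
    show "(\<Sum>j\<in>\<Lambda> {l..u}. obs_dev N act T Kx (\<phi> j) (\<phi> j)) \<le> real N * (2 * real (card T))\<^sup>2"
      by (rule order.trans[OF diag_le obs_dev_subset[OF \<Lambda>_subset \<Lambda>_subset]])
    show "c * real N \<le> real (card (\<Lambda> (window E \<eta>)))" if "l \<le> E" "E \<le> u" "\<Lambda> (window E \<eta>) \<noteq> {}" for E
      by (rule 2[OF that])
    show "c * real N \<le> real (card (\<Lambda> {l..u}))" if "\<Lambda> {l..u} \<noteq> {}"
      by (rule 4[OF that])
  qed (use * in auto)
qed

text \<open>The scale \<open>\<eta>\<close> is microscopic. The fixed scale \<open>\<eta>c\<close>
  serves only to show that the whole interval contains a proportion of all eigenvalues, via one
  window around its midpoint.\<close>

lemma ergodicity_main: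
  fixes \<eta> \<eta>c M Cf :: real
  assumes \<eta>: "0 < \<eta>" "\<eta> \<le> 1" "\<eta> \<le> \<eta>c" and \<eta>c: "\<eta>c \<le> 1" "2 * \<eta>c \<le> u - l"
    and len: "\<And>g. g \<in> ks p \<Longrightarrow> wl g \<le> d" "\<And>t. t \<in> T \<Longrightarrow> wl t \<le> d"
    and r: "n * d + d \<le> r"
    and tail: "real (max 1 (n * d)) powr C1' * (2 * tail_err R \<eta> n) ^ 4 \<le> 1"
    and bad: "card (bad r) \<le> real N * \<eta> ^ 6"
    and M: "M = 16 * C0\<^sup>2"
    and err: "4 * real N * tail_err R (\<eta> / M) n + card (bad r) * (32 * R / (\<eta> / M)\<^sup>2) \<le> real N / (4 * C0)"
    and err': "4 * real N * tail_err R (\<eta>c / M) n + card (bad r) * (32 * R / (\<eta>c / M)\<^sup>2) \<le> real N / (4 * C0)"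
    and hyp: "\<And>E1 E2 t s. E1 \<in> net \<eta> \<Longrightarrow> E2 \<in> net \<eta> \<Longrightarrow> t \<in> T \<Longrightarrow> s \<in> T \<Longrightarrow>
      cmod (cinner (fl N (Kc t)) (F.lop (cross (ga_pois G R p E1 \<eta> n) (ga_pois G R p E2 \<eta> n) t s) (fl N (Kc s)))) \<le>
      (2 * opn (cross (ga_pois G R p E1 \<eta> n) (ga_pois G R p E2 \<eta> n) t s) + 1) *
        (norm (fl N (Kc t)) * norm (fl N (Kc s)))"
    and B: "2 * C0 * M * pairc d (card T) * (u - l + 1) / \<eta>c \<le> Cf"
  shows "ergodicity_bounds N act p \<phi> {l..u} T Kx \<eta> (Cf * \<eta> powr ((1 + \<gamma>) / 2))"
proof -
  define P where "P = pairc d (card T)"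
  define w where "w = \<eta> powr (1 + (1 + \<gamma>) / 2)"
  define v where "v = \<eta> powr ((1 + \<gamma>) / 2)"
  have M0: "M > 0" using C0_ge M by simp
  have P0: "0 \<le> P" by (simp add: P_def pairc_nonneg)
  have \<eta>c0: "0 < \<eta>c" using \<eta> by simp
  have v0: "0 \<le> v" by (simp add: v_def)
  have wv: "w = \<eta> * v" using \<eta> by (simp add: w_def v_def powr_add)
  have rd: "n * d \<le> 2 * r" using r by simp
  have C0p: "0 < C0" using C0_ge by simp
  have pair: "(\<Sum>j\<in>A1. \<Sum>k\<in>A2. obs_dev N act T Kx (\<phi> k) (\<phi> j)) \<le> P * (real N * w)"
    if "E1 \<in> net \<eta>" "E2 \<in> net \<eta>" "A1 \<subseteq> {j. j < N \<and> \<bar>lam j - E1\<bar> \<le> 2 * \<eta>}"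
      "A2 \<subseteq> {j. j < N \<and> \<bar>lam j - E2\<bar> \<le> 2 * \<eta>}" for E1 E2 A1 A2
    unfolding P_def w_def
    using net_bounds[OF \<eta>(1) that(1)] net_bounds[OF \<eta>(1) that(2)]
    by (intro pair_bound[OF \<eta>(1,2) len r tail bad _ _ _ _ that(3,4) hyp[OF that(1,2)]]) auto
  have cnt: "real N * (h / M) / (2 * C0) \<le> real (card (\<Lambda> (window E h)))"
    if "0 < h" "h \<le> 1" "l \<le> E" "E \<le> u"
      "4 * real N * tail_err R (h / M) n + card (bad r) * (32 * R / (h / M)\<^sup>2) \<le> real N / (4 * C0)" for h E
    using window_count[OF C0_ge M, of "h / M" d n r E] that M0 len(1) rd AC[OF that(3,4)]
    by (simp add: \<Lambda>_def)
  have "(u - l + 1) / \<eta>c \<ge> 1"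
    using \<eta>c0 \<eta>c lu by (simp add: le_divide_eq)
  then have Cf1: "2 * C0 * M * P \<le> Cf"
    using mult_left_mono[of 1 "(u - l + 1) / \<eta>c" "2 * C0 * M * P"] B C0p M0 P0 by (simp add: P_def)
  show ?thesis
  proof (rule ergodicityI[where b = "P * (real N * w)" and b' = "((u - l + 1) / \<eta>) * (P * (real N * w))"
        and c = "real N * (\<eta> / M) / (2 * C0)" and c' = "real N * (\<eta>c / M) / (2 * C0)"])
    fix E1 E2 assume E: "l \<le> E1" "E1 \<le> u" "l \<le> E2" "E2 \<le> u"
    obtain E1' where E1': "E1' \<in> net \<eta>" "\<bar>E1 - E1'\<bar> \<le> \<eta>" by (rule net_near[OF \<eta>(1) E(1,2)])
    obtain E2' where E2': "E2' \<in> net \<eta>" "\<bar>E2 - E2'\<bar> \<le> \<eta>" by (rule net_near[OF \<eta>(1) E(3,4)])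
    show "(\<Sum>j\<in>\<Lambda> (window E1 \<eta>). \<Sum>k\<in>\<Lambda> (window E2 \<eta>). obs_dev N act T Kx (\<phi> k) (\<phi> j)) \<le> P * (real N * w)"
      by (rule pair[OF E1'(1) E2'(1)]) (use E1'(2) E2'(2) in \<open>auto simp: \<Lambda>_def window_def abs_le_iff\<close>)
  next
    fix E assume "l \<le> E" "E \<le> u"
    then show "real N * (\<eta> / M) / (2 * C0) \<le> real (card (\<Lambda> (window E \<eta>)))"
      by (rule cnt[OF \<eta>(1,2) _ _ err])
  next
    \<comment> \<open>The diagonal average is reduced to windows: the net windows cover the
      interval, each diagonal sum is part of a double sum, and the about \<open>1 / \<eta>\<close>
      windows cost exactly the extra factor \<open>\<eta>\<close> in \<open>w\<close>.\<close>
    have sub: "\<Lambda> {l..u} \<subseteq> (\<Union>E\<in>net \<eta>. \<Lambda> (window E \<eta>))"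
    proof
      fix j assume "j \<in> \<Lambda> {l..u}"
      then have j: "j < N" "l \<le> lam j" "lam j \<le> u" by (auto simp: \<Lambda>_def)
      obtain E where E: "E \<in> net \<eta>" "\<bar>lam j - E\<bar> \<le> \<eta>" by (rule net_near[OF \<eta>(1) j(2,3)])
      then have "j \<in> \<Lambda> (window E \<eta>)"
        using j(1) by (auto simp: \<Lambda>_def window_def abs_le_iff)
      then show "j \<in> (\<Union>E\<in>net \<eta>. \<Lambda> (window E \<eta>))"
        using E(1) by blast
    qed
    define f where "f = (\<lambda>j. obs_dev N act T Kx (\<phi> j) (\<phi> j))"
    have "(\<Sum>j\<in>\<Lambda> {l..u}. f j) \<le> (\<Sum>j\<in>(\<Union>E\<in>net \<eta>. \<Lambda> (window E \<eta>)). f j)"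
      by (rule sum_mono2[OF _ sub]) (auto simp: f_def obs_dev_nonneg finite_net finite_\<Lambda>)
    also have "\<dots> \<le> (\<Sum>E\<in>net \<eta>. \<Sum>j\<in>\<Lambda> (window E \<eta>). f j)"
      by (rule sum_UNION_le) (auto simp: f_def obs_dev_nonneg finite_net finite_\<Lambda>)
    also have "\<dots> \<le> (\<Sum>E\<in>net \<eta>. P * (real N * w))"
    proof (rule sum_mono)
      fix E assume E: "E \<in> net \<eta>"
      have "\<Lambda> (window E \<eta>) \<subseteq> {j. j < N \<and> \<bar>lam j - E\<bar> \<le> 2 * \<eta>}"
        using \<eta>(1) by (auto simp: \<Lambda>_def window_def abs_le_iff)
      then show "(\<Sum>j\<in>\<Lambda> (window E \<eta>). f j) \<le> P * (real N * w)"
        unfolding f_def by (intro order.trans[OF diag_le pair[OF E E]])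
    qed
    also have "\<dots> = real (card (net \<eta>)) * (P * (real N * w))" by simp
    also have "\<dots> \<le> ((u - l + 1) / \<eta>) * (P * (real N * w))"
    proof (rule mult_right_mono)
      have "1 \<le> 1 / \<eta>" using \<eta> by simp
      then show "real (card (net \<eta>)) \<le> (u - l + 1) / \<eta>"
        using card_net[OF \<eta>(1)] by (simp add: add_divide_distrib)
    qed (use P0 in \<open>simp add: w_def\<close>)
    finally show "(\<Sum>j\<in>\<Lambda> {l..u}. obs_dev N act T Kx (\<phi> j) (\<phi> j)) \<le> ((u - l + 1) / \<eta>) * (P * (real N * w))"
      unfolding f_def .
  next
    have "real N * (\<eta>c / M) / (2 * C0) \<le> real (card (\<Lambda> (window ((l + u) / 2) \<eta>c)))"
      by (rule cnt[OF \<eta>c0 \<eta>c(1) _ _ err']) (use lu in auto)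
    also have "\<dots> \<le> real (card (\<Lambda> {l..u}))"
    proof -
      have "\<Lambda> (window ((l + u) / 2) \<eta>c) \<subseteq> \<Lambda> {l..u}"
        using \<eta>c(2) by (auto simp: \<Lambda>_def window_def field_simps)
      then show ?thesis by (simp add: card_mono finite_\<Lambda>)
    qed
    finally show "real N * (\<eta>c / M) / (2 * C0) \<le> real (card (\<Lambda> {l..u}))" .
  next
    have "P * (real N * w) / (real N * (\<eta> / M) / (2 * C0)) = 2 * C0 * M * P * v"
      using N0 \<eta> M0 C0p by (simp add: wv field_simps)
    also have "\<dots> \<le> Cf * v"
      by (rule mult_right_mono[OF Cf1 v0])
    finally show "P * (real N * w) / (real N * (\<eta> / M) / (2 * C0)) \<le> Cf * \<eta> powr ((1 + \<gamma>) / 2)"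
      by (simp add: v_def)
  next
    have "((u - l + 1) / \<eta>) * (P * (real N * w)) / (real N * (\<eta>c / M) / (2 * C0)) =
        (2 * C0 * M * P * (u - l + 1) / \<eta>c) * v"
      using N0 \<eta> M0 C0p \<eta>c0 by (simp add: wv field_simps)
    also have "\<dots> \<le> Cf * v"
      by (rule mult_right_mono[OF _ v0]) (use B in \<open>simp add: P_def\<close>)
    finally show "((u - l + 1) / \<eta>) * (P * (real N * w)) / (real N * (\<eta>c / M) / (2 * C0)) \<le> Cf * \<eta> powr ((1 + \<gamma>) / 2)"
      by (simp add: v_def)
  qed (use P0 N0 M0 C0p \<eta> \<eta>c0 lu in \<open>auto simp: w_def intro!: mult_nonneg_nonneg\<close>)
qed

end

section \<open>Norm bounds for symbols, with and without strong convergence\<close>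

context perm_rep
begin

lemma norm_lop_strong_convergence:
  assumes q: "ks q \<subseteq> carrier G" and sc: "opnorm_perp_one N (perm_rep_ga N act q) \<le> 2 * opn q"
    and v: "l2_on {0..<N} v" and mean: "(\<Sum>x<N. l2_at v x) = 0"
  shows "norm (F.lop q v) \<le> 2 * opn q * norm v"
proof (cases "norm v = 0")
  case True
  then show ?thesis using F.norm_lop_le[OF q, of v] by simp
next
  case False
  define c where "c = 1 / norm v"
  define w where "w = c *\<^sub>R v"
  have c0: "0 < c" using False by (simp add: c_def)
  have won: "l2_on {0..<N} w" using v by (simp add: w_def l2_on_def)
  have nw: "norm w = 1" using False by (simp add: w_def c_def)
  define A where "A = {v \<in> carrier_vec N. cv_inner (vec N (\<lambda>_. 1)) v = 0 \<and> cv_norm v \<le> 1}"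
  let ?M = "perm_rep_ga N act q"
  have M: "?M \<in> carrier_mat N N" by (simp add: perm_rep_ga_def)
  have act: "gact G {0..<N} act" by (rule F.gact_axioms)
  have eq: "cv_norm (?M *\<^sub>v y) = norm (F.lop q (vl N y))" if "y \<in> carrier_vec N" for y
  proof -
    have "?M *\<^sub>v y \<in> carrier_vec N" using M that by simp
    then have "cv_norm (?M *\<^sub>v y) = norm (vl N (?M *\<^sub>v y))" by (rule cv_norm_vl)
    then show ?thesis by (simp only: vl_mult_mat_vec[OF M that] perm_rep_ga_vl[OF act q])
  qed
  have wv: "vl N (vec N (l2_at w)) = w" by (rule vl_vec[OF won])
  have "cv_inner (vec N (\<lambda>_. 1)) (vec N (l2_at w)) = (\<Sum>x<N. of_real c * l2_at v x)"
    by (simp add: cv_inner_vl cinner_finite[OF vl_on] w_def scaleR_conv_of_real)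
  also have "\<dots> = 0" by (simp add: mean flip: sum_distrib_left)
  finally have wA: "vec N (l2_at w) \<in> A"
    using nw by (simp add: A_def cv_norm_vl wv)
  \<comment> \<open>A supremum of reals bounds its members only if the set is bounded above; the sum
    of the coefficients provides this.\<close>
  have bdd: "bdd_above ((\<lambda>y. cv_norm (?M *\<^sub>v y)) ` A)"
  proof (rule bdd_aboveI2)
    fix y assume y: "y \<in> A"
    then have "norm (vl N y) \<le> 1" "y \<in> carrier_vec N" by (auto simp: A_def cv_norm_vl)
    then have "cv_norm (?M *\<^sub>v y) \<le> (\<Sum>g\<in>ks q. cmod (lk q g)) * 1"
      unfolding eq[OF \<open>y \<in> carrier_vec N\<close>]
      by (intro order.trans[OF F.norm_lop_le[OF q]] mult_left_mono sum_nonneg) auto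
    then show "cv_norm (?M *\<^sub>v y) \<le> (\<Sum>g\<in>ks q. cmod (lk q g))" by simp
  qed
  have "norm (F.lop q w) = cv_norm (?M *\<^sub>v vec N (l2_at w))"
    by (simp add: eq wv)
  also have "\<dots> \<le> opnorm_perp_one N ?M"
    unfolding opnorm_perp_one_def A_def[symmetric] by (rule cSUP_upper[OF wA bdd])
  finally have 1: "norm (F.lop q w) \<le> 2 * opn q" using sc by linarith
  have "F.lop q w = c *\<^sub>R F.lop q v"
    unfolding w_def by (rule linear_scale[OF F.lop_linear[OF q]])
  then have "c * norm (F.lop q v) \<le> 2 * opn q" using 1 c0 by simp
  then show ?thesis using False by (simp add: c_def field_simps)
qed

text \<open>The span of the exceptional families of all cross symbols, for pairs of energies in
  \<open>Es\<close> and pairs in \<open>T\<close>, together with the constant vector. The last one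
  makes observables orthogonal to the space have mean zero.\<close>

lemma exceptional_space:
  fixes \<eta> :: real
  assumes Es: "finite Es" and T: "finite T" "T \<subseteq> carrier G"
    and \<eta>: "0 < \<eta>" "\<eta> \<le> 1" and len: "\<And>g. g \<in> ks p \<Longrightarrow> wl g \<le> d" and r: "2 ^ j * (2 * (n * d)) \<le> r"
  obtains H where "subspace class_ring H (module_vec TYPE(complex) N)"
    "real (vectorspace.dim class_ring ((module_vec TYPE(complex) N)\<lparr>carrier := H\<rparr>)) \<le>
      1 + (real (card Es) * real (card T))\<^sup>2 *
        (real N / 16 ^ (2 ^ j) + real (card (bad r)) * ((12 * R / \<eta>\<^sup>2)\<^sup>2) ^ (4 * 2 ^ j))"
    "vec N (\<lambda>_. 1) \<in> H"
    "\<And>E1 E2 t s v. E1 \<in> Es \<Longrightarrow> E2 \<in> Es \<Longrightarrow> t \<in> T \<Longrightarrow> s \<in> T \<Longrightarrow> v \<in> carrier_vec N \<Longrightarrow>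
      (\<And>h. h \<in> H \<Longrightarrow> cv_inner h v = 0) \<Longrightarrow>
      norm (F.lop (cross (ga_pois G R p E1 \<eta> n) (ga_pois G R p E2 \<eta> n) t s) (vl N v)) \<le>
      (2 * opn (cross (ga_pois G R p E1 \<eta> n) (ga_pois G R p E2 \<eta> n) t s) + 1) * norm (vl N v)"
proof -
  define B where "B = real N / 16 ^ (2 ^ j) + real (card (bad r)) * ((12 * R / \<eta>\<^sup>2)\<^sup>2) ^ (4 * 2 ^ j)"
  define I where "I = (Es \<times> Es) \<times> (T \<times> T)"
  define q where "q = (\<lambda>((E1, E2), (t, s)). cross (ga_pois G R p E1 \<eta> n) (ga_pois G R p E2 \<eta> n) t s)"
  define P where "P = (\<lambda>i mf. orthfam N (fst mf) (snd mf) \<and> real (fst mf) \<le> B \<and>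
      (\<forall>v. l2_on {0..<N} v \<longrightarrow> (\<forall>k<fst mf. cinner (snd mf k) v = 0) \<longrightarrow>
        norm (F.lop (q i) v) \<le> (2 * opn (q i) + 1) * norm v))"
  have "\<exists>mf. P i mf" if i: "i \<in> I" for i
  proof -
    obtain E1 E2 t s where i': "i = ((E1, E2), (t, s))" "t \<in> T" "s \<in> T"
      using i by (auto simp: I_def)
    then have tc: "t \<in> carrier G" "s \<in> carrier G" using T by auto
    define q1 q2 where "q1 = ga_pois G R p E1 \<eta> n" and "q2 = ga_pois G R p E2 \<eta> n"
    have qc: "ks q1 \<subseteq> carrier G" "ks q2 \<subseteq> carrier G"
      unfolding q1_def q2_def by (rule carrier_ga_pois[OF p_carrier])+
    have k: "ks (cross q1 q2 t s) \<subseteq> {g \<in> carrier G. wl g \<le> n * d}"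
      unfolding q1_def by (rule order.trans[OF keys_cross keys_ga_pois[OF p_carrier len]])
    have "norm (L.lop (ga_pois G R p E \<eta> n) (l2_delta \<one>)) \<le> 12 * R / \<eta>\<^sup>2 * norm (l2_delta \<one> :: 'g l2)" for E
      by (rule L.norm_lop_ga_pois[OF \<eta> l2_on_delta[OF one_closed]])
    then have M: "norm (L.lop (ga_pois G R p E \<eta> n) (l2_delta \<one>)) \<le> 12 * R / \<eta>\<^sup>2" for E
      by simp
    have "(\<Sum>g\<in>ks (cross q1 q2 t s). cmod (lk (cross q1 q2 t s) g)) \<le>
        (\<Sum>g\<in>ks q1. cmod (lk (cross q1 q2 t s) g))"
      by (rule sum_mono2[OF finite_keys keys_cross]) simp
    also have "\<dots> \<le> (12 * R / \<eta>\<^sup>2)\<^sup>2"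
      by (rule cross_norm1[OF qc tc]) (simp_all only: q1_def q2_def M)
    finally have W: "(\<Sum>g\<in>ks (cross q1 q2 t s). cmod (lk (cross q1 q2 t s) g)) \<le> (12 * R / \<eta>\<^sup>2)\<^sup>2" .
    obtain m f where "orthfam N m f"
      "real m \<le> real N / 16 ^ (2 ^ j) + real (card (bad r)) * ((12 * R / \<eta>\<^sup>2)\<^sup>2 / 1) ^ (4 * 2 ^ j)"
      "\<And>v. l2_on {0..<N} v \<Longrightarrow> (\<And>i. i < m \<Longrightarrow> cinner (f i) v = 0) \<Longrightarrow>
        norm (F.lop (cross q1 q2 t s) v) \<le> (2 * opn (cross q1 q2 t s) + 1) * norm v"
      proof (rule exceptional_family[OF k W _ r, of 1])
      fix m f
      assume f: "orthfam N m f" "real m \<le> real N / 16 ^ (2 ^ j) + real (card (bad r)) * ((12 * R / \<eta>\<^sup>2)\<^sup>2 / 1) ^ (4 * 2 ^ j)"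
        "\<And>v. l2_on {0..<N} v \<Longrightarrow> (\<And>i. i < m \<Longrightarrow> cinner (f i) v = 0) \<Longrightarrow>
          norm (F.lop (cross q1 q2 t s) v) \<le> (2 * opn (cross q1 q2 t s) + 1) * norm v"
      show thesis by (rule that[OF f])
    qed simp
    then have "P i (m, f)"
      by (simp add: P_def B_def i'(1) q_def q1_def q2_def)
    then show ?thesis ..
  qed
  then have "\<forall>i\<in>I. \<exists>mf. P i mf" by blast
  from bchoice[OF this] obtain mf where mf: "\<And>i. i \<in> I \<Longrightarrow> P i (mf i)" by blast
  define A where "A = insert (vec N (\<lambda>_. 1)) (\<Union>i\<in>I. (\<lambda>k. vec N (l2_at (snd (mf i) k))) ` {..<fst (mf i)})"
  have finI: "finite I" using Es T by (simp add: I_def)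
  then have "finite A" by (simp add: A_def)
  have "A \<subseteq> carrier_vec N" by (auto simp: A_def)
  obtain H :: "complex vec set" where H: "subspace class_ring H (module_vec TYPE(complex) N)"
    "vectorspace.dim class_ring ((module_vec TYPE(complex) N)\<lparr>carrier := H\<rparr>) \<le> card A" "A \<subseteq> H"
    by (rule subspace_of_finite[OF \<open>finite A\<close> \<open>A \<subseteq> carrier_vec N\<close>])
  have cI: "real (card I) = (real (card Es) * real (card T))\<^sup>2"
    by (simp add: I_def card_cartesian_product power2_eq_square)
  have "card A \<le> 1 + card (\<Union>i\<in>I. (\<lambda>k. vec N (l2_at (snd (mf i) k))) ` {..<fst (mf i)})"
    unfolding A_def using finI by (simp add: card_insert_if)
  also have "card (\<Union>i\<in>I. (\<lambda>k. vec N (l2_at (snd (mf i) k))) ` {..<fst (mf i)}) \<le>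
      (\<Sum>i\<in>I. card ((\<lambda>k. vec N (l2_at (snd (mf i) k))) ` {..<fst (mf i)}))"
    by (rule card_UN_le[OF finI])
  also have "\<dots> \<le> (\<Sum>i\<in>I. fst (mf i))"
  proof (rule sum_mono)
    fix i
    show "card ((\<lambda>k. vec N (l2_at (snd (mf i) k))) ` {..<fst (mf i)}) \<le> fst (mf i)"
      using card_image_le[OF finite_lessThan, of "\<lambda>k. vec N (l2_at (snd (mf i) k))" "fst (mf i)"] by simp
  qed
  finally have "real (card A) \<le> 1 + (\<Sum>i\<in>I. real (fst (mf i)))"
    by (simp flip: of_nat_sum)
  moreover have "(\<Sum>i\<in>I. real (fst (mf i))) \<le> (\<Sum>i\<in>I. B)"
  proof (rule sum_mono)
    fix i assume "i \<in> I"
    then have "P i (mf i)" by (rule mf)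
    then show "real (fst (mf i)) \<le> B" by (simp add: P_def)
  qed
  ultimately have "real (card A) \<le> 1 + (real (card Es) * real (card T))\<^sup>2 * B"
    by (simp add: cI)
  then have dim: "real (vectorspace.dim class_ring ((module_vec TYPE(complex) N)\<lparr>carrier := H\<rparr>)) \<le>
      1 + (real (card Es) * real (card T))\<^sup>2 * B"
    using H(2) by linarith
  have one: "vec N (\<lambda>_. 1) \<in> H" using H(3) by (auto simp: A_def)
  have perp: "norm (F.lop (cross (ga_pois G R p E1 \<eta> n) (ga_pois G R p E2 \<eta> n) t s) (vl N v)) \<le>
      (2 * opn (cross (ga_pois G R p E1 \<eta> n) (ga_pois G R p E2 \<eta> n) t s) + 1) * norm (vl N v)"
    if i: "E1 \<in> Es" "E2 \<in> Es" "t \<in> T" "s \<in> T" and v: "v \<in> carrier_vec N" "\<And>h. h \<in> H \<Longrightarrow> cv_inner h v = 0"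
    for E1 E2 t s v
  proof -
    define i where "i = ((E1, E2), (t, s))"
    have iI: "i \<in> I" using i by (simp add: i_def I_def)
    have qi: "q i = cross (ga_pois G R p E1 \<eta> n) (ga_pois G R p E2 \<eta> n) t s"
      by (simp add: i_def q_def)
    have Pi: "P i (mf i)" by (rule mf[OF iI])
    have "cinner (snd (mf i) k) (vl N v) = 0" if k: "k < fst (mf i)" for k
    proof -
      have on: "l2_on {0..<N} (snd (mf i) k)" using Pi k by (simp add: P_def orthfam_def)
      have "vec N (l2_at (snd (mf i) k)) \<in> H" using H(3) iI k by (auto simp: A_def)
      then have "cv_inner (vec N (l2_at (snd (mf i) k))) v = 0" by (rule v(2))
      then show ?thesis by (simp add: cv_inner_vl[OF _ v(1)] vl_vec[OF on])
    qed
    then have "norm (F.lop (q i) (vl N v)) \<le> (2 * opn (q i) + 1) * norm (vl N v)"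
      using Pi vl_on[of N v] by (simp add: P_def)
    then show ?thesis unfolding qi .
  qed
  show ?thesis
  proof (rule that[OF H(1)])
    show "vec N (\<lambda>_. 1) \<in> H" by (rule one)
    show "norm (F.lop (cross (ga_pois G R p E1 \<eta> n) (ga_pois G R p E2 \<eta> n) t s) (vl N v)) \<le>
        (2 * opn (cross (ga_pois G R p E1 \<eta> n) (ga_pois G R p E2 \<eta> n) t s) + 1) * norm (vl N v)"
      if "E1 \<in> Es" "E2 \<in> Es" "t \<in> T" "s \<in> T" "v \<in> carrier_vec N" "\<And>h. h \<in> H \<Longrightarrow> cv_inner h v = 0"
      for E1 E2 t s v
      by (rule perp[OF that])
  qed (rule dim[unfolded B_def])
qed

end

context local_obs
begin

lemma cinner_lop_fl_le:
  assumes "norm (F.lop q (fl N (Kc s))) \<le> c * norm (fl N (Kc s))"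
  shows "cmod (cinner (fl N (Kc t)) (F.lop q (fl N (Kc s)))) \<le> c * (norm (fl N (Kc t)) * norm (fl N (Kc s)))"
proof -
  have "cmod (cinner (fl N (Kc t)) (F.lop q (fl N (Kc s)))) \<le> norm (fl N (Kc t)) * norm (F.lop q (fl N (Kc s)))"
    by (rule cinner_cmod_le)
  also have "\<dots> \<le> norm (fl N (Kc t)) * (c * norm (fl N (Kc s)))"
    by (rule mult_left_mono[OF assms]) simp
  finally show ?thesis by (simp only: mult.left_commute)
qed

text \<open>Orthogonality to the constant vector makes the mean vanish, so centring changes nothing
  and the condition on \<open>obs_vec\<close> speaks about \<open>Kc\<close>.\<close>

lemma fl_Kc_obs_vec:
  assumes "cv_inner (vec N (\<lambda>_. 1)) (obs_vec N act K t) = 0"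
  shows "fl N (Kc t) = vl N (obs_vec N act K t)"
proof (rule l2_eqI)
  have c: "obs_vec N act K t \<in> carrier_vec N" "vec N (\<lambda>_. 1 :: complex) \<in> carrier_vec N"
    by (simp_all add: obs_vec_def)
  have "cinner (vl N (vec N (\<lambda>_. 1))) (vl N (obs_vec N act K t)) = 0"
    using assms unfolding cv_inner_vl[OF c(2,1)] .
  moreover have "kmean t = (1 / of_nat N) * cinner (vl N (vec N (\<lambda>_. 1))) (vl N (obs_vec N act K t))"
    by (simp add: kmean_def cinner_finite[OF vl_on] atLeast0LessThan)
  ultimately have km: "kmean t = 0" by simp
  show "l2_at (fl N (Kc t)) x = l2_at (vl N (obs_vec N act K t)) x" for x
    by (cases "x < N") (simp_all add: Kc_def obs_vec_def km)
qed

end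

section \<open>Asymptotics\<close>

lemma tail_err_antimono:
  assumes "0 < R" "0 < \<eta>" "\<eta> \<le> \<eta>'"
  shows "tail_err R \<eta>' n \<le> tail_err R \<eta> n"
proof -
  have "4 * R / \<eta>'\<^sup>2 \<le> 4 * R / \<eta>\<^sup>2"
    using assms by (intro divide_left_mono power_mono mult_pos_pos zero_less_power) auto
  moreover have "exp (- \<eta>' * real n / (2 * R)) \<le> exp (- \<eta> * real n / (2 * R))"
    using assms by (auto intro!: divide_right_mono mult_right_mono)
  ultimately show ?thesis
    unfolding tail_err_def using assms(1) by (intro mult_mono) auto
qed

text \<open>Here \<open>L\<close> is \<open>ln N\<close>. In the exponent
  \<open>3 + C1' / 4\<close>, two powers of \<open>L\<close> pay for \<open>1 / \<eta>^2\<close>,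
  the share \<open>C1' / 4\<close> pays for the weight after the fourth power, and the remaining
  power beats the constants.\<close>

lemma tail_small:
  fixes R M C0 C1' a L \<eta> m :: real
  assumes R: "R \<ge> 1" and M: "M \<ge> 1" and C0: "C0 \<ge> 1" and C1': "0 \<le> C1'" and a: "0 < a"
    and L: "1 \<le> L" "(a + 1) powr C1' * (8 * R * M\<^sup>2) ^ 4 \<le> L" "128 * R * M\<^sup>2 * C0 \<le> L"
    and \<eta>: "1 / L \<le> \<eta>" and n: "2 * R * M * (3 + C1' / 4) * ln L \<le> \<eta> * real n"
    and m: "0 \<le> m" "m \<le> (a + 1) * L"
  shows "tail_err R (\<eta> / M) n \<le> 1 / (32 * C0)" "m powr C1' * (2 * tail_err R \<eta> n) ^ 4 \<le> 1"
proof -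
  define Z where "Z = 4 * R * M\<^sup>2 * L powr (- 1 - C1' / 4)"
  have L0: "0 < L" using L by simp
  have "0 < 1 / L" using L0 by simp
  then have \<eta>0: "0 < \<eta>" using \<eta> by linarith
  have t1: "tail_err R (\<eta> / M) n \<le> Z"
  proof -
    have "1 \<le> \<eta> * L" using \<eta> L0 by (simp add: divide_le_eq)
    then have e1: "1 \<le> (\<eta> * L)\<^sup>2" by simp
    have "4 * R / (\<eta> / M)\<^sup>2 = (4 * R * M\<^sup>2) / \<eta>\<^sup>2 * 1"
      using M by (simp add: power_divide)
    also have "\<dots> \<le> (4 * R * M\<^sup>2) / \<eta>\<^sup>2 * (\<eta> * L)\<^sup>2"
      using R by (intro mult_left_mono e1) auto
    also have "\<dots> = 4 * R * M\<^sup>2 * L\<^sup>2"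
      using \<eta>0 by (simp add: power_mult_distrib)
    also have "L\<^sup>2 = L powr 2" using L0 by simp
    finally have 1: "4 * R / (\<eta> / M)\<^sup>2 \<le> 4 * R * M\<^sup>2 * L powr 2" .
    have "(3 + C1' / 4) * ln L \<le> \<eta> * real n / (2 * R * M)"
      using n R M by (simp add: le_divide_eq mult_ac)
    moreover have "- (\<eta> / M) * real n / (2 * R) = - (\<eta> * real n / (2 * R * M))" by simp
    ultimately have "- (\<eta> / M) * real n / (2 * R) \<le> - (3 + C1' / 4) * ln L"
      unfolding minus_mult_left[symmetric] by linarith
    then have "exp (- (\<eta> / M) * real n / (2 * R)) \<le> exp (- (3 + C1' / 4) * ln L)" by simp
    also have "\<dots> = L powr (- (3 + C1' / 4))" using L0 by (simp add: powr_def)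
    finally have 2: "exp (- (\<eta> / M) * real n / (2 * R)) \<le> L powr (- (3 + C1' / 4))" .
    have "tail_err R (\<eta> / M) n \<le> (4 * R * M\<^sup>2 * L powr 2) * L powr (- (3 + C1' / 4))"
      unfolding tail_err_def using R by (intro mult_mono 1 2) auto
    also have "\<dots> = 4 * R * M\<^sup>2 * (L powr 2 * L powr (- (3 + C1' / 4)))" by simp
    also have "L powr 2 * L powr (- (3 + C1' / 4)) = L powr (2 + - (3 + C1' / 4))"
      by (rule powr_add[symmetric])
    also have "2 + - (3 + C1' / 4) = - 1 - C1' / 4" by simp
    finally show ?thesis unfolding Z_def .
  qed
  show "tail_err R (\<eta> / M) n \<le> 1 / (32 * C0)"
  proof -
    have "L powr (- 1 - C1' / 4) \<le> L powr (- 1)" using L C1' by (intro powr_mono) auto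
    also have "\<dots> = 1 / L" using L0 by (simp add: powr_minus divide_inverse)
    finally have "Z \<le> 4 * R * M\<^sup>2 * (1 / L)"
      unfolding Z_def using R by (intro mult_left_mono) auto
    also have "\<dots> \<le> 1 / (32 * C0)" using L(3) L0 C0 by (simp add: field_simps)
    finally show ?thesis using t1 by simp
  qed
  have Z0: "0 \<le> Z" using R by (simp add: Z_def)
  have "tail_err R \<eta> n \<le> tail_err R (\<eta> / M) n"
    by (rule tail_err_antimono) (use R M \<eta>0 in \<open>auto simp: divide_le_eq mult_le_cancel_left1\<close>)
  then have tz: "2 * tail_err R \<eta> n \<le> 2 * Z" using t1 by simp
  have "m powr C1' \<le> ((a + 1) * L) powr C1'"
    by (rule powr_mono2[OF C1' m])
  also have "\<dots> = (a + 1) powr C1' * L powr C1'" using a L0 by (simp add: powr_mult)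
  finally have m1: "m powr C1' \<le> (a + 1) powr C1' * L powr C1'" .
  have t0: "0 \<le> 2 * tail_err R \<eta> n" using R tail_err_nonneg[of R \<eta> n] by simp
  have "(2 * tail_err R \<eta> n) ^ 4 \<le> (2 * Z) ^ 4" by (rule power_mono[OF tz t0])
  also have "\<dots> = (8 * R * M\<^sup>2) ^ 4 * (L powr (- 1 - C1' / 4)) ^ 4"
  proof -
    have "2 * Z = (8 * R * M\<^sup>2) * L powr (- 1 - C1' / 4)" by (simp add: Z_def)
    then show ?thesis by (simp only: power_mult_distrib)
  qed
  also have "(L powr (- 1 - C1' / 4)) ^ 4 = L powr (- 4 - C1')"
    using L0 by (simp add: powr_powr flip: powr_realpow[of "L powr (- 1 - C1' / 4)" 4])
  finally have t4: "(2 * tail_err R \<eta> n) ^ 4 \<le> (8 * R * M\<^sup>2) ^ 4 * L powr (- 4 - C1')" .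
  have "m powr C1' * (2 * tail_err R \<eta> n) ^ 4 \<le>
      ((a + 1) powr C1' * L powr C1') * ((8 * R * M\<^sup>2) ^ 4 * L powr (- 4 - C1'))"
    by (rule mult_mono[OF m1 t4]) (use t0 in auto)
  also have "\<dots> = ((a + 1) powr C1' * (8 * R * M\<^sup>2) ^ 4) * (L powr C1' * L powr (- 4 - C1'))"
    by simp
  also have "L powr C1' * L powr (- 4 - C1') = L powr (C1' + (- 4 - C1'))"
    by (rule powr_add[symmetric])
  also have "C1' + (- 4 - C1') = - 4" by simp
  also have "((a + 1) powr C1' * (8 * R * M\<^sup>2) ^ 4) * L powr (- 4) \<le> L * L powr (- 4)"
    by (rule mult_right_mono[OF L(2)]) simp
  also have "\<dots> = L powr 1 * L powr (- 4)" using L0 by simp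
  also have "\<dots> = L powr (1 + - 4)" by (rule powr_add[symmetric])
  also have "\<dots> \<le> L powr 0" using L by (intro powr_mono) auto
  also have "\<dots> = 1" using L0 by simp
  finally show "m powr C1' * (2 * tail_err R \<eta> n) ^ 4 \<le> 1" .
qed

context qe
begin

definition Mc :: real where "Mc = 16 * C0\<^sup>2"

definition degc :: real where "degc = 2 * R * Mc * (3 + C1' / 4)"

definition logc :: "real \<Rightarrow> real" where
  "logc a = max 1 (max ((a + 1) powr C1' * (8 * R * Mc\<^sup>2) ^ 4) (128 * R * Mc\<^sup>2 * C0))"

text \<open>\<open>256 = 8 * 32\<close>: bad points may spend half of the allowance
  \<open>N / (4 * C0)\<close>, that is \<open>N / (8 * C0)\<close>, against the factor
  \<open>32 * R * Mc^2\<close> of \<open>window_count\<close>.\<close>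

definition badc :: real where "badc = 256 * R * Mc\<^sup>2 * C0"

lemma Mc_ge_1: "1 \<le> Mc"
proof -
  have "1 \<le> C0\<^sup>2" using C0_ge by simp
  then show ?thesis by (simp add: Mc_def)
qed

lemma badc_ge_1: "1 \<le> badc"
proof -
  have "1 * 1 \<le> R * Mc\<^sup>2" using R1 Mc_ge_1 by (intro mult_mono) auto
  then have "1 * 1 \<le> (R * Mc\<^sup>2) * C0" using C0_ge by (intro mult_mono) auto
  then show ?thesis by (simp add: badc_def)
qed

end

context qe_obs
begin

lemma count_window:
  fixes h :: real
  assumes "\<And>g. g \<in> ks p \<Longrightarrow> wl g \<le> d" "n * d \<le> 2 * r" "0 < h" "h \<le> 1" "l \<le> E" "E \<le> u"
    "4 * real N * tail_err R (h / Mc) n + card (bad r) * (32 * R / (h / Mc)\<^sup>2) \<le> real N / (4 * C0)"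
  shows "real N * (h / Mc) / (2 * C0) \<le> real (card (\<Lambda> (window E h)))"
  using window_count[OF C0_ge Mc_def, of "h / Mc" d n r E] assms Mc_ge_1 AC[OF assms(5,6)]
  by (simp add: \<Lambda>_def)

text \<open>Half of the error allowed in \<open>window_count\<close> goes to the truncation and half
  to the bad points, at both scales.\<close>

lemma ergodicity_large:
  fixes \<eta> \<eta>c a L Cf :: real
  assumes \<eta>c: "0 < \<eta>c" "\<eta>c \<le> 1" "2 * \<eta>c \<le> u - l"
    and len: "\<And>g. g \<in> ks p \<Longrightarrow> wl g \<le> d" "\<And>t. t \<in> T \<Longrightarrow> wl t \<le> d"
    and r: "n * d + d \<le> r" "real r \<le> (a + 1) * L" and a: "0 < a" and L: "logc a \<le> L"
    and Lc: "1 / L \<le> \<eta>c" "degc * ln L \<le> \<eta>c * real n" and L\<eta>: "1 / L \<le> \<eta>" "degc * ln L \<le> \<eta> * real n"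
    and bad: "card (bad r) * L ^ 6 * badc \<le> real N"
    and hyp: "\<And>E1 E2 t s. \<eta> \<le> \<eta>c \<Longrightarrow> E1 \<in> net \<eta> \<Longrightarrow> E2 \<in> net \<eta> \<Longrightarrow> t \<in> T \<Longrightarrow> s \<in> T \<Longrightarrow>
      cmod (cinner (fl N (Kc t)) (F.lop (cross (ga_pois G R p E1 \<eta> n) (ga_pois G R p E2 \<eta> n) t s) (fl N (Kc s)))) \<le>
      (2 * opn (cross (ga_pois G R p E1 \<eta> n) (ga_pois G R p E2 \<eta> n) t s) + 1) *
        (norm (fl N (Kc t)) * norm (fl N (Kc s)))"
    and Cf: "2 * C0 * Mc * pairc d (card T) * (u - l + 1) / \<eta>c \<le> Cf"
      "(2 * real (card T))\<^sup>2 / (\<eta>c / Mc / (2 * C0)) \<le> Cf * \<eta>c powr ((1 + \<gamma>) / 2)"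
  shows "ergodicity_bounds N act p \<phi> {l..u} T Kx \<eta> (Cf * \<eta> powr ((1 + \<gamma>) / 2))"
proof -
  define m where "m = real (max 1 (n * d))"
  have L1: "1 \<le> L" "(a + 1) powr C1' * (8 * R * Mc\<^sup>2) ^ 4 \<le> L" "128 * R * Mc\<^sup>2 * C0 \<le> L"
    using L by (simp_all add: logc_def)
  have L0: "0 < L" using L1 by simp
  have nd: "n * d \<le> r" "n * d \<le> 2 * r" using r(1) by simp_all
  have aL: "1 \<le> (a + 1) * L" using mult_mono[of 1 "a + 1" 1 L] a L1(1) by simp
  have m: "0 \<le> m" "m \<le> (a + 1) * L"
    using nd(1) r(2) aL by (simp_all add: m_def max_def del: of_nat_mult)
  note ts = tail_small[OF R1 Mc_ge_1 C0_ge C1'_nonneg a L1 _ _ m, folded degc_def]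
  have bad': "card (bad r) * badc \<le> real N / L ^ 6"
    using bad L0 by (simp add: le_divide_eq mult_ac)
  have err: "4 * real N * tail_err R (h / Mc) n + card (bad r) * (32 * R / (h / Mc)\<^sup>2) \<le> real N / (4 * C0)"
    if h: "1 / L \<le> h" "degc * ln L \<le> h * real n" for h
  proof -
    have "4 * real N * tail_err R (h / Mc) n \<le> 4 * real N * (1 / (32 * C0))"
      by (rule mult_left_mono[OF ts(1)[OF h]]) simp
    moreover have "card (bad r) * (32 * R / (h / Mc)\<^sup>2) \<le> real N / (8 * C0)"
    proof -
      have "0 < 1 / L" using L0 by simp
      then have h0: "0 < h" using h(1) by linarith
      have "1 \<le> h * L" using h(1) L0 by (simp add: divide_le_eq)
      then have e1: "1 \<le> (h * L)\<^sup>2" by simp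
      have "card (bad r) * (32 * R / (h / Mc)\<^sup>2) = card (bad r) * (32 * R * Mc\<^sup>2 / h\<^sup>2) * 1"
        using Mc_ge_1 by (simp add: power_divide)
      also have "\<dots> \<le> card (bad r) * (32 * R * Mc\<^sup>2 / h\<^sup>2) * (h * L)\<^sup>2"
        using R1 by (intro mult_left_mono[OF e1]) auto
      also have "\<dots> = (card (bad r) * badc) * L\<^sup>2 / (8 * C0)"
        using h0 C0_ge by (simp add: power_mult_distrib badc_def)
      also have "\<dots> \<le> (real N / L ^ 6) * L\<^sup>2 / (8 * C0)"
        using C0_ge by (intro divide_right_mono mult_right_mono bad') auto
      also have "\<dots> = (real N / L ^ 4) / (8 * C0)"
        using L0 by (simp add: eval_nat_numeral)
      also have "\<dots> \<le> real N / (8 * C0)"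
      proof -
        have "1 \<le> L ^ 4" using L1(1) by simp
        then have "real N / L ^ 4 \<le> real N / 1" by (intro divide_left_mono) auto
        then show ?thesis using C0_ge by (intro divide_right_mono) auto
      qed
      finally show ?thesis .
    qed
    moreover have "real N / (4 * C0) = 4 * real N * (1 / (32 * C0)) + real N / (8 * C0)"
      using C0_ge by (simp add: field_simps)
    ultimately show ?thesis by linarith
  qed
  show ?thesis
  proof (cases "\<eta> \<le> \<eta>c")
    case True
    have "0 < 1 / L" using L0 by simp
    then have \<eta>0: "0 < \<eta>" using L\<eta>(1) by linarith
    have b6: "card (bad r) \<le> real N * \<eta> ^ 6"
    proof -
      have "real (card (bad r)) * 1 \<le> real (card (bad r)) * badc" by (rule mult_left_mono[OF badc_ge_1]) simp
      also have "\<dots> \<le> real N / L ^ 6" by (rule bad')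
      also have "\<dots> = real N * (1 / L) ^ 6" by (simp add: power_divide)
      also have "\<dots> \<le> real N * \<eta> ^ 6"
        using L0 by (intro mult_left_mono power_mono L\<eta>) auto
      finally show ?thesis by simp
    qed
    have \<eta>1: "\<eta> \<le> 1" using True \<eta>c by simp
    show ?thesis
      by (rule ergodicity_main[OF \<eta>0 \<eta>1 True \<eta>c(2,3) len r(1) ts(2)[OF L\<eta>, unfolded m_def] b6 Mc_def
            err[OF L\<eta>] err[OF Lc] hyp[OF True] Cf(1)])
  next
    case False
    \<comment> \<open>For \<open>\<eta> > \<eta>c\<close> the claimed bound is of order one: every
      window contains one of half-width \<open>\<eta>c\<close>, which already holds a fixed
      proportion of the eigenvalues.\<close>
    define c where "c = \<eta>c / Mc / (2 * C0)"
    have c0: "0 < c" using \<eta>c Mc_ge_1 C0_ge by (simp add: c_def)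
    have cnt: "c * real N \<le> real (card (\<Lambda> (window E \<eta>c)))" if "l \<le> E" "E \<le> u" for E
    proof -
      have "c * real N = real N * (\<eta>c / Mc) / (2 * C0)" by (simp add: c_def)
      then show ?thesis using count_window[OF len(1) nd(2) \<eta>c(1,2) that err[OF Lc]] by linarith
    qed
    show ?thesis
    proof (rule ergodicity_trivial[OF c0])
      show "c * real N \<le> real (card (\<Lambda> (window E \<eta>)))" if "l \<le> E" "E \<le> u" for E
      proof -
        have "\<Lambda> (window E \<eta>c) \<subseteq> \<Lambda> (window E \<eta>)" using False by (auto simp: \<Lambda>_def window_def)
        then have "card (\<Lambda> (window E \<eta>c)) \<le> card (\<Lambda> (window E \<eta>))" by (rule card_mono[OF finite_\<Lambda>])
        then show ?thesis using cnt[OF that] by linarith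
      qed
      have "\<Lambda> (window ((l + u) / 2) \<eta>c) \<subseteq> \<Lambda> {l..u}"
        using \<eta>c(3) by (auto simp: \<Lambda>_def window_def field_simps)
      then have "card (\<Lambda> (window ((l + u) / 2) \<eta>c)) \<le> card (\<Lambda> {l..u})" by (rule card_mono[OF finite_\<Lambda>])
      moreover have "c * real N \<le> real (card (\<Lambda> (window ((l + u) / 2) \<eta>c)))"
        by (rule cnt) (use lu in auto)
      ultimately show "c * real N \<le> real (card (\<Lambda> {l..u}))" by linarith
      have "0 \<le> Cf * \<eta>c powr ((1 + \<gamma>) / 2)"
        by (rule order.trans[OF _ Cf(2)[folded c_def]]) (use c0 in simp)
      then have "0 \<le> Cf" using \<eta>c(1) by (simp add: zero_le_mult_iff)
      then have "Cf * \<eta>c powr ((1 + \<gamma>) / 2) \<le> Cf * \<eta> powr ((1 + \<gamma>) / 2)"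
        using False \<eta>c \<gamma> by (intro mult_left_mono powr_mono2) auto
      then show "(2 * real (card T))\<^sup>2 / c \<le> Cf * \<eta> powr ((1 + \<gamma>) / 2)"
        using Cf(2) unfolding c_def by linarith
    qed
  qed
qed

text \<open>For bounded \<open>N\<close> a nonempty index set contains at least the proportion
  \<open>1 / X\<close> of all indices, and the trivial bound applies.\<close>

lemma ergodicity_small:
  fixes \<eta> \<eta>c X Cf :: real
  assumes \<eta>c: "0 < \<eta>c" "\<eta>c \<le> \<eta>" and X: "real N \<le> X"
    and Cf: "(2 * real (card T))\<^sup>2 * X \<le> Cf * \<eta>c powr ((1 + \<gamma>) / 2)" "0 \<le> Cf"
  shows "ergodicity_bounds N act p \<phi> {l..u} T Kx \<eta> (Cf * \<eta> powr ((1 + \<gamma>) / 2))"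
proof -
  have X0: "0 < X" using N0 X by linarith
  have cd: "1 / X * real N \<le> real (card (\<Lambda> J))" if "\<Lambda> J \<noteq> {}" for J
  proof -
    have "1 / X * real N \<le> 1" using X X0 by (simp add: divide_le_eq)
    moreover have "1 \<le> card (\<Lambda> J)" using that finite_\<Lambda>[of J] by (simp add: Suc_le_eq card_gt_0_iff)
    ultimately show ?thesis by linarith
  qed
  show ?thesis
  proof (rule ergodicity_trivial[of "1 / X"])
    have "Cf * \<eta>c powr ((1 + \<gamma>) / 2) \<le> Cf * \<eta> powr ((1 + \<gamma>) / 2)"
      using \<eta>c \<gamma> by (intro mult_left_mono[OF _ Cf(2)] powr_mono2) auto
    then show "(2 * real (card T))\<^sup>2 / (1 / X) \<le> Cf * \<eta> powr ((1 + \<gamma>) / 2)"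
      using Cf(1) by simp
  qed (use X0 cd in auto)
qed

end

section \<open>Choice of the scales along the sequence\<close>

locale qe_seq = qe G S p R C1' K C0 C4 \<gamma> l u
  for G :: "('g, 'm) monoid_scheme" (structure) and S p R C1' K C0 C4 \<gamma> l u +
  fixes Ns :: "nat set" and \<rho> :: "nat \<Rightarrow> 'g \<Rightarrow> nat \<Rightarrow> nat" and \<phi> :: "nat \<Rightarrow> nat \<Rightarrow> complex vec"
    and a \<beta> Cb :: real
  assumes Ns0: "0 \<notin> Ns" and actions: "\<And>N. N \<in> Ns \<Longrightarrow> group_action G {0..<N} (\<rho> N)"
    and eigenbases: "\<And>N. N \<in> Ns \<Longrightarrow> orthonormal_eigenbasis N (perm_rep_ga N (\<rho> N) p) (\<phi> N)"
    and a: "a > 0" and \<beta>: "\<beta> < 1" and Cb: "Cb > 0"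
    and card_Bad: "\<And>N. N \<in> Ns \<Longrightarrow> real (card (Bad G S N (\<rho> N) (radius a N))) \<le> Cb * real N powr \<beta>"
begin

lemma perm_rep: "N \<in> Ns \<Longrightarrow> perm_rep G S p R N (\<rho> N) (\<phi> N)"
  using Ns0 by (intro perm_rep.intro perm_rep_axioms.intro cayley_sa_axioms actions eigenbases) (auto intro: gr0I)

lemma qe_obs:
  assumes "N \<in> Ns" "T \<subseteq> carrier G" "finite T" "local_mat N (\<rho> N) T Kx" "norm_one_inf Kx \<le> 1"
  shows "qe_obs G S p R C1' K C0 C4 \<gamma> l u N (\<rho> N) (\<phi> N) T Kx"
proof -
  interpret perm_rep G S p R N "\<rho> N" "\<phi> N" by (rule perm_rep[OF assms(1)])
  show ?thesis by unfold_locales (fact assms)+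
qed

text \<open>The largest scale at most 1 for which a window around the midpoint fits into the
  interval.\<close>

definition \<eta>c :: real where "\<eta>c = min 1 ((u - l) / 2)"

lemma \<eta>c: "0 < \<eta>c" "\<eta>c \<le> 1" "2 * \<eta>c \<le> u - l"
  using lu by (auto simp: \<eta>c_def min_def)

text \<open>The single input that differs between the two halves of the theorem. Strong convergence
  gives it without the summand 1; otherwise it follows from orthogonality to the exceptional space,
  where 1 is the \<open>\<epsilon>\<close> of \<open>exceptional_family\<close>.\<close>

definition obs_hyp :: "nat \<Rightarrow> 'g set \<Rightarrow> complex mat \<Rightarrow> real \<Rightarrow> nat \<Rightarrow> bool" where
  "obs_hyp N T Kx \<eta> n \<longleftrightarrow> (\<forall>E1\<in>net \<eta>. \<forall>E2\<in>net \<eta>. \<forall>t\<in>T. \<forall>s\<in>T.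
      norm (gact.lop G {0..<N} (\<rho> N) (cross (ga_pois G R p E1 \<eta> n) (ga_pois G R p E2 \<eta> n) t s)
        (fl N (local_obs.Kc N (\<rho> N) Kx s))) \<le>
      (2 * opn (cross (ga_pois G R p E1 \<eta> n) (ga_pois G R p E2 \<eta> n) t s) + 1) *
        norm (fl N (local_obs.Kc N (\<rho> N) Kx s)))"

text \<open>As large as the radius \<open>a * L\<close> permits once each word of the polynomial is
  lengthened by the factor \<open>q * w\<close>; taking the floor loses at most a factor 2 in the
  range used.\<close>

definition degree :: "real \<Rightarrow> real \<Rightarrow> real \<Rightarrow> nat" where
  "degree q w L = nat \<lfloor>a * L / (q * w)\<rfloor>"

lemma degree_bounds:
  assumes "0 < q" "0 < w" "2 \<le> a * L / (q * w)"
  shows "real (degree q w L) \<le> a * L / (q * w)" "a * L / (2 * q * w) \<le> real (degree q w L)"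
proof -
  define y where "y = a * L / (q * w)"
  have "2 \<le> y" using assms(3) by (simp add: y_def)
  then have "y / 2 \<le> real (nat \<lfloor>y\<rfloor>)" by linarith
  moreover have "a * L / (2 * q * w) = y / 2" by (simp add: y_def)
  ultimately show "a * L / (2 * q * w) \<le> real (degree q w L)"
    by (simp add: degree_def y_def)
  show "real (degree q w L) \<le> a * L / (q * w)"
    using assms(3) unfolding degree_def by linarith
qed

lemma radius_bounds:
  assumes "1 \<le> ln (real N)"
  shows "a * ln (real N) \<le> real (radius a N)" "real (radius a N) \<le> (a + 1) * ln (real N)"
proof -
  have "0 < a * ln (real N)" using a assms by simp
  then have "a * ln (real N) \<le> real (radius a N)" "real (radius a N) \<le> a * ln (real N) + 1"
    unfolding radius_def by linarith+
  then show "a * ln (real N) \<le> real (radius a N)" "real (radius a N) \<le> (a + 1) * ln (real N)"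
    using assms by (simp_all add: distrib_right)
qed

text \<open>The weight \<open>W\<close> is \<open>1\<close> under strong convergence and \<open>ln\<close> without it. The function \<open>Q\<close> carries a further
  condition on large \<open>L = ln N\<close>, whose threshold has to be fixed together with that of the conclusion.\<close>

lemma ergodicity_asymptotic:
  fixes W :: "real \<Rightarrow> real" and q \<omega> :: real
  assumes T: "finite T" "T \<subseteq> carrier G" and len: "\<And>g. g \<in> ks p \<Longrightarrow> wl g \<le> d" "\<And>t. t \<in> T \<Longrightarrow> wl t \<le> d"
    and q: "0 < q" "2 * real d \<le> q"
    and W: "eventually (\<lambda>L. 1 \<le> W L) at_top" "filterlim (\<lambda>L. L / (ln L * W L)) at_top at_top"
    and \<omega>: "0 < \<omega>" "\<And>L. ln 3 \<le> L \<Longrightarrow> \<omega> \<le> ln L * W L"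
    and Q: "eventually Q at_top"
  obtains C X :: real where "C > 0"
    "\<And>N Kx. N \<in> Ns \<Longrightarrow> N \<ge> 3 \<Longrightarrow> ln (real N) < X \<or> \<eta>c < C * (ln (ln (real N)) * W (ln (real N))) / ln (real N) \<or>
        obs_hyp N T Kx (C * (ln (ln (real N)) * W (ln (real N))) / ln (real N))
          (degree q (W (ln (real N))) (ln (real N))) \<Longrightarrow>
      local_mat N (\<rho> N) T Kx \<Longrightarrow> norm_one_inf Kx \<le> 1 \<Longrightarrow>
      ergodicity_bounds N (\<rho> N) p (\<phi> N) {l..u} T Kx (C * (ln (ln (real N)) * W (ln (real N))) / ln (real N))
        (C * (C * (ln (ln (real N)) * W (ln (real N))) / ln (real N)) powr ((1 + \<gamma>) / 2))"
    "\<And>L. X \<le> L \<Longrightarrow> Q L \<and> 1 \<le> L \<and> 1 \<le> ln L \<and> 1 \<le> W L \<and> 1 / L \<le> C * (ln L * W L) / L \<and>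
      real d \<le> a * L / 2 \<and> real (degree q (W L) L) \<le> a * L / (q * W L)"
proof -
  define k where "k = real (card T)"
  define \<nu> where "\<nu> = \<eta>c powr ((1 + \<gamma>) / 2)"
  have \<nu>0: "0 < \<nu>" using \<eta>c(1) by (simp add: \<nu>_def)
  \<comment> \<open>The number of bad points is a power of \<open>N\<close> below 1, so it beats any
    power of \<open>ln N\<close>.\<close>
  have badlim: "eventually (\<lambda>L. Cb * badc * (L ^ 6 * exp (\<beta> * L) / exp L) < 1) at_top"
  proof -
    define \<delta> where "\<delta> = 1 - \<beta>"
    have "\<delta> > 0" using \<beta> by (simp add: \<delta>_def)
    then have "((\<lambda>L::real. L ^ 6 * exp (- \<delta> * L)) \<longlongrightarrow> 0) at_top"
      by real_asymp
    moreover have "(\<lambda>L::real. L ^ 6 * exp (- \<delta> * L)) = (\<lambda>L. L ^ 6 * exp (\<beta> * L) / exp L)"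
      by (simp add: \<delta>_def algebra_simps exp_diff)
    ultimately have "((\<lambda>L::real. L ^ 6 * exp (\<beta> * L) / exp L) \<longlongrightarrow> 0) at_top"
      by simp
    then have "((\<lambda>L. Cb * badc * (L ^ 6 * exp (\<beta> * L) / exp L)) \<longlongrightarrow> Cb * badc * 0) at_top"
      by (rule tendsto_mult_left)
    then show ?thesis by (intro order_tendstoD(2)) auto
  qed
  have big: "eventually (\<lambda>L::real. y \<le> L) at_top" for y by (rule eventually_ge_at_top)
  have W2: "eventually (\<lambda>L. y \<le> L / (ln L * W L)) at_top" for y
    using W(2) unfolding filterlim_at_top by blast
  have lnbig: "eventually (\<lambda>L::real. 1 \<le> ln L) at_top" by real_asymp
  \<comment> \<open>None of these conditions mentions \<open>C\<close>, so the threshold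
    \<open>X\<close> is fixed first and \<open>C\<close> may depend on it.\<close>
  have "eventually (\<lambda>L. Q L \<and> 1 \<le> W L \<and> 1 \<le> ln L \<and> 1 \<le> L \<and> logc a \<le> L \<and> 1 / \<eta>c \<le> L \<and> 2 * real d / a \<le> L \<and>
      2 * q * degc / (\<eta>c * a) \<le> L / (ln L * W L) \<and> 2 * q / a \<le> L / (ln L * W L) \<and>
      Cb * badc * (L ^ 6 * exp (\<beta> * L) / exp L) < 1) at_top"
    by (intro eventually_conj Q W(1) big W2 lnbig badlim)
  then obtain X where X: "\<And>L. X \<le> L \<Longrightarrow> Q L \<and> 1 \<le> W L \<and> 1 \<le> ln L \<and> 1 \<le> L \<and> logc a \<le> L \<and> 1 / \<eta>c \<le> L \<and>
      2 * real d / a \<le> L \<and>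
      2 * q * degc / (\<eta>c * a) \<le> L / (ln L * W L) \<and> 2 * q / a \<le> L / (ln L * W L) \<and>
      Cb * badc * (L ^ 6 * exp (\<beta> * L) / exp L) < 1"
    unfolding eventually_at_top_linorder by blast
  \<comment> \<open>In order, the entries make \<open>\<eta>\<close> at least \<open>1 / L\<close>,
    make the degree large enough for \<open>tail_small\<close>, force
    \<open>\<eta> >= \<eta>c\<close> when \<open>ln N < X\<close>, and dominate the constants of the
    main case, of the case \<open>\<eta> > \<eta>c\<close> and of small \<open>N\<close>.\<close>
  define Cl where "Cl = [1, 2 * q * degc / a, \<bar>\<eta>c * X / \<omega>\<bar>, 2 * C0 * Mc * pairc d (card T) * (u - l + 1) / \<eta>c,
    (2 * k)\<^sup>2 / (\<eta>c / Mc / (2 * C0)) / \<nu>, (2 * k)\<^sup>2 * exp X / \<nu>]"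
  define C where "C = Max (set Cl)"
  have C: "x \<le> C" if "x \<in> set Cl" for x unfolding C_def using that by (intro Max_ge) auto
  have C1: "1 \<le> C" by (rule C) (simp add: Cl_def)
  have C2: "2 * q * degc / a \<le> C" by (rule C) (simp add: Cl_def)
  have C3: "\<eta>c * X / \<omega> \<le> C"
    by (rule order.trans[OF abs_ge_self], rule C) (simp add: Cl_def)
  have C4': "2 * C0 * Mc * pairc d (card T) * (u - l + 1) / \<eta>c \<le> C"
    by (rule C) (simp add: Cl_def)
  have C5: "(2 * k)\<^sup>2 / (\<eta>c / Mc / (2 * C0)) \<le> C * \<nu>"
    by (subst pos_divide_le_eq[OF \<nu>0, symmetric], rule C) (simp add: Cl_def)
  have C6: "(2 * k)\<^sup>2 * exp X \<le> C * \<nu>"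
    by (subst pos_divide_le_eq[OF \<nu>0, symmetric], rule C) (simp add: Cl_def)
  have lower: "1 / L \<le> C * (ln L * W L) / L" if "X \<le> L" for L
  proof -
    have "1 * 1 \<le> ln L * W L" using X[OF that] by (intro mult_mono) auto
    then have "1 * 1 \<le> C * (ln L * W L)" using C1 by (intro mult_mono) auto
    then show ?thesis using X[OF that] by (intro divide_right_mono) auto
  qed
  have deg2: "2 \<le> a * L / (q * W L)" if "X \<le> L" for L
  proof -
    have "2 * q / a * 1 \<le> L / (ln L * W L) * ln L"
      using X[OF that] q a by (intro mult_mono) auto
    also have "\<dots> = L / W L"
    proof -
      have "ln L \<noteq> 0" using X[OF that] by linarith
      then show ?thesis by simp
    qed
    finally have "2 * q / a \<le> L / W L" by simp
    then have "2 * q / a * (a / q) \<le> L / W L * (a / q)" using a q by (intro mult_right_mono) auto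
    then show ?thesis using a q by (simp add: mult_ac)
  qed
  show ?thesis
  proof (rule that[of C X])
    show "C > 0" using C1 by simp
    show "Q L \<and> 1 \<le> L \<and> 1 \<le> ln L \<and> 1 \<le> W L \<and> 1 / L \<le> C * (ln L * W L) / L \<and>
        real d \<le> a * L / 2 \<and> real (degree q (W L) L) \<le> a * L / (q * W L)" if "X \<le> L" for L
    proof -
      have "real (degree q (W L) L) \<le> a * L / (q * W L)"
        by (rule degree_bounds(1)[OF q(1) _ deg2[OF that]]) (use X[OF that] in simp)
      moreover have "real d \<le> a * L / 2" using X[OF that] a by (simp add: field_simps)
      ultimately show ?thesis using X[OF that] lower[OF that] by simp
    qed
    fix N Kx assume N: "N \<in> Ns" "N \<ge> 3"
      and h: "ln (real N) < X \<or> \<eta>c < C * (ln (ln (real N)) * W (ln (real N))) / ln (real N) \<or>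
        obs_hyp N T Kx (C * (ln (ln (real N)) * W (ln (real N))) / ln (real N))
          (degree q (W (ln (real N))) (ln (real N)))"
      and Kx: "local_mat N (\<rho> N) T Kx" "norm_one_inf Kx \<le> 1"
    define L where "L = ln (real N)"
    define \<eta> where "\<eta> = C * (ln L * W L) / L"
    have L3: "ln 3 \<le> L" using N(2) by (simp add: L_def)
    have L0: "0 < L" using L3 ln_gt_zero[of "3::real"] by linarith
    interpret O: qe_obs G S p R C1' K C0 C4 \<gamma> l u N "\<rho> N" "\<phi> N" T Kx
      by (rule qe_obs[OF N(1) T(2,1) Kx])
    have "ergodicity_bounds N (\<rho> N) p (\<phi> N) {l..u} T Kx \<eta> (C * \<eta> powr ((1 + \<gamma>) / 2))"
    proof (cases "L < X")
      case True
      show ?thesis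
      proof (rule O.ergodicity_small[OF \<eta>c(1)])
        have "real N = exp L" using N(2) by (simp add: L_def)
        then show "real N \<le> exp X" using True by simp
        show "(2 * real (card T))\<^sup>2 * exp X \<le> C * \<eta>c powr ((1 + \<gamma>) / 2)"
          using C6 by (simp only: k_def \<nu>_def)
        show "0 \<le> C" using C1 by simp
        have "\<eta>c * L \<le> \<eta>c * X" using True \<eta>c(1) by simp
        also have "\<dots> \<le> C * \<omega>" using C3 \<omega>(1) by (simp add: pos_divide_le_eq)
        also have "\<dots> \<le> C * (ln L * W L)" using C1 \<omega>(2)[OF L3] by (intro mult_left_mono) auto
        finally show "\<eta>c \<le> \<eta>" using L0 by (simp add: \<eta>_def pos_le_divide_eq)
      qed
    next
      case False
      then have XL: "X \<le> L" by simp
      note XL' = X[OF XL]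
      define n where "n = degree q (W L) L"
      have Wp: "0 < W L" using XL' by simp
      have n: "real n \<le> a * L / (q * W L)" "a * L / (2 * q * W L) \<le> real n"
        unfolding n_def by (rule degree_bounds[OF q(1) Wp deg2[OF XL]])+
      have rb: "a * L \<le> real (radius a N)" "real (radius a N) \<le> (a + 1) * L"
        using radius_bounds[of N] XL' unfolding L_def by auto
      \<comment> \<open>One half of the radius holds the support of the polynomials, since
        \<open>q >= 2 * d\<close> and \<open>W L >= 1\<close>; the other half holds the
        multiplication by an element of \<open>T\<close>.\<close>
      have nd: "n * d + d \<le> radius a N"
      proof -
        have "2 * real d * 1 \<le> q * W L" using q XL' by (intro mult_mono) auto
        then have "real n * (2 * real d) \<le> real n * (q * W L)" by (intro mult_left_mono) auto
        also have "\<dots> \<le> a * L" using n(1) q(1) Wp by (simp add: pos_le_divide_eq)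
        finally have "real n * real d \<le> a * L / 2" by simp
        moreover have "real d \<le> a * L / 2" using XL' a by (simp add: field_simps)
        ultimately have "real (n * d + d) \<le> real (radius a N)" using rb(1) by simp
        then show ?thesis by (simp only: of_nat_le_iff)
      qed
      have dn: "degc * ln L \<le> h * real n" if "degc * ln L \<le> h * (a * L / (2 * q * W L))" "0 \<le> h" for h
        using mult_left_mono[OF n(2) that(2)] that(1) by linarith
      have d1: "degc * ln L \<le> \<eta>c * (a * L / (2 * q * W L))"
      proof -
        have "0 < ln L" using XL' by linarith
        then have "0 < ln L * W L" using Wp by (rule mult_pos_pos)
        moreover have "2 * q * degc / (\<eta>c * a) \<le> L / (ln L * W L)" using XL' by simp
        ultimately have "2 * q * degc / (\<eta>c * a) * (ln L * W L) \<le> L" by (simp only: pos_le_divide_eq)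
        then have "(\<eta>c * a) * (2 * q * degc / (\<eta>c * a) * (ln L * W L)) \<le> (\<eta>c * a) * L"
          using \<eta>c(1) a by (intro mult_left_mono) auto
        then have "2 * q * degc * (ln L * W L) \<le> \<eta>c * a * L"
          using \<eta>c(1) a by simp
        then show ?thesis using q(1) Wp by (simp add: field_simps)
      qed
      have \<eta>e: "\<eta> * (a * L / (2 * q * W L)) = C * a / (2 * q) * ln L"
        using L0 Wp q(1) by (simp add: \<eta>_def field_simps)
      have "degc \<le> C * a / (2 * q)" using C2 a q(1) by (simp add: field_simps)
      then have d2: "degc * ln L \<le> \<eta> * (a * L / (2 * q * W L))"
        unfolding \<eta>e using XL' by (intro mult_right_mono) auto
      have L\<eta>: "1 / L \<le> \<eta>" unfolding \<eta>_def by (rule lower[OF XL])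
      have \<eta>0: "0 \<le> \<eta>" using order.trans[OF _ L\<eta>, of 0] L0 by simp
      show ?thesis
      proof (rule O.ergodicity_large[OF \<eta>c len nd rb(2) a])
        show "logc a \<le> L" using XL' by simp
        show "1 / L \<le> \<eta>c" using XL' \<eta>c(1) L0 by (simp add: field_simps)
        show "degc * ln L \<le> \<eta>c * real n" using \<eta>c by (intro dn d1) auto
        show "1 / L \<le> \<eta>" by (rule L\<eta>)
        show "degc * ln L \<le> \<eta> * real n" by (intro dn d2 \<eta>0)
        show "real (card (Bad G S N (\<rho> N) (radius a N))) * L ^ 6 * badc \<le> real N"
        proof -
          have e: "real N = exp L" using N(2) by (simp add: L_def)
          have "real N powr \<beta> = exp (\<beta> * L)" using N(2) by (simp add: powr_def L_def)
          then have "real (card (Bad G S N (\<rho> N) (radius a N))) \<le> Cb * exp (\<beta> * L)"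
            using card_Bad[OF N(1)] by simp
          then have "real (card (Bad G S N (\<rho> N) (radius a N))) * (L ^ 6 * badc) \<le> Cb * exp (\<beta> * L) * (L ^ 6 * badc)"
            using L0 badc_ge_1 by (intro mult_right_mono) auto
          also have "\<dots> = Cb * badc * (L ^ 6 * exp (\<beta> * L) / exp L) * exp L" by simp
          also have "\<dots> \<le> 1 * exp L" using XL' by (intro mult_right_mono) auto
          finally show ?thesis by (simp add: e mult_ac)
        qed
        show "2 * C0 * Mc * pairc d (card T) * (u - l + 1) / \<eta>c \<le> C" by (rule C4')
        show "(2 * real (card T))\<^sup>2 / (\<eta>c / Mc / (2 * C0)) \<le> C * \<eta>c powr ((1 + \<gamma>) / 2)"
          using C5 by (simp only: k_def \<nu>_def)
        fix E1 E2 t s assume E: "\<eta> \<le> \<eta>c" "E1 \<in> net \<eta>" "E2 \<in> net \<eta>" "t \<in> T" "s \<in> T"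
        have "obs_hyp N T Kx \<eta> n"
          using h E(1) False unfolding L_def[symmetric] \<eta>_def[symmetric] n_def[symmetric] by linarith
        then show "cmod (cinner (fl N (O.Kc t)) (O.F.lop (cross (ga_pois G R p E1 \<eta> n) (ga_pois G R p E2 \<eta> n) t s) (fl N (O.Kc s)))) \<le>
          (2 * opn (cross (ga_pois G R p E1 \<eta> n) (ga_pois G R p E2 \<eta> n) t s) + 1) *
            (norm (fl N (O.Kc t)) * norm (fl N (O.Kc s)))"
          unfolding obs_hyp_def using E by (intro O.cinner_lop_fl_le) blast
      qed
    qed
    then show "ergodicity_bounds N (\<rho> N) p (\<phi> N) {l..u} T Kx (C * (ln (ln (real N)) * W (ln (real N))) / ln (real N))
        (C * (C * (ln (ln (real N)) * W (ln (real N))) / ln (real N)) powr ((1 + \<gamma>) / 2))"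
      unfolding L_def \<eta>_def .
  qed
qed

end

lemma ex_two_power:
  fixes y :: real
  assumes "1 \<le> y"
  obtains j :: nat where "y \<le> 2 ^ j" "2 ^ j \<le> 2 * y"
proof -
  define j where "j = nat \<lceil>log 2 y\<rceil>"
  have "0 \<le> log 2 y" using assms by simp
  then have j: "log 2 y \<le> real j" "real j \<le> log 2 y + 1" unfolding j_def by linarith+
  have p: "2 powr real j = 2 ^ j" by (simp add: powr_realpow)
  have y: "2 powr (log 2 y) = y" using assms by simp
  have "2 powr (log 2 y) \<le> 2 powr real j" using j(1) by simp
  then have 1: "y \<le> 2 ^ j" unfolding p y .
  have "2 powr real j \<le> 2 powr (log 2 y + 1)" using j(2) by simp
  also have "\<dots> = 2 * y" using y by (simp add: powr_add)
  finally have 2: "2 ^ j \<le> 2 * y" unfolding p .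
  show ?thesis by (rule that[OF 1 2])
qed

text \<open>Makes \<open>ln (ln N)\<close> bounded below by a positive constant for
  \<open>N >= 3\<close>. The estimate is \<open>exp (-1) >= (5 / 6)^6 > 1 / 3\<close>.\<close>

lemma ln_3_gt_1: "1 < ln (3 :: real)"
proof -
  have "5 / 6 \<le> exp (- 1 / 6 :: real)" using exp_ge_add_one_self[of "- 1 / 6 :: real"] by simp
  then have "(5 / 6) ^ 6 \<le> exp (- 1 / 6 :: real) ^ 6" by (rule power_mono) simp
  also have "\<dots> = exp (- 1)" by (simp flip: exp_of_nat_mult)
  finally have "(1 / 3 :: real) < exp (- 1)" by (simp add: eval_nat_numeral)
  then have "ln (1 / 3 :: real) < ln (exp (- 1))" by (subst ln_less_cancel_iff) simp_all
  then show ?thesis by (simp add: ln_div)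
qed

text \<open>The three terms are made at most a third each. With \<open>\<kappa> = b + 4\<close> the
  power \<open>L powr (- 2 * \<kappa>)\<close> beats both \<open>L^2\<close>, from the pairs of net
  points, and the target \<open>L powr b\<close>. The bad points lose because \<open>exp\<close> of
  a multiple of \<open>(ln L)^2\<close> is negligible against
  \<open>exp ((1 - \<beta>) * L)\<close>.\<close>

lemma dimension_eventually:
  fixes b \<kappa> \<beta> D c R :: real
  assumes b: "0 < b" and \<kappa>: "\<kappa> = b + 4" and \<beta>: "\<beta> < 1" and R: "1 \<le> R"
  shows "eventually (\<lambda>L. 1 + (D * L)\<^sup>2 * (exp L * L powr (- 2 * \<kappa>) +
      c * exp (\<beta> * L) * exp (8 * \<kappa> * ln L * ln (144 * R\<^sup>2 * L ^ 4))) \<le> exp L / L powr b) at_top"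
proof -
  define \<delta> where "\<delta> = 1 - \<beta>"
  define c0 where "c0 = ln (144 * R\<^sup>2)"
  have \<delta>: "\<delta> > 0" using \<beta> by (simp add: \<delta>_def)
  have \<kappa>0: "\<kappa> > 0" using b \<kappa> by simp
  have c0: "c0 > 0"
  proof -
    have "1 \<le> R\<^sup>2" using R by simp
    then have "1 < 144 * R\<^sup>2" by linarith
    then show ?thesis unfolding c0_def by (rule ln_gt_zero)
  qed
  have "((\<lambda>L::real. L powr b / exp L) \<longlongrightarrow> 0) at_top"
    using b by real_asymp
  then have e1: "eventually (\<lambda>L::real. L powr b / exp L < 1 / 3) at_top"
    by (rule order_tendstoD) simp
  have "((\<lambda>L::real. L\<^sup>2 * L powr (- b - 8)) \<longlongrightarrow> 0) at_top"
    using b by real_asymp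
  then have "((\<lambda>L::real. D\<^sup>2 * (L\<^sup>2 * L powr (- b - 8))) \<longlongrightarrow> D\<^sup>2 * 0) at_top"
    by (rule tendsto_mult_left)
  then have e2: "eventually (\<lambda>L. D\<^sup>2 * (L\<^sup>2 * L powr (- b - 8)) < 1 / 3) at_top"
    by (rule order_tendstoD) simp
  have "((\<lambda>L::real. L\<^sup>2 * exp (- \<delta> * L) * exp (8 * \<kappa> * ln L * (c0 + 4 * ln L)) * L powr b) \<longlongrightarrow> 0) at_top"
    using b \<delta> \<kappa>0 c0 by real_asymp
  then have "((\<lambda>L::real. D\<^sup>2 * c * (L\<^sup>2 * exp (- \<delta> * L) * exp (8 * \<kappa> * ln L * (c0 + 4 * ln L)) * L powr b)) \<longlongrightarrow> D\<^sup>2 * c * 0) at_top"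
    by (rule tendsto_mult_left)
  then have e3: "eventually (\<lambda>L. D\<^sup>2 * c * (L\<^sup>2 * exp (- \<delta> * L) * exp (8 * \<kappa> * ln L * (c0 + 4 * ln L)) * L powr b) < 1 / 3) at_top"
    by (rule order_tendstoD) simp
  from e1 e2 e3 eventually_ge_at_top[of 1] show ?thesis
  proof eventually_elim
    case (elim L)
    have L0: "0 < L" using elim by simp
    define Y where "Y = exp L / L powr b"
    have Y0: "0 < Y" using L0 by (simp add: Y_def)
    have lnc: "ln (144 * R\<^sup>2 * L ^ 4) = c0 + 4 * ln L"
    proof -
      have "0 < 144 * R\<^sup>2" using R by simp
      then show ?thesis using L0 by (simp add: c0_def ln_mult ln_realpow)
    qed
    have "1 = (L powr b / exp L) * Y" using L0 by (simp add: Y_def)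
    also have "\<dots> \<le> 1 / 3 * Y" using elim Y0 by (intro mult_right_mono) auto
    finally have 1: "1 \<le> 1 / 3 * Y" .
    have "(D * L)\<^sup>2 * (exp L * L powr (- 2 * \<kappa>)) = (D\<^sup>2 * (L\<^sup>2 * L powr (- b - 8))) * Y"
    proof -
      have "L powr (- 2 * \<kappa>) = L powr (- b - 8) * L powr (- b)"
        by (simp add: \<kappa> flip: powr_add)
      also have "L powr (- b) = 1 / L powr b" by (simp add: powr_minus divide_inverse)
      finally show ?thesis by (simp add: Y_def power_mult_distrib)
    qed
    also have "\<dots> \<le> 1 / 3 * Y" using elim Y0 by (intro mult_right_mono) auto
    finally have 2: "(D * L)\<^sup>2 * (exp L * L powr (- 2 * \<kappa>)) \<le> 1 / 3 * Y" .
    have "(D * L)\<^sup>2 * (c * exp (\<beta> * L) * exp (8 * \<kappa> * ln L * (c0 + 4 * ln L))) =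
        (D\<^sup>2 * c * (L\<^sup>2 * exp (- \<delta> * L) * exp (8 * \<kappa> * ln L * (c0 + 4 * ln L)) * L powr b)) * Y"
    proof -
      have "exp (\<beta> * L) = exp (- \<delta> * L) * exp L"
        by (simp add: \<delta>_def algebra_simps flip: exp_add)
      also have "exp L = L powr b * Y" using L0 by (simp add: Y_def)
      finally show ?thesis by (simp add: power_mult_distrib)
    qed
    also have "\<dots> \<le> 1 / 3 * Y" using elim Y0 by (intro mult_right_mono) auto
    finally have 3: "(D * L)\<^sup>2 * (c * exp (\<beta> * L) * exp (8 * \<kappa> * ln L * (c0 + 4 * ln L))) \<le> 1 / 3 * Y" .
    show ?case unfolding lnc Y_def[symmetric] distrib_left[of "(D * L)\<^sup>2"] using 1 2 3 by linarith
  qed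
qed

section \<open>The two halves of the theorem\<close>

context qe_seq
begin

lemma ex_length_bound:
  assumes "finite T"
  obtains d :: nat where "1 \<le> d" "\<And>g. g \<in> ks p \<Longrightarrow> wl g \<le> d" "\<And>t. t \<in> T \<Longrightarrow> wl t \<le> d"
proof
  let ?A = "insert 1 (wl ` (ks p \<union> T))"
  have f: "finite ?A" using assms by simp
  show "1 \<le> Max ?A" "\<And>g. g \<in> ks p \<Longrightarrow> wl g \<le> Max ?A" "\<And>t. t \<in> T \<Longrightarrow> wl t \<le> Max ?A"
    by (rule Max_ge[OF f]; simp)+
qed

lemma strong_convergence_ergodicity:
  assumes sc: "quantitative_strong_convergence G S Ns \<rho> a" and T: "finite T" "T \<subseteq> carrier G"
  shows "\<exists>C>0. \<forall>N\<in>Ns. N \<ge> 3 \<longrightarrow>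
           (let \<eta> = C * ln (ln (real N)) / ln (real N) in
            \<forall>K. local_mat N (\<rho> N) T K \<and> norm_one_inf K \<le> 1 \<longrightarrow>
              ergodicity_bounds N (\<rho> N) p (\<phi> N) {l..u} T K \<eta> (C * \<eta> powr ((1 + \<gamma>) / 2)))"
proof -
  obtain d :: nat where d: "1 \<le> d" and len: "\<And>g. g \<in> ks p \<Longrightarrow> wl g \<le> d" "\<And>t. t \<in> T \<Longrightarrow> wl t \<le> d"
    using ex_length_bound[OF T(1)] by blast
  define W where "W = (\<lambda>L::real. 1 :: real)"
  define q where "q = 2 * real d"
  have q: "0 < q" "2 * real d \<le> q" using d by (simp_all add: q_def)
  have W: "eventually (\<lambda>L. 1 \<le> W L) at_top" "filterlim (\<lambda>L. L / (ln L * W L)) at_top at_top"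
    unfolding W_def by simp real_asymp
  have \<omega>: "0 < ln (ln (3::real))" "ln (ln 3) \<le> ln L * W L" if "ln 3 \<le> L" for L
    using ln_3_gt_1 that by (simp_all add: W_def)
  obtain C X :: real where C: "C > 0" and
    erg: "\<And>N Kx. N \<in> Ns \<Longrightarrow> N \<ge> 3 \<Longrightarrow> ln (real N) < X \<or> \<eta>c < C * (ln (ln (real N)) * W (ln (real N))) / ln (real N) \<or>
        obs_hyp N T Kx (C * (ln (ln (real N)) * W (ln (real N))) / ln (real N))
          (degree q (W (ln (real N))) (ln (real N))) \<Longrightarrow>
      local_mat N (\<rho> N) T Kx \<Longrightarrow> norm_one_inf Kx \<le> 1 \<Longrightarrow>
      ergodicity_bounds N (\<rho> N) p (\<phi> N) {l..u} T Kx (C * (ln (ln (real N)) * W (ln (real N))) / ln (real N))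
        (C * (C * (ln (ln (real N)) * W (ln (real N))) / ln (real N)) powr ((1 + \<gamma>) / 2))" and
    XL: "\<And>L. X \<le> L \<Longrightarrow> True \<and> 1 \<le> L \<and> 1 \<le> ln L \<and> 1 \<le> W L \<and> 1 / L \<le> C * (ln L * W L) / L \<and>
      real d \<le> a * L / 2 \<and> real (degree q (W L) L) \<le> a * L / (q * W L)"
    by (rule ergodicity_asymptotic[OF T len q W \<omega>(1)[OF order.refl] \<omega>(2) always_eventually, of "\<lambda>_. True"]) blast+
  have "ergodicity_bounds N (\<rho> N) p (\<phi> N) {l..u} T Kx (C * ln (ln (real N)) / ln (real N))
      (C * (C * ln (ln (real N)) / ln (real N)) powr ((1 + \<gamma>) / 2))"
    if N: "N \<in> Ns" "N \<ge> 3" and Kx: "local_mat N (\<rho> N) T Kx" "norm_one_inf Kx \<le> 1" for N Kx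
  proof -
    define L where "L = ln (real N)"
    define \<eta> where "\<eta> = C * (ln L * W L) / L"
    define n where "n = degree q (W L) L"
    interpret O: qe_obs G S p R C1' K C0 C4 \<gamma> l u N "\<rho> N" "\<phi> N" T Kx
      by (rule qe_obs[OF N(1) T(2,1) Kx])
    have "obs_hyp N T Kx \<eta> n" if X: "X \<le> L"
      unfolding obs_hyp_def
    proof (intro ballI)
      fix E1 E2 t s assume ts: "t \<in> T" "s \<in> T"
      define w where "w = cross (ga_pois G R p E1 \<eta> n) (ga_pois G R p E2 \<eta> n) t s"
      have nd: "n * d \<le> radius a N"
      proof -
        have "real n \<le> a * L / q" using XL[OF X] by (simp add: n_def W_def)
        then have "real n * (2 * real d) \<le> a * L" using q by (simp add: q_def pos_le_divide_eq)
        moreover have "a * L \<le> real (radius a N)"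
          using radius_bounds(1)[of N] XL[OF X] by (simp add: L_def)
        ultimately have "real (n * d) \<le> real (radius a N)" by simp
        then show ?thesis by (simp only: of_nat_le_iff)
      qed
      have "ks w \<subseteq> {g \<in> carrier G. wl g \<le> n * d}"
        unfolding w_def by (rule order.trans[OF keys_cross keys_ga_pois[OF p_carrier len(1)]])
      then have k: "ks w \<subseteq> carrier G" "ks w \<subseteq> cayley_ball G S (radius a N)"
        using nd by (auto simp: cayley_ball_iff)
      then have "opnorm_perp_one N (perm_rep_ga N (\<rho> N) w) \<le> 2 * opn w"
        using sc N(1) by (simp add: quantitative_strong_convergence_def group_algebra_def opn_def)
      then have "norm (O.F.lop w (fl N (O.Kc s))) \<le> 2 * opn w * norm (fl N (O.Kc s))"
        by (rule O.norm_lop_strong_convergence[OF k(1) _ fl_on]) (use O.sum_Kc[OF ts(2)] in simp)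
      also have "\<dots> \<le> (2 * opn w + 1) * norm (fl N (O.Kc s))"
        by (rule mult_right_mono) simp_all
      finally show "norm (O.F.lop (cross (ga_pois G R p E1 \<eta> n) (ga_pois G R p E2 \<eta> n) t s) (fl N (O.Kc s))) \<le>
          (2 * opn (cross (ga_pois G R p E1 \<eta> n) (ga_pois G R p E2 \<eta> n) t s) + 1) * norm (fl N (O.Kc s))"
        unfolding w_def .
    qed
    then have "L < X \<or> \<eta>c < \<eta> \<or> obs_hyp N T Kx \<eta> n" by linarith
    then have "ergodicity_bounds N (\<rho> N) p (\<phi> N) {l..u} T Kx \<eta> (C * \<eta> powr ((1 + \<gamma>) / 2))"
      unfolding \<eta>_def n_def L_def by (intro erg N Kx)
    moreover have "\<eta> = C * ln (ln (real N)) / ln (real N)"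
      by (simp add: \<eta>_def W_def L_def)
    ultimately show ?thesis by simp
  qed
  then show ?thesis using C unfolding Let_def by blast
qed

lemma exceptional_space_ergodicity:
  fixes b :: real
  assumes T: "finite T" "T \<subseteq> carrier G" and b: "0 < b"
  shows "\<exists>C>0. \<exists>H :: nat \<Rightarrow> complex vec set. \<forall>N\<in>Ns. N \<ge> 3 \<longrightarrow>
         subspace class_ring (H N) (module_vec TYPE(complex) N) \<and>
         real (vectorspace.dim class_ring ((module_vec TYPE(complex) N)\<lparr>carrier := H N\<rparr>))
           \<le> real N / ln (real N) powr b \<and>
         (let \<eta> = C * (ln (ln (real N)))\<^sup>2 / ln (real N) in
          \<forall>K. local_mat N (\<rho> N) T K \<and> norm_one_inf K \<le> 1 \<and>
              (\<forall>g\<in>T. \<forall>h\<in>H N. cv_inner h (obs_vec N (\<rho> N) K g) = 0) \<longrightarrow>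
            ergodicity_bounds N (\<rho> N) p (\<phi> N) {l..u} T K \<eta> (C * \<eta> powr ((1 + \<gamma>) / 2)))"
proof -
  obtain d :: nat where d: "1 \<le> d" and len: "\<And>g. g \<in> ks p \<Longrightarrow> wl g \<le> d" "\<And>t. t \<in> T \<Longrightarrow> wl t \<le> d"
    using ex_length_bound[OF T(1)] by blast
  define \<kappa> where "\<kappa> = b + 4"
  \<comment> \<open>With \<open>2 ^ j <= 2 * \<kappa> * ln L\<close> the Gram power has word length
    at most \<open>4 * \<kappa> * ln L * n * d\<close>, which is \<open>n * q * ln L / 2\<close> and
    fits into half the radius.\<close>
  define q where "q = 8 * \<kappa> * real d"
  define D where "D = (u - l + 1) * real (card T)"
  have \<kappa>1: "1 \<le> \<kappa>" using b by (simp add: \<kappa>_def)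
  have q: "0 < q" "2 * real d \<le> q" using d \<kappa>1 by (simp_all add: q_def)
  have W: "eventually (\<lambda>L::real. 1 \<le> ln L) at_top" "filterlim (\<lambda>L::real. L / (ln L * ln L)) at_top at_top"
    by real_asymp+
  have \<omega>: "0 < ln (ln (3::real)) * ln (ln 3)" "ln (ln 3) * ln (ln 3) \<le> ln L * ln L" if "ln 3 \<le> L" for L :: real
    using ln_3_gt_1 that by (auto intro!: mult_mono mult_pos_pos)
  define Q where "Q = (\<lambda>L::real. 1 + (D * L)\<^sup>2 * (exp L * L powr (- 2 * \<kappa>) +
      Cb * exp (\<beta> * L) * exp (8 * \<kappa> * ln L * ln (144 * R\<^sup>2 * L ^ 4))) \<le> exp L / L powr b)"
  have Q: "eventually Q at_top"
    unfolding Q_def by (rule dimension_eventually[OF b \<kappa>_def \<beta> R1])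
  obtain C X :: real where C: "C > 0" and
    erg: "\<And>N Kx. N \<in> Ns \<Longrightarrow> N \<ge> 3 \<Longrightarrow> ln (real N) < X \<or> \<eta>c < C * (ln (ln (real N)) * ln (ln (real N))) / ln (real N) \<or>
        obs_hyp N T Kx (C * (ln (ln (real N)) * ln (ln (real N))) / ln (real N))
          (degree q (ln (ln (real N))) (ln (real N))) \<Longrightarrow>
      local_mat N (\<rho> N) T Kx \<Longrightarrow> norm_one_inf Kx \<le> 1 \<Longrightarrow>
      ergodicity_bounds N (\<rho> N) p (\<phi> N) {l..u} T Kx (C * (ln (ln (real N)) * ln (ln (real N))) / ln (real N))
        (C * (C * (ln (ln (real N)) * ln (ln (real N))) / ln (real N)) powr ((1 + \<gamma>) / 2))" and
    XL: "\<And>L. X \<le> L \<Longrightarrow> Q L \<and> 1 \<le> L \<and> 1 \<le> ln L \<and> 1 \<le> ln L \<and> 1 / L \<le> C * (ln L * ln L) / L \<and>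
      real d \<le> a * L / 2 \<and> real (degree q (ln L) L) \<le> a * L / (q * ln L)"
    by (rule ergodicity_asymptotic[OF T len q W \<omega>(1)[OF order.refl] \<omega>(2) Q]) blast+
  have "\<exists>H. subspace class_ring H (module_vec TYPE(complex) N) \<and>
         real (vectorspace.dim class_ring ((module_vec TYPE(complex) N)\<lparr>carrier := H\<rparr>))
           \<le> real N / ln (real N) powr b \<and>
         (\<forall>Kx. local_mat N (\<rho> N) T Kx \<and> norm_one_inf Kx \<le> 1 \<and>
              (\<forall>g\<in>T. \<forall>h\<in>H. cv_inner h (obs_vec N (\<rho> N) Kx g) = 0) \<longrightarrow>
            ergodicity_bounds N (\<rho> N) p (\<phi> N) {l..u} T Kx (C * (ln (ln (real N)))\<^sup>2 / ln (real N))
              (C * (C * (ln (ln (real N)))\<^sup>2 / ln (real N)) powr ((1 + \<gamma>) / 2)))"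
    if N: "N \<in> Ns" "N \<ge> 3" for N
  proof -
    define L where "L = ln (real N)"
    define \<eta> where "\<eta> = C * (ln L * ln L) / L"
    define n where "n = degree q (ln L) L"
    have N_exp: "real N = exp L" using N(2) by (simp add: L_def)
    have eta: "C * (ln (ln (real N)))\<^sup>2 / ln (real N) = \<eta>"
      by (simp add: \<eta>_def L_def power2_eq_square)
    have erg': "ergodicity_bounds N (\<rho> N) p (\<phi> N) {l..u} T Kx \<eta> (C * \<eta> powr ((1 + \<gamma>) / 2))"
      if "L < X \<or> \<eta>c < \<eta> \<or> obs_hyp N T Kx \<eta> n" "local_mat N (\<rho> N) T Kx" "norm_one_inf Kx \<le> 1" for Kx
      using that unfolding \<eta>_def n_def L_def by (intro erg N)
    show ?thesis
    proof (cases "L < X \<or> \<eta>c < \<eta>")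
      case True
      \<comment> \<open>The observable bound holds here for every \<open>Kx\<close>, so the span of
        the empty set serves as the exceptional space.\<close>
      obtain H :: "complex vec set" where H: "subspace class_ring H (module_vec TYPE(complex) N)"
        "vectorspace.dim class_ring ((module_vec TYPE(complex) N)\<lparr>carrier := H\<rparr>) \<le> card {}"
        by (rule subspace_of_finite[of "{}" N]) auto
      have "real (vectorspace.dim class_ring ((module_vec TYPE(complex) N)\<lparr>carrier := H\<rparr>)) \<le> real N / ln (real N) powr b"
        using H(2) by simp
      then show ?thesis using H(1) True erg' unfolding eta by blast
    next
      case False
      then have X: "X \<le> L" "\<eta> \<le> \<eta>c" by simp_all
      note XL' = XL[OF X(1)]
      have L0: "0 < L" "0 < ln L" using XL' by linarith+
      have \<eta>: "1 / L \<le> \<eta>" using XL' by (simp add: \<eta>_def)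
      have \<eta>1: "\<eta> \<le> 1" using X(2) \<eta>c(2) by linarith
      have "0 < 1 / L" using L0 by simp
      then have \<eta>0: "0 < \<eta>" using \<eta> by linarith
      have "1 * 1 \<le> \<kappa> * ln L" using \<kappa>1 XL' by (intro mult_mono) auto
      \<comment> \<open>The exponent must be a power of two for \<open>norm_power_two\<close>. The
        lower bound makes \<open>16 ^ (2 ^ j)\<close> at least \<open>L powr (2 * \<kappa>)\<close>;
        the upper bound keeps words within the radius and the bad-point term subexponential in
        \<open>L\<close>.\<close>
      then obtain j :: nat where j: "\<kappa> * ln L \<le> 2 ^ j" "2 ^ j \<le> 2 * (\<kappa> * ln L)"
        using ex_two_power[of "\<kappa> * ln L"] by auto
      interpret O: perm_rep G S p R N "\<rho> N" "\<phi> N" by (rule perm_rep[OF N(1)])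
      define r where "r = radius a N"
      have r: "2 ^ j * (2 * (n * d)) \<le> r"
      proof -
        have "real n \<le> a * L / (q * ln L)" using XL' by (simp add: n_def)
        moreover have "0 < q * ln L" using q(1) L0(2) by (rule mult_pos_pos)
        ultimately have 1: "real n * (q * ln L) \<le> a * L" by (simp only: pos_le_divide_eq)
        have "2 ^ j * (2 * (real n * real d)) \<le> 2 * (\<kappa> * ln L) * (2 * (real n * real d))"
          by (rule mult_right_mono[OF j(2)]) simp
        also have "\<dots> = real n * (q * ln L) / 2" by (simp add: q_def)
        also have "\<dots> \<le> a * L / 2" using 1 by simp
        also have "\<dots> \<le> a * L" using a L0 by simp
        also have "\<dots> \<le> real r"
          using radius_bounds(1)[of N] XL' by (simp add: L_def r_def)
        finally have "real (2 ^ j * (2 * (n * d))) \<le> real r" by simp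
        then show ?thesis by (simp only: of_nat_le_iff)
      qed
      obtain H where H: "subspace class_ring H (module_vec TYPE(complex) N)"
        "real (vectorspace.dim class_ring ((module_vec TYPE(complex) N)\<lparr>carrier := H\<rparr>)) \<le>
          1 + (real (card (net \<eta>)) * real (card T))\<^sup>2 *
            (real N / 16 ^ (2 ^ j) + real (card (O.bad r)) * ((12 * R / \<eta>\<^sup>2)\<^sup>2) ^ (4 * 2 ^ j))"
        "vec N (\<lambda>_. 1) \<in> H"
        "\<And>E1 E2 t s v. E1 \<in> net \<eta> \<Longrightarrow> E2 \<in> net \<eta> \<Longrightarrow> t \<in> T \<Longrightarrow> s \<in> T \<Longrightarrow> v \<in> carrier_vec N \<Longrightarrow>
          (\<And>h. h \<in> H \<Longrightarrow> cv_inner h v = 0) \<Longrightarrow>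
          norm (O.F.lop (cross (ga_pois G R p E1 \<eta> n) (ga_pois G R p E2 \<eta> n) t s) (vl N v)) \<le>
          (2 * opn (cross (ga_pois G R p E1 \<eta> n) (ga_pois G R p E2 \<eta> n) t s) + 1) * norm (vl N v)"
        by (rule O.exceptional_space[OF finite_net T \<eta>0 \<eta>1 len(1) r, of \<eta>]) blast+
      have "1 + (real (card (net \<eta>)) * real (card T))\<^sup>2 *
            (real N / 16 ^ (2 ^ j) + real (card (O.bad r)) * ((12 * R / \<eta>\<^sup>2)\<^sup>2) ^ (4 * 2 ^ j))
          \<le> real N / ln (real N) powr b"
      proof -
        have net: "real (card (net \<eta>)) * real (card T) \<le> D * L"
        proof -
          have i\<eta>: "1 / \<eta> \<le> L" using \<eta> \<eta>0 L0 by (simp add: field_simps)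
          have "(u - l) * (1 / \<eta>) \<le> (u - l) * L" using lu by (intro mult_left_mono[OF i\<eta>]) auto
          moreover have "1 \<le> L" using XL' by simp
          ultimately have "real (card (net \<eta>)) \<le> (u - l + 1) * L"
            using card_net[OF \<eta>0] by (simp add: distrib_right)
          then have "real (card (net \<eta>)) * real (card T) \<le> (u - l + 1) * L * real (card T)"
            by (rule mult_right_mono) simp
          then show ?thesis by (simp add: D_def mult_ac)
        qed
        have t1: "real N / 16 ^ (2 ^ j) \<le> exp L * L powr (- 2 * \<kappa>)"
        proof -
          have e16: "exp 2 \<le> (16 :: real)"
          proof -
            have "exp 2 = exp 1 * exp (1 :: real)" by (simp flip: exp_add)
            also have "\<dots> \<le> 3 * 3" by (intro mult_mono exp_le) auto
            finally show ?thesis by simp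
          qed
          have "L powr (2 * \<kappa>) = exp (2 * (\<kappa> * ln L))" using L0 by (simp add: powr_def mult_ac)
          also have "\<dots> \<le> exp (2 * 2 ^ j)" using j(1) by simp
          also have "\<dots> = exp 2 ^ (2 ^ j)"
            using exp_of_nat_mult[of "2 ^ j" "2 :: real"] by (simp add: mult.commute)
          also have "\<dots> \<le> 16 ^ (2 ^ j)" by (rule power_mono[OF e16]) simp
          finally have "exp L / 16 ^ (2 ^ j) \<le> exp L / L powr (2 * \<kappa>)"
            using L0 by (intro divide_left_mono) auto
          then show ?thesis unfolding N_exp by (simp add: powr_minus divide_inverse)
        qed
        have t2: "real (card (O.bad r)) \<le> Cb * exp (\<beta> * L)"
          using card_Bad[OF N(1)] N(2) by (simp add: r_def powr_def L_def)
        have t3: "((12 * R / \<eta>\<^sup>2)\<^sup>2) ^ (4 * 2 ^ j) \<le> exp (8 * \<kappa> * ln L * ln (144 * R\<^sup>2 * L ^ 4))"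
        proof -
          have i\<eta>: "1 / \<eta> \<le> L" using \<eta> \<eta>0 L0 by (simp add: field_simps)
          have "(1 / \<eta>) ^ 4 \<le> L ^ 4" by (rule power_mono[OF i\<eta>]) (use \<eta>0 in simp)
          then have "144 * R\<^sup>2 * (1 / \<eta>) ^ 4 \<le> 144 * R\<^sup>2 * L ^ 4" by (rule mult_left_mono) simp
          moreover have "(12 * R / \<eta>\<^sup>2)\<^sup>2 = 144 * R\<^sup>2 * (1 / \<eta>) ^ 4"
            by (simp add: power_divide power_mult_distrib)
          ultimately have b1: "(12 * R / \<eta>\<^sup>2)\<^sup>2 \<le> 144 * R\<^sup>2 * L ^ 4" by simp
          have "1 * 1 \<le> R\<^sup>2 * L ^ 4" using R1 XL' by (intro mult_mono) auto
          then have b2: "1 \<le> 144 * R\<^sup>2 * L ^ 4" by simp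
          have b3: "0 < 144 * R\<^sup>2 * L ^ 4" using b2 by linarith
          have "((12 * R / \<eta>\<^sup>2)\<^sup>2) ^ (4 * 2 ^ j) \<le> (144 * R\<^sup>2 * L ^ 4) ^ (4 * 2 ^ j)"
            by (rule power_mono[OF b1]) simp
          also have "\<dots> = exp (real (4 * 2 ^ j) * ln (144 * R\<^sup>2 * L ^ 4))"
            by (simp only: exp_of_nat_mult exp_ln[OF b3])
          also have "\<dots> \<le> exp (8 * \<kappa> * ln L * ln (144 * R\<^sup>2 * L ^ 4))"
          proof -
            have "real (4 * 2 ^ j) \<le> 8 * \<kappa> * ln L" using j(2) by simp
            then have "real (4 * 2 ^ j) * ln (144 * R\<^sup>2 * L ^ 4) \<le> 8 * \<kappa> * ln L * ln (144 * R\<^sup>2 * L ^ 4)"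
              by (rule mult_right_mono) (use ln_ge_zero[OF b2] in simp)
            then show ?thesis by (simp only: exp_le_cancel_iff)
          qed
          finally show ?thesis .
        qed
        have t4: "real (card (O.bad r)) * ((12 * R / \<eta>\<^sup>2)\<^sup>2) ^ (4 * 2 ^ j) \<le>
            Cb * exp (\<beta> * L) * exp (8 * \<kappa> * ln L * ln (144 * R\<^sup>2 * L ^ 4))"
          by (rule mult_mono[OF t2 t3]) (use Cb in auto)
        have "(real (card (net \<eta>)) * real (card T))\<^sup>2 *
            (real N / 16 ^ (2 ^ j) + real (card (O.bad r)) * ((12 * R / \<eta>\<^sup>2)\<^sup>2) ^ (4 * 2 ^ j)) \<le>
            (D * L)\<^sup>2 * (exp L * L powr (- 2 * \<kappa>) +
              Cb * exp (\<beta> * L) * exp (8 * \<kappa> * ln L * ln (144 * R\<^sup>2 * L ^ 4)))"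
          by (rule mult_mono[OF power_mono[OF net] add_mono[OF t1 t4]]) auto
        moreover have "Q L" using XL' by simp
        ultimately show ?thesis unfolding Q_def N_exp by simp
      qed
      with H(2) have dim: "real (vectorspace.dim class_ring ((module_vec TYPE(complex) N)\<lparr>carrier := H\<rparr>))
          \<le> real N / ln (real N) powr b" by (rule order.trans)
      have "ergodicity_bounds N (\<rho> N) p (\<phi> N) {l..u} T Kx \<eta> (C * \<eta> powr ((1 + \<gamma>) / 2))"
        if Kx: "local_mat N (\<rho> N) T Kx" "norm_one_inf Kx \<le> 1"
          and perp: "\<forall>g\<in>T. \<forall>h\<in>H. cv_inner h (obs_vec N (\<rho> N) Kx g) = 0" for Kx
      proof (rule erg'[OF _ Kx], intro disjI2)
        interpret Oo: qe_obs G S p R C1' K C0 C4 \<gamma> l u N "\<rho> N" "\<phi> N" T Kx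
          by (rule qe_obs[OF N(1) T(2,1) Kx])
        show "obs_hyp N T Kx \<eta> n"
          unfolding obs_hyp_def
        proof (intro ballI)
          fix E1 E2 t s assume E: "E1 \<in> net \<eta>" "E2 \<in> net \<eta>" "t \<in> T" "s \<in> T"
          have c: "obs_vec N (\<rho> N) Kx s \<in> carrier_vec N" by (simp add: obs_vec_def)
          have "cv_inner (vec N (\<lambda>_. 1)) (obs_vec N (\<rho> N) Kx s) = 0" using perp H(3) E(4) by blast
          then have "fl N (Oo.Kc s) = vl N (obs_vec N (\<rho> N) Kx s)" by (rule Oo.fl_Kc_obs_vec)
          moreover have "norm (O.F.lop (cross (ga_pois G R p E1 \<eta> n) (ga_pois G R p E2 \<eta> n) t s) (vl N (obs_vec N (\<rho> N) Kx s))) \<le>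
              (2 * opn (cross (ga_pois G R p E1 \<eta> n) (ga_pois G R p E2 \<eta> n) t s) + 1) * norm (vl N (obs_vec N (\<rho> N) Kx s))"
            by (rule H(4)[OF E c]) (use perp E(4) in blast)
          ultimately show "norm (O.F.lop (cross (ga_pois G R p E1 \<eta> n) (ga_pois G R p E2 \<eta> n) t s) (fl N (Oo.Kc s))) \<le>
              (2 * opn (cross (ga_pois G R p E1 \<eta> n) (ga_pois G R p E2 \<eta> n) t s) + 1) * norm (fl N (Oo.Kc s))"
            by simp
        qed
      qed
      then show ?thesis using H(1) dim unfolding eta by blast
    qed
  qed
  then have "\<forall>N\<in>{N \<in> Ns. N \<ge> 3}. \<exists>H. subspace class_ring H (module_vec TYPE(complex) N) \<and>
         real (vectorspace.dim class_ring ((module_vec TYPE(complex) N)\<lparr>carrier := H\<rparr>))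
           \<le> real N / ln (real N) powr b \<and>
         (\<forall>Kx. local_mat N (\<rho> N) T Kx \<and> norm_one_inf Kx \<le> 1 \<and>
              (\<forall>g\<in>T. \<forall>h\<in>H. cv_inner h (obs_vec N (\<rho> N) Kx g) = 0) \<longrightarrow>
            ergodicity_bounds N (\<rho> N) p (\<phi> N) {l..u} T Kx (C * (ln (ln (real N)))\<^sup>2 / ln (real N))
              (C * (C * (ln (ln (real N)))\<^sup>2 / ln (real N)) powr ((1 + \<gamma>) / 2)))"
    by blast
  from bchoice[OF this] show ?thesis
    using C unfolding Let_def by blast
qed

end

theorem theoremC3:
  fixes G :: "('g, 'm) monoid_scheme" and S :: "'g set"
    and Ns :: "nat set" and \<rho> :: "nat \<Rightarrow> 'g \<Rightarrow> nat \<Rightarrow> nat"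
    and p :: "'g \<Rightarrow>\<^sub>0 complex" and \<phi> :: "nat \<Rightarrow> nat \<Rightarrow> complex vec"
    and C1 a \<gamma> l0 u0 l u :: real and I0 I :: "real set"
  assumes "group G"
    and "symmetric_generating_set G S"
    and "rapid_decay G S C1"
    and "infinite Ns" and "0 \<notin> Ns"
    and "\<And>N. N \<in> Ns \<Longrightarrow> group_action G {0..<N} (\<rho> N)"
    and "few_bad_points G S Ns \<rho> a"
    and "p \<in> group_algebra G" and "ga_star G p = p"
    and "I0 = {l0..u0}" and "abs_continuous_on G p I0"
    and "I = {l..u}" and "l < u" and "I \<subseteq> interior I0"
    and "R4 G S C1 p \<gamma> I"
    and "\<And>N. N \<in> Ns \<Longrightarrow> orthonormal_eigenbasis N (perm_rep_ga N (\<rho> N) p) (\<phi> N)"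
  shows
    "(quantitative_strong_convergence G S Ns \<rho> a \<longrightarrow>
       (\<forall>T. finite T \<and> T \<subseteq> carrier G \<longrightarrow>
         (\<exists>C>0. \<forall>N\<in>Ns. N \<ge> 3 \<longrightarrow>
           (let \<eta> = C * ln (ln (real N)) / ln (real N) in
            \<forall>K. local_mat N (\<rho> N) T K \<and> norm_one_inf K \<le> 1 \<longrightarrow>
              ergodicity_bounds N (\<rho> N) p (\<phi> N) I T K \<eta> (C * \<eta> powr ((1 + \<gamma>) / 2))))))
     \<and>
     (\<forall>T b. finite T \<and> T \<subseteq> carrier G \<and> b > 0 \<longrightarrow>
       (\<exists>C>0. \<exists>H :: nat \<Rightarrow> complex vec set. \<forall>N\<in>Ns. N \<ge> 3 \<longrightarrow>
         subspace class_ring (H N) (module_vec TYPE(complex) N) \<and>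
         real (vectorspace.dim class_ring ((module_vec TYPE(complex) N)\<lparr>carrier := H N\<rparr>))
           \<le> real N / ln (real N) powr b \<and>
         (let \<eta> = C * (ln (ln (real N)))\<^sup>2 / ln (real N) in
          \<forall>K. local_mat N (\<rho> N) T K \<and> norm_one_inf K \<le> 1 \<and>
              (\<forall>g\<in>T. \<forall>h\<in>H N. cv_inner h (obs_vec N (\<rho> N) K g) = 0) \<longrightarrow>
            ergodicity_bounds N (\<rho> N) p (\<phi> N) I T K \<eta> (C * \<eta> powr ((1 + \<gamma>) / 2)))))"
proof -
  interpret cayley G S
    using assms(1,2) by (intro cayley.intro cayley_axioms.intro)
  \<comment> \<open>The summand 1 ensures \<open>R >= 1\<close> even when \<open>p\<close> is small
    or 0.\<close>
  define R where "R = 1 + (\<Sum>g\<in>ks p. cmod (lk p g))"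
  have R: "1 \<le> R" "(\<Sum>g\<in>ks p. cmod (lk p g)) \<le> R"
    by (simp_all add: R_def sum_nonneg)
  have I: "{l..u} \<subseteq> I0"
    using \<open>I = {l..u}\<close> \<open>I \<subseteq> interior I0\<close> interior_subset by blast
  obtain C0 where C0: "C0 \<ge> 1" "\<And>E h. E \<in> I0 \<Longrightarrow> 0 < h \<Longrightarrow> h \<le> 1 \<Longrightarrow>
      1 / C0 \<le> Re (Im_resolvent G p (Complex E h) \<one>\<^bsub>G\<^esub> \<one>\<^bsub>G\<^esub>) \<and>
      Re (Im_resolvent G p (Complex E h) \<one>\<^bsub>G\<^esub> \<one>\<^bsub>G\<^esub>) \<le> C0"
    using \<open>abs_continuous_on G p I0\<close> unfolding abs_continuous_on_def by blast
  have \<gamma>: "0 < \<gamma>" "\<gamma> \<le> 1"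
    using \<open>R4 G S C1 p \<gamma> I\<close> unfolding R4_def by blast+
  obtain C4 C1' where C4: "C4 > 0" "C1' > 2 * C1 + 1"
    "\<And>E h. E \<in> I \<Longrightarrow> 0 < h \<Longrightarrow> h \<le> 1 \<Longrightarrow>
        (\<lambda>g. h\<^sup>2 * real (wl g) powr C1' * cmod (Im_resolvent G p (Complex E h) \<one>\<^bsub>G\<^esub> g) ^ 4) summable_on carrier G \<and>
        (\<Sum>\<^sub>\<infinity>g\<in>carrier G. h\<^sup>2 * real (wl g) powr C1' * cmod (Im_resolvent G p (Complex E h) \<one>\<^bsub>G\<^esub> g) ^ 4)
          \<le> C4 * h powr (1 + \<gamma>)"
    using \<open>R4 G S C1 p \<gamma> I\<close> unfolding R4_def Let_def by blast
  have C1': "0 \<le> C1'"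
    using C4(2) \<open>rapid_decay G S C1\<close> by (simp add: rapid_decay_def)
  obtain K where K: "K > 0"
    "\<And>q. ks q \<subseteq> carrier G \<Longrightarrow> opn q \<le> K * sqrt (\<Sum>g\<in>ks q. wt g powr C1' * (cmod (lk q g))\<^sup>2)"
    by (rule rapid_decay_weighted[OF \<open>rapid_decay G S C1\<close> C4(2)]) (rule that)
  obtain \<beta> Cb where a: "a > 0" and \<beta>: "\<beta> < 1" "Cb > 0"
    "\<And>N. N \<in> Ns \<Longrightarrow> real (card (Bad G S N (\<rho> N) (radius a N))) \<le> Cb * real N powr \<beta>"
    using \<open>few_bad_points G S Ns \<rho> a\<close> unfolding few_bad_points_def by blast
  interpret qe_seq G S p R C1' K C0 C4 \<gamma> l u Ns \<rho> \<phi> a \<beta> Cb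
  proof (intro qe_seq.intro qe_seq_axioms.intro qe.intro qe_axioms.intro cayley_sa.intro cayley_sa_axioms.intro)
    show "cayley G S" by (rule cayley_axioms)
    show "ks p \<subseteq> carrier G" using \<open>p \<in> group_algebra G\<close> by (simp add: group_algebra_def)
    show "1 / C0 \<le> Re (Im_resolvent G p (Complex E h) \<one>\<^bsub>G\<^esub> \<one>\<^bsub>G\<^esub>) \<and>
        Re (Im_resolvent G p (Complex E h) \<one>\<^bsub>G\<^esub> \<one>\<^bsub>G\<^esub>) \<le> C0"
      if "l \<le> E" "E \<le> u" "0 < h" "h \<le> 1" for E h
      by (rule C0(2)) (use I that in auto)
    show "(\<lambda>g. h\<^sup>2 * real (wl g) powr C1' * cmod (Im_resolvent G p (Complex E h) \<one>\<^bsub>G\<^esub> g) ^ 4) summable_on carrier G \<and>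
        (\<Sum>\<^sub>\<infinity>g\<in>carrier G. h\<^sup>2 * real (wl g) powr C1' * cmod (Im_resolvent G p (Complex E h) \<one>\<^bsub>G\<^esub> g) ^ 4)
          \<le> C4 * h powr (1 + \<gamma>)"
      if "l \<le> E" "E \<le> u" "0 < h" "h \<le> 1" for E h
      by (rule C4(3)) (use \<open>I = {l..u}\<close> that in auto)
  qed (fact R C0(1) \<gamma> C1' K C4(1) a \<beta> assms)+
  show ?thesis
    unfolding \<open>I = {l..u}\<close>
    by (intro conjI impI allI; elim conjE)
      (rule strong_convergence_ergodicity exceptional_space_ergodicity; assumption)+
qed

end
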